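(* Let $H$ be a good homogeneous relation on a finite set $X$, given by its matrix representation. Then the modular decomposition tree of $H$ can be built in $O(|X|^2)$ time.
   Context: A diverse triple of a finite set $X$ is a triple $(x,y,z)\in X^3$ with $x\neq y$ and $x\neq z$, written $(x|yz)$. A homogeneous relation $H$ on $X$ is a relation on diverse triples such that for every $x\in X$ the binary relation $H_x$ on $X\setminus\{x\}$ defined by $H_x(y,z)\Leftrightarrow H(x|yz)$ is an equivalence relation. If $\neg H(x|yz)$, $x$ is said to distinguish $y$ from $z$ (a splitter of $\{y,z\}$). A subset $M\subseteq X$ is a homogeneous module of $H$ if $H(x|mm')$ for all $m,m'\in M$ and all $x\in X\setminus M$. $H$ is good (modular quotient) if for every homogeneous module $M$, all $x,y\in M$ and all $s,t\notin M$ (with the triples diverse), $H(x|st)\Leftrightarrow H(y|st)$. Two sets $A,B$ overlap if $A\cap B$, $A\setminus B$, $B\setminus A$ are all non-empty. A homogeneous module is strong if it overlaps no other homogeneous module; $X$ and the singletons are strong. The modular decomposition tree of $H$ is the tree of strong homogeneous modules ordered by inclusion, each internal node being typed prime, degenerate (complete) or linear, with the children of linear nodes ordered. Matrix representation: with $X=\{x_1,\dots,x_n\}$, an $n\times n$ matrix $A$ with entries in $\{1,\dots,n\}$ where the equivalence classes of each $H_{x_i}$ get distinct numbers and $A_{i,j}=k$ iff $x_j$ lies in the class of $H_{x_i}$ numbered $k$. *)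

theory Defs
  imports Complex_Main "HOL-Library.Landau_Symbols"
begin

section \<open>Homogeneous relations and their modules\<close>

text \<open>
  A relation on diverse triples is a predicate \<open>H\<close>, where \<open>H x y z\<close> stands for \<open>H(x|yz)\<close>.
  It is only ever consulted at triples of \<open>X\<close> with \<open>x \<noteq> y\<close> and \<open>x \<noteq> z\<close>.
\<close>

definition hom_rel_at :: "'a set \<Rightarrow> ('a \<Rightarrow> 'a \<Rightarrow> 'a \<Rightarrow> bool) \<Rightarrow> 'a \<Rightarrow> ('a \<times> 'a) set" where
  "hom_rel_at X H x = {(y, z). y \<in> X - {x} \<and> z \<in> X - {x} \<and> H x y z}"

definition homogeneous_relation :: "'a set \<Rightarrow> ('a \<Rightarrow> 'a \<Rightarrow> 'a \<Rightarrow> bool) \<Rightarrow> bool" where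
  "homogeneous_relation X H \<longleftrightarrow> (\<forall>x\<in>X. equiv (X - {x}) (hom_rel_at X H x))"

definition hom_module :: "'a set \<Rightarrow> ('a \<Rightarrow> 'a \<Rightarrow> 'a \<Rightarrow> bool) \<Rightarrow> 'a set \<Rightarrow> bool" where
  "hom_module X H M \<longleftrightarrow> M \<subseteq> X \<and> (\<forall>x\<in>X - M. \<forall>m\<in>M. \<forall>m'\<in>M. H x m m')"

definition good :: "'a set \<Rightarrow> ('a \<Rightarrow> 'a \<Rightarrow> 'a \<Rightarrow> bool) \<Rightarrow> bool" where
  "good X H \<longleftrightarrow>
    (\<forall>M. hom_module X H M \<longrightarrow>
      (\<forall>x\<in>M. \<forall>y\<in>M. \<forall>s\<in>X - M. \<forall>t\<in>X - M. H x s t \<longleftrightarrow> H y s t))"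

definition overlap :: "'a set \<Rightarrow> 'a set \<Rightarrow> bool" where
  "overlap A B \<longleftrightarrow> A \<inter> B \<noteq> {} \<and> A - B \<noteq> {} \<and> B - A \<noteq> {}"

text \<open>
  The empty set is vacuously a module that overlaps nothing. It is not a node of the
  decomposition tree, so it is excluded here.
\<close>

definition strong_module :: "'a set \<Rightarrow> ('a \<Rightarrow> 'a \<Rightarrow> 'a \<Rightarrow> bool) \<Rightarrow> 'a set \<Rightarrow> bool" where
  "strong_module X H M \<longleftrightarrow>
    hom_module X H M \<and> M \<noteq> {} \<and> (\<forall>M'. hom_module X H M' \<longrightarrow> \<not> overlap M M')"

text \<open>
  The matrix representation, relative to the enumeration \<open>x 0, \<dots>, x (n - 1)\<close> of \<open>X\<close>. The
  function \<open>num i\<close> numbers the classes of \<open>H\<^sub>x\<^sub>i\<close>; the diagonal entries carry no information.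
\<close>

definition matrix_representation ::
  "'a set \<Rightarrow> ('a \<Rightarrow> 'a \<Rightarrow> 'a \<Rightarrow> bool) \<Rightarrow> (nat \<Rightarrow> 'a) \<Rightarrow> (nat \<Rightarrow> nat \<Rightarrow> nat) \<Rightarrow> bool" where
  "matrix_representation X H x A \<longleftrightarrow>
    bij_betw x {..<card X} X \<and>
    (\<forall>i<card X. \<forall>j<card X. A i j \<in> {1..card X}) \<and>
    (\<exists>num :: nat \<Rightarrow> 'a set \<Rightarrow> nat. \<forall>i<card X.
        inj_on (num i) ((X - {x i}) // hom_rel_at X H (x i)) \<and>
        (\<forall>j<card X. j \<noteq> i \<longrightarrow> A i j = num i (hom_rel_at X H (x i) `` {x j})))"


section \<open>The modular decomposition tree\<close>

datatype node_type = Complete | Linear | Prime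

datatype 'a mdtree = Leaf 'a | Node node_type "'a mdtree list"

definition child_modules :: "'a set \<Rightarrow> ('a \<Rightarrow> 'a \<Rightarrow> 'a \<Rightarrow> bool) \<Rightarrow> 'a set \<Rightarrow> 'a set set" where
  "child_modules X H M =
    {C. strong_module X H C \<and> C \<subset> M \<and> (\<nexists>D. strong_module X H D \<and> C \<subset> D \<and> D \<subset> M)}"

text \<open>
  \<open>node_typed X H ty Cs\<close> says that a node with the list \<open>Cs\<close> of children has type \<open>ty\<close>: all
  unions of children are modules (complete); exactly the unions of intervals of \<open>Cs\<close> are
  (linear); or only the trivial unions are (prime). The three conditions coincide on nodes with
  two children; these are complete.
\<close>

fun node_typed ::
  "'a set \<Rightarrow> ('a \<Rightarrow> 'a \<Rightarrow> 'a \<Rightarrow> bool) \<Rightarrow> node_type \<Rightarrow> 'a set list \<Rightarrow> bool" where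
  "node_typed X H Complete Cs \<longleftrightarrow> (\<forall>S \<subseteq> set Cs. hom_module X H (\<Union>S))"
| "node_typed X H Linear Cs \<longleftrightarrow> length Cs \<ge> 3 \<and>
    (\<forall>S \<subseteq> set Cs. hom_module X H (\<Union>S) \<longleftrightarrow> (\<exists>i k. S = set (take k (drop i Cs))))"
| "node_typed X H Prime Cs \<longleftrightarrow> length Cs \<ge> 3 \<and>
    (\<forall>S \<subseteq> set Cs. hom_module X H (\<Union>S) \<longleftrightarrow> S = {} \<or> card S = 1 \<or> S = set Cs)"

text \<open>\<open>md_tree_at X H M t\<close>: \<open>t\<close> is the part of the decomposition tree below the strong module \<open>M\<close>.\<close>

inductive md_tree_at ::
  "'a set \<Rightarrow> ('a \<Rightarrow> 'a \<Rightarrow> 'a \<Rightarrow> bool) \<Rightarrow> 'a set \<Rightarrow> 'a mdtree \<Rightarrow> bool" for X H where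
  Leaf: "x \<in> X \<Longrightarrow> md_tree_at X H {x} (Leaf x)"
| Node: "strong_module X H M \<Longrightarrow> \<not> is_singleton M \<Longrightarrow>
    distinct Cs \<Longrightarrow> set Cs = child_modules X H M \<Longrightarrow> node_typed X H ty Cs \<Longrightarrow>
    list_all2 (md_tree_at X H) Cs ts \<Longrightarrow> md_tree_at X H M (Node ty ts)"

definition modular_decomposition_tree ::
  "'a set \<Rightarrow> ('a \<Rightarrow> 'a \<Rightarrow> 'a \<Rightarrow> bool) \<Rightarrow> 'a mdtree \<Rightarrow> bool" where
  "modular_decomposition_tree X H t \<longleftrightarrow> md_tree_at X H X t"


section \<open>A word RAM\<close>

text \<open>
  Running time is measured on a random access machine with words of bounded size, programmed in
  a structured language. Its memory consists of scalar variables and of finitely many named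
  arrays (those occurring in the program), all of them holding words. Every expression and
  statement constructor costs one unit each time it is executed.
\<close>

type_synonym store = "(string \<Rightarrow> nat) \<times> (string \<Rightarrow> nat \<Rightarrow> nat)"

datatype aexp =
    Const nat
  | Var string
  | Read string aexp
  | Plus aexp aexp
  | Minus aexp aexp
  | Times aexp aexp
  | Div aexp aexp
  | Mod aexp aexp

datatype bexp =
    Less aexp aexp
  | Eq aexp aexp
  | Neg bexp
  | Conj bexp bexp

datatype com =
    Skip
  | Assign string aexp
  | Write string aexp aexp
  | Seq com com
  | Cond bexp com com
  | While bexp com

fun aval :: "aexp \<Rightarrow> store \<Rightarrow> nat" where
  "aval (Const k) s = k"
| "aval (Var v) s = fst s v"
| "aval (Read a e) s = snd s a (aval e s)"
| "aval (Plus e f) s = aval e s + aval f s"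
| "aval (Minus e f) s = aval e s - aval f s"
| "aval (Times e f) s = aval e s * aval f s"
| "aval (Div e f) s = aval e s div aval f s"
| "aval (Mod e f) s = aval e s mod aval f s"

fun bval :: "bexp \<Rightarrow> store \<Rightarrow> bool" where
  "bval (Less e f) s \<longleftrightarrow> aval e s < aval f s"
| "bval (Eq e f) s \<longleftrightarrow> aval e s = aval f s"
| "bval (Neg b) s \<longleftrightarrow> \<not> bval b s"
| "bval (Conj b c) s \<longleftrightarrow> bval b s \<and> bval c s"

text \<open>
  \<open>afits B\<close> and \<open>bfits B\<close>: all values met during the evaluation, array indices included, are words,
  that is, smaller than \<open>B\<close>. On inputs of size \<open>n\<close> the intended bound is \<open>B = (n + 1) ^ d\<close> for a
  constant \<open>d\<close>, i.e. words of \<open>O(log n)\<close> bits. Without a bound, unit-cost arithmetic could hide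
  work in huge numbers.
\<close>

fun afits :: "nat \<Rightarrow> aexp \<Rightarrow> store \<Rightarrow> bool" where
  "afits B (Const k) s \<longleftrightarrow> k < B"
| "afits B (Var v) s \<longleftrightarrow> aval (Var v) s < B"
| "afits B (Read a e) s \<longleftrightarrow> afits B e s \<and> aval (Read a e) s < B"
| "afits B (Plus e f) s \<longleftrightarrow> afits B e s \<and> afits B f s \<and> aval (Plus e f) s < B"
| "afits B (Minus e f) s \<longleftrightarrow> afits B e s \<and> afits B f s"
| "afits B (Times e f) s \<longleftrightarrow> afits B e s \<and> afits B f s \<and> aval (Times e f) s < B"
| "afits B (Div e f) s \<longleftrightarrow> afits B e s \<and> afits B f s"
| "afits B (Mod e f) s \<longleftrightarrow> afits B e s \<and> afits B f s"

fun bfits :: "nat \<Rightarrow> bexp \<Rightarrow> store \<Rightarrow> bool" where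
  "bfits B (Less e f) s \<longleftrightarrow> afits B e s \<and> afits B f s"
| "bfits B (Eq e f) s \<longleftrightarrow> afits B e s \<and> afits B f s"
| "bfits B (Neg b) s \<longleftrightarrow> bfits B b s"
| "bfits B (Conj b c) s \<longleftrightarrow> bfits B b s \<and> bfits B c s"

fun acost :: "aexp \<Rightarrow> nat" where
  "acost (Const k) = 1"
| "acost (Var v) = 1"
| "acost (Read a e) = 1 + acost e"
| "acost (Plus e f) = 1 + acost e + acost f"
| "acost (Minus e f) = 1 + acost e + acost f"
| "acost (Times e f) = 1 + acost e + acost f"
| "acost (Div e f) = 1 + acost e + acost f"
| "acost (Mod e f) = 1 + acost e + acost f"

fun bcost :: "bexp \<Rightarrow> nat" where
  "bcost (Less e f) = 1 + acost e + acost f"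
| "bcost (Eq e f) = 1 + acost e + acost f"
| "bcost (Neg b) = 1 + bcost b"
| "bcost (Conj b c) = 1 + bcost b + bcost c"

text \<open>
  \<open>exec B c s k s'\<close>: started in \<open>s\<close>, the program \<open>c\<close> halts in \<open>s'\<close> after \<open>k\<close> units of time without
  ever computing a value that is not a word (on overflow there is no execution).
\<close>

inductive exec :: "nat \<Rightarrow> com \<Rightarrow> store \<Rightarrow> nat \<Rightarrow> store \<Rightarrow> bool" for B where
  Skip: "exec B Skip s 1 s"
| Assign: "afits B e s \<Longrightarrow>
    exec B (Assign v e) s (1 + acost e) ((fst s)(v := aval e s), snd s)"
| Write: "afits B e s \<Longrightarrow> afits B f s \<Longrightarrow>
    exec B (Write a e f) s (1 + acost e + acost f)
      (fst s, (snd s)(a := (snd s a)(aval e s := aval f s)))"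
| Seq: "exec B c s k s' \<Longrightarrow> exec B d s' l s'' \<Longrightarrow> exec B (Seq c d) s (1 + k + l) s''"
| CondTrue: "bfits B b s \<Longrightarrow> bval b s \<Longrightarrow> exec B c s k s' \<Longrightarrow>
    exec B (Cond b c d) s (1 + bcost b + k) s'"
| CondFalse: "bfits B b s \<Longrightarrow> \<not> bval b s \<Longrightarrow> exec B d s k s' \<Longrightarrow>
    exec B (Cond b c d) s (1 + bcost b + k) s'"
| WhileFalse: "bfits B b s \<Longrightarrow> \<not> bval b s \<Longrightarrow> exec B (While b c) s (1 + bcost b) s"
| WhileTrue: "bfits B b s \<Longrightarrow> bval b s \<Longrightarrow> exec B c s k s' \<Longrightarrow> exec B (While b c) s' l s'' \<Longrightarrow>
    exec B (While b c) s (1 + bcost b + k + l) s''"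

inductive_cases exec_SkipE: "exec B Skip s k s'"
inductive_cases exec_AssignE: "exec B (Assign v e) s k s'"
inductive_cases exec_WriteE: "exec B (Write a e f) s k s'"
inductive_cases exec_SeqE: "exec B (Seq c d) s k s'"
inductive_cases exec_CondE: "exec B (Cond b c d) s k s'"
inductive_cases exec_WhileE: "exec B (While b c) s k s'"

lemma exec_deterministic:
  assumes "exec B c s k s'" and "exec B c s l t"
  shows "l = k \<and> t = s'"
  using assms
proof (induction arbitrary: l t rule: exec.induct)
  case (Skip s)
  from Skip.prems show ?case by (rule exec_SkipE) simp
next
  case (Assign e s v)
  from Assign.prems show ?case by (rule exec_AssignE) simp
next
  case (Write e s f a)
  from Write.prems show ?case by (rule exec_WriteE) simp
next
  case (Seq c s k s' d l' s'')
  from Seq.prems obtain k1 s1 k2 where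
    "l = 1 + k1 + k2" "exec B c s k1 s1" "exec B d s1 k2 t"
    by (rule exec_SeqE) simp
  with Seq.IH show ?case by auto
next
  case (CondTrue b s c k s' d)
  from CondTrue.prems show ?case
    by (rule exec_CondE) (simp_all add: CondTrue.IH CondTrue.hyps)
next
  case (CondFalse b s d k s' c)
  from CondFalse.prems show ?case
    by (rule exec_CondE) (simp_all add: CondFalse.IH CondFalse.hyps)
next
  case (WhileFalse b s c)
  from WhileFalse.prems show ?case
    by (rule exec_WhileE) (simp_all add: WhileFalse.hyps)
next
  case (WhileTrue b s c k s' l' s'')
  from WhileTrue.prems WhileTrue.hyps obtain k1 s1 k2 where
    "l = 1 + bcost b + k1 + k2" "exec B c s k1 s1" "exec B (While b c) s1 k2 t"
    by (auto elim: exec_WhileE)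
  with WhileTrue.IH show ?case by auto
qed


section \<open>Input and output\<close>

text \<open>The input is \<open>n\<close> together with the \<open>n \<times> n\<close> matrix in row-major order; all else is zero.\<close>

definition input_store :: "nat \<Rightarrow> (nat \<Rightarrow> nat \<Rightarrow> nat) \<Rightarrow> store" where
  "input_store n A =
    ((\<lambda>v. if v = ''n'' then n else 0),
     (\<lambda>a p. if a = ''A'' \<and> p < n * n then A (p div n) (p mod n) else 0))"

fun type_code :: "node_type \<Rightarrow> nat" where
  "type_code Complete = 1"
| "type_code Linear = 2"
| "type_code Prime = 3"

text \<open>
  Trees are stored as linked structures, \<open>0\<close> being the null pointer: the record at address \<open>p\<close> has
  the fields \<open>kind\<close> (\<open>0\<close> for a leaf, the code of the type otherwise), \<open>label\<close> (the index of the
  element, at leaves), \<open>child\<close> (first child) and \<open>next\<close> (next sibling).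
\<close>

fun stored_tree :: "(string \<Rightarrow> nat \<Rightarrow> nat) \<Rightarrow> nat \<Rightarrow> nat mdtree \<Rightarrow> bool"
  and stored_forest :: "(string \<Rightarrow> nat \<Rightarrow> nat) \<Rightarrow> nat \<Rightarrow> nat mdtree list \<Rightarrow> bool" where
  "stored_tree m p (Leaf i) \<longleftrightarrow> p \<noteq> 0 \<and> m ''kind'' p = 0 \<and> m ''label'' p = i"
| "stored_tree m p (Node ty ts) \<longleftrightarrow>
    p \<noteq> 0 \<and> m ''kind'' p = type_code ty \<and> stored_forest m (m ''child'' p) ts"
| "stored_forest m p [] \<longleftrightarrow> p = 0"
| "stored_forest m p (t # ts) \<longleftrightarrow> stored_tree m p t \<and> stored_forest m (m ''next'' p) ts"

text \<open>
  The output is the tree pointed to by \<open>root\<close>. Its leaves are labelled with indices, which the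
  enumeration \<open>x\<close> translates into elements of \<open>X\<close>.
\<close>

definition outputs_md_tree ::
  "'a set \<Rightarrow> ('a \<Rightarrow> 'a \<Rightarrow> 'a \<Rightarrow> bool) \<Rightarrow> (nat \<Rightarrow> 'a) \<Rightarrow> store \<Rightarrow> bool" where
  "outputs_md_tree X H x s \<longleftrightarrow>
    (\<exists>t. stored_tree (snd s) (fst s ''root'') t \<and> set_mdtree t \<subseteq> {..<card X} \<and>
         modular_decomposition_tree X H (map_mdtree x t))"

end

theory Submission
  imports Defs "HOL-Library.Disjoint_Sets" "HOL-Combinatorics.Permutations"
begin

text \<open>
  The program has two phases, both quadratic. The first one is partition refinement. It computes a
  permutation \<open>p\<close> of the indices and, for every position \<open>c\<close>, the largest module all of whose positions
  are at least \<open>c\<close> and that contains \<open>c\<close>; this module occupies an interval of positions, the block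
  of \<open>c\<close>. The blocks are laminar. A module that is not a block but starts at \<open>c\<close> consists of \<open>c\<close> and
  some of the maximal blocks inside the block of \<open>c\<close>, namely a set of them that is closed under
  forcing: \<open>x\<close> forces \<open>y\<close> if \<open>y\<close> distinguishes \<open>x\<close> from \<open>c\<close>.

  The second phase runs through the positions from the last to the first. Gabow's path algorithm
  finds the strongly connected components of the forcing graph, sinks first. The modules
  containing \<open>c\<close> thus grow along a chain: a component of at least two blocks gives a prime node, a
  single block a node with two children. Such a binary node absorbs those of its children that are
  complete or linear and that are not strong in the union; since the relation is good, two matrix entries
  per child decide this and the orientation. Each block is visited once, which makes \<open>O(n)\<close> events of cost
  \<open>O(n)\<close> each.
\<close>

section \<open>Weakly partitive families\<close>

text \<open>Goodness is used for three facts: the difference of overlapping modules is a module, so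
  modules form a weakly partitive family; a pivot speaks for its whole block when forcing is tested;
  and a comparison made at one element of an outer child holds at all of them. The obstacle is that
  the family is only weakly partitive: a node that is not prime may be linear, and a binary step
  must then orient its parts without looking at all their children. A purely combinatorial theorem
  settles this: if no nontrivial member of such a family is strong, the family consists of all
  subsets or of the intervals of one list. Trees are judged inside their own leaf set, because a
  module under construction need not survive as a node. Refinement is quadratic since two positions
  are compared only after a split has separated them, which happens at most once per pair; the
  construction is, since each position becomes a child of at most one \<open>c\<close>. Time is an
  integer budget that is handed from program to program; its numerical constants are merely
  generous.\<close>

lemma ex_greatest_nat_le:
  fixes f :: "'c \<Rightarrow> nat"
  assumes "P k" "\<And>y. P y \<Longrightarrow> f y \<le> b"
  shows "\<exists>x. P x \<and> (\<forall>y. P y \<longrightarrow> f y \<le> f x)"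
  using ex_has_greatest_nat[of P k f "Suc b"] assms by (simp add: less_Suc_eq_le)

lemma nth_range_eq_set_take_drop:
  assumes "j \<le> length L"
  shows "{L ! m |m. i \<le> m \<and> m < j} = set (take (j - i) (drop i L))"
proof (cases "i \<le> j")
  case True
  have "x \<in> set (take (j - i) (drop i L)) \<longleftrightarrow> (\<exists>m. i \<le> m \<and> m < j \<and> x = L ! m)" for x
  proof
    assume "x \<in> set (take (j - i) (drop i L))"
    then obtain m where "m < j - i" "x = L ! (i + m)" using assms True by (auto simp: in_set_conv_nth)
    then show "\<exists>m. i \<le> m \<and> m < j \<and> x = L ! m" by (intro exI[of _ "i + m"]) auto
  next
    assume "\<exists>m. i \<le> m \<and> m < j \<and> x = L ! m"
    then obtain m where "i \<le> m" "m < j" "x = L ! m" by blast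
    then show "x \<in> set (take (j - i) (drop i L))"
      using assms True by (auto simp: in_set_conv_nth intro!: exI[of _ "m - i"])
  qed
  then show ?thesis by auto
qed auto

section \<open>Weakly partitive families and the graph of their two-element members\<close>

locale weakly_partitive =
  fixes V :: "'b set" and F :: "'b set set"
  assumes finite_V: "finite V"
    and F_subset: "S \<in> F \<Longrightarrow> S \<subseteq> V"
    and V_in: "V \<in> F"
    and empty_in: "{} \<in> F"
    and singleton_in: "x \<in> V \<Longrightarrow> {x} \<in> F"
    and Un_in: "S \<in> F \<Longrightarrow> T \<in> F \<Longrightarrow> S \<inter> T \<noteq> {} \<Longrightarrow> S \<union> T \<in> F"
    and Int_in: "S \<in> F \<Longrightarrow> T \<in> F \<Longrightarrow> S \<inter> T \<in> F"
    and Diff_in: "S \<in> F \<Longrightarrow> T \<in> F \<Longrightarrow> overlap S T \<Longrightarrow> S - T \<in> F"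
begin

lemma finite_member: "S \<in> F \<Longrightarrow> finite S"
  using F_subset finite_V finite_subset by blast

lemma insert_edge: "S \<in> F \<Longrightarrow> x \<in> S \<Longrightarrow> {x, y} \<in> F \<Longrightarrow> insert y S \<in> F"
  using Un_in[of S "{x, y}"] by (auto simp: insert_absorb)

text \<open>\<open>{a, b, c}\<close> is a union of two edges at \<open>b\<close> and overlaps
  \<open>{b, d}\<close>; the difference is \<open>{a, c}\<close>. Three neighbours of one vertex are
  therefore pairwise adjacent, which leaves a connected edge graph only the shapes path, cycle and
  complete graph.\<close>

lemma edge_fan:
  assumes "{b, a} \<in> F" "{b, c} \<in> F" "{b, d} \<in> F" "distinct [a, b, c, d]"
  shows "{a, c} \<in> F"
proof -
  have abc: "{a, b, c} \<in> F"
    using Un_in[OF assms(1,2)] by (simp add: insert_commute)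
  have "overlap {a, b, c} {b, d}"
    using assms(4) by (auto simp: overlap_def)
  from Diff_in[OF abc assms(3) this] show ?thesis
    using assms(4) by (auto simp: insert_Diff_if insert_commute split: if_splits)
qed

lemma intervals_in:
  assumes "successively (\<lambda>x y. {x, y} \<in> F) L" "set L \<subseteq> V"
  shows "set L \<in> F"
  using assms
proof (induction L rule: induct_list012)
  case (3 x y zs)
  then have "set (y # zs) \<in> F" by simp
  with 3(3) show ?case
    using insert_edge[of "set (y # zs)" y x] by (simp add: insert_commute)
qed (auto simp: empty_in singleton_in)

lemma successively_take_drop:
  "successively P L \<Longrightarrow> successively P (take k (drop i L))"
  by (metis append_take_drop_id successively_append_iff)

end

text \<open>The case of a node that is not prime: \<open>nontrivial\<close> keeps the prime families
  out, and \<open>not_strong\<close> leaves no strong member strictly between the singletons and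
  \<open>V\<close>. The two-element members, called edges, then determine all of
  \<open>F\<close>.\<close>

locale strongless = weakly_partitive +
  assumes not_strong: "S \<in> F \<Longrightarrow> 2 \<le> card S \<Longrightarrow> S \<noteq> V \<Longrightarrow> \<exists>T\<in>F. overlap S T"
    and nontrivial: "\<exists>S\<in>F. 2 \<le> card S \<and> S \<noteq> V"
begin

text \<open>A smallest nontrivial member \<open>S\<close> is overlapped by some \<open>T\<close>.
  Both \<open>S \<inter> T\<close> and \<open>S - T\<close> are nonempty smaller members, hence
  singletons, so \<open>S\<close> is an edge.\<close>

lemma edge_exists: "\<exists>x y. x \<noteq> y \<and> {x, y} \<in> F"
proof -
  obtain S where S: "S \<in> F" "2 \<le> card S" "S \<noteq> V"
    and min: "\<And>T. T \<in> F \<Longrightarrow> 2 \<le> card T \<Longrightarrow> T \<noteq> V \<Longrightarrow> card S \<le> card T"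
    using nontrivial ex_has_least_nat[of "\<lambda>S. S \<in> F \<and> 2 \<le> card S \<and> S \<noteq> V" _ card] by blast
  obtain T where T: "T \<in> F" "overlap S T" using not_strong S by blast
  have fS: "finite S" by (simp add: S finite_member)
  have sub: "R \<subset> S \<Longrightarrow> R \<in> F \<Longrightarrow> card R \<le> 1" for R
    using min[of R] psubset_card_mono[OF fS, of R] F_subset S(1)
    by (metis leD not_less_eq_eq numeral_2_eq_2 One_nat_def psubsetE subset_antisym)
  have "card (S \<inter> T) \<le> 1" "card (S - T) \<le> 1"
    using sub[of "S \<inter> T"] sub[of "S - T"] Int_in Diff_in T S(1) unfolding overlap_def by blast+
  then have "card S \<le> 2"
    using card_Un_disjoint[of "S \<inter> T" "S - T"] fS by (simp add: Int_Diff_Un Int_Diff_disjoint)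
  then have "card S = 2" using S by simp
  then show ?thesis using S(1) by (auto simp: card_2_iff)
qed

text \<open>Connectivity of the edge graph. The component \<open>C\<close> of an edge is itself a
  member, so if it were not \<open>V\<close>, some member would overlap it; a smallest such member
  \<open>N\<close> can always be made smaller.\<close>

lemma edge_leaving:
  assumes K: "K \<subseteq> V" "K \<noteq> {}" "K \<noteq> V"
  shows "\<exists>x\<in>K. \<exists>y\<in>V - K. {x, y} \<in> F"
proof -
  define E where "E = {(x, y). {x, y} \<in> F}"
  have symE: "sym E" by (auto simp: E_def sym_def insert_commute)
  obtain x0 y0 where x0: "x0 \<noteq> y0" "{x0, y0} \<in> F" using edge_exists by blast
  define C where "C = {y. (x0, y) \<in> E\<^sup>*}"
  have x0V: "x0 \<in> V" using F_subset[OF x0(2)] by simp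
  have C_V: "C \<subseteq> V"
  proof
    fix y assume "y \<in> C"
    then have "(x0, y) \<in> E\<^sup>*" by (simp add: C_def)
    then show "y \<in> V"
      by (induction) (use x0V F_subset in \<open>auto simp: E_def\<close>)
  qed
  have x0C: "x0 \<in> C" "y0 \<in> C" using x0 by (auto simp: C_def E_def)
  have leave: "\<exists>x\<in>S. \<exists>y\<in>C - S. {x, y} \<in> F" if S: "S \<inter> C \<noteq> {}" "\<not> C \<subseteq> S" for S
  proof (rule ccontr)
    assume neg: "\<not> ?thesis"
    obtain a where a: "a \<in> S" "a \<in> C" using S by blast
    have aC: "(a, y) \<in> E\<^sup>*" if "y \<in> C" for y
    proof -
      have "(a, x0) \<in> E\<^sup>*" using a symE sym_rtrancl by (auto simp: C_def dest: symD)
      then show ?thesis using that by (auto simp: C_def)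
    qed
    have "y \<in> S" if "(a, y) \<in> E\<^sup>*" for y
      using that
    proof (induction)
      case (step y z)
      have "z \<in> C" using step(1,2) a by (metis C_def mem_Collect_eq rtrancl.simps rtrancl_trans)
      with neg step show ?case by (auto simp: E_def)
    qed (rule a)
    with aC S show False by blast
  qed
  \<comment> \<open>A largest member inside \<open>C\<close> that contains \<open>x0\<close> absorbs
    every edge by which the component continues.\<close>
  have CF: "C \<in> F"
  proof -
    obtain S where S: "S \<in> F" "x0 \<in> S" "S \<subseteq> C"
      and mx: "\<And>T. T \<in> F \<Longrightarrow> x0 \<in> T \<Longrightarrow> T \<subseteq> C \<Longrightarrow> card T \<le> card S"
    proof -
      have "\<exists>S. (S \<in> F \<and> x0 \<in> S \<and> S \<subseteq> C) \<and> (\<forall>T. T \<in> F \<and> x0 \<in> T \<and> T \<subseteq> C \<longrightarrow> card T \<le> card S)"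
        by (rule ex_greatest_nat_le[where k = "{x0}" and b = "card V"])
          (use x0C x0V singleton_in F_subset card_mono[OF finite_V] in auto)
      then show ?thesis using that by blast
    qed
    have "S = C"
    proof (rule ccontr)
      assume "S \<noteq> C"
      then obtain x y where xy: "x \<in> S" "y \<in> C - S" "{x, y} \<in> F" using leave[of S] S x0C by blast
      have "insert y S \<in> F" using insert_edge S xy by blast
      then have "card (insert y S) \<le> card S" using mx S xy by blast
      then show False using xy finite_member[OF S(1)] by simp
    qed
    then show ?thesis using S by simp
  qed
  have C2: "2 \<le> card C"
    using x0C x0 finite_member[OF CF] by (metis card_2_iff card_mono empty_subsetI insert_subset)
  have noleave: "\<not> (\<exists>x\<in>C. \<exists>y. y \<notin> C \<and> {x, y} \<in> F)"
    by (auto simp: C_def E_def intro: rtrancl_into_rtrancl)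
  have "C = V"
  proof (rule ccontr)
    assume "C \<noteq> V"
    then have ex: "\<exists>T. T \<in> F \<and> overlap C T" using not_strong CF C2 by blast
    obtain N where N: "N \<in> F" "overlap C N"
      and min: "\<And>T. T \<in> F \<Longrightarrow> overlap C T \<Longrightarrow> card N \<le> card T"
      using ex_has_least_nat[of "\<lambda>T. T \<in> F \<and> overlap C T" _ card] ex by blast
    have fN: "finite N" by (simp add: N finite_member)
    have small: "\<not> overlap C T" if "T \<in> F" "T \<subset> N" for T
      using min[OF that(1)] psubset_card_mono[OF fN that(2)] by auto
    obtain x y where xy: "x \<in> N" "y \<in> C - N" "{x, y} \<in> F" "x \<in> C"
      using leave[of "N \<inter> C"] N by (auto simp: overlap_def)
    have "overlap N {x, y}" using xy N by (auto simp: overlap_def)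
    then have Nx: "N - {x, y} \<in> F" using Diff_in N xy by blast
    have Nx': "N - {x, y} = N - {x}" using xy by auto
    \<comment> \<open>The edge \<open>{x, y}\<close> takes only \<open>x\<close> away from
      \<open>N\<close>. By minimality the rest no longer overlaps \<open>C\<close>, although it
      still has elements outside \<open>C\<close>; so it misses \<open>C\<close>.\<close>
    have NC: "N \<inter> C = {x}"
      using small[of "N - {x}"] Nx Nx' xy N by (auto simp: overlap_def)
    define D where "D = N - {x}"
    have D: "D \<in> F" "D \<noteq> {}" "D \<inter> C = {}" "N = insert x D" "x \<notin> D"
      using Nx Nx' N NC xy by (auto simp: D_def overlap_def)
    \<comment> \<open>Otherwise \<open>N\<close> would be an edge leading out of the
      component.\<close>
    have "2 \<le> card D"
    proof (rule ccontr)
      assume "\<not> 2 \<le> card D"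
      then have "card D = 1" using D finite_member by (metis One_nat_def card_0_eq le_SucE less_2_cases not_le numeral_2_eq_2)
      then obtain d where "D = {d}" by (auto simp: card_1_singleton_iff)
      then show False using N D noleave xy by auto
    qed
    moreover have "D \<noteq> V" using D x0V x0C xy F_subset by blast
    ultimately obtain D' where D': "D' \<in> F" "overlap D D'" using not_strong D by blast
    \<comment> \<open>According to whether \<open>x\<close> lies in \<open>D'\<close>, the member
      \<open>N \<inter> D'\<close> or \<open>N - D'\<close> keeps \<open>x\<close> together with a
      proper nonempty part of \<open>D\<close>. It still overlaps \<open>C\<close> but is smaller
      than \<open>N\<close>.\<close>
    show False
    proof (cases "x \<in> D'")
      case True
      have "N \<inter> D' \<in> F" using Int_in N D' by blast
      moreover have "N \<inter> D' \<subset> N" using D' D by (auto simp: overlap_def)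
      moreover have "overlap C (N \<inter> D')"
        using True D' D xy NC by (auto simp: overlap_def)
      ultimately show False using small by blast
    next
      case False
      have "overlap N D'" using False D' D by (auto simp: overlap_def)
      then have "N - D' \<in> F" using Diff_in N D' by blast
      moreover have "N - D' \<subset> N" using D' D by (auto simp: overlap_def)
      moreover have "overlap C (N - D')"
        using False D' D xy NC by (auto simp: overlap_def)
      ultimately show False using small by blast
    qed
  qed
  then show ?thesis using leave[of K] K by blast
qed

text \<open>A maximal clique \<open>K\<close> of at least three vertices is extended by any
  \<open>w\<close> adjacent to one \<open>k\<close> in \<open>K\<close>: for another
  \<open>x\<close> in \<open>K\<close>, a third vertex \<open>y\<close> makes
  \<open>edge_fan\<close> at \<open>k\<close> applicable. So \<open>K\<close> is \<open>V\<close>,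
  and unions of edges give every subset.\<close>

lemma complete_if_triangle:
  assumes tri: "{a, b} \<in> F" "{b, c} \<in> F" "{a, c} \<in> F" "distinct [a, b, c]" and "S \<subseteq> V"
  shows "S \<in> F"
proof -
  define clique where "clique K \<longleftrightarrow> K \<subseteq> V \<and> 3 \<le> card K \<and> (\<forall>x\<in>K. \<forall>y\<in>K. {x, y} \<in> F)" for K
  have c0: "clique {a, b, c}"
    using tri F_subset[OF tri(1)] F_subset[OF tri(2)] singleton_in
    by (auto simp: clique_def insert_commute)
  have "\<exists>K. clique K \<and> (\<forall>T. clique T \<longrightarrow> card T \<le> card K)"
    by (rule ex_greatest_nat_le[where k = "{a, b, c}" and b = "card V"])
      (use c0 card_mono[OF finite_V] in \<open>auto simp: clique_def\<close>)
  then obtain K where K: "clique K" and mx: "\<And>T. clique T \<Longrightarrow> card T \<le> card K" by blast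
  have fK: "finite K" using K finite_V finite_subset by (auto simp: clique_def)
  have "K = V"
  proof (rule ccontr)
    assume "K \<noteq> V"
    moreover have "K \<noteq> {}" using K by (auto simp: clique_def)
    ultimately obtain k w where kw: "k \<in> K" "w \<in> V - K" "{k, w} \<in> F"
      using edge_leaving[of K] K by (auto simp: clique_def)
    have adj: "{x, w} \<in> F" if x: "x \<in> K" "x \<noteq> k" for x
    proof -
      have "3 \<le> card K" using K by (simp add: clique_def)
      then have "card (K - {k, x}) \<ge> 1" using fK x kw by (simp add: card_Diff_subset)
      then have "K - {k, x} \<noteq> {}" by (metis card.empty not_one_le_zero)
      then obtain y where y: "y \<in> K - {k, x}" by blast
      show ?thesis
        using edge_fan[of k x w y] K kw x y by (auto simp: clique_def)
    qed
    have "clique (insert w K)"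
      using K kw adj fK singleton_in by (auto simp: clique_def insert_commute)
    then show False using mx[of "insert w K"] kw fK by simp
  qed
  then have pair: "{x, y} \<in> F" if "x \<in> V" "y \<in> V" for x y using K that by (auto simp: clique_def)
  have "finite S" using assms(5) finite_V finite_subset by blast
  then show ?thesis using assms(5)
  proof (induction S rule: finite_induct)
    case (insert x S)
    show ?case
    proof (cases "S = {}")
      case False
      then obtain y where "y \<in> S" by blast
      then show ?thesis using insert insert_edge[of S y x] pair by (auto simp: insert_commute)
    qed (use insert singleton_in in auto)
  qed (rule empty_in)
qed

text \<open>Without triangles a longest path covers everything: a vertex attached to an end would
  prolong the path, and one attached to an inner vertex would create a triangle by
  \<open>edge_fan\<close>. That every member is convex along the path also excludes the
  cycle.\<close>

theorem complete_or_linear: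
  "(\<forall>S\<subseteq>V. S \<in> F) \<or>
   (\<exists>L. distinct L \<and> set L = V \<and> (\<forall>S\<subseteq>V. S \<in> F \<longleftrightarrow> (\<exists>i k. S = set (take k (drop i L)))))"
proof (cases "\<exists>a b c. {a, b} \<in> F \<and> {b, c} \<in> F \<and> {a, c} \<in> F \<and> distinct [a, b, c]")
  case True
  then show ?thesis using complete_if_triangle by blast
next
  case notri: False
  define path where "path L \<longleftrightarrow> L \<noteq> [] \<and> distinct L \<and> set L \<subseteq> V \<and> successively (\<lambda>x y. {x, y} \<in> F) L" for L
  obtain x0 where "x0 \<in> V" using nontrivial F_subset by fastforce
  then have p0: "path [x0]" by (simp add: path_def)
  have "\<exists>L. path L \<and> (\<forall>M. path M \<longrightarrow> length M \<le> length L)"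
    by (rule ex_greatest_nat_le[where k = "[x0]" and b = "card V"])
      (use p0 card_mono[OF finite_V] in \<open>auto simp: path_def simp flip: distinct_card\<close>)
  then obtain L where L: "path L" and mx: "\<And>M. path M \<Longrightarrow> length M \<le> length L" by blast
  have nolong: "\<not> path M" if "length M = Suc (length L)" for M using mx[of M] that by auto
  have setL: "set L = V"
  proof (rule ccontr)
    assume "set L \<noteq> V"
    then obtain x w where xw: "x \<in> set L" "w \<in> V - set L" "{x, w} \<in> F"
      using edge_leaving[of "set L"] L by (auto simp: path_def)
    obtain ys zs where L_eq: "L = ys @ x # zs" using xw(1) by (meson split_list)
    show False
    proof (cases "ys = [] \<or> zs = []")
      case True
      then show False
      proof
        assume "ys = []"
        then have "path (w # L)" using L xw L_eq by (auto simp: path_def insert_commute)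
        then show False using nolong by auto
      next
        assume "zs = []"
        then have "path (L @ [w])" using L xw L_eq by (auto simp: path_def successively_append_iff)
        then show False using nolong by auto
      qed
    next
      case False
      then obtain a ys' c zs' where e: "ys = ys' @ [a]" "zs = c # zs'"
        by (metis neq_Nil_conv rev_exhaust)
      have ax: "{a, x} \<in> F" "{x, c} \<in> F" using L L_eq e
        by (auto simp: path_def successively_append_iff)
      have "distinct [a, x, c, w]" using L L_eq e xw by (auto simp: path_def)
      then have "{a, c} \<in> F" using edge_fan[of x a c w] ax xw by (auto simp: insert_commute)
      then show False using notri ax \<open>distinct [a, x, c, w]\<close> by auto
    qed
  qed
  have dL: "distinct L" and sL: "successively (\<lambda>x y. {x, y} \<in> F) L" using L by (auto simp: path_def)
  have int_in: "set (take k (drop i L)) \<in> F" for i k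
    by (rule intervals_in[OF successively_take_drop[OF sL]])
      (metis setL set_take_subset set_drop_subset subset_trans)
  have sub_in: "{L ! m |m. i \<le> m \<and> m < j} \<in> F" if "j \<le> length L" for i j
    using int_in by (simp add: nth_range_eq_set_take_drop[OF that])
  have only: "\<exists>i k. S = set (take k (drop i L))" if S: "S \<in> F" "S \<noteq> {}" for S
  proof -
    define I where "I = {m. m < length L \<and> L ! m \<in> S}"
    have finI: "finite I" by (simp add: I_def)
    have S_eq: "S = (!) L ` I"
    proof
      show "S \<subseteq> (!) L ` I"
      proof
        fix x assume "x \<in> S"
        then obtain m where "m < length L" "x = L ! m"
          using F_subset[OF S(1)] setL by (metis in_set_conv_nth subsetD)
        then show "x \<in> (!) L ` I" using \<open>x \<in> S\<close> by (auto simp: I_def)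
      qed
    qed (auto simp: I_def)
    have Ine: "I \<noteq> {}" using S S_eq by auto
    define i where "i = Min I"
    define j where "j = Max I"
    have ij: "i \<in> I" "j \<in> I" "I \<subseteq> {i..j}" using finI Ine by (auto simp: i_def j_def)
    have "I = {i..j}"
    proof (rule ccontr)
      assume "I \<noteq> {i..j}"
      then obtain g where g: "g \<notin> I" "i < g" "g < j"
        using ij by (metis atLeastAtMost_iff le_neq_implies_less subsetI subset_antisym)
      define a where "a = Max (I \<inter> {..<g})"
      define b where "b = Min (I \<inter> {g<..})"
      have a: "a \<in> I" "a < g" "\<And>m. m \<in> I \<Longrightarrow> m < g \<Longrightarrow> m \<le> a"
      proof -
        have "I \<inter> {..<g} \<noteq> {}" using ij g by blast
        then have "a \<in> I \<inter> {..<g}" unfolding a_def using finI by (intro Max_in) auto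
        then show "a \<in> I" "a < g" by auto
      qed (use finI in \<open>auto simp: a_def\<close>)
      have b: "b \<in> I" "g < b" "\<And>m. m \<in> I \<Longrightarrow> g < m \<Longrightarrow> b \<le> m"
      proof -
        have "I \<inter> {g<..} \<noteq> {}" using ij g by blast
        then have "b \<in> I \<inter> {g<..}" unfolding b_def using finI by (intro Min_in) auto
        then show "b \<in> I" "g < b" by auto
      qed (use finI in \<open>auto simp: b_def\<close>)
      have bl: "b < length L" using b by (simp add: I_def)
      have gap: "m \<in> I \<Longrightarrow> a \<le> m \<Longrightarrow> m \<le> b \<Longrightarrow> m = a \<or> m = b" for m
        using a b g by (metis le_antisym linorder_neqE_nat)
      \<comment> \<open>\<open>a\<close> and \<open>b\<close> are the members of \<open>S\<close>
        next to the gap, so cutting \<open>S\<close> down to the interval between them leaves an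
        edge that bridges the gap.\<close>
      have "S \<inter> {L ! m |m. a \<le> m \<and> m < Suc b} = {L ! a, L ! b}"
        using gap a b bl dL by (auto simp: I_def nth_eq_iff_index_eq) (metis less_Suc_eq_le)
      then have ab: "{L ! a, L ! b} \<in> F"
        using Int_in[OF S(1) sub_in[of "Suc b" a]] bl by simp
      have "a + 2 \<le> b" using a b by simp
      \<comment> \<open>The far end of the bridging edge is pulled back: join the interval from
        \<open>a + 2\<close> to \<open>b\<close>, then intersect with the three positions from
        \<open>a\<close> on. This leaves an edge from \<open>a\<close> to \<open>a + 2\<close>, and
        with the path edges a triangle.\<close>
      have "{L ! a, L ! b} \<union> {L ! m |m. a + 2 \<le> m \<and> m < Suc b} \<in> F"
        by (rule Un_in[OF ab sub_in]) (use \<open>a + 2 \<le> b\<close> bl in auto)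
      then have "({L ! a, L ! b} \<union> {L ! m |m. a + 2 \<le> m \<and> m < Suc b}) \<inter> {L ! m |m. a \<le> m \<and> m < a + 3} \<in> F"
        by (rule Int_in[OF _ sub_in]) (use \<open>a + 2 \<le> b\<close> bl in auto)
      also have "({L ! a, L ! b} \<union> {L ! m |m. a + 2 \<le> m \<and> m < Suc b}) \<inter> {L ! m |m. a \<le> m \<and> m < a + 3}
        = {L ! a, L ! (a + 2)}" (is "?X = ?Y")
      proof
        show "?X \<subseteq> ?Y"
        proof
          fix x assume x: "x \<in> ?X"
          then obtain m where m: "x = L ! m" "a \<le> m" "m < a + 3" by auto
          have "m = a \<or> m = a + 2"
          proof (rule ccontr)
            assume "\<not> ?thesis"
            then have "m = a + 1" using m by auto
            then show False using x m dL bl \<open>a + 2 \<le> b\<close> by (auto simp: nth_eq_iff_index_eq)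
          qed
          then show "x \<in> ?Y" using m by auto
        qed
        show "?Y \<subseteq> ?X" using \<open>a + 2 \<le> b\<close> by auto
      qed
      finally have "{L ! a, L ! (a + 2)} \<in> F" .
      moreover have "{L ! a, L ! Suc a} \<in> F" "{L ! Suc a, L ! Suc (Suc a)} \<in> F"
        using sL bl \<open>a + 2 \<le> b\<close> by (auto simp: successively_conv_nth)
      moreover have "distinct [L ! a, L ! Suc a, L ! Suc (Suc a)]"
        using dL bl \<open>a + 2 \<le> b\<close> by (auto simp: nth_eq_iff_index_eq)
      ultimately show False using notri by (metis add_2_eq_Suc')
    qed
    then have "S = {L ! m |m. i \<le> m \<and> m < Suc j}" using S_eq by auto
    moreover have "Suc j \<le> length L" using ij by (simp add: I_def)
    ultimately have "S = set (take (Suc j - i) (drop i L))"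
      using nth_range_eq_set_take_drop[of "Suc j" L i] by (simp only:)
    then show ?thesis by blast
  qed
  have "\<forall>S\<subseteq>V. S \<in> F \<longleftrightarrow> (\<exists>i k. S = set (take k (drop i L)))"
  proof (intro allI impI iffI)
    fix S assume "S \<subseteq> V" "S \<in> F"
    then show "\<exists>i k. S = set (take k (drop i L))"
      using only[of S] by (cases "S = {}") (auto intro: exI[of _ 0])
  qed (use int_in in auto)
  then show ?thesis using dL setL by blast
qed

end

section \<open>Modules of a matrix\<close>

lemma interval_iff_nth:
  "(\<exists>i k. S = set (take k (drop i L))) \<longleftrightarrow> (\<exists>i j. j \<le> length L \<and> S = {L ! m |m. i \<le> m \<and> m < j})"
  (is "?A \<longleftrightarrow> ?B")
proof
  assume ?A
  then obtain i k where S: "S = set (take k (drop i L))" by blast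
  show ?B
  proof (cases "i \<le> length L")
    case True
    have "take k (drop i L) = take (min (i + k) (length L) - i) (drop i L)"
      using True by (simp add: min_def)
    then have "S = set (take (min (i + k) (length L) - i) (drop i L))" using S by (simp only:)
    then show ?B
      by (intro exI[of _ i] exI[of _ "min (i + k) (length L)"] conjI min.cobounded2)
        (simp only: nth_range_eq_set_take_drop[OF min.cobounded2])
  next
    case False
    then show ?B using S by (intro exI[of _ i] exI[of _ 0]) auto
  qed
next
  assume ?B
  then obtain i j where "j \<le> length L" "S = {L ! m |m. i \<le> m \<and> m < j}" by blast
  then have "S = set (take (j - i) (drop i L))" by (simp only: nth_range_eq_set_take_drop)
  then show ?A by blast
qed

lemma interval_rev:
  assumes "\<exists>i k. S = set (take k (drop i L))"
  shows "\<exists>i k. S = set (take k (drop i (rev L)))"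
proof -
  obtain i j where ij: "j \<le> length L" "S = {L ! m |m. i \<le> m \<and> m < j}"
    using assms interval_iff_nth[of S L] by blast
  have "S = {rev L ! m |m. length L - j \<le> m \<and> m < length L - i}"
  proof -
    have "x \<in> S \<longleftrightarrow> (\<exists>m. x = rev L ! m \<and> length L - j \<le> m \<and> m < length L - i)" for x
    proof
      assume "x \<in> S"
      then obtain m where "i \<le> m" "m < j" "x = L ! m" using ij by auto
      then show "\<exists>m. x = rev L ! m \<and> length L - j \<le> m \<and> m < length L - i"
        using ij(1) by (intro exI[of _ "length L - Suc m"]) (auto simp: rev_nth)
    next
      assume "\<exists>m. x = rev L ! m \<and> length L - j \<le> m \<and> m < length L - i"
      then obtain m where "x = rev L ! m" "length L - j \<le> m" "m < length L - i" by blast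
      then show "x \<in> S" using ij by (auto simp: rev_nth intro!: exI[of _ "length L - Suc m"])
    qed
    then show ?thesis by auto
  qed
  moreover have "length L - i \<le> length (rev L)" by simp
  ultimately show ?thesis unfolding interval_iff_nth by blast
qed

lemma interval_rev_iff:
  "(\<exists>i k. S = set (take k (drop i (rev L)))) \<longleftrightarrow> (\<exists>i k. S = set (take k (drop i L)))"
  using interval_rev[of S L] interval_rev[of S "rev L"] by auto

lemma interval_convex:
  assumes "\<exists>i k. S = set (take k (drop i L))" and "distinct L"
    and "L ! p \<in> S" "L ! r \<in> S" "p \<le> q" "q \<le> r" "r < length L"
  shows "L ! q \<in> S"
proof -
  obtain i j where ij: "j \<le> length L" "S = {L ! m |m. i \<le> m \<and> m < j}"
    using assms(1) interval_iff_nth[of S L] by blast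
  have "i \<le> p" "r < j" using ij assms by (auto simp: nth_eq_iff_index_eq)
  then show ?thesis using ij assms by auto
qed

text \<open>If the interval \<open>P\<close> were neither first nor last, \<open>Q\<close> would
  contain both ends of the list, and convexity of \<open>Q\<close> would put an element of
  \<open>P\<close> into it.\<close>

lemma interval_split:
  assumes d: "distinct L" and U: "set L = P \<union> Q" "P \<inter> Q = {}"
    and P: "\<exists>i k. P = set (take k (drop i L))" and Q: "\<exists>i k. Q = set (take k (drop i L))"
  shows "\<exists>M R. (L = M @ R \<or> L = R @ M) \<and> set M = P \<and> set R = Q"
proof -
  obtain i k where ik: "P = set (take k (drop i L))" using P by blast
  define A where "A = take i L"
  define B where "B = take k (drop i L)"
  define C where "C = drop k (drop i L)"
  have L: "L = A @ B @ C" by (simp add: A_def B_def C_def del: drop_drop)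
  have P_eq: "P = set B" using ik by (simp only: B_def)
  have "distinct (A @ B @ C)" "set (A @ B @ C) = P \<union> Q" using d U(1) by (simp_all only: L)
  then have Q_eq: "Q = set A \<union> set C" using P_eq U(2) by auto
  have "A = [] \<or> C = [] \<or> B = []"
  proof (rule ccontr)
    assume "\<not> ?thesis"
    then have ne: "A \<noteq> []" "B \<noteq> []" "C \<noteq> []" by auto
    have "L ! 0 \<in> Q" using ne unfolding L by (auto simp: Q_eq nth_append)
    moreover have "L ! (length L - 1) \<in> Q" using ne Q_eq L
      by (metis UnI2 append_is_Nil_conv last_appendR last_conv_nth last_in_set)
    moreover have "length A < length L" using ne unfolding L by auto
    ultimately have "L ! length A \<in> Q"
      using interval_convex[OF Q d, of 0 "length L - 1" "length A"] by simp
    moreover have "L ! length A \<in> P" using ne unfolding L by (auto simp: nth_append P_eq)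
    ultimately show False using U by blast
  qed
  then consider "A = []" | "C = []" | "B = []" by blast
  then show ?thesis
  proof cases
    case 3
    then show ?thesis using L Q_eq P_eq by (intro exI[of _ "[]"] exI[of _ L]) simp
  next
    case 1
    then show ?thesis using L Q_eq P_eq by (intro exI[of _ B] exI[of _ C]) simp
  next
    case 2
    then show ?thesis using L Q_eq P_eq by (intro exI[of _ B] exI[of _ A]) simp
  qed
qed

text \<open>From one entry of \<open>xs\<close> to the next, the position in \<open>ys\<close>
  changes by exactly one, and injectivity forbids a turn. This is how a linear order is recovered
  from its intervals of length two, up to reversal.\<close>

lemma same_adjacency_eq_or_rev:
  assumes d: "distinct xs" "distinct ys" "set xs = set ys"
    and adj: "\<And>i. Suc i < length xs \<Longrightarrow> \<exists>j. Suc j < length ys \<and> {xs ! i, xs ! Suc i} = {ys ! j, ys ! Suc j}"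
  shows "xs = ys \<or> xs = rev ys"
proof -
  have len: "length xs = length ys" using d by (metis distinct_card)
  define p where "p i = (SOME k. k < length ys \<and> ys ! k = xs ! i)" for i
  have p: "p i < length ys \<and> ys ! p i = xs ! i" if "i < length xs" for i
  proof -
    have "xs ! i \<in> set ys" using that d(3) nth_mem by blast
    then have "\<exists>k. k < length ys \<and> ys ! k = xs ! i" by (simp add: in_set_conv_nth)
    then show ?thesis unfolding p_def by (rule someI_ex)
  qed
  have pinj: "p i = p j \<Longrightarrow> i < length xs \<Longrightarrow> j < length xs \<Longrightarrow> i = j" for i j
    using p d by (metis nth_eq_iff_index_eq)
  have step: "p (Suc i) = Suc (p i) \<or> p i = Suc (p (Suc i))" if i: "Suc i < length xs" for i
  proof -
    obtain j where j: "Suc j < length ys" "{xs ! i, xs ! Suc i} = {ys ! j, ys ! Suc j}"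
      using adj[OF i] by blast
    have "xs ! i = ys ! p i" "xs ! Suc i = ys ! p (Suc i)" "p i < length ys" "p (Suc i) < length ys"
      using p[of i] p[of "Suc i"] i by auto
    then show ?thesis using j d by (auto simp: doubleton_eq_iff nth_eq_iff_index_eq)
  qed
  show ?thesis
  proof (cases "length xs \<le> 1")
    case True
    then show ?thesis using d len
      by (metis length_0_conv length_Suc_conv le_SucE One_nat_def le_zero_eq insertI1 list.set(1) list.simps(15)
          rev_singleton_conv singletonD rev.simps(1))
  next
    case False
    consider (up) "p 1 = Suc (p 0)" | (down) "p 0 = Suc (p 1)" using step[of 0] False by auto
    then show ?thesis
    proof cases
      case up
      have "i < length xs \<Longrightarrow> p i = p 0 + i" for i
      proof (induction i rule: less_induct)
        case (less i)
        consider "i = 0" | "i = 1" | j where "i = Suc (Suc j)" by (metis One_nat_def not0_implies_Suc)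
        then show ?case
        proof cases
          case 3
          then have "p (Suc j) = p 0 + Suc j" "p j = p 0 + j" using less.IH[of "Suc j"] less.IH[of j] less.prems by auto
          moreover have "p i \<noteq> p j" using pinj[of j i] less.prems 3 by auto
          ultimately show ?thesis using step[of "Suc j"] less.prems unfolding 3 by linarith
        qed (use up in auto)
      qed
      moreover have "p (length xs - 1) < length xs" using p[of "length xs - 1"] len False by auto
      with calculation[of "length xs - 1"] False have "p 0 = 0" by linarith
      ultimately have "xs = ys" using p len by (metis add_0 nth_equalityI)
      then show ?thesis ..
    next
      case down
      have dn: "i < length xs \<Longrightarrow> p 0 = p i + i" for i
      proof (induction i rule: less_induct)
        case (less i)
        consider "i = 0" | "i = 1" | j where "i = Suc (Suc j)" by (metis One_nat_def not0_implies_Suc)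
        then show ?case
        proof cases
          case 3
          then have "p 0 = p (Suc j) + Suc j" "p 0 = p j + j" using less.IH[of "Suc j"] less.IH[of j] less.prems by auto
          moreover have "p i \<noteq> p j" using pinj[of j i] less.prems 3 by auto
          ultimately show ?thesis using step[of "Suc j"] less.prems unfolding 3 by linarith
        qed (use down in auto)
      qed
      have "p 0 < length xs" using p[of 0] len False by linarith
      with dn[of "length xs - 1"] False have p0: "p 0 = length xs - 1" by linarith
      have "xs = rev ys"
      proof (rule nth_equalityI)
        fix i assume i: "i < length xs"
        then have "p i = length ys - Suc i" using dn[of i] p0 len by linarith
        then show "xs ! i = rev ys ! i" using p[of i] i len by (simp add: rev_nth)
      qed (simp add: len)
      then show ?thesis ..
    qed
  qed
qed

section \<open>Modules of a good matrix\<close>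

definition row_rel :: "('a \<Rightarrow> 'a \<Rightarrow> 'b) \<Rightarrow> 'a \<Rightarrow> 'a \<Rightarrow> 'a \<Rightarrow> bool" where
  "row_rel a i j k \<longleftrightarrow> a i j = a i k"

locale good_matrix =
  fixes N :: "nat set" and a :: "nat \<Rightarrow> nat \<Rightarrow> nat"
  assumes finite_N: "finite N" and good_a: "good N (row_rel a)"
begin

abbreviation "md \<equiv> hom_module N (row_rel a)"

lemma md_iff: "md S \<longleftrightarrow> S \<subseteq> N \<and> (\<forall>x\<in>N - S. \<forall>m\<in>S. \<forall>m'\<in>S. a x m = a x m')"
  by (simp add: hom_module_def row_rel_def)

lemma md_subset: "md S \<Longrightarrow> S \<subseteq> N"
  by (simp add: md_iff)

lemma mdD: "md S \<Longrightarrow> x \<in> N \<Longrightarrow> x \<notin> S \<Longrightarrow> m \<in> S \<Longrightarrow> m' \<in> S \<Longrightarrow> a x m = a x m'"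
  unfolding md_iff by blast

lemma goodD:
  "md M \<Longrightarrow> x \<in> M \<Longrightarrow> y \<in> M \<Longrightarrow> s \<in> N - M \<Longrightarrow> t \<in> N - M \<Longrightarrow> a x s = a x t \<longleftrightarrow> a y s = a y t"
  using good_a unfolding good_def row_rel_def by blast

lemma md_empty: "md {}" by (simp add: md_iff)

lemma md_N: "md N" by (simp add: md_iff)

lemma md_Int: "md S \<Longrightarrow> md T \<Longrightarrow> md (S \<inter> T)"
  unfolding md_iff by blast

text \<open>Any two elements of the union are compared through a detour over \<open>S\<close>, which
  every member of \<open>\<T>\<close> meets; the members may be disjoint from each other.\<close>

lemma md_Un_Union:
  assumes "md S" "\<And>T. T \<in> \<T> \<Longrightarrow> md T \<and> S \<inter> T \<noteq> {}"
  shows "md (S \<union> \<Union>\<T>)"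
proof -
  have link: "a x m = a x s" if "x \<in> N - (S \<union> \<Union>\<T>)" "m \<in> S \<union> \<Union>\<T>" "s \<in> S" for x m s
  proof (cases "m \<in> S")
    case True
    then show ?thesis using mdD[OF assms(1)] that by blast
  next
    case False
    then obtain T where "T \<in> \<T>" "m \<in> T" using \<open>m \<in> S \<union> \<Union>\<T>\<close> by blast
    moreover obtain s' where "s' \<in> T" "s' \<in> S" using assms(2)[OF \<open>T \<in> \<T>\<close>] by blast
    ultimately show ?thesis using mdD[OF assms(1), of x s' s] mdD[of T x m s'] assms(2) that by auto
  qed
  show ?thesis
  proof (cases "S = {}")
    case True
    then have "\<T> = {}" using assms(2) by blast
    then show ?thesis using assms(1) by simp
  next
    case False
    then obtain s where "s \<in> S" by blast
    then show ?thesis using link assms md_subset unfolding md_iff by (metis UnE UnionE Un_subset_iff Union_least)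
  qed
qed

lemma md_Un: "md S \<Longrightarrow> md T \<Longrightarrow> S \<inter> T \<noteq> {} \<Longrightarrow> md (S \<union> T)"
  using md_Un_Union[of S "{T}"] by simp

text \<open>Critical are only the pivots \<open>x\<close> in \<open>S \<inter> T\<close>. A pivot
  \<open>y\<close> in \<open>T - S\<close> does not split \<open>S\<close>, and goodness of
  \<open>T\<close> hands this over from \<open>y\<close> to \<open>x\<close>.\<close>

lemma md_Diff:
  assumes "md S" "md T" "overlap S T"
  shows "md (S - T)"
  unfolding md_iff
proof (intro conjI ballI)
  show "S - T \<subseteq> N" using md_subset[OF assms(1)] by blast
next
  fix x m m' assume x: "x \<in> N - (S - T)" and m: "m \<in> S - T" "m' \<in> S - T"
  show "a x m = a x m'"
  proof (cases "x \<in> S")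
    case False
    then show ?thesis using mdD[OF assms(1)] x m by blast
  next
    case True
    obtain y where y: "y \<in> T - S" using assms(3) by (auto simp: overlap_def)
    have "a y m = a y m'" using mdD[OF assms(1)] y m md_subset[OF assms(2)] by blast
    then show ?thesis using goodD[OF assms(2), of x y m m'] True x y m md_subset[OF assms(1)] by blast
  qed
qed

section \<open>Modules, strength and trees relative to a module\<close>

lemma hom_module_within:
  assumes "md M" "S \<subseteq> M"
  shows "hom_module M (row_rel a) S \<longleftrightarrow> md S"
proof -
  have "a x m = a x m'" if "x \<in> N - M" "m \<in> S" "m' \<in> S" for x m m'
    using mdD[OF assms(1)] that assms(2) by blast
  then show ?thesis using assms md_subset[OF assms(1)]
    unfolding hom_module_def row_rel_def by blast
qed

text \<open>Strength is tested against modules inside \<open>M\<close> alone. While a subtree is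
  being built, it is not yet known which larger modules will turn out to be strong.\<close>

definition strong_in :: "nat set \<Rightarrow> nat set \<Rightarrow> bool" where
  "strong_in M C \<longleftrightarrow> md C \<and> C \<noteq> {} \<and> C \<subseteq> M \<and> (\<forall>T. md T \<longrightarrow> T \<subseteq> M \<longrightarrow> \<not> overlap C T)"

lemma strong_module_within:
  assumes "md M"
  shows "strong_module M (row_rel a) C \<longleftrightarrow> strong_in M C"
proof -
  have "hom_module M (row_rel a) S \<longleftrightarrow> S \<subseteq> M \<and> md S" for S
    using hom_module_within[OF assms] by (metis hom_module_def)
  then show ?thesis by (auto simp: strong_module_def strong_in_def)
qed

text \<open>A module that overlaps \<open>D\<close> meets \<open>C\<close> without containing it, so
  strength of \<open>C\<close> forces it inside \<open>C\<close>. Hence a finished subtree remains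
  correct whenever its leaf set becomes a strong child.\<close>

lemma strong_in_trans:
  assumes "strong_in M C" "D \<subseteq> C"
  shows "strong_in C D \<longleftrightarrow> strong_in M D"
proof
  assume D: "strong_in C D"
  have "\<not> overlap D T" if T: "md T" "T \<subseteq> M" for T
  proof
    assume ov: "overlap D T"
    have "\<not> overlap C T" using assms(1) T by (auto simp: strong_in_def)
    then have "T \<subseteq> C" using ov assms(2) by (auto simp: overlap_def)
    then show False using D T ov by (auto simp: strong_in_def)
  qed
  then show "strong_in M D" using D assms by (auto simp: strong_in_def)
qed (use assms in \<open>auto simp: strong_in_def\<close>)

lemma node_typed_within:
  assumes "md M" "\<Union>(set Cs) \<subseteq> M"
  shows "node_typed M (row_rel a) ty Cs \<longleftrightarrow> node_typed N (row_rel a) ty Cs"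
proof -
  have "hom_module M (row_rel a) (\<Union>S) \<longleftrightarrow> md (\<Union>S)" if "S \<subseteq> set Cs" for S
    using hom_module_within[OF assms(1), of "\<Union>S"] that assms(2) by blast
  then show ?thesis by (cases ty) (auto simp: subset_iff)
qed

text \<open>The children are characterised by strength and by the type of the node instead of by
  maximality; \<open>child_modules_decomp\<close> shows that they are the maximal strong
  ones.\<close>

definition decomp :: "nat set \<Rightarrow> node_type \<Rightarrow> nat set list \<Rightarrow> bool" where
  "decomp M ty Cs \<longleftrightarrow> md M \<and> 2 \<le> length Cs \<and> distinct Cs \<and> {} \<notin> set Cs \<and> disjoint (set Cs) \<and>
     \<Union>(set Cs) = M \<and> (\<forall>C\<in>set Cs. strong_in M C) \<and> node_typed N (row_rel a) ty Cs"

text \<open>Every node refers to its own leaf set only, so trees for modules that later dissolve can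
  be treated on a par with the final tree.\<close>

inductive local_tree :: "nat set \<Rightarrow> nat mdtree \<Rightarrow> bool" where
  Leaf: "x \<in> N \<Longrightarrow> local_tree {x} (Leaf x)"
| Node: "decomp M ty Cs \<Longrightarrow> list_all2 local_tree Cs ts \<Longrightarrow> local_tree M (Node ty ts)"

section \<open>Nodes as partitions into blocks\<close>

lemma disjoint_blocks:
  "disjoint V \<Longrightarrow> C \<in> V \<Longrightarrow> D \<in> V \<Longrightarrow> x \<in> C \<Longrightarrow> x \<in> D \<Longrightarrow> C = D"
  by (auto simp: disjoint_def)

lemma Union_Diff_blocks:
  assumes "disjoint V" "S \<subseteq> V" "T \<subseteq> V"
  shows "\<Union>S - \<Union>T = \<Union>(S - T)" "\<Union>S \<inter> \<Union>T = \<Union>(S \<inter> T)"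
  using disjoint_blocks[OF assms(1)] assms(2,3) by blast+

lemma overlap_blocks:
  assumes "disjoint V" "{} \<notin> V" "S \<subseteq> V" "T \<subseteq> V"
  shows "overlap (\<Union>S) (\<Union>T) \<longleftrightarrow> overlap S T"
proof -
  have ne: "\<Union>R \<noteq> {} \<longleftrightarrow> R \<noteq> {}" if "R \<subseteq> V" for R
    using that assms(2) by (metis Sup_empty Union_empty_conv ex_in_conv subsetD)
  have "S \<inter> T \<subseteq> V" "S - T \<subseteq> V" "T - S \<subseteq> V" using assms by blast+
  then show ?thesis
    using Union_Diff_blocks[OF assms(1,3,4)] Union_Diff_blocks[OF assms(1,4,3)] ne
    by (simp add: overlap_def)
qed

text \<open>Passing from elements to whole blocks keeps all closure properties, because unions of
  disjoint nonempty blocks intersect, differ and overlap exactly as the sets of blocks do. This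
  makes the combinatorial theorem applicable to the children of a node.\<close>

lemma weakly_partitive_blocks:
  assumes "finite V" "disjoint V" "{} \<notin> V" "\<And>C. C \<in> V \<Longrightarrow> md C" "md (\<Union>V)"
  shows "weakly_partitive V {S. S \<subseteq> V \<and> md (\<Union>S)}"
proof
  fix S T assume "S \<in> {S. S \<subseteq> V \<and> md (\<Union>S)}" "T \<in> {S. S \<subseteq> V \<and> md (\<Union>S)}"
  then have S: "S \<subseteq> V" "md (\<Union>S)" and T: "T \<subseteq> V" "md (\<Union>T)" by auto
  show "S \<inter> T \<in> {S. S \<subseteq> V \<and> md (\<Union>S)}"
    using md_Int[OF S(2) T(2)] S(1) Union_Diff_blocks[OF assms(2) S(1) T(1)] by auto
  show "S \<union> T \<in> {S. S \<subseteq> V \<and> md (\<Union>S)}" if "S \<inter> T \<noteq> {}"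
  proof -
    have "\<Union>S \<inter> \<Union>T \<noteq> {}"
    proof -
      obtain C where "C \<in> S" "C \<in> T" using \<open>S \<inter> T \<noteq> {}\<close> by blast
      moreover obtain x where "x \<in> C" using calculation S(1) assms(3) by (metis equals0I subsetD)
      ultimately show ?thesis by blast
    qed
    then show ?thesis using md_Un[OF S(2) T(2)] S T by (simp add: Union_Un_distrib)
  qed
  show "S - T \<in> {S. S \<subseteq> V \<and> md (\<Union>S)}" if "overlap S T"
    using md_Diff[OF S(2) T(2)] overlap_blocks[OF assms(2,3) S(1) T(1)] that S(1)
      Union_Diff_blocks[OF assms(2) S(1) T(1)] by auto
qed (use assms md_empty in auto)

text \<open>In a complete node a pair with one child on each side of the border of \<open>S\<close>
  overlaps \<open>S\<close>; in a linear node an interval shifted across an end of \<open>S\<close>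
  does; in a prime node there is no such \<open>S\<close>.\<close>

lemma not_strong_typed:
  assumes d: "distinct Cs" and ty: "node_typed N (row_rel a) ty Cs"
    and S: "S \<subseteq> set Cs" "2 \<le> card S" "S \<noteq> set Cs" "md (\<Union>S)"
  shows "\<exists>T\<subseteq>set Cs. md (\<Union>T) \<and> overlap S T"
proof (cases ty)
  case Complete
  obtain x y where "x \<in> S" "y \<in> S" "x \<noteq> y"
  proof -
    have "finite S" using S(1) finite_subset by blast
    then show thesis using card_le_Suc0_iff_eq[of S] S(2) that by force
  qed
  moreover obtain z where "z \<in> set Cs - S" using S by blast
  moreover have "md (\<Union>{x, z})"
  proof -
    have "{x, z} \<subseteq> set Cs" using calculation S(1) by blast
    then show ?thesis using ty Complete by (metis node_typed.simps(1))
  qed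
  ultimately show ?thesis using S(1)
    by (intro exI[of _ "{x, z}"]) (auto simp: overlap_def)
next
  case Prime
  then show ?thesis using ty S by auto
next
  case Linear
  then obtain i j where ij: "j \<le> length Cs" "S = {Cs ! m |m. i \<le> m \<and> m < j}"
    using ty S interval_iff_nth[of S Cs] by auto
  have "i + 2 \<le> j"
  proof (rule ccontr)
    assume "\<not> ?thesis"
    have "S \<subseteq> {Cs ! i}"
    proof
      fix x assume "x \<in> S"
      then obtain m where m: "i \<le> m" "m < j" "x = Cs ! m" using ij(2) by blast
      then have "m = i" using \<open>\<not> i + 2 \<le> j\<close> by linarith
      then show "x \<in> {Cs ! i}" using m by simp
    qed
    then show False using S(2) card_mono[of "{Cs ! i}" S] by simp
  qed
  define seg where "seg p q = {Cs ! m |m. p \<le> m \<and> m < q}" for p q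
  have mem: "Cs ! q \<in> seg p r \<longleftrightarrow> p \<le> q \<and> q < r" if "q < length Cs" "r \<le> length Cs" for p q r
    using that nth_eq_iff_index_eq[OF d] by (auto simp: seg_def dest: less_le_trans)
  have sub: "seg p q \<subseteq> set Cs" if "q \<le> length Cs" for p q
    using that by (auto simp: seg_def)
  have int: "md (\<Union>(seg p q))" if "q \<le> length Cs" for p q
  proof -
    have "\<exists>i k. seg p q = set (take k (drop i Cs))"
      unfolding interval_iff_nth seg_def by (intro exI[of _ p] exI[of _ q] conjI that refl)
    then show ?thesis using ty Linear sub[OF that] by auto
  qed
  have S_eq: "S = seg i j" using ij(2) by (simp only: seg_def)
  show ?thesis
  \<comment> \<open>An initial interval is overlapped beyond its right end by the positions from 1
    to \<open>j\<close>; any other one at its left end by the pair \<open>i - 1\<close>,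
    \<open>i\<close>.\<close>
  proof (cases "i = 0")
    case True
    have "j < length Cs"
    proof (rule ccontr)
      assume "\<not> ?thesis"
      then have "S = set Cs" using ij True by (auto simp: set_conv_nth)
      then show False using S by simp
    qed
    moreover have "Cs \<noteq> []" using calculation by auto
    ultimately have "Cs ! 1 \<in> S \<inter> seg 1 (Suc j)" "Cs ! 0 \<in> S - seg 1 (Suc j)" "Cs ! j \<in> seg 1 (Suc j) - S"
      using \<open>i + 2 \<le> j\<close> True by (auto simp: S_eq mem)
    then have "overlap S (seg 1 (Suc j))" unfolding overlap_def by blast
    then show ?thesis using int[of "Suc j" 1] sub[of "Suc j" 1] \<open>j < length Cs\<close> by auto
  next
    case False
    have "Cs ! i \<in> S \<inter> seg (i - 1) (Suc i)" "Cs ! Suc i \<in> S - seg (i - 1) (Suc i)"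
      "Cs ! (i - 1) \<in> seg (i - 1) (Suc i) - S"
      using \<open>i + 2 \<le> j\<close> False ij(1) by (auto simp: S_eq mem)
    then have "overlap S (seg (i - 1) (Suc i))" unfolding overlap_def by blast
    then show ?thesis using int[of "Suc i" "i - 1"] sub[of "Suc i" "i - 1"] ij(1) \<open>i + 2 \<le> j\<close> by auto
  qed
qed

text \<open>The children are themselves modules inside \<open>M\<close>. As no child is overlapped
  by \<open>X\<close>, each child that \<open>X\<close> meets is contained in it, unless
  \<open>X\<close> lies inside a single child.\<close>

lemma strong_union_of_blocks:
  assumes D: "decomp M ty Cs" and X: "strong_in M X"
  shows "(\<exists>C\<in>set Cs. X \<subseteq> C) \<or> (\<exists>S\<subseteq>set Cs. X = \<Union>S \<and> 2 \<le> card S)"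
proof (cases "\<exists>C\<in>set Cs. X \<subseteq> C")
  case False
  define S where "S = {C \<in> set Cs. C \<inter> X \<noteq> {}}"
  have XM: "X \<subseteq> \<Union>(set Cs)" "X \<noteq> {}" using D X by (auto simp: decomp_def strong_in_def)
  have "C \<subseteq> X" if "C \<in> S" for C
  proof -
    have "strong_in M C" using that D by (auto simp: S_def decomp_def)
    then have "\<not> overlap X C" using X by (auto simp: strong_in_def)
    then show ?thesis using that False by (auto simp: S_def overlap_def)
  qed
  moreover have "X \<subseteq> \<Union>S" using XM by (fastforce simp: S_def)
  ultimately have X_eq: "X = \<Union>S" by blast
  have "card S \<noteq> 0" using X_eq XM by (auto simp: S_def)
  moreover have "card S \<noteq> 1"
  proof
    assume "card S = 1"
    then obtain C where "S = {C}" by (auto simp: card_1_singleton_iff)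
    then have "C \<in> S" "X \<subseteq> C" using X_eq by simp_all
    then show False using False unfolding S_def by blast
  qed
  ultimately have "2 \<le> card S" by linarith
  moreover have "S \<subseteq> set Cs" by (auto simp: S_def)
  ultimately show ?thesis using X_eq by blast
qed simp

lemma decomp_proper_block:
  assumes "decomp M ty Cs" "C \<in> set Cs"
  shows "C \<subset> M"
proof -
  have "card (set Cs) \<ge> 2" using assms by (simp add: decomp_def distinct_card)
  then obtain D where "D \<in> set Cs" "D \<noteq> C"
    using card_mono[of "{C}" "set Cs"] by fastforce
  moreover obtain x where "x \<in> D" using calculation assms by (auto simp: decomp_def) (metis equals0I)
  ultimately have "x \<in> M" "x \<notin> C" using assms disjoint_blocks[of "set Cs" C D x] by (auto simp: decomp_def)
  then show ?thesis using assms by (auto simp: decomp_def)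
qed

text \<open>By \<open>not_strong_typed\<close> no proper union of two or more children is strong, so
  a strong proper subset of \<open>M\<close> lies inside one child. This gives the maximality in
  both directions.\<close>

lemma child_modules_decomp:
  assumes D: "decomp M ty Cs"
  shows "child_modules M (row_rel a) M = set Cs"
proof -
  have M: "md M" and str: "\<And>C. C \<in> set Cs \<Longrightarrow> strong_in M C"
    and disj: "disjoint (set Cs)" "{} \<notin> set Cs" and un: "\<Union>(set Cs) = M"
    and dist: "distinct Cs" and typed: "node_typed N (row_rel a) ty Cs"
    using D by (auto simp: decomp_def)
  have big: False if X: "strong_in M X" "X \<subset> M" "S \<subseteq> set Cs" "X = \<Union>S" "2 \<le> card S" for X S
  proof -
    have "S \<noteq> set Cs" using X un by auto
    then obtain T where T: "T \<subseteq> set Cs" "md (\<Union>T)" "overlap S T"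
      using not_strong_typed[OF dist typed X(3,5)] X by (auto simp: strong_in_def)
    then have "overlap X (\<Union>T)" "\<Union>T \<subseteq> M" using overlap_blocks[OF disj X(3) T(1)] X(4) un by auto
    then show False using X(1) T(2) by (auto simp: strong_in_def)
  qed
  have cm: "C \<in> child_modules M (row_rel a) M \<longleftrightarrow>
    strong_in M C \<and> C \<subset> M \<and> (\<nexists>D. strong_in M D \<and> C \<subset> D \<and> D \<subset> M)" for C
    by (simp add: child_modules_def strong_module_within[OF M])
  show ?thesis
  proof (intro set_eqI iffI)
    fix C assume C: "C \<in> set Cs"
    have *: "False" if X: "strong_in M X" "C \<subset> X" "X \<subset> M" for X
      using strong_union_of_blocks[OF D X(1)]
    proof (elim disjE bexE exE conjE)
      fix C' assume "C' \<in> set Cs" "X \<subseteq> C'"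
      moreover obtain x where "x \<in> C" using C disj by fastforce
      ultimately have "C = C'" using disjoint_blocks[OF disj(1) C, of C' x] X by blast
      then show False using X \<open>X \<subseteq> C'\<close> by blast
    qed (use big X in blast)
    then show "C \<in> child_modules M (row_rel a) M"
      unfolding cm using str[OF C] decomp_proper_block[OF D C] by blast
  next
    fix C assume "C \<in> child_modules M (row_rel a) M"
    then have C: "strong_in M C" "C \<subset> M" "\<And>D. strong_in M D \<Longrightarrow> C \<subset> D \<Longrightarrow> D \<subset> M \<Longrightarrow> False"
      using cm by blast+
    from strong_union_of_blocks[OF D C(1)] show "C \<in> set Cs"
    proof (elim disjE bexE exE conjE)
      fix C' assume "C' \<in> set Cs" "C \<subseteq> C'"
      then show ?thesis using C(3)[of C'] str[of C'] decomp_proper_block[OF D, of C'] by blast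
    qed (use big C in blast)
  qed
qed

text \<open>Below a set that is strong in \<open>M\<close>, strength in \<open>C\<close> and
  strength in \<open>M\<close> coincide, so the derivation of the tree can be replayed in the larger
  module.\<close>

lemma md_tree_at_within:
  assumes "md_tree_at C (row_rel a) D t" "strong_in M C" "md M" "D \<subseteq> C"
  shows "md_tree_at M (row_rel a) D t"
  using assms(1,4)
proof (induction D t rule: md_tree_at.induct)
  case (Leaf x)
  then show ?case using assms by (auto simp: strong_in_def intro: md_tree_at.Leaf)
next
  case (Node D Cs ty ts)
  have C: "md C" "C \<subseteq> M" using assms by (auto simp: strong_in_def)
  have st: "strong_module C (row_rel a) E \<longleftrightarrow> strong_module M (row_rel a) E" if "E \<subseteq> C" for E
    using strong_in_trans[OF assms(2) that] strong_module_within C assms(3) by blast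
  have ch: "child_modules C (row_rel a) D = child_modules M (row_rel a) D"
    using st Node.prems unfolding child_modules_def by (metis (lifting) dual_order.trans psubset_imp_subset)
  have sub: "E \<subseteq> C" if "E \<in> set Cs" for E
    using that Node by (auto simp: child_modules_def)
  then have "\<Union>(set Cs) \<subseteq> C" "\<Union>(set Cs) \<subseteq> M" using C by blast+
  then have "node_typed M (row_rel a) ty Cs"
    using Node.hyps node_typed_within[OF C(1)] node_typed_within[OF assms(3)] by simp
  moreover have "list_all2 (md_tree_at M (row_rel a)) Cs ts"
    using Node.IH by (rule list.rel_mono_strong) (use sub in auto)
  ultimately show ?case using Node.hyps st Node.prems ch by (intro md_tree_at.Node) auto
qed

lemma decomp_not_singleton:
  assumes D: "decomp M ty Cs"
  shows "\<not> is_singleton M"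
proof
  assume "is_singleton M"
  then obtain x where x: "M = {x}" by (auto simp: is_singleton_def)
  have "Cs \<noteq> []" using D by (auto simp: decomp_def)
  then obtain C where "C \<in> set Cs" by (meson list.set_sel(1))
  then have "C \<subset> {x}" "C \<noteq> {}" using decomp_proper_block[OF D] x D by (auto simp: decomp_def)
  then show False by blast
qed

lemma md_tree_at_if_local_tree: "local_tree M t \<Longrightarrow> md_tree_at M (row_rel a) M t"
proof (induction M t rule: local_tree.induct)
  case (Node M ty Cs ts)
  have M: "md M" using Node by (simp add: decomp_def)
  have "Cs \<noteq> []" using Node(1) by (auto simp: decomp_def)
  then have "hd Cs \<in> set Cs" by simp
  then have "M \<noteq> {}" using decomp_proper_block[OF Node(1), of "hd Cs"] by blast
  then have "strong_in M M" using M by (auto simp: strong_in_def overlap_def)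
  then have "strong_module M (row_rel a) M" using strong_module_within[OF M] by blast
  moreover have "list_all2 (md_tree_at M (row_rel a)) Cs ts"
    using Node(2) by (rule list.rel_mono_strong)
      (use Node(1) M md_tree_at_within in \<open>auto simp: decomp_def\<close>)
  ultimately show ?case
    using Node(1) decomp_not_singleton[OF Node(1)] child_modules_decomp[OF Node(1)]
      node_typed_within[OF M]
    by (intro md_tree_at.Node) (auto simp: decomp_def)
qed (auto intro: md_tree_at.Leaf)

end

section \<open>Prime and binary nodes\<close>

context good_matrix
begin

text \<open>The added blocks all meet \<open>T\<close> and together cover it, so \<open>T\<close>
  itself disappears from the union. A module that cuts through blocks is thereby replaced by a union
  of blocks.\<close>

lemma saturation:
  assumes "md T" "T \<subseteq> \<Union>V" "T \<noteq> {}" "\<And>C. C \<in> V \<Longrightarrow> md C"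
  shows "md (\<Union>{C \<in> V. C \<inter> T \<noteq> {}})"
proof -
  have "md (T \<union> \<Union>{C \<in> V. C \<inter> T \<noteq> {}})"
    using assms by (intro md_Un_Union) auto
  moreover have "T \<union> \<Union>{C \<in> V. C \<inter> T \<noteq> {}} = \<Union>{C \<in> V. C \<inter> T \<noteq> {}}"
    using assms(2) by blast
  ultimately show ?thesis by simp
qed

text \<open>The hypothesis controls only unions of children; to be excluded is a module
  \<open>T\<close> that cuts through a child \<open>F\<close>. The children met by \<open>T\<close>
  form a module with more than one member, so they are all children, and then \<open>T - F\<close>
  saturates to a forbidden union.\<close>

lemma decomp_prime:
  assumes M: "md M" "\<Union>(set Cs) = M" and len: "3 \<le> length Cs" and dist: "distinct Cs"
    and disj: "{} \<notin> set Cs" "disjoint (set Cs)" and mds: "\<And>C. C \<in> set Cs \<Longrightarrow> md C"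
    and prime: "\<And>S. S \<subseteq> set Cs \<Longrightarrow> md (\<Union>S) \<Longrightarrow> S = {} \<or> card S = 1 \<or> S = set Cs"
  shows "decomp M Prime Cs"
proof -
  have cardV: "3 \<le> card (set Cs)" using len dist by (simp add: distinct_card)
  have "strong_in M F" if F: "F \<in> set Cs" for F
    unfolding strong_in_def
  proof (intro conjI allI impI notI)
    show "md F" "F \<subseteq> M" using F mds M by auto
    show "F = {} \<Longrightarrow> False" using F disj by auto
  next
    fix T assume T: "md T" "T \<subseteq> M" "overlap F T"
    define S where "S = {C \<in> set Cs. C \<inter> T \<noteq> {}}"
    have "md (\<Union>S)" unfolding S_def using T M mds by (intro saturation) (auto simp: overlap_def)
    moreover have "F \<in> S" using T F by (auto simp: S_def overlap_def)
    moreover have "S \<noteq> {F}"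
    proof
      assume "S = {F}"
      have "T \<subseteq> F"
      proof
        fix x assume "x \<in> T"
        moreover obtain C where "C \<in> set Cs" "x \<in> C" using T(2) M(2) \<open>x \<in> T\<close> by blast
        ultimately have "C \<in> S" unfolding S_def by blast
        then show "x \<in> F" using \<open>S = {F}\<close> \<open>x \<in> C\<close> by simp
      qed
      then show False using T by (auto simp: overlap_def)
    qed
    moreover have "S \<subseteq> set Cs" by (auto simp: S_def)
    moreover have "card S \<noteq> 1"
      using \<open>F \<in> S\<close> \<open>S \<noteq> {F}\<close> by (metis card_1_singletonE singletonD)
    ultimately have "S = set Cs" using prime[of S] by blast
    then have meet: "C \<inter> T \<noteq> {}" if "C \<in> set Cs" for C using that by (auto simp: S_def)
    have md': "md (T - F)" using md_Diff[OF T(1) mds[OF F]] T by (auto simp: overlap_def)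
    \<comment> \<open>Removing \<open>F\<close> keeps \<open>T\<close> in contact with all other
      children. Since there are at least three children, all but \<open>F\<close> is a union that is
      neither trivial nor a single child.\<close>
    have "{C \<in> set Cs. C \<inter> (T - F) \<noteq> {}} = set Cs - {F}"
    proof (intro equalityI subsetI)
      fix C assume C: "C \<in> set Cs - {F}"
      then obtain x where "x \<in> C" "x \<in> T" using meet by blast
      moreover have "x \<notin> F" using disjoint_blocks[OF disj(2), of C F x] C F \<open>x \<in> C\<close> by blast
      ultimately show "C \<in> {C \<in> set Cs. C \<inter> (T - F) \<noteq> {}}" using C by blast
    qed auto
    then have "md (\<Union>(set Cs - {F}))"
      using saturation[OF md', of "set Cs"] T M mds by (auto simp: overlap_def)
    then have "set Cs - {F} = {} \<or> card (set Cs - {F}) = 1 \<or> set Cs - {F} = set Cs"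
      using prime by blast
    moreover have "card (set Cs - {F}) = card (set Cs) - 1" using F by simp
    ultimately have "card (set Cs - {F}) \<noteq> 0" "card (set Cs - {F}) \<noteq> 1" "set Cs - {F} \<noteq> set Cs"
      using cardV F by (linarith, linarith, blast)
    then show False
      using \<open>set Cs - {F} = {} \<or> card (set Cs - {F}) = 1 \<or> set Cs - {F} = set Cs\<close>
      by (metis card.empty)
  qed
  moreover have "md (\<Union>S)" if "S \<subseteq> set Cs" "S = {} \<or> card S = 1 \<or> S = set Cs" for S
    using that M mds md_empty by (auto simp: card_1_singleton_iff)
  then have "node_typed N (row_rel a) Prime Cs" using prime len by (metis node_typed.simps(3))
  ultimately show ?thesis using assms by (simp add: decomp_def)
qed

section \<open>Binary nodes: which sides dissolve, and in which direction\<close>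

text \<open>The test that decides whether a child \<open>F\<close> of a binary node dissolves into that node.\<close>

definition merges :: "node_type \<Rightarrow> nat set list \<Rightarrow> nat \<Rightarrow> nat \<Rightarrow> nat \<Rightarrow> bool" where
  "merges ty Cs x y f \<longleftrightarrow> ty \<noteq> Prime \<and> (a x y = a x f \<or> a y x = a y f)"

text \<open>\<open>Ds\<close> is what \<open>F\<close> contributes to the children of its union with
  a disjoint module containing \<open>f\<close>; the flag \<open>d\<close> says that
  \<open>F\<close> comes first. A successful test at \<open>hd Cs\<close> identifies
  \<open>hd Cs\<close> as the end away from \<open>f\<close>, so the list is reversed if this end is
  not where \<open>d\<close> wants it. \<open>lin\<close> records that exactly one test succeeded;
  two successes belong to a complete node.\<close>

inductive oriented :: "nat set \<Rightarrow> nat \<Rightarrow> bool \<Rightarrow> nat set list \<Rightarrow> bool \<Rightarrow> bool" where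
  Singleton: "x \<in> N \<Longrightarrow> oriented {x} f d [{x}] False"
| Kept: "decomp F ty Cs \<Longrightarrow> x \<in> hd Cs \<Longrightarrow> y \<in> last Cs \<Longrightarrow> \<not> merges ty Cs x y f \<Longrightarrow>
    oriented F f d [F] False"
| Merged: "decomp F ty Cs \<Longrightarrow> x \<in> hd Cs \<Longrightarrow> y \<in> last Cs \<Longrightarrow> merges ty Cs x y f \<Longrightarrow>
    lin \<longleftrightarrow> (a x y = a x f) \<noteq> (a y x = a y f) \<Longrightarrow>
    Ds = (if lin \<and> (a x y = a x f) \<noteq> d then rev Cs else Cs) \<Longrightarrow>
    oriented F f d Ds lin"

lemma decompD:
  assumes "decomp F ty Cs"
  shows "md F" "2 \<le> length Cs" "distinct Cs" "{} \<notin> set Cs" "disjoint (set Cs)" "\<Union>(set Cs) = F"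
    "C \<in> set Cs \<Longrightarrow> strong_in F C" "C \<in> set Cs \<Longrightarrow> md C" "node_typed N (row_rel a) ty Cs"
    "Cs \<noteq> []" "hd Cs \<in> set Cs" "last Cs \<in> set Cs" "hd Cs \<noteq> last Cs"
proof -
  show ne: "Cs \<noteq> []" using assms by (auto simp: decomp_def)
  then show "hd Cs \<in> set Cs" "last Cs \<in> set Cs" by simp_all
  show "hd Cs \<noteq> last Cs" using assms
    by (cases Cs) (auto simp: decomp_def split: if_splits)
qed (use assms in \<open>auto simp: decomp_def strong_in_def\<close>)

text \<open>
  The outer child \<open>hd Cs\<close> does not distinguish the other outer child from \<open>f\<close> iff everything
  except \<open>hd Cs\<close> is a module; one test suffices since the quotient is good.
\<close>

lemma outer_test:
  assumes D: "decomp F ty Cs" and C: "C \<in> set Cs" "md (F - C)" and x: "x \<in> C" and y: "y \<in> F - C"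
    and F2: "md F2" "F \<inter> F2 = {}" "md (F \<union> F2)" "f \<in> F2"
  shows "a x y = a x f \<longleftrightarrow> md (F2 \<union> (F - C))"
proof
  assume "md (F2 \<union> (F - C))"
  then show "a x y = a x f"
    by (rule mdD) (use x y F2 C decompD(6)[OF D] md_subset[OF F2(3)] in auto)
next
  assume xy: "a x y = a x f"
  have CN: "md C" "C \<subseteq> F" using decompD[OF D] C by auto
  show "md (F2 \<union> (F - C))"
    unfolding md_iff
  proof (intro conjI ballI)
    show "F2 \<union> (F - C) \<subseteq> N" using md_subset[OF F2(3)] by blast
  next
    fix z m m' assume z: "z \<in> N - (F2 \<union> (F - C))" and m: "m \<in> F2 \<union> (F - C)" "m' \<in> F2 \<union> (F - C)"
    show "a z m = a z m'"
    proof (cases "z \<in> C")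
      case False
      then show ?thesis using mdD[OF F2(3), of z m m'] z m by blast
    next
      case True
      have yN: "y \<in> N - C" "f \<in> N - C" using y F2 CN md_subset[OF F2(3)] by blast+
      \<comment> \<open>Goodness of \<open>C\<close> transfers the comparison made at
        \<open>x\<close> to every other pivot of \<open>C\<close>.\<close>
      have link: "a z y = a z f" using goodD[OF CN(1) x True yN] xy by simp
      have "a z m = a z f" if "m \<in> F2 \<union> (F - C)" for m
      proof (cases "m \<in> F2")
        case True
        then show ?thesis using mdD[OF F2(1), of z m f] z F2(4) by blast
      next
        case False
        then have "a z m = a z y" using mdD[OF C(2), of z m y] that z True y by blast
        then show ?thesis using link by simp
      qed
      then show ?thesis using m by metis
    qed
  qed
qed

lemma interval_drop_outer:
  assumes "Cs \<noteq> []" "distinct Cs"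
  shows "set Cs - {hd Cs} = set (tl Cs)" "set Cs - {last Cs} = set (butlast Cs)"
    "\<exists>i k. set (tl Cs) = set (take k (drop i Cs))" "\<exists>i k. set (butlast Cs) = set (take k (drop i Cs))"
proof -
  show "set Cs - {hd Cs} = set (tl Cs)" using assms by (cases Cs) auto
  show "set Cs - {last Cs} = set (butlast Cs)" using assms by (cases Cs rule: rev_cases) auto
  show "\<exists>i k. set (tl Cs) = set (take k (drop i Cs))"
    by (intro exI[of _ 1] exI[of _ "length Cs"]) (simp add: drop_Suc)
  show "\<exists>i k. set (butlast Cs) = set (take k (drop i Cs))"
    by (intro exI[of _ 0] exI[of _ "length Cs - 1"]) (simp add: butlast_conv_take)
qed

lemma md_drop_outer:
  assumes D: "decomp F ty Cs" and ty: "ty \<noteq> Prime"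
  shows "md (F - hd Cs)" "md (F - last Cs)"
proof -
  note d = decompD[OF D]
  have "md (\<Union>(set (tl Cs)))" "md (\<Union>(set (butlast Cs)))"
  proof -
    have "md (\<Union>R)" if "R \<subseteq> set Cs" "\<exists>i k. R = set (take k (drop i Cs))" for R
      using d(9) ty that by (cases ty) (simp_all only: node_typed.simps simp_thms)
    moreover have "set (tl Cs) \<subseteq> set Cs" "set (butlast Cs) \<subseteq> set Cs"
      using interval_drop_outer(1,2)[OF d(10,3)] by blast+
    ultimately show "md (\<Union>(set (tl Cs)))" "md (\<Union>(set (butlast Cs)))"
      using interval_drop_outer(3,4)[OF d(10,3)] by blast+
  qed
  moreover have "F - C = \<Union>(set Cs - {C})" if "C \<in> set Cs" for C
    using Union_Diff_blocks(1)[OF d(5), of "set Cs" "{C}"] that d(6) by simp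
  ultimately show "md (F - hd Cs)" "md (F - last Cs)"
    using d(11,12) interval_drop_outer[OF d(10,3)] by simp_all
qed

lemma outer_tests:
  assumes D: "decomp F ty Cs" and ty: "ty \<noteq> Prime" and x: "x \<in> hd Cs" and y: "y \<in> last Cs"
    and F2: "md F2" "F \<inter> F2 = {}" "md (F \<union> F2)" "f \<in> F2"
  shows "a x y = a x f \<longleftrightarrow> md (F2 \<union> (F - hd Cs))" "a y x = a y f \<longleftrightarrow> md (F2 \<union> (F - last Cs))"
proof -
  note d = decompD[OF D]
  have "y \<in> F - hd Cs" "x \<in> F - last Cs"
    using disjoint_blocks[OF d(5,11,12)] d(6,11,12,13) x y by blast+
  then show "a x y = a x f \<longleftrightarrow> md (F2 \<union> (F - hd Cs))" "a y x = a y f \<longleftrightarrow> md (F2 \<union> (F - last Cs))"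
    using outer_test[OF D d(11) md_drop_outer(1)[OF D ty] x _ F2]
      outer_test[OF D d(12) md_drop_outer(2)[OF D ty] y _ F2] by blast+
qed

text \<open>A module that meets \<open>F2\<close> may be assumed to contain it: inside
  \<open>F\<close> nothing changes.\<close>

lemma enlarge:
  assumes F2: "md F2" "F \<inter> F2 = {}" and T: "md T" "T \<subseteq> F \<union> F2" "T \<inter> F2 \<noteq> {}"
  shows "md (T \<union> F2)" "(T \<union> F2) \<inter> F = T \<inter> F"
  using md_Un[OF T(1) F2(1) T(3)] F2 by auto

lemma oriented_block:
  assumes "oriented F f d Ds lin" "md F" "C \<in> set Ds"
  shows "md C" "C \<subseteq> F" "C \<noteq> {}"
proof -
  have "md C \<and> C \<subseteq> F \<and> C \<noteq> {}"
    using assms(1)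
  proof cases
    case (Merged ty Cs x y)
    then have "C \<in> set Cs" using assms(3) by (auto split: if_splits)
    then show ?thesis using decompD[OF Merged(1)] by blast
  next
    case (Kept ty Cs x y)
    then have "C = F" using assms(3) by simp
    then show ?thesis using decompD[OF Kept(3)] assms(2) by blast
  qed (use assms in auto)
  then show "md C" "C \<subseteq> F" "C \<noteq> {}" by blast+
qed

text \<open>A module \<open>T\<close> overlapping a piece must meet \<open>F2\<close>; enlarged by
  \<open>F2\<close> it overlaps \<open>F\<close>, so it cuts \<open>F\<close> into two modules
  \<open>T \<inter> F\<close> and \<open>F - T\<close>. A child that is strong in \<open>F\<close>
  resists such a cut, and if \<open>F\<close> was kept whole, the cut contradicts the failure of
  both tests.\<close>

lemma oriented_strong:
  assumes O: "oriented F f d Ds lin" and F: "md F"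
    and F2: "md F2" "F \<inter> F2 = {}" "md (F \<union> F2)" "f \<in> F2"
    and C: "C \<in> set Ds"
  shows "strong_in (F \<union> F2) C"
  unfolding strong_in_def
proof (intro conjI allI impI notI)
  show "md C" "C \<subseteq> F \<union> F2" "C = {} \<Longrightarrow> False"
    using oriented_block[OF O F C] by blast+
next
  fix T assume T: "md T" "T \<subseteq> F \<union> F2" "overlap C T"
  from O C consider (single) x where "F = {x}" "C = F"
    | (kept) ty Cs x y where "decomp F ty Cs" "x \<in> hd Cs" "y \<in> last Cs" "\<not> merges ty Cs x y f" "C = F"
    | (merged) ty Cs where "decomp F ty Cs" "C \<in> set Cs"
    by (cases rule: oriented.cases) (auto split: if_splits)
  then show False
  proof cases
    case single
    then show False using T by (auto simp: overlap_def)
  next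
    case merged
    note d = decompD[OF merged(1)]
    have CF: "C \<subseteq> F" "strong_in F C" using merged d by auto
    have "T \<inter> F2 \<noteq> {}"
    proof
      assume "T \<inter> F2 = {}"
      then have "T \<subseteq> F" using T by blast
      then show False using CF T by (auto simp: strong_in_def)
    qed
    define T' where "T' = T \<union> F2"
    have T': "md T'" "T' \<inter> F = T \<inter> F" "F2 \<subseteq> T'"
      using enlarge[OF F2(1,2) T(1,2) \<open>T \<inter> F2 \<noteq> {}\<close>] by (auto simp: T'_def)
    have ov: "overlap F T'" using T CF F2 unfolding overlap_def T'_def by blast
    have FT: "F - T' = F - T" unfolding T'_def using F2(2) by blast
    have "md (T \<inter> F)" "md (F - T)" using md_Int[OF T'(1) F] md_Diff[OF F T'(1) ov] T'(2) FT by simp_all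
    then have no: "\<not> overlap C (T \<inter> F)" "\<not> overlap C (F - T)"
      using CF(2) unfolding strong_in_def by blast+
    \<comment> \<open>\<open>C\<close> meets both parts of \<open>F\<close> but overlaps neither, so
      it contains both and is all of \<open>F\<close>.\<close>
    have "C \<subset> F" using decomp_proper_block[OF merged] .
    then show False using no T by (auto simp: overlap_def)
  next
    case kept
    note d = decompD[OF kept(1)]
    have "T \<inter> F2 \<noteq> {}" using T kept by (auto simp: overlap_def)
    define T' where "T' = T \<union> F2"
    have T': "md T'" "T' \<inter> F = T \<inter> F" "F2 \<subseteq> T'" "T' = F2 \<union> (T \<inter> F)"
    proof -
      show "T' = F2 \<union> (T \<inter> F)" unfolding T'_def using T(2) by blast
    qed (use enlarge[OF F2(1,2) T(1,2) \<open>T \<inter> F2 \<noteq> {}\<close>] in \<open>simp_all add: T'_def\<close>)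
    have ov: "overlap F T'" using T kept(5) F2 unfolding overlap_def T'_def by blast
    have FT: "F - T' = F - T" unfolding T'_def using F2(2) by blast
    have P: "md (T \<inter> F)" "md (F - T)" 
      using md_Int[OF T'(1) F] md_Diff[OF F T'(1) ov] T'(2) FT by simp_all
    have nov: "\<not> overlap E (T \<inter> F)" "\<not> overlap E (F - T)" if "E \<in> set Cs" for E
      using d(7)[OF that] P by (auto simp: strong_in_def)
    define S where "S = {E \<in> set Cs. E \<subseteq> T}"
    have in_or_out: "E \<subseteq> T \<or> E \<subseteq> F - T" if E: "E \<in> set Cs" for E
    proof (rule ccontr)
      assume neg: "\<not> ?thesis"
      have "E \<subset> F" using decomp_proper_block[OF kept(1) E] .
      then have "T \<inter> F \<subseteq> E" "F - T \<subseteq> E" using nov[OF E] neg by (auto simp: overlap_def)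
      then show False using \<open>E \<subset> F\<close> by blast
    qed
    have S: "S \<subseteq> set Cs" "T \<inter> F = \<Union>S"
    proof -
      show "S \<subseteq> set Cs" by (auto simp: S_def)
      show "T \<inter> F = \<Union>S"
      proof
        show "T \<inter> F \<subseteq> \<Union>S" using in_or_out d(6) by (fastforce simp: S_def)
        show "\<Union>S \<subseteq> T \<inter> F" using d(6) by (auto simp: S_def)
      qed
    qed
    have "F - T = F - \<Union>S" unfolding S(2)[symmetric] by blast
    then have S': "F - T = \<Union>(set Cs - S)"
      using Union_Diff_blocks(1)[OF d(5) order_refl S(1)] d(6) by simp
    have ne: "S \<noteq> {}" "S \<noteq> set Cs"
      using S d(6) ov T' kept(5) T by (auto simp: overlap_def)
    have mdS: "md (\<Union>S)" "md (\<Union>(set Cs - S))" using P S S' by auto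
    show False
    proof (cases "ty = Prime")
      case True
      then have prime: "3 \<le> length Cs" "\<And>S. S \<subseteq> set Cs \<Longrightarrow> md (\<Union>S) \<Longrightarrow> S = {} \<or> card S = 1 \<or> S = set Cs"
        using d(9) by auto
      have "card S = 1" "card (set Cs - S) = 1"
        using prime(2)[OF S(1) mdS(1)] prime(2)[of "set Cs - S"] mdS(2) ne S(1) by auto
      moreover have "card (set Cs) = card S + card (set Cs - S)"
        using S(1) by (metis card_Diff_subset card_mono finite_set finite_subset le_add_diff_inverse)
      ultimately show False using prime(1) d(3) by (simp add: distinct_card)
    next
      case False
      note tests = outer_tests[OF kept(1) False kept(2,3) F2]
      have neg: "\<not> md (F2 \<union> (F - hd Cs))" "\<not> md (F2 \<union> (F - last Cs))"
        using kept(4) False tests by (auto simp: merges_def)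
      have T'md: "md (F2 \<union> \<Union>S)" using T' S by simp
      have xF: "x \<in> F" "y \<in> F" "x \<notin> last Cs" "y \<notin> hd Cs"
        using disjoint_blocks[OF d(5,11,12)] d(6,11,12,13) kept(2,3) by blast+
      have sep: "f \<notin> F" using F2 by auto
      \<comment> \<open>Both tests failed: \<open>x\<close> distinguishes \<open>y\<close> from
        \<open>f\<close>, and \<open>y\<close> distinguishes \<open>x\<close> from \<open>f\<close>.
        A module with \<open>f\<close> inside therefore contains both representatives or
        neither.\<close>
      have viaT: "\<not> md R" if "R \<subseteq> N" "f \<in> R" "(x \<notin> R \<and> y \<in> R) \<or> (x \<in> R \<and> y \<notin> R)" for R
      proof
        assume R: "md R"
        have "a x y \<noteq> a x f" "a y x \<noteq> a y f" using kept(4) False by (auto simp: merges_def)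
        then show False using mdD[OF R] that xF md_subset[OF F] by blast
      qed
      have in_block: "z \<in> \<Union>R \<longleftrightarrow> B \<in> R" if "z \<in> B" "B \<in> set Cs" "R \<subseteq> set Cs" for z B R
        using disjoint_blocks[OF d(5)] that by blast
      note inx = in_block[OF kept(2) d(11)] and iny = in_block[OF kept(3) d(12)]
      have xyF2: "x \<notin> F2" "y \<notin> F2" using xF F2(2) by blast+
      have mem: "x \<in> F2 \<union> \<Union>R \<longleftrightarrow> hd Cs \<in> R" "y \<in> F2 \<union> \<Union>R \<longleftrightarrow> last Cs \<in> R" if "R \<subseteq> set Cs" for R
        using inx[OF that] iny[OF that] xyF2 by auto
      have bad: "\<not> md (F2 \<union> \<Union>R)" if R: "R \<subseteq> set Cs" "(hd Cs \<in> R) \<noteq> (last Cs \<in> R)" for R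
      proof
        assume m: "md (F2 \<union> \<Union>R)"
        then show False using viaT[of "F2 \<union> \<Union>R"] md_subset[OF m] F2(4) mem[OF R(1)] R(2) by blast
      qed
      \<comment> \<open>The two outer children lie on the same side of the cut. In a complete node
        one of them can be moved across it alone, by removing or adding it together with a suitable
        \<open>E\<close>. In a linear node convexity makes their side everything.\<close>
      have both: "(hd Cs \<in> S) = (last Cs \<in> S)" using bad[OF S(1)] T'md by blast
      show False
      proof (cases ty)
        case Complete
        then have all: "md (\<Union>R)" if "R \<subseteq> set Cs" for R using d(9) that by simp
        show False
        proof (cases "hd Cs \<in> S")
          case True
          obtain E where E: "E \<in> set Cs - S" using ne S(1) by blast
          have lastS: "last Cs \<in> S" using True both by simp
          have U: "md (\<Union>{hd Cs, E})" using all[of "{hd Cs, E}"] E d(11) by blast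
          have "overlap (F2 \<union> \<Union>S) (\<Union>{hd Cs, E})"
          proof -
            obtain z where z: "z \<in> E" using E d(4) by (metis DiffD1 ex_in_conv)
            have "x \<in> (F2 \<union> \<Union>S) \<inter> \<Union>{hd Cs, E}" using True kept(2) by blast
            moreover have "f \<in> (F2 \<union> \<Union>S) - \<Union>{hd Cs, E}" using F2(4) sep E d(6,11) by blast
            moreover have "z \<in> \<Union>{hd Cs, E} - (F2 \<union> \<Union>S)"
              using z in_block[OF z _ S(1)] E d(6) F2(2) by blast
            ultimately show ?thesis unfolding overlap_def by blast
          qed
          then have "md (F2 \<union> \<Union>S - \<Union>{hd Cs, E})" using md_Diff[OF T'md U] by blast
          moreover have "F2 \<union> \<Union>S - \<Union>{hd Cs, E} = F2 \<union> \<Union>(S - {hd Cs})"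
          proof -
            have "F2 \<inter> \<Union>{hd Cs, E} = {}" using F2(2) d(6,11) E by blast
            moreover have "\<Union>S - \<Union>{hd Cs, E} = \<Union>(S - {hd Cs, E})"
              using Union_Diff_blocks(1)[OF d(5) S(1), of "{hd Cs, E}"] E d(11) by blast
            moreover have "S - {hd Cs, E} = S - {hd Cs}" using E by blast
            ultimately show ?thesis by (simp add: Un_Diff Diff_triv)
          qed
          ultimately show False using bad[of "S - {hd Cs}"] S(1) lastS d(13) by auto
        next
          case False
          obtain E where E: "E \<in> S" using ne by blast
          have "md (\<Union>{hd Cs, E})" using all[of "{hd Cs, E}"] E d(11) S(1) by blast
          then have "md ((F2 \<union> \<Union>S) \<union> \<Union>{hd Cs, E})"
            by (rule md_Un[OF T'md]) (use E S(1) d(4) in \<open>auto simp: ex_in_conv[symmetric]\<close>, metis ex_in_conv subsetD)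
          moreover have "(F2 \<union> \<Union>S) \<union> \<Union>{hd Cs, E} = F2 \<union> \<Union>(insert (hd Cs) S)" using E by blast
          ultimately show False using bad[of "insert (hd Cs) S"] False both d(11,13) S(1) by auto
        qed
      next
        case Linear
        then have int: "\<exists>i k. R = set (take k (drop i Cs))" if "R \<subseteq> set Cs" "md (\<Union>R)" for R
          using d(9) that by simp
        have hl: "hd Cs = Cs ! 0" "last Cs = Cs ! (length Cs - 1)"
          using d(10) by (auto simp: hd_conv_nth last_conv_nth)
        have conv: "R = set Cs" if R: "R \<subseteq> set Cs" "md (\<Union>R)" "hd Cs \<in> R" "last Cs \<in> R" for R
        proof
          show "set Cs \<subseteq> R"
          proof
            fix E assume "E \<in> set Cs"
            then obtain q where "q < length Cs" "E = Cs ! q" by (auto simp: in_set_conv_nth)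
            then show "E \<in> R"
              using interval_convex[OF int[OF R(1,2)] d(3), of 0 "length Cs - 1" q] R(3,4) hl by auto
          qed
        qed (rule R(1))
        show False
        proof (cases "hd Cs \<in> S")
          case True
          then have "last Cs \<in> S" using both by simp
          then show False using conv[OF S(1) mdS(1) True] ne by simp
        next
          case False
          then have "hd Cs \<in> set Cs - S" "last Cs \<in> set Cs - S" using both d(11,12) by simp_all
          then have "set Cs - S = set Cs" by (rule conv[OF Diff_subset mdS(2)])
          then show False using ne S(1) by blast
        qed
      qed (use False in simp)
    qed
  qed
qed

lemma oriented_props:
  assumes "oriented F f d Ds lin" "md F"
  shows "distinct Ds" "\<Union>(set Ds) = F" "disjoint (set Ds)" "Ds \<noteq> []"
proof -
  have "distinct Ds \<and> \<Union>(set Ds) = F \<and> disjoint (set Ds) \<and> Ds \<noteq> []"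
    using assms(1)
  proof cases
    case (Merged ty Cs x y)
    then have "set Ds = set Cs" "distinct Ds = distinct Cs" "Ds = [] \<longleftrightarrow> Cs = []" by simp_all
    then show ?thesis using decompD(3,5,6,10)[OF Merged(1)] by metis
  qed (auto simp: disjoint_def)
  then show "distinct Ds" "\<Union>(set Ds) = F" "disjoint (set Ds)" "Ds \<noteq> []" by blast+
qed

text \<open>Consecutive children of \<open>F\<close> form a module of two pieces and stay
  consecutive in \<open>L1 @ L2\<close>, so the stored order is \<open>L1\<close> or its reverse.
  Only the end away from \<open>F2\<close> can be removed without leaving a gap, hence exactly one
  test succeeds and tells which of the two orders is stored.\<close>

lemma oriented_side:
  assumes O: "oriented F f d Ds lin" and F: "md F"
    and F2: "md F2" "F \<inter> F2 = {}" "md (F \<union> F2)" "f \<in> F2"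
    and L: "distinct (L1 @ L2)" "set L1 = set Ds" "\<Union>(set L2) = F2" "L2 \<noteq> []"
    and disj: "disjoint (set (L1 @ L2))"
    and int: "\<And>S. S \<subseteq> set (L1 @ L2) \<Longrightarrow> md (\<Union>S) \<longleftrightarrow> (\<exists>i k. S = set (take k (drop i (L1 @ L2))))"
  shows "Ds = (if d then L1 else rev L1) \<and> (2 \<le> length Ds \<longrightarrow> lin)"
proof -
  from O consider (one) "Ds = [F]" "\<not> lin"
    | (merged) ty Cs x y where "decomp F ty Cs" "x \<in> hd Cs" "y \<in> last Cs" "merges ty Cs x y f"
      "lin \<longleftrightarrow> (a x y = a x f) \<noteq> (a y x = a y f)" "Ds = (if lin \<and> (a x y = a x f) \<noteq> d then rev Cs else Cs)"
    by cases auto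
  then show ?thesis
  proof cases
    case one
    then have "set L1 = {F}" "distinct L1" using L by auto
    then have "L1 = [F]" by (metis distinct.simps(2) empty_iff insert_iff list.exhaust list.set(1) list.set_intros(1) list.set_intros(2) singletonD)
    then show ?thesis using one by simp
  next
    case merged
    note d = decompD[OF merged(1)]
    have ty: "ty \<noteq> Prime" using merged(4) by (simp add: merges_def)
    have set1: "set Cs = set L1" using merged(6) L(2) by simp
    have dL1: "distinct L1" using L by simp
    have len1: "length L1 = length Cs" using set1 dL1 d(3) by (metis distinct_card)
    define L where "L = L1 @ L2"
    have dL: "distinct L" using L(1) by (simp only: L_def)
    have adj: "\<exists>j. Suc j < length L1 \<and> {Cs ! i, Cs ! Suc i} = {L1 ! j, L1 ! Suc j}" if i: "Suc i < length Cs" for i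
    proof -
      have tk: "set (take 2 (drop i Cs)) = {Cs ! i, Cs ! Suc i}"
        using i by (simp add: numeral_2_eq_2 take_Suc_conv_app_nth Cons_nth_drop_Suc[symmetric])
      have sub: "{Cs ! i, Cs ! Suc i} \<subseteq> set Cs" using i by simp
      have "md (\<Union>{Cs ! i, Cs ! Suc i})"
        using d(9) ty sub tk by (cases ty) (simp_all only: node_typed.simps simp_thms, metis)
      moreover have "{Cs ! i, Cs ! Suc i} \<subseteq> set (L1 @ L2)" using sub set1 by auto
      ultimately have "\<exists>i' k. {Cs ! i, Cs ! Suc i} = set (take k (drop i' L))"
        unfolding L_def using int by blast
      then obtain p q where pq: "q \<le> length L" "{Cs ! i, Cs ! Suc i} = {L ! m |m. p \<le> m \<and> m < q}"
        unfolding interval_iff_nth by blast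
      have "Cs ! i \<noteq> Cs ! Suc i" using i d(3) by (simp add: nth_eq_iff_index_eq)
      then have c2: "card {Cs ! i, Cs ! Suc i} = 2" by simp
      have img: "{L ! m |m. p \<le> m \<and> m < q} = (!) L ` {p..<q}" by auto
      moreover note img
      moreover have "inj_on ((!) L) {p..<q}" using dL pq(1) by (auto simp: inj_on_def nth_eq_iff_index_eq)
      ultimately have "q - p = 2" using c2 unfolding pq(2) by (simp add: card_image)
      then have q: "q = Suc (Suc p)" by simp
      then have "{p..<q} = {p, Suc p}" by auto
      then have eq: "{Cs ! i, Cs ! Suc i} = {L ! p, L ! Suc p}"
        unfolding pq(2) img by (simp only: image_insert image_empty)
      have "L ! Suc p \<in> {Cs ! i, Cs ! Suc i}" unfolding eq by simp
      then have "L ! Suc p \<in> set L1" using sub unfolding set1 by (rule subsetD[rotated])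
      then obtain j where "j < length L1" "L1 ! j = L ! Suc p" by (auto simp: in_set_conv_nth)
      then have "L ! j = L ! Suc p" "j < length L" by (simp_all add: L_def nth_append)
      then have "j = Suc p" using dL pq(1) q by (simp add: nth_eq_iff_index_eq)
      then have "Suc p < length L1" using \<open>j < length L1\<close> by simp
      then show ?thesis using eq by (intro exI[of _ p]) (simp add: L_def nth_append)
    qed
    have Cs: "Cs = L1 \<or> Cs = rev L1"
      by (rule same_adjacency_eq_or_rev[OF d(3) dL1 set1 adj])
    have ne: "L1 \<noteq> []" "2 \<le> length L1" using len1 d(2) by auto
    have drop_eq: "F2 \<union> (F - C) = \<Union>(set L - {C})" if "C \<in> set Cs" for C
    proof -
      have "F - C = \<Union>(set Cs - {C})"
        using Union_Diff_blocks(1)[OF d(5), of "set Cs" "{C}"] that d(6) by simp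
      moreover have "set L - {C} = (set Cs - {C}) \<union> set L2"
        using that set1 L(1) by (auto simp: L_def)
      ultimately show ?thesis using L(3) by auto
    qed
    have ends: "hd L1 = L ! 0" "last L1 = L ! (length L1 - 1)"
      using ne by (simp_all add: L_def hd_conv_nth last_conv_nth nth_append)
    have intL: "md (\<Union>S) \<longleftrightarrow> (\<exists>i k. S = set (take k (drop i L)))" if "S \<subseteq> set L" for S
      using int that by (simp only: L_def)
    have P1: "md (\<Union>(set L - {hd L1}))"
    proof -
      have "hd L1 = hd L" "L \<noteq> []" using ne by (simp_all add: L_def)
      moreover have "set (tl L) \<subseteq> set L" using interval_drop_outer(1)[OF \<open>L \<noteq> []\<close> dL] by blast
      ultimately show ?thesis using intL[of "set (tl L)"] interval_drop_outer(1,3)[of L] dL by simp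
    qed
    \<comment> \<open>Without \<open>last L1\<close> a gap separates the beginning of
      \<open>L1\<close> from \<open>L2\<close>.\<close>
    have P2: "\<not> md (\<Union>(set L - {last L1}))"
    proof
      assume "md (\<Union>(set L - {last L1}))"
      then have "\<exists>i k. set L - {last L1} = set (take k (drop i L))" using intL[of "set L - {last L1}"] by blast
      moreover have "length L1 < length L" using L(4) by (simp add: L_def)
      moreover have "L ! 0 \<in> set L - {last L1}" "L ! length L1 \<in> set L - {last L1}"
      proof -
        have "L \<noteq> []" using ne by (simp add: L_def)
        then show "L ! 0 \<in> set L - {last L1}" "L ! length L1 \<in> set L - {last L1}"
          using ne dL \<open>length L1 < length L\<close> by (auto simp: ends nth_eq_iff_index_eq)
      qed
      ultimately have "L ! (length L1 - 1) \<in> set L - {last L1}"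
        using interval_convex[OF _ dL, of "set L - {last L1}" 0 "length L1" "length L1 - 1"] by simp
      then show False by (simp add: ends)
    qed
    have hl: "hd (rev L1) = last L1" "last (rev L1) = hd L1" using ne by (simp_all add: hd_rev last_rev)
    note tests = outer_tests[OF merged(1) ty merged(2,3) F2, unfolded drop_eq[OF d(11)] drop_eq[OF d(12)]]
    from Cs show ?thesis
    proof
      assume "Cs = L1"
      then have "a x y = a x f" "a y x \<noteq> a y f" using tests P1 P2 by auto
      then show ?thesis using merged(5,6) \<open>Cs = L1\<close> by auto
    next
      assume "Cs = rev L1"
      then have "a x y \<noteq> a x f" "a y x = a y f" using tests P1 P2 hl by auto
      then show ?thesis using merged(5,6) \<open>Cs = rev L1\<close> by auto
    qed
  qed
qed

text \<open>A smaller union of pieces is overlapped already inside \<open>F\<close>, by the old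
  type. The union of all pieces is overlapped because one test succeeded: \<open>F2\<close> together
  with all children but one outer child is a module.\<close>

lemma oriented_not_strong:
  assumes O: "oriented F f d Ds lin" and F: "md F"
    and F2: "md F2" "F \<inter> F2 = {}" "md (F \<union> F2)" "f \<in> F2"
    and V: "\<Union>(set E) = F2" "E \<noteq> []" "disjoint (set Ds \<union> set E)" "{} \<notin> set Ds \<union> set E"
    and S: "S \<subseteq> set Ds" "2 \<le> card S" "md (\<Union>S)"
  shows "\<exists>T\<subseteq>set Ds \<union> set E. md (\<Union>T) \<and> overlap S T"
proof -
  have "card (set Ds) \<ge> 2" using S(1,2) card_mono[of "set Ds" S] by simp
  then have "length Ds \<ge> 2" using card_length[of Ds] by linarith
  with O obtain ty Cs x y where m: "decomp F ty Cs" "x \<in> hd Cs" "y \<in> last Cs" "merges ty Cs x y f"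
      "set Ds = set Cs"
    by cases (auto split: if_splits)
  note d = decompD[OF m(1)]
  have ty: "ty \<noteq> Prime" using m(4) by (simp add: merges_def)
  show ?thesis
  proof (cases "S = set Cs")
    case False
    then show ?thesis using not_strong_typed[OF d(3,9) _ S(2) _ S(3)] S(1) m(5) by blast
  next
    case True
    have EC: "C \<notin> set E" if "C \<in> set Cs" for C
    proof
      assume "C \<in> set E"
      then have "C \<subseteq> F \<inter> F2" using that d(6) V(1) by blast
      then show False using that d(4) F2(2) by auto
    qed
    have "md (F2 \<union> (F - hd Cs)) \<or> md (F2 \<union> (F - last Cs))"
      using outer_tests[OF m(1) ty m(2,3) F2] m(4) by (auto simp: merges_def)
    then obtain C where C: "C \<in> set Cs" "md (F2 \<union> (F - C))" using d(11,12) by blast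
    have "F - C = \<Union>(set Cs - {C})"
      using Union_Diff_blocks(1)[OF d(5), of "set Cs" "{C}"] C(1) d(6) by simp
    then have "F2 \<union> (F - C) = \<Union>(set E \<union> (set Cs - {C}))" using V(1) by auto
    then have md: "md (\<Union>(set E \<union> (set Cs - {C})))" using C(2) by simp
    obtain C' where C': "C' \<in> set Cs" "C' \<noteq> C" using d(11,12,13) by metis
    obtain D where D: "D \<in> set E" using V(2) by (meson list.set_sel(1))
    have "C' \<in> S \<inter> (set E \<union> (set Cs - {C}))" "C \<in> S - (set E \<union> (set Cs - {C}))"
      "D \<in> set E \<union> (set Cs - {C}) - S"
      using True C' C EC D by blast+
    then have "overlap S (set E \<union> (set Cs - {C}))" unfolding overlap_def by blast
    moreover have "set E \<union> (set Cs - {C}) \<subseteq> set Ds \<union> set E" using m(5) by blast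
    ultimately show ?thesis using md by blast
  qed
qed

text \<open>The pieces are strong, and unless each side contributes one piece only, no nontrivial
  union of pieces is strong. Then \<open>complete_or_linear\<close> leaves two shapes, and the flags
  computed at the two sides tell which one holds.\<close>

theorem decomp_binary:
  assumes O1: "oriented F1 f2 True D1 lin1" and O2: "oriented F2 f1 False D2 lin2"
    and F: "md F1" "md F2" "F1 \<inter> F2 = {}" "md (F1 \<union> F2)" "f1 \<in> F1" "f2 \<in> F2"
  shows "decomp (F1 \<union> F2) (if lin1 \<or> lin2 then Linear else Complete) (D1 @ D2)"
proof -
  have F': "F2 \<inter> F1 = {}" "md (F2 \<union> F1)" using F by (simp_all add: Int_commute Un_commute)
  note o1 = oriented_props[OF O1 F(1)] and o2 = oriented_props[OF O2 F(2)]
  define V where "V = set (D1 @ D2)"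
  have V_eq: "V = set D1 \<union> set D2" by (simp add: V_def)
  have un: "\<Union>V = F1 \<union> F2" using o1(2) o2(2) by (simp add: V_eq)
  have strong: "strong_in (F1 \<union> F2) C" if "C \<in> V" for C
    using that oriented_strong[OF O1 F(1,2,3,4,6)] oriented_strong[OF O2 F(2,1) F' F(5)]
    by (auto simp: V_eq Un_commute)
  have mdV: "md C" "C \<noteq> {}" if "C \<in> V" for C using strong[OF that] by (auto simp: strong_in_def)
  have noempty: "{} \<notin> V" using mdV(2) by blast
  have inD: "C \<subseteq> F1" if "C \<in> set D1" for C using that o1(2) by blast
  have inD2: "C \<subseteq> F2" if "C \<in> set D2" for C using that o2(2) by blast
  have d12: "set D1 \<inter> set D2 = {}"
  proof (rule ccontr)
    assume "set D1 \<inter> set D2 \<noteq> {}"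
    then obtain C where "C \<in> set D1" "C \<in> set D2" by blast
    then have "C \<subseteq> F1 \<inter> F2" "C \<in> V" using inD inD2 by (auto simp: V_eq)
    then show False using mdV(2) F(3) by blast
  qed
  have distD: "distinct (D1 @ D2)" using o1(1) o2(1) d12 by simp
  have disj: "disjoint V"
  proof (rule disjointI)
    fix A B assume AB: "A \<in> V" "B \<in> V" "A \<noteq> B"
    then consider "A \<in> set D1" "B \<in> set D1" | "A \<in> set D2" "B \<in> set D2"
      | "A \<in> set D1" "B \<in> set D2" | "A \<in> set D2" "B \<in> set D1" by (auto simp: V_eq)
    then show "A \<inter> B = {}"
    proof cases
      case 1 then show ?thesis using o1(3) AB(3) by (simp add: disjoint_def)
    next
      case 2 then show ?thesis using o2(3) AB(3) by (simp add: disjoint_def)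
    next
      case 3 then show ?thesis using inD[of A] inD2[of B] F(3) by blast
    next
      case 4 then show ?thesis using inD[of B] inD2[of A] F(3) by blast
    qed
  qed
  have len: "2 \<le> length (D1 @ D2)" using o1(4) o2(4) by (cases D1; cases D2) auto
  have sub1: "set D1 \<subseteq> V" "set D2 \<subseteq> V" by (auto simp: V_eq)
  have ty: "node_typed N (row_rel a) (if lin1 \<or> lin2 then Linear else Complete) (D1 @ D2)"
  proof (cases "2 \<le> length D1 \<or> 2 \<le> length D2")
    case False
    moreover have "length D1 \<noteq> 0" "length D2 \<noteq> 0" using o1(4) o2(4) by simp_all
    ultimately have one: "length D1 = 1" "length D2 = 1" by linarith+
    have nl: "\<not> lin" "Ds = [F]" if "oriented F f d Ds lin" "length Ds = 1" for F f d Ds lin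
    proof -
      have "\<not> lin \<and> Ds = [F]" using that(1)
      proof cases
        case (Merged ty Cs x y)
        then have "length Ds = length Cs" by simp
        then show ?thesis using that(2) decompD(2)[OF Merged(1)] by simp
      qed simp_all
      then show "\<not> lin" "Ds = [F]" by simp_all
    qed
    have D: "D1 = [F1]" "D2 = [F2]" "\<not> lin1" "\<not> lin2" using nl[OF O1 one(1)] nl[OF O2 one(2)] by auto
    \<comment> \<open>A node with two children is complete by convention.\<close>
    have "md (\<Union>S)" if "S \<subseteq> {F1, F2}" for S
    proof -
      have "S = {} \<or> S = {F1} \<or> S = {F2} \<or> S = {F1, F2}" using that by blast
      then show ?thesis using F md_empty by auto
    qed
    then show ?thesis using D by simp
  next
    case True
    define Fam where "Fam = {S. S \<subseteq> V \<and> md (\<Union>S)}"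
    interpret weakly_partitive V Fam
      unfolding Fam_def using un F(4) mdV
      by (intro weakly_partitive_blocks disj noempty) (auto simp: V_def)
    have UD: "\<Union>(set D1) = F1" "\<Union>(set D2) = F2" using o1 o2 by auto
    have strl: "strongless V Fam"
    proof
      fix S assume S: "S \<in> Fam" "2 \<le> card S" "S \<noteq> V"
      then have S': "S \<subseteq> V" "md (\<Union>S)" by (auto simp: Fam_def)
      show "\<exists>T\<in>Fam. overlap S T"
      proof (rule ccontr)
        assume neg: "\<not> ?thesis"
        have "set D1 \<in> Fam" "set D2 \<in> Fam" using UD F sub1 by (auto simp: Fam_def)
        then have no: "\<not> overlap S (set D1)" "\<not> overlap S (set D2)" using neg by blast+
        have "S \<subseteq> set D1 \<or> S \<subseteq> set D2"
          using no S(3) S'(1) unfolding overlap_def V_eq by blast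
        then show False
        proof
          assume "S \<subseteq> set D1"
          then show False
            using oriented_not_strong[OF O1 F(1,2,3,4,6) UD(2) o2(4) _ _ _ S(2) S'(2)] neg disj noempty
            by (auto simp: V_eq Fam_def)
        next
          assume "S \<subseteq> set D2"
          then show False
            using oriented_not_strong[OF O2 F(2,1) F' F(5) UD(1) o1(4) _ _ _ S(2) S'(2)] neg disj noempty
            by (auto simp: V_eq Fam_def Un_commute)
        qed
      qed
    next
      show "\<exists>S\<in>Fam. 2 \<le> card S \<and> S \<noteq> V"
      proof -
        have c: "card (set D1) = length D1" "card (set D2) = length D2" using distD distinct_card by auto
        have "set D1 \<in> Fam" "set D2 \<in> Fam" using UD F sub1 by (auto simp: Fam_def)
        moreover obtain A B where "A \<in> set D1" "B \<in> set D2"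
          using o1(4) o2(4) by (meson list.set_sel(1))
        then have "set D1 \<noteq> V" "set D2 \<noteq> V" using d12 sub1 by blast+
        ultimately show ?thesis using True c by metis
      qed
    qed
    have FamD: "S \<in> Fam \<longleftrightarrow> md (\<Union>S)" if "S \<subseteq> V" for S using that by (simp add: Fam_def)
    have len3: "3 \<le> length (D1 @ D2)" using True o1(4) o2(4) by (cases D1; cases D2) auto
    from strongless.complete_or_linear[OF strl] show ?thesis
    proof
      assume all: "\<forall>S\<subseteq>V. S \<in> Fam"
      have notlin: "\<not> lin" if O: "oriented F f d Ds lin" and Fs: "md F" "md G" "F \<inter> G = {}" "md (F \<union> G)" "f \<in> G"
        and E: "\<Union>(set E) = G" "V = set Ds \<union> set E" for F f d Ds lin G E
        using O
      proof cases
        case (Merged ty Cs x y)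
        note d = decompD[OF Merged(1)]
        have ty: "ty \<noteq> Prime" using Merged(4) by (simp add: merges_def)
        have DC: "set Ds = set Cs" using Merged by auto
        have "md (G \<union> (F - C))" if "C \<in> set Cs" for C
        proof -
          have "F - C = \<Union>(set Cs - {C})"
            using Union_Diff_blocks(1)[OF d(5), of "set Cs" "{C}"] that d(6) by simp
          then have "G \<union> (F - C) = \<Union>(set E \<union> (set Cs - {C}))" using E(1) by auto
          moreover have "set E \<union> (set Cs - {C}) \<subseteq> V" using E(2) DC by blast
          moreover have "md (\<Union>(set E \<union> (set Cs - {C})))" using all FamD calculation(2) by blast
          ultimately show ?thesis by (simp only:)
        qed
        then show ?thesis
          using outer_tests[OF Merged(1) ty Merged(2,3) Fs(2,3,4,5)] d(11,12) Merged(5) by blast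
      qed simp_all
      have "\<not> lin1" using notlin[OF O1 F(1,2,3,4,6) UD(2) V_eq] .
      moreover have "\<not> lin2" using notlin[OF O2 F(2,1) F' F(5) UD(1)] V_eq by (simp add: Un_commute)
      ultimately show ?thesis using all FamD by (simp add: V_def)
    next
      assume "\<exists>L. distinct L \<and> set L = V \<and> (\<forall>S\<subseteq>V. S \<in> Fam \<longleftrightarrow> (\<exists>i k. S = set (take k (drop i L))))"
      then obtain L where L: "distinct L" "set L = V"
        and L_int: "\<And>S. S \<subseteq> V \<Longrightarrow> md (\<Union>S) \<longleftrightarrow> (\<exists>i k. S = set (take k (drop i L)))"
        using FamD by metis
      have "\<exists>i k. set D1 = set (take k (drop i L))" "\<exists>i k. set D2 = set (take k (drop i L))"
        using L_int[OF sub1(1)] L_int[OF sub1(2)] UD F by simp_all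
      then obtain M1 M2 where M: "L = M1 @ M2 \<or> L = M2 @ M1" "set M1 = set D1" "set M2 = set D2"
        using interval_split[OF L(1), of "set D1" "set D2"] L(2) V_eq d12 by blast
      \<comment> \<open>The order \<open>L\<close> is determined only up to reversal;
        \<open>K\<close> is the variant in which the pieces of \<open>F1\<close> come first.\<close>
      define K where "K = (if L = M1 @ M2 then L else rev L)"
      have K: "distinct K" "set K = V" using L by (auto simp: K_def)
      have K_cases: "K = L \<or> K = rev L" by (simp add: K_def)
      have K_int: "md (\<Union>S) \<longleftrightarrow> (\<exists>i k. S = set (take k (drop i K)))" if "S \<subseteq> V" for S
        using K_cases L_int[OF that] interval_rev_iff[of S L] by (elim disjE) (simp_all only:)
      obtain L1 L2 where KL: "K = L1 @ L2" "set L1 = set D1" "set L2 = set D2"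
        using M by (cases "L = M1 @ M2") (auto simp: K_def)
      have ne: "L1 \<noteq> []" "L2 \<noteq> []" using KL o1(4) o2(4) by auto
      have s1: "D1 = (if True then L1 else rev L1) \<and> (2 \<le> length D1 \<longrightarrow> lin1)"
      proof (rule oriented_side[OF O1 F(1,2,3,4,6)])
        show "distinct (L1 @ L2)" using K(1) KL(1) by simp
        show "disjoint (set (L1 @ L2))" using disj K(2) KL(1) by simp
        show "md (\<Union>S) \<longleftrightarrow> (\<exists>i k. S = set (take k (drop i (L1 @ L2))))" if "S \<subseteq> set (L1 @ L2)" for S
          using K_int[of S] that K(2) KL(1) by simp
      qed (use KL UD ne in simp_all)
      \<comment> \<open>Seen from the second side its own pieces come first in the reversed order.
        With the flag \<open>False\<close> the answer is reversed back to \<open>L2\<close>.\<close>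
      have s2: "D2 = (if False then rev L2 else rev (rev L2)) \<and> (2 \<le> length D2 \<longrightarrow> lin2)"
      proof (rule oriented_side[OF O2 F(2,1) F' F(5)])
        show "distinct (rev L2 @ rev L1)" using K(1) KL(1) by auto
        show "disjoint (set (rev L2 @ rev L1))" using disj K(2) KL(1) by (simp add: Un_commute)
        show "md (\<Union>S) \<longleftrightarrow> (\<exists>i k. S = set (take k (drop i (rev L2 @ rev L1))))" if "S \<subseteq> set (rev L2 @ rev L1)" for S
        proof -
          have "rev L2 @ rev L1 = rev K" using KL(1) by simp
          then show ?thesis using K_int[of S] that K(2) interval_rev_iff[of S K] by (metis set_rev)
        qed
      qed (use KL UD ne in simp_all)
      have "D1 @ D2 = K" using s1 s2 KL(1) by simp
      then have "node_typed N (row_rel a) Linear (D1 @ D2)" using K_int K(2) len3 by simp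
      then show ?thesis using s1 s2 True by auto
    qed
  qed
  have "\<Union>(set (D1 @ D2)) = F1 \<union> F2" "disjoint (set (D1 @ D2))" "{} \<notin> set (D1 @ D2)"
    "\<forall>C\<in>set (D1 @ D2). strong_in (F1 \<union> F2) C"
    using un disj noempty strong unfolding V_def by blast+
  then show ?thesis unfolding decomp_def using F(4) len distD ty by blast
qed

end

section \<open>Partition refinement\<close>

text \<open>The partition is stored as boundary marks: a nonzero \<open>st k\<close> means that a
  class starts at \<open>k\<close>. Classes are thus runs of positions, and a split is a single
  write.\<close>

definition same_class :: "(nat \<Rightarrow> nat) \<Rightarrow> nat \<Rightarrow> nat \<Rightarrow> bool" where
  "same_class st i j \<longleftrightarrow> (\<forall>k. min i j < k \<and> k \<le> max i j \<longrightarrow> st k = 0)"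

lemma same_class_refl [simp]: "same_class st i i"
  by (simp add: same_class_def)

lemma same_class_sym: "same_class st i j \<longleftrightarrow> same_class st j i"
  by (simp add: same_class_def min.commute max.commute)

lemma same_class_le: "i \<le> j \<Longrightarrow> same_class st i j \<longleftrightarrow> (\<forall>k. i < k \<and> k \<le> j \<longrightarrow> st k = 0)"
  by (simp add: same_class_def)

lemma same_class_trans: "same_class st i j \<Longrightarrow> same_class st j k \<Longrightarrow> same_class st i k"
  unfolding same_class_def
proof (intro allI impI)
  fix l assume H: "\<forall>k. min i j < k \<and> k \<le> max i j \<longrightarrow> st k = 0" "\<forall>l. min j k < l \<and> l \<le> max j k \<longrightarrow> st l = 0"
    and l: "min i k < l \<and> l \<le> max i k"
  then have "min i j < l \<and> l \<le> max i j \<or> min j k < l \<and> l \<le> max j k" by linarith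
  then show "st l = 0" using H by blast
qed

lemma same_class_boundary: "same_class st i j \<Longrightarrow> st b \<noteq> 0 \<Longrightarrow> b \<le> i \<longleftrightarrow> b \<le> j"
  unfolding same_class_def by (metis le_less_linear max.coboundedI1 max.coboundedI2 min_less_iff_disj)

lemma same_class_split:
  "same_class (st(m := Suc 0)) i j \<longleftrightarrow> same_class st i j \<and> (m \<le> i \<longleftrightarrow> m \<le> j)" if "st m = 0"
proof
  assume H: "same_class (st(m := Suc 0)) i j"
  then have "m \<le> i \<longleftrightarrow> m \<le> j" using same_class_boundary[OF H, of m] by simp
  moreover have "same_class st i j"
    using H that unfolding same_class_def by (metis fun_upd_apply Zero_not_Suc)
  ultimately show "same_class st i j \<and> (m \<le> i \<longleftrightarrow> m \<le> j)" by blast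
next
  assume H: "same_class st i j \<and> (m \<le> i \<longleftrightarrow> m \<le> j)"
  then show "same_class (st(m := Suc 0)) i j"
    unfolding same_class_def by (auto simp: min_def max_def split: if_splits)
qed

text \<open>Task \<open>k\<close> remembers that the run from \<open>tL k\<close> to
  \<open>tR k\<close> was split at \<open>tM k\<close>. Each position of one side has to act as a
  pivot on the other side, and only these pairs.\<close>

definition opposite :: "(nat \<Rightarrow> nat) \<Rightarrow> (nat \<Rightarrow> nat) \<Rightarrow> (nat \<Rightarrow> nat) \<Rightarrow> nat \<Rightarrow> nat \<Rightarrow> nat \<Rightarrow> bool" where
  "opposite tL tM tR k y i \<longleftrightarrow> tL k \<le> y \<and> y < tM k \<and> tM k \<le> i \<and> i < tR k \<or>
     tL k \<le> i \<and> i < tM k \<and> tM k \<le> y \<and> y < tR k"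

definition tasks_wf :: "nat \<Rightarrow> (nat \<Rightarrow> nat) \<Rightarrow> (nat \<Rightarrow> nat) \<Rightarrow> (nat \<Rightarrow> nat) \<Rightarrow> (nat \<Rightarrow> nat) \<Rightarrow> nat \<Rightarrow> bool" where
  "tasks_wf n st tL tM tR ns \<longleftrightarrow> (\<forall>k<ns. tL k < tM k \<and> tM k < tR k \<and> tR k \<le> n \<and>
     st (tL k) \<noteq> 0 \<and> st (tM k) \<noteq> 0 \<and> st (tR k) \<noteq> 0)"

text \<open>Pivot and class pairs that still have to be examined once tasks \<open>t < k < ns\<close> and the rest of task \<open>t\<close>,
  from pivot position \<open>y\<close> and scan position \<open>q\<close> on, are pending.\<close>

definition pend :: "(nat \<Rightarrow> nat) \<Rightarrow> (nat \<Rightarrow> nat) \<Rightarrow> (nat \<Rightarrow> nat) \<Rightarrow> nat \<Rightarrow> nat \<Rightarrow> nat \<Rightarrow> nat \<Rightarrow> nat \<Rightarrow> nat \<Rightarrow> nat \<Rightarrow> bool" where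
  "pend tL tM tR ns t y q y' i j \<longleftrightarrow> (\<exists>k. t < k \<and> k < ns \<and> opposite tL tM tR k y' i) \<or>
     t < ns \<and> opposite tL tM tR t y' i \<and> (y < y' \<or> y' = y \<and> (q \<le> i \<or> q \<le> j))"

section \<open>Invariants of the refinement\<close>

locale refinement = good_matrix "{..<n}" mt for n :: nat and mt :: "nat \<Rightarrow> nat \<Rightarrow> nat"
begin

text \<open>Stability of the partition up to exceptions: pivots never split a foreign class, except
  for the comparisons that \<open>pe\<close> still lists.\<close>

definition refined :: "(nat \<Rightarrow> nat) \<Rightarrow> (nat \<Rightarrow> nat) \<Rightarrow> (nat \<Rightarrow> nat \<Rightarrow> nat \<Rightarrow> bool) \<Rightarrow> bool" where
  "refined P st pe \<longleftrightarrow> (\<forall>y i j. y < n \<longrightarrow> i < n \<longrightarrow> j < n \<longrightarrow> same_class st i j \<longrightarrow> \<not> same_class st y i \<longrightarrow>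
     mt (P y) (P i) = mt (P y) (P j) \<or> pe y i j)"

text \<open>The other half of exactness: splits may be forced by pivots, but no module from position
  \<open>c\<close> on is ever cut. Stability alone would also hold for the finest partition.\<close>

definition modules_in_classes :: "nat \<Rightarrow> (nat \<Rightarrow> nat) \<Rightarrow> (nat \<Rightarrow> nat) \<Rightarrow> bool" where
  "modules_in_classes c P st \<longleftrightarrow> (\<forall>S. md S \<longrightarrow> (\<forall>i<n. P i \<in> S \<longrightarrow> c \<le> i) \<longrightarrow>
     (\<forall>i<n. \<forall>j<n. P i \<in> S \<longrightarrow> P j \<in> S \<longrightarrow> same_class st i j))"

definition stage_done :: "nat \<Rightarrow> (nat \<Rightarrow> nat) \<Rightarrow> nat \<Rightarrow> bool" where
  "stage_done c P e \<longleftrightarrow> c < e \<and> e \<le> n \<and> md (P ` {c..<e}) \<and>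
     (\<forall>S. md S \<longrightarrow> P c \<in> S \<longrightarrow> (\<forall>i<n. P i \<in> S \<longrightarrow> c \<le> i) \<longrightarrow> (\<forall>i<n. P i \<in> S \<longrightarrow> i < e))"

definition stages_done :: "nat \<Rightarrow> (nat \<Rightarrow> nat) \<Rightarrow> (nat \<Rightarrow> nat) \<Rightarrow> bool" where
  "stages_done d P en \<longleftrightarrow> (\<forall>c<d. stage_done c P (en c))"

text \<open>The positions before \<open>d\<close> are singleton classes and every recorded end
  \<open>en c\<close> is a boundary. Permuting inside a class therefore keeps all recorded blocks
  intact.\<close>

definition state_ok where
  "state_ok d P st tL tM tR ns en pe \<longleftrightarrow> bij_betw P {..<n} {..<n} \<and> st n \<noteq> 0 \<and> d \<le> n \<and> (\<forall>i\<le>d. st i \<noteq> 0) \<and>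
     tasks_wf n st tL tM tR ns \<and> refined P st pe \<and> modules_in_classes d P st \<and> stages_done d P en \<and>
     (\<forall>c<d. st (en c) \<noteq> 0)"

lemma state_ok_init:
  assumes "P = (\<lambda>i. i) \<or> (\<forall>i<n. P i = i)" "st 0 \<noteq> 0" "st n \<noteq> 0" "\<And>i. 0 < i \<Longrightarrow> i < n \<Longrightarrow> st i = 0"
  shows "state_ok 0 P st tL tM tR 0 en (\<lambda>_ _ _. False)"
proof -
  have id: "\<And>i. i < n \<Longrightarrow> P i = i" using assms(1) by auto
  have "same_class st i j" if "i < n" "j < n" for i j
    using assms(4) that by (auto simp: same_class_def)
  moreover have "bij_betw P {..<n} {..<n}"
    using id by (intro bij_betw_byWitness[where f' = "\<lambda>i. i"]) auto
  ultimately show ?thesis using assms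
    by (auto simp: state_ok_def tasks_wf_def refined_def modules_in_classes_def stages_done_def)
qed

lemma state_ok_final:
  assumes "state_ok n P st tL tM tR ns en pe"
  shows "bij_betw P {..<n} {..<n}" "stages_done n P en"
  using assms by (auto simp: state_ok_def)

lemma refined_mono:
  "refined P st pe \<Longrightarrow> (\<And>y i j. pe y i j \<Longrightarrow> \<not> same_class st y i \<Longrightarrow> same_class st i j \<Longrightarrow> y < n \<Longrightarrow> i < n \<Longrightarrow> j < n \<Longrightarrow>
     mt (P y) (P i) = mt (P y) (P j) \<or> pe' y i j) \<Longrightarrow> refined P st pe'"
  unfolding refined_def by blast

text \<open>As long as nothing moves, progress consists in dropping pending comparisons; one may be
  dropped once it is known to find equal entries.\<close>

lemma state_ok_mono:
  assumes "state_ok d P st tL tM tR ns en pe"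
    "\<And>y i j. pe y i j \<Longrightarrow> \<not> same_class st y i \<Longrightarrow> same_class st i j \<Longrightarrow> y < n \<Longrightarrow> i < n \<Longrightarrow> j < n \<Longrightarrow>
       mt (P y) (P i) = mt (P y) (P j) \<or> pe' y i j"
  shows "state_ok d P st tL tM tR ns en pe'"
  using assms refined_mono[of P st pe pe'] unfolding state_ok_def by blast

lemma class_interval:
  assumes "st c \<noteq> 0" "st e \<noteq> 0" "c < e" "\<And>i. c < i \<Longrightarrow> i < e \<Longrightarrow> st i = 0" "c \<le> i" "i < e"
  shows "same_class st i j \<longleftrightarrow> c \<le> j \<and> j < e"
proof
  assume "same_class st i j"
  then show "c \<le> j \<and> j < e"
    using same_class_boundary[of st i j c] same_class_boundary[of st i j e] assms by auto
next
  assume "c \<le> j \<and> j < e"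
  then show "same_class st i j" using assms by (auto simp: same_class_def)
qed

text \<open>With nothing pending, no outside pivot splits the class of \<open>c\<close>, so this
  class is a module; by \<open>modules_in_classes\<close> it is the largest one from
  \<open>c\<close> on. Afterwards only modules from \<open>Suc c\<close> on matter, which allows
  \<open>c\<close> to be split off. The pairs that this separates are one new task.\<close>

lemma stage_begin:
  assumes ok: "state_ok c P st tL tM tR ns en (\<lambda>_ _ _. False)" and c: "c < n" "c < e" "e \<le> n" "st e \<noteq> 0"
    "\<And>i. c < i \<Longrightarrow> i < e \<Longrightarrow> st i = 0"
  shows "e = Suc c \<Longrightarrow> state_ok (Suc c) P st tL tM tR ns (en(c := e)) (\<lambda>_ _ _. False)"
    and "Suc c < e \<Longrightarrow> state_ok (Suc c) P (st(Suc c := Suc 0)) (tL(ns := c)) (tM(ns := Suc c)) (tR(ns := e))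
      (Suc ns) (en(c := e)) (pend (tL(ns := c)) (tM(ns := Suc c)) (tR(ns := e)) (Suc ns) ns 0 0)"
proof -
  have st: "st c \<noteq> 0" "\<And>i. i \<le> c \<Longrightarrow> st i \<noteq> 0" using ok by (auto simp: state_ok_def)
  have bij: "bij_betw P {..<n} {..<n}" and mic: "modules_in_classes c P st" and sd: "stages_done c P en"
    and rf: "refined P st (\<lambda>_ _ _. False)"
    using ok by (auto simp: state_ok_def)
  note cls = class_interval[OF st(1) c(4,2,5)]
  have mdM: "md (P ` {c..<e})"
    unfolding md_iff
  proof (intro conjI ballI)
    show "P ` {c..<e} \<subseteq> {..<n}" using bij c(3) by (fastforce simp: bij_betw_def)
  next
    fix x m m' assume x: "x \<in> {..<n} - P ` {c..<e}" and m: "m \<in> P ` {c..<e}" "m' \<in> P ` {c..<e}"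
    obtain y where y: "y < n" "x = P y" using x bij by (auto simp: bij_betw_def)
    obtain i j where ij: "i \<in> {c..<e}" "j \<in> {c..<e}" "m = P i" "m' = P j" using m by blast
    have "\<not> same_class st y i" using cls[of i y] x y ij same_class_sym[of st y i] by auto
    moreover have "same_class st i j" using cls[of i j] ij by auto
    ultimately show "mt x m = mt x m'" using rf y ij c(3) by (auto simp: refined_def)
  qed
  have sd': "stages_done (Suc c) P (en(c := e))"
  proof -
    have "i < e" if S: "md S" "P c \<in> S" "\<forall>i<n. P i \<in> S \<longrightarrow> c \<le> i" "i < n" "P i \<in> S" for S i
    proof -
      have "same_class st c i" using mic S c(1) unfolding modules_in_classes_def by blast
      then show ?thesis using cls[of c i] c(2) by simp
    qed
    then have "stage_done c P e"
      using c mdM unfolding stage_done_def by blast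
    then show ?thesis using sd by (simp add: stages_done_def less_Suc_eq)
  qed
  have en': "\<forall>k<Suc c. st ((en(c := e)) k) \<noteq> 0" using ok c(4) by (auto simp: state_ok_def less_Suc_eq)
  have mic': "modules_in_classes (Suc c) P st" using mic unfolding modules_in_classes_def by (meson Suc_leD)
  {
    assume e: "e = Suc c"
    then show "state_ok (Suc c) P st tL tM tR ns (en(c := e)) (\<lambda>_ _ _. False)"
      using ok sd' en' mic' c st by (auto simp: state_ok_def le_Suc_eq)
  next
    assume e: "Suc c < e"
    let ?st = "st(Suc c := Suc 0)"
    have z: "st (Suc c) = 0" using c(5)[of "Suc c"] e by simp
    note split = same_class_split[of st, OF z]
    have "modules_in_classes (Suc c) P ?st"
      using mic' by (auto simp: modules_in_classes_def split)
    moreover have "refined P ?st (pend (tL(ns := c)) (tM(ns := Suc c)) (tR(ns := e)) (Suc ns) ns 0 0)"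
      unfolding refined_def
    proof (intro allI impI)
      fix y i j assume yij: "y < n" "i < n" "j < n" "same_class ?st i j" "\<not> same_class ?st y i"
      then have ij: "same_class st i j" by (simp add: split)
      show "mt (P y) (P i) = mt (P y) (P j) \<or> pend (tL(ns := c)) (tM(ns := Suc c)) (tR(ns := e)) (Suc ns) ns 0 0 y i j"
      proof (cases "same_class st y i")
        case False
        then show ?thesis using rf yij(1,2,3) ij unfolding refined_def by blast
      next
        case True
        then have d: "Suc c \<le> y \<longleftrightarrow> \<not> Suc c \<le> i" using yij by (auto simp: split)
        have "same_class st i y" using True same_class_sym by blast
        have "c \<le> y \<longleftrightarrow> c \<le> i" using same_class_boundary[OF True st(1)] .
        then have "c = y \<or> c = i" "c \<le> y" "c \<le> i" using d by linarith+
        then have "y < e" "i < e"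
          using cls[of y i] cls[of i y] True \<open>same_class st i y\<close> c(2) by auto
        have "opposite (tL(ns := c)) (tM(ns := Suc c)) (tR(ns := e)) ns y i"
          using d \<open>c \<le> y\<close> \<open>c \<le> i\<close> \<open>y < e\<close> \<open>i < e\<close> by (auto simp: opposite_def)
        then show ?thesis by (auto simp: pend_def)
      qed
    qed
    moreover have "tasks_wf n ?st (tL(ns := c)) (tM(ns := Suc c)) (tR(ns := e)) (Suc ns)"
      using ok c e st by (auto simp: tasks_wf_def state_ok_def less_Suc_eq)
    ultimately show "state_ok (Suc c) P ?st (tL(ns := c)) (tM(ns := Suc c)) (tR(ns := e))
      (Suc ns) (en(c := e)) (pend (tL(ns := c)) (tM(ns := Suc c)) (tR(ns := e)) (Suc ns) ns 0 0)"
      using ok sd' en' c st by (auto simp: state_ok_def le_Suc_eq)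
  }
qed

lemma task_end:
  assumes "state_ok d P st tL tM tR ns en (pend tL tM tR ns t y 0)" "tR t \<le> y"
  shows "state_ok d P st tL tM tR ns en (pend tL tM tR ns (Suc t) 0 0)"
proof (rule state_ok_mono[OF assms(1)], intro disjI2)
  fix y' i j assume "pend tL tM tR ns t y 0 y' i j"
  moreover have "\<not> (opposite tL tM tR t y' i \<and> (y < y' \<or> y' = y))"
    using assms(2) by (auto simp: opposite_def)
  ultimately obtain k where k: "t < k" "k < ns" "opposite tL tM tR k y' i"
    unfolding pend_def by blast
  then consider "k = Suc t" | "Suc t < k" by linarith
  then show "pend tL tM tR ns (Suc t) 0 0 y' i j"
    using k by cases (auto simp: pend_def)
qed

lemma task_begin:
  assumes "state_ok d P st tL tM tR ns en (pend tL tM tR ns t 0 0)"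
  shows "state_ok d P st tL tM tR ns en (pend tL tM tR ns t (tL t) 0)"
proof (rule state_ok_mono[OF assms], intro disjI2)
  fix y' i j assume H: "pend tL tM tR ns t 0 0 y' i j"
  then show "pend tL tM tR ns t (tL t) 0 y' i j"
  proof (cases "\<exists>k. t < k \<and> k < ns \<and> opposite tL tM tR k y' i")
    case False
    then have "t < ns" "opposite tL tM tR t y' i" using H by (auto simp: pend_def)
    moreover have "tL t \<le> y'" using calculation(2) by (auto simp: opposite_def)
    ultimately show ?thesis by (auto simp: pend_def)
  qed (auto simp: pend_def)
qed

lemma no_pending:
  assumes "state_ok d P st tL tM tR ns en (pend tL tM tR ns ns y q)"
  shows "state_ok d P st tL tM tR ns en (\<lambda>_ _ _. False)"
  by (rule state_ok_mono[OF assms]) (auto simp: pend_def)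

text \<open>The first position \<open>lo\<close> of the opposite side starts a class. Two distinct
  positions of one class cannot both be \<open>lo\<close>, so the scan may begin at
  \<open>Suc lo\<close> with \<open>lo\<close> as reference.\<close>

lemma pivot_begin:
  assumes ok: "state_ok d P st tL tM tR ns en (pend tL tM tR ns t y 0)"
    and y: "tL t \<le> y" "y < tR t" and lo: "lo = (if y < tM t then tM t else tL t)"
  shows "state_ok d P st tL tM tR ns en (pend tL tM tR ns t y (Suc lo))"
proof (rule state_ok_mono[OF ok])
  fix y' i j assume H: "pend tL tM tR ns t y 0 y' i j" "same_class st i j"
  show "mt (P y') (P i) = mt (P y') (P j) \<or> pend tL tM tR ns t y (Suc lo) y' i j"
  proof (cases "(\<exists>k. t < k \<and> k < ns \<and> opposite tL tM tR k y' i) \<or> y' \<noteq> y")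
    case True
    then show ?thesis using H by (auto simp: pend_def)
  next
    case False
    then have op: "t < ns" "opposite tL tM tR t y i" "y' = y" using H by (auto simp: pend_def)
    then have b: "st (tM t) \<noteq> 0" "st (tL t) \<noteq> 0" using ok by (auto simp: state_ok_def tasks_wf_def)
    have "lo \<le> i" using op(2) lo y by (auto simp: opposite_def split: if_splits)
    moreover have "lo \<le> j"
      using same_class_boundary[OF H(2)] b calculation lo by (auto split: if_splits)
    ultimately show ?thesis
      using op by (cases "i = j") (auto simp: pend_def)
  qed
qed

lemma pivot_end:
  assumes ok: "state_ok d P st tL tM tR ns en (pend tL tM tR ns t y hi)" and t: "t < ns"
    and hi: "hi = (if y < tM t then tR t else tM t)"
  shows "state_ok d P st tL tM tR ns en (pend tL tM tR ns t (Suc y) 0)"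
proof (rule state_ok_mono[OF ok])
  fix y' i j assume H: "pend tL tM tR ns t y hi y' i j" "same_class st i j"
  have b: "st hi \<noteq> 0" using ok t hi by (auto simp: state_ok_def tasks_wf_def)
  show "mt (P y') (P i) = mt (P y') (P j) \<or> pend tL tM tR ns t (Suc y) 0 y' i j"
  proof (cases "(\<exists>k. t < k \<and> k < ns \<and> opposite tL tM tR k y' i) \<or> y < y'")
    case True
    then show ?thesis using H by (auto simp: pend_def Suc_le_eq le_less)
  next
    case False
    then have op: "opposite tL tM tR t y i" "hi \<le> i \<or> hi \<le> j" "y' = y" using H by (auto simp: pend_def)
    then have "hi \<le> i" using same_class_boundary[OF H(2) b] by blast
    then have False using op(1) hi by (auto simp: opposite_def split: if_splits)
    then show ?thesis ..
  qed
qed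

text \<open>\<open>scan_ok\<close>: the pivot at position \<open>y\<close> does not split the part of its opposite side scanned so far,
  and \<open>a\<close> is the start of the class of the last scanned position.\<close>

definition scan_ok where
  "scan_ok P st tL tM tR t y a q hi \<longleftrightarrow> tL t \<le> y \<and> y < tR t \<and> (if y < tM t then tM t else tL t) \<le> a \<and> a < q \<and> q \<le> hi \<and>
     hi = (if y < tM t then tR t else tM t) \<and> st a \<noteq> 0 \<and> (\<forall>i. a < i \<longrightarrow> i < q \<longrightarrow> st i = 0) \<and>
     (\<forall>i. a \<le> i \<longrightarrow> i < q \<longrightarrow> mt (P y) (P i) = mt (P y) (P a))"

lemma scan_step:
  assumes ok: "state_ok d P st tL tM tR ns en (pend tL tM tR ns t y q)"
    and sc: "scan_ok P st tL tM tR t y a q hi" "q < hi"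
    and eq: "st q = 0 \<Longrightarrow> mt (P y) (P q) = mt (P y) (P a)"
  shows "state_ok d P st tL tM tR ns en (pend tL tM tR ns t y (Suc q))"
    "scan_ok P st tL tM tR t y (if st q = 0 then a else q) (Suc q) hi"
proof -
  have loc: "mt (P y) (P i) = mt (P y) (P q)" if "same_class st i q" "i < q" for i
  proof -
    have q0: "st q = 0" using that by (auto simp: same_class_le)
    have a: "a < q" "st a \<noteq> 0" "\<And>i. a \<le> i \<Longrightarrow> i < q \<Longrightarrow> mt (P y) (P i) = mt (P y) (P a)"
      using sc(1) unfolding scan_ok_def by blast+
    have "a \<le> i" using same_class_boundary[OF that(1) a(2)] a(1) by simp
    then show ?thesis using a(3)[of i] eq[OF q0] that(2) by simp
  qed
  show "state_ok d P st tL tM tR ns en (pend tL tM tR ns t y (Suc q))"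
  proof (rule state_ok_mono[OF ok])
    fix y' i j assume H: "pend tL tM tR ns t y q y' i j" "same_class st i j"
    show "mt (P y') (P i) = mt (P y') (P j) \<or> pend tL tM tR ns t y (Suc q) y' i j"
    proof (cases "pend tL tM tR ns t y (Suc q) y' i j")
      case False
      then have "y' = y" "i = q \<or> j = q" "i \<le> q" "j \<le> q"
        using H by (auto simp: pend_def not_less_eq_eq)
      then show ?thesis
        using loc[of i] loc[of j] H(2) same_class_sym[of st i j] by (cases "i = j") auto
    qed simp
  qed
  show "scan_ok P st tL tM tR t y (if st q = 0 then a else q) (Suc q) hi"
  proof (cases "st q = 0")
    case True
    have "\<forall>i. a < i \<longrightarrow> i < Suc q \<longrightarrow> st i = 0" using sc(1) True by (simp add: scan_ok_def less_Suc_eq)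
    moreover have "\<forall>i. a \<le> i \<longrightarrow> i < Suc q \<longrightarrow> mt (P y) (P i) = mt (P y) (P a)"
    proof (intro allI impI)
      fix i assume "a \<le> i" "i < Suc q"
      then show "mt (P y) (P i) = mt (P y) (P a)"
        using sc(1) eq[OF True] unfolding scan_ok_def by (metis less_SucE)
    qed
    moreover have "a < Suc q" "Suc q \<le> hi" using sc unfolding scan_ok_def by linarith+
    ultimately show ?thesis using sc(1) unfolding scan_ok_def if_P[OF True] by blast
  next
    case False
    have "(if y < tM t then tM t else tL t) \<le> q" "q < Suc q" "Suc q \<le> hi"
      using sc unfolding scan_ok_def by linarith+
    moreover have "\<forall>i. q < i \<longrightarrow> i < Suc q \<longrightarrow> st i = 0" by simp
    moreover have "\<forall>i. q \<le> i \<longrightarrow> i < Suc q \<longrightarrow> mt (P y) (P i) = mt (P y) (P q)"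
      by (metis le_less_Suc_eq)
    ultimately show ?thesis using sc(1) False unfolding scan_ok_def if_not_P[OF False] by blast
  qed
qed

text \<open>The permutation stays inside one class. Boundaries, tasks and recorded blocks are
  insensitive to it, which carries over everything known before; what is new is the boundary
  \<open>m\<close> and the task for the pairs that it separates. The entries from \<open>m\<close>
  on need not be equal to each other; later positions of the scan deal with that.\<close>

lemma split_step:
  assumes ok: "state_ok d P st tL tM tR ns en (pend tL tM tR ns t y q)" and t: "t < ns"
    and sc: "scan_ok P st tL tM tR t y a q hi" "q < hi"
    and e: "q \<le> m" "m < e" "e \<le> n" "st e \<noteq> 0" "\<And>i. q \<le> i \<Longrightarrow> i < e \<Longrightarrow> st i = 0"
    and tau: "\<tau> permutes {q..<e}" and P': "P' = P \<circ> \<tau>"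
    and eqs: "\<And>i. q \<le> i \<Longrightarrow> i < m \<Longrightarrow> mt (P' y) (P' i) = mt (P' y) (P' a)"
    and neqs: "\<And>i. m \<le> i \<Longrightarrow> i < e \<Longrightarrow> mt (P' y) (P' i) \<noteq> mt (P' y) (P' a)"
  defines "st' \<equiv> st(m := Suc 0)" and "tL' \<equiv> tL(ns := a)" and "tM' \<equiv> tM(ns := m)" and "tR' \<equiv> tR(ns := e)"
  shows "state_ok d P' st' tL' tM' tR' (Suc ns) en (pend tL' tM' tR' (Suc ns) t y q)"
    "scan_ok P' st' tL' tM' tR' t y a q hi"
    "st' q = 0 \<Longrightarrow> mt (P' y) (P' q) = mt (P' y) (P' a)"
proof -
  have bij: "bij_betw P {..<n} {..<n}" and mic: "modules_in_classes d P st" and sd: "stages_done d P en"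
    and rf: "refined P st (pend tL tM tR ns t y q)" and wf: "tasks_wf n st tL tM tR ns"
    and std: "\<And>i. i \<le> d \<Longrightarrow> st i \<noteq> 0" "d \<le> n" "st n \<noteq> 0" and en: "\<And>c. c < d \<Longrightarrow> st (en c) \<noteq> 0"
    using ok by (auto simp: state_ok_def)
  have a: "a < q" "st a \<noteq> 0" "\<And>i. a < i \<Longrightarrow> i < e \<Longrightarrow> st i = 0" "a < e"
  proof -
    fix i assume "a < i" "i < e"
    then show "st i = 0" using sc(1) e(5)[of i] by (cases "i < q") (auto simp: scan_ok_def)
  qed (use sc e in \<open>auto simp: scan_ok_def\<close>)
  note cls = class_interval[OF a(2) e(4) a(4,3)]
  have sthi: "st hi \<noteq> 0" using sc(1) wf t by (auto simp: scan_ok_def tasks_wf_def)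
  \<comment> \<open>There is no boundary from \<open>q\<close> to \<open>e - 1\<close>, whereas
    \<open>hi\<close> is one.\<close>
  have e_hi: "e \<le> hi"
  proof (rule ccontr)
    assume "\<not> e \<le> hi"
    then show False using e(5)[of hi] sc sthi by auto
  qed
  have m: "a < m" "m < n" "st m = 0" "m \<noteq> 0" using a e by auto
  have y: "y < n" "y \<notin> {a..<e}"
    using sc(1) wf t e_hi unfolding scan_ok_def tasks_wf_def by (auto split: if_splits dest!: spec[of _ t])
  have tau_out: "\<tau> i = i" if "i \<notin> {q..<e}" for i using tau that by (simp add: permutes_def)
  have tau_in: "q \<le> \<tau> i \<and> \<tau> i < e \<longleftrightarrow> q \<le> i \<and> i < e" for i
    using permutes_in_image[OF tau, of i] by simp
  have tau_n: "\<tau> i < n \<longleftrightarrow> i < n" for i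
    using tau_in[of i] tau_out[of i] e(3) by (cases "i \<in> {q..<e}") auto
  have tau_cls: "same_class st (\<tau> i) i" for i
  proof (cases "i \<in> {q..<e}")
    case True
    then show ?thesis using tau_in[of i] cls[of "\<tau> i" i] a(1) by auto
  qed (simp add: tau_out)
  have tau_b: "b \<le> \<tau> i \<longleftrightarrow> b \<le> i" if "st b \<noteq> 0" for b i
    using same_class_boundary[OF tau_cls that] .
  have tau_sc: "same_class st (\<tau> i) (\<tau> j) \<longleftrightarrow> same_class st i j" for i j
    using tau_cls same_class_trans same_class_sym by metis
  have tau_opp: "opposite tL tM tR k (\<tau> y') (\<tau> i) \<longleftrightarrow> opposite tL tM tR k y' i" if "k < ns" for k y' i
  proof -
    have "st (tL k) \<noteq> 0" "st (tM k) \<noteq> 0" "st (tR k) \<noteq> 0" using wf that by (auto simp: tasks_wf_def)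
    from tau_b[OF this(1)] tau_b[OF this(2)] tau_b[OF this(3)] show ?thesis
      unfolding opposite_def not_le[symmetric] by simp
  qed
  have Py: "P' y = P y" "P' a = P a" using tau_out[of y] tau_out[of a] y a by (auto simp: P')
  note split = same_class_split[of st, OF m(3)]
  have "{q..<e} \<subseteq> {..<n}" using e(3) by auto
  then have bijt: "bij_betw \<tau> {..<n} {..<n}"
    using permutes_subset[OF tau] permutes_imp_bij by blast
  have 1: "bij_betw P' {..<n} {..<n}" unfolding P' using bijt bij by (rule bij_betw_trans)
  have opp': "opposite tL' tM' tR' k y' i \<longleftrightarrow> opposite tL tM tR k y' i" if "k < ns" for k y' i
    using that by (simp add: opposite_def tL'_def tM'_def tR'_def)
  have oppn: "opposite tL' tM' tR' ns y' i \<longleftrightarrow> a \<le> y' \<and> y' < m \<and> m \<le> i \<and> i < e \<or> a \<le> i \<and> i < m \<and> m \<le> y' \<and> y' < e" for y' i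
    by (simp add: opposite_def tL'_def tM'_def tR'_def)
  have 2: "refined P' st' (pend tL' tM' tR' (Suc ns) t y q)"
    unfolding refined_def
  proof (intro allI impI)
    fix y' i j assume yij: "y' < n" "i < n" "j < n" "same_class st' i j" "\<not> same_class st' y' i"
    then have ij: "same_class st i j" by (simp add: split st'_def)
    show "mt (P' y') (P' i) = mt (P' y') (P' j) \<or> pend tL' tM' tR' (Suc ns) t y q y' i j"
    proof (cases "same_class st y' i")
      \<comment> \<open>\<open>y'\<close> and \<open>i\<close> shared a class until now, so the new
        boundary separates them, and the new task has the pair pending.\<close>
      case True
      then have d: "m \<le> y' \<longleftrightarrow> \<not> m \<le> i" using yij by (auto simp: split st'_def)
      have "a \<le> y' \<longleftrightarrow> a \<le> i" "e \<le> y' \<longleftrightarrow> e \<le> i"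
        using same_class_boundary[OF True] a(2) e(4) by blast+
      then have "opposite tL' tM' tR' ns y' i" using d m e unfolding oppn by linarith
      then show ?thesis using t by (auto simp: pend_def)
    next
      case False
      then have "\<not> same_class st (\<tau> y') (\<tau> i)" "same_class st (\<tau> i) (\<tau> j)" using ij tau_sc by auto
      then consider "mt (P (\<tau> y')) (P (\<tau> i)) = mt (P (\<tau> y')) (P (\<tau> j))" | "pend tL tM tR ns t y q (\<tau> y') (\<tau> i) (\<tau> j)"
        using rf yij tau_n unfolding refined_def by blast
      then show ?thesis
      proof cases
        case 1
        then show ?thesis by (simp add: P')
      next
        case 2
        then consider k where "t < k" "k < ns" "opposite tL tM tR k (\<tau> y') (\<tau> i)"
          | "opposite tL tM tR t (\<tau> y') (\<tau> i)" "y < \<tau> y' \<or> \<tau> y' = y \<and> (q \<le> \<tau> i \<or> q \<le> \<tau> j)"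
          by (auto simp: pend_def)
        then show ?thesis
        proof cases
          case 1
          then have "opposite tL' tM' tR' k y' i" "t < k" "k < Suc ns" using tau_opp opp' by auto
          then show ?thesis unfolding pend_def by blast
        next
          case 2
          have "opposite tL' tM' tR' t y' i" using tau_opp[OF t] opp'[OF t] 2(1) by simp
          \<comment> \<open>The pivot lies outside the permuted range, so no position is moved
            across it and a pivot that comes later still comes later.\<close>
          moreover have "y < y' \<or> y' = y \<and> (q \<le> i \<or> q \<le> j)"
          proof -
            have q: "q \<le> \<tau> x \<Longrightarrow> q \<le> x" for x using tau_in[of x] tau_out[of x] by (cases "x \<in> {q..<e}") auto
            show ?thesis
            proof (cases "y' \<in> {q..<e}")
              case True
              then have ty': "q \<le> \<tau> y'" "\<tau> y' < e" using tau_in[of y'] by auto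
              have "y < q"
              proof (rule ccontr)
                assume "\<not> y < q"
                then have "e \<le> y" using y(2) a(1) by auto
                then show False using 2(2) ty' by auto
              qed
              then show ?thesis using True by auto
            next
              case False
              show ?thesis using 2(2) q unfolding tau_out[OF False] by blast
            qed
          qed
          ultimately show ?thesis using t unfolding pend_def by auto
        qed
      qed
    qed
  qed
  have 3: "modules_in_classes d P' st'"
    unfolding modules_in_classes_def
  proof (intro allI impI)
    fix S i j assume S: "md S" "\<forall>i<n. P' i \<in> S \<longrightarrow> d \<le> i" and ij: "i < n" "j < n" "P' i \<in> S" "P' j \<in> S"
    have pos: "d \<le> k" if "k < n" "P k \<in> S" for k
    proof -
      have "k \<in> \<tau> ` {..<n}" using bijt that(1) by (simp add: bij_betw_def)
      then obtain l where l: "l < n" "\<tau> l = k" by blast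
      then have "d \<le> l" using S(2) that(2) by (auto simp: P')
      then show ?thesis using tau_b[OF std(1)[OF order_refl]] l by auto
    qed
    have sc_all: "same_class st k l" if "k < n" "l < n" "P' k \<in> S" "P' l \<in> S" for k l
    proof -
      have "same_class st (\<tau> k) (\<tau> l)"
        using mic S(1) pos that tau_n unfolding modules_in_classes_def P' comp_def by blast
      then show ?thesis using tau_sc by simp
    qed
    have ij_st: "same_class st i j" using sc_all ij by blast
    show "same_class st' i j"
    proof (cases "i \<in> {a..<e}")
      case False
      have "a \<le> i \<longleftrightarrow> a \<le> j" "e \<le> i \<longleftrightarrow> e \<le> j" using same_class_boundary[OF ij_st] a(2) e(4) by blast+
      then have "m \<le> i \<longleftrightarrow> m \<le> j" using False m e by auto
      then show ?thesis using ij_st by (simp add: split st'_def)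
    next
      case True
      then have ji: "j \<in> {a..<e}" using cls[of i j] ij_st by auto
      \<comment> \<open>\<open>S\<close> stays inside the class that is being split, and the pivot
        lies outside this class. Being outside the module, the pivot sees one value on all of
        \<open>S\<close>, so \<open>S\<close> falls on one side of \<open>m\<close>.\<close>
      have "P' y \<notin> S"
      proof
        assume "P' y \<in> S"
        then have "same_class st i y" using sc_all ij y by blast
        then show False using cls[of i y] True y by auto
      qed
      moreover have "P' y \<in> {..<n}" using bij_betwE[OF 1] y(1) by blast
      ultimately have same: "mt (P' y) (P' i) = mt (P' y) (P' j)"
        using mdD[OF S(1)] ij(3,4) by blast
      have val: "mt (P' y) (P' k) = mt (P' y) (P' a) \<longleftrightarrow> k < m" if "k \<in> {a..<e}" for k
      proof (cases "k < q")
        case True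
        then have "P' k = P k" using tau_out[of k] by (simp add: P')
        moreover have "mt (P y) (P k) = mt (P y) (P a)"
          using sc(1) True that unfolding scan_ok_def by (meson atLeastLessThan_iff)
        ultimately show ?thesis using True e(1) Py by simp
      next
        case False
        then show ?thesis using eqs[of k] neqs[of k] that by (cases "k < m") auto
      qed
      have "m \<le> i \<longleftrightarrow> m \<le> j" using val[OF True] val[OF ji] same by auto
      then show ?thesis using ij_st by (simp add: split st'_def)
    qed
  qed
  have 4: "stages_done d P' en"
    unfolding stages_done_def stage_done_def
  proof (intro allI impI conjI)
    fix c assume c: "c < d"
    then have "stage_done c P (en c)" using sd by (simp add: stages_done_def)
    then have sdc: "c < en c" "en c \<le> n" "md (P ` {c..<en c})"
      "\<And>S i. md S \<Longrightarrow> P c \<in> S \<Longrightarrow> \<forall>i<n. P i \<in> S \<longrightarrow> c \<le> i \<Longrightarrow> i < n \<Longrightarrow> P i \<in> S \<Longrightarrow> i < en c"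
      unfolding stage_done_def by blast+
    have stc: "st c \<noteq> 0" "st (Suc c) \<noteq> 0" "st (en c) \<noteq> 0" using std(1) c en by auto
    have tc: "\<tau> c = c" using tau_b[OF stc(1), of c] tau_b[OF stc(2), of c] by auto
    show "c < en c" "en c \<le> n" by fact+
    have "\<tau> ` {c..<en c} = {c..<en c}"
    proof -
      have "\<tau> i \<in> {c..<en c} \<longleftrightarrow> i \<in> {c..<en c}" for i
        using tau_b[OF stc(1), of i] tau_b[OF stc(3), of i] by auto
      moreover have "surj \<tau>" using permutes_bij[OF tau] bij_is_surj by blast
      ultimately show ?thesis 
      proof (intro equalityI subsetI)
        fix j assume "j \<in> {c..<en c}"
        moreover obtain i where "j = \<tau> i" using \<open>surj \<tau>\<close> by (rule surjE)
        ultimately show "j \<in> \<tau> ` {c..<en c}" using \<open>\<And>i. \<tau> i \<in> {c..<en c} \<longleftrightarrow> i \<in> {c..<en c}\<close> by blast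
      qed blast
    qed
    then show "md (P' ` {c..<en c})" using sdc(3) unfolding P' image_comp[symmetric] by (simp only:)
    fix S i assume S: "md S" "P' c \<in> S" "\<forall>i<n. P' i \<in> S \<longrightarrow> c \<le> i" "i < n" "P' i \<in> S"
    have pos: "c \<le> k" if "k < n" "P k \<in> S" for k
    proof -
      have "k \<in> \<tau> ` {..<n}" using bijt that(1) by (simp add: bij_betw_def)
      then obtain l where l: "l < n" "\<tau> l = k" by blast
      then have "c \<le> l" using S(3) that(2) by (auto simp: P')
      then show ?thesis using tau_b[OF stc(1)] l by auto
    qed
    have "\<tau> i < en c"
      by (rule sdc(4)[OF S(1)]) (use S tc pos tau_n in \<open>auto simp: P'\<close>)
    then show "i < en c" using tau_b[OF stc(3), of i] by (simp add: not_le[symmetric])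
  qed
  have "tasks_wf n st' tL' tM' tR' (Suc ns)"
    using wf m e a unfolding tasks_wf_def st'_def tL'_def tM'_def tR'_def by (auto simp: less_Suc_eq)
  then show "state_ok d P' st' tL' tM' tR' (Suc ns) en (pend tL' tM' tR' (Suc ns) t y q)"
    using 1 2 3 4 std en unfolding state_ok_def st'_def by simp
  have old: "tL' t = tL t" "tM' t = tM t" "tR' t = tR t" using t by (simp_all add: tL'_def tM'_def tR'_def)
  have low: "P' i = P i" if "i < q" for i using tau_out[of i] that by (simp add: P')
  show "scan_ok P' st' tL' tM' tR' t y a q hi"
    unfolding scan_ok_def old
  proof (intro conjI allI impI)
    show "st' a \<noteq> 0" using a(2) by (simp add: st'_def)
    show "st' i = 0" if "a < i" "i < q" for i
      using that sc(1) e(1) unfolding scan_ok_def by (simp add: st'_def)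
    show "mt (P' y) (P' i) = mt (P' y) (P' a)" if "a \<le> i" "i < q" for i
      using that sc(1) unfolding scan_ok_def low[OF that(2)] Py by blast
  qed (use sc(1) in \<open>unfold scan_ok_def, blast+\<close>)
  show "st' q = 0 \<Longrightarrow> mt (P' y) (P' q) = mt (P' y) (P' a)"
    using eqs[of q] e(1) by (cases "q = m") (auto simp: st'_def)
qed

end

section \<open>Counting the pairs not yet separated\<close>

definition linked_pairs :: "nat \<Rightarrow> (nat \<Rightarrow> nat) \<Rightarrow> nat" where
  "linked_pairs n st = card {(i, j). i < j \<and> j < n \<and> same_class st i j}"

definition unsplit :: "nat \<Rightarrow> (nat \<Rightarrow> nat) \<Rightarrow> nat" where
  "unsplit n st = card {q. 0 < q \<and> q < n \<and> st q = 0}"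

lemma linked_pairs_le: "linked_pairs n st \<le> n * n"
proof -
  have "linked_pairs n st \<le> card ({..<n} \<times> {..<n})"
    unfolding linked_pairs_def by (rule card_mono) auto
  then show ?thesis by simp
qed

lemma unsplit_le: "unsplit n st \<le> n"
proof -
  have "unsplit n st \<le> card {..<n}" unfolding unsplit_def by (rule card_mono) auto
  then show ?thesis by simp
qed

lemma unsplit_upd:
  assumes "0 < m" "m < n" "st m = 0"
  shows "unsplit n st = Suc (unsplit n (st(m := Suc 0)))"
proof -
  have "{q. 0 < q \<and> q < n \<and> st q = 0} = insert m {q. 0 < q \<and> q < n \<and> (st(m := Suc 0)) q = 0}"
    using assms by auto
  then show ?thesis unfolding unsplit_def by simp
qed

text \<open>The pairs in \<open>{a..<m} \<times> {m..<e}\<close> are linked before the split and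
  separated after it. Their number is the number of comparisons, up to a factor two, that the new
  task will make.\<close>

lemma linked_pairs_upd:
  assumes "a < m" "m < e" "e \<le> n" and z: "\<And>i. a < i \<Longrightarrow> i < e \<Longrightarrow> st i = 0"
  shows "linked_pairs n (st(m := Suc 0)) + (m - a) * (e - m) \<le> linked_pairs n st"
proof -
  let ?A = "{(i, j). i < j \<and> j < n \<and> same_class (st(m := Suc 0)) i j}" and ?B = "{a..<m} \<times> {m..<e}"
    and ?C = "{(i, j). i < j \<and> j < n \<and> same_class st i j}"
  note split = same_class_split[of st m, OF z[OF assms(1,2)]]
  have fin: "finite ?C" by (rule finite_subset[of _ "{..<n} \<times> {..<n}"]) auto
  have "?A \<subseteq> ?C" by (auto simp: split)
  moreover have "?B \<subseteq> ?C" using assms(3) z by (auto simp: same_class_le)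
  moreover have "?A \<inter> ?B = {}" by (auto simp: split)
  ultimately have "card ?A + card ?B \<le> card ?C"
    using fin by (metis (no_types, lifting) card_Un_disjoint card_mono finite_subset le_sup_iff)
  then show ?thesis by (simp add: linked_pairs_def)
qed

section \<open>Time-bounded weakest preconditions\<close>

text \<open>\<open>wp B c Q g s\<close>: with \<open>g\<close> units of time left, \<open>c\<close> halts from \<open>s\<close> in a state that satisfies \<open>Q\<close>
  together with the time left then. A negative amount means that the budget was exceeded.\<close>

definition wp :: "nat \<Rightarrow> com \<Rightarrow> (int \<Rightarrow> store \<Rightarrow> bool) \<Rightarrow> int \<Rightarrow> store \<Rightarrow> bool" where
  "wp B c Q g s \<longleftrightarrow> (\<exists>k s'. exec B c s k s' \<and> Q (g - int k) s')"

lemma wpI: "exec B c s k s' \<Longrightarrow> Q (g - int k) s' \<Longrightarrow> wp B c Q g s"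
  unfolding wp_def by blast

lemma wp_Skip: "Q (g - 1) s \<Longrightarrow> wp B Skip Q g s"
  by (rule wpI[OF exec.Skip]) simp

lemma wp_Assign:
  "afits B e s \<Longrightarrow> Q (g - 1 - int (acost e)) ((fst s)(v := aval e s), snd s) \<Longrightarrow> wp B (Assign v e) Q g s"
  by (rule wpI[OF exec.Assign]) (simp_all add: algebra_simps)

lemma wp_Write:
  "afits B e s \<Longrightarrow> afits B f s \<Longrightarrow>
   Q (g - 1 - int (acost e) - int (acost f)) (fst s, (snd s)(a := (snd s a)(aval e s := aval f s))) \<Longrightarrow>
   wp B (Write a e f) Q g s"
  by (rule wpI[OF exec.Write]) (simp_all add: algebra_simps)

lemma wp_Seq:
  assumes "wp B c (wp B d Q) (g - 1) s"
  shows "wp B (Seq c d) Q g s"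
proof -
  obtain k s' l s'' where "exec B c s k s'" "exec B d s' l s''" "Q (g - 1 - int k - int l) s''"
    using assms unfolding wp_def by blast
  then show ?thesis by (intro wpI[OF exec.Seq]) (auto simp: algebra_simps)
qed

lemma wp_Cond:
  assumes "bfits B b s" "bval b s \<Longrightarrow> wp B c Q (g - 1 - int (bcost b)) s"
    "\<not> bval b s \<Longrightarrow> wp B d Q (g - 1 - int (bcost b)) s"
  shows "wp B (Cond b c d) Q g s"
proof (cases "bval b s")
  case True
  then obtain k s' where "exec B c s k s'" "Q (g - 1 - int (bcost b) - int k) s'"
    using assms(2) unfolding wp_def by blast
  then show ?thesis using True assms(1) by (intro wpI[OF exec.CondTrue]) (auto simp: algebra_simps)
next
  case False
  then obtain k s' where "exec B d s k s'" "Q (g - 1 - int (bcost b) - int k) s'"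
    using assms(3) unfolding wp_def by blast
  then show ?thesis using False assms(1) by (intro wpI[OF exec.CondFalse]) (auto simp: algebra_simps)
qed

text \<open>The remaining time doubles as the termination measure.\<close>

lemma wp_While:
  assumes I: "I g s"
    and fits: "\<And>g s. I g s \<Longrightarrow> 0 \<le> g \<and> bfits B b s"
    and body: "\<And>g s. I g s \<Longrightarrow> bval b s \<Longrightarrow> wp B c I (g - 1 - int (bcost b)) s"
    and exit: "\<And>g s. I g s \<Longrightarrow> \<not> bval b s \<Longrightarrow> Q (g - 1 - int (bcost b)) s"
  shows "wp B (While b c) Q g s"
  using I
proof (induction "nat g" arbitrary: g s rule: less_induct)
  case less
  have g: "0 \<le> g" "bfits B b s" using fits[OF less.prems] by auto
  show ?case
  proof (cases "bval b s")
    case False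
    then have "exec B (While b c) s (1 + bcost b) s" by (intro exec.WhileFalse g)
    moreover have "Q (g - int (1 + bcost b)) s" using exit[OF less.prems False] by (simp add: algebra_simps)
    ultimately show ?thesis unfolding wp_def by blast
  next
    case True
    obtain k s' where k: "exec B c s k s'" "I (g - 1 - int (bcost b) - int k) s'"
      using body[OF less.prems True] unfolding wp_def by blast
    define g' where "g' = g - 1 - int (bcost b) - int k"
    have "0 \<le> g'" using fits[OF k(2)] by (simp add: g'_def)
    then have "nat g' < nat g" by (simp add: g'_def)
    then obtain l s'' where "exec B (While b c) s' l s''" "Q (g' - int l) s''"
      using less.hyps[of g' s'] k(2) unfolding wp_def g'_def by blast
    then show ?thesis
      using g(2) True k(1) by (intro wpI[OF exec.WhileTrue]) (auto simp: g'_def algebra_simps)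
  qed
qed

text \<open>Stated as equivalences, these rules let the simplifier execute straight-line code
  symbolically, together with its word-size conditions and its exact cost.\<close>

lemma wp_simps:
  "wp B Skip Q g s \<longleftrightarrow> Q (g - 1) s"
  "wp B (Assign v e) Q g s \<longleftrightarrow> afits B e s \<and> Q (g - 1 - int (acost e)) ((fst s)(v := aval e s), snd s)"
  "wp B (Write a e f) Q g s \<longleftrightarrow> afits B e s \<and> afits B f s \<and>
    Q (g - 1 - int (acost e) - int (acost f)) (fst s, (snd s)(a := (snd s a)(aval e s := aval f s)))"
  "wp B (Seq c d) Q g s \<longleftrightarrow> wp B c (wp B d Q) (g - 1) s"
  "wp B (Cond b c d) Q g s \<longleftrightarrow> bfits B b s \<and>
    (if bval b s then wp B c Q (g - 1 - int (bcost b)) s else wp B d Q (g - 1 - int (bcost b)) s)"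
proof -
  show "wp B Skip Q g s \<longleftrightarrow> Q (g - 1) s"
    (is "?L \<longleftrightarrow> ?R")
  proof
    show "?L \<Longrightarrow> ?R" unfolding wp_def by (auto elim!: exec_SkipE)
  qed (rule wp_Skip)
  show "wp B (Assign v e) Q g s \<longleftrightarrow> afits B e s \<and> Q (g - 1 - int (acost e)) ((fst s)(v := aval e s), snd s)"
    (is "?L \<longleftrightarrow> ?R")
  proof
    show "?L \<Longrightarrow> ?R" unfolding wp_def by (auto elim!: exec_AssignE simp: algebra_simps)
  qed (auto intro: wp_Assign)
  show "wp B (Write a e f) Q g s \<longleftrightarrow> afits B e s \<and> afits B f s \<and>
    Q (g - 1 - int (acost e) - int (acost f)) (fst s, (snd s)(a := (snd s a)(aval e s := aval f s)))"
    (is "?L \<longleftrightarrow> ?R")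
  proof
    show "?L \<Longrightarrow> ?R" unfolding wp_def by (auto elim!: exec_WriteE simp: algebra_simps)
  qed (auto intro: wp_Write)
  show "wp B (Seq c d) Q g s \<longleftrightarrow> wp B c (wp B d Q) (g - 1) s" (is "?L \<longleftrightarrow> ?R")
  proof
    assume ?L
    then obtain k s' where "exec B (Seq c d) s k s'" "Q (g - int k) s'" unfolding wp_def by blast
    then obtain k1 s1 k2 where "k = 1 + k1 + k2" "exec B c s k1 s1" "exec B d s1 k2 s'"
      by (auto elim: exec_SeqE)
    moreover have "Q (g - 1 - int k1 - int k2) s'"
      using \<open>Q (g - int k) s'\<close> \<open>k = 1 + k1 + k2\<close> by (simp add: algebra_simps)
    ultimately show ?R unfolding wp_def by blast
  qed (rule wp_Seq)
  show "wp B (Cond b c d) Q g s \<longleftrightarrow> bfits B b s \<and>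
    (if bval b s then wp B c Q (g - 1 - int (bcost b)) s else wp B d Q (g - 1 - int (bcost b)) s)"
    (is "?L \<longleftrightarrow> ?R")
  proof
    assume ?L
    then obtain k s' where ks: "exec B (Cond b c d) s k s'" "Q (g - int k) s'" unfolding wp_def by blast
    from ks(1) show ?R
    proof (rule exec_CondE)
      fix k1 assume "k = Suc (bcost b + k1)" "bfits B b s" "bval b s" "exec B c s k1 s'"
      moreover have "Q (g - 1 - int (bcost b) - int k1) s'"
        using ks(2) \<open>k = Suc (bcost b + k1)\<close> by (simp add: algebra_simps)
      ultimately show ?R using wpI[where Q = Q] by simp
    next
      fix k1 assume "k = Suc (bcost b + k1)" "bfits B b s" "\<not> bval b s" "exec B d s k1 s'"
      moreover have "Q (g - 1 - int (bcost b) - int k1) s'"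
        using ks(2) \<open>k = Suc (bcost b + k1)\<close> by (simp add: algebra_simps)
      ultimately show ?R using wpI[where Q = Q] by simp
    qed
  qed (auto intro!: wp_Cond)
qed

section \<open>The refinement program\<close>

abbreviation seq :: "com \<Rightarrow> com \<Rightarrow> com"  (infixr ";;" 60) where "c ;; d \<equiv> Seq c d"

text \<open>The programs think in positions; the matrix is given by indices, so both coordinates
  pass through the permutation \<open>p\<close>.\<close>

abbreviation Entry :: "aexp \<Rightarrow> aexp \<Rightarrow> aexp" where
  "Entry y x \<equiv> Read ''A'' (Plus (Times (Read ''p'' y) (Var ''n'')) (Read ''p'' x))"

abbreviation IVar :: "string \<Rightarrow> com" where
  "IVar v \<equiv> Assign v (Plus (Var v) (Const 1))"

text \<open>One-directional partitioning by swaps: \<open>m\<close> ends the entries that agree with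
  the reference \<open>a\<close>, and \<open>b\<close> runs ahead to the next boundary mark, which
  serves as a sentinel.\<close>

definition part_prog :: com where
  "part_prog = While (Eq (Read ''s'' (Var ''b'')) (Const 0))
    (Cond (Eq (Entry (Var ''y'') (Var ''b'')) (Entry (Var ''y'') (Var ''a'')))
       (Assign ''x'' (Read ''p'' (Var ''b'')) ;;
        Write ''p'' (Var ''b'') (Read ''p'' (Var ''m'')) ;;
        Write ''p'' (Var ''m'') (Var ''x'') ;;
        IVar ''m'')
       Skip ;;
     IVar ''b'')"

definition scan_prog :: com where
  "scan_prog = While (Less (Var ''q'') (Var ''h''))
    (Cond (Conj (Eq (Read ''s'' (Var ''q'')) (Const 0))
        (Neg (Eq (Entry (Var ''y'') (Var ''q'')) (Entry (Var ''y'') (Var ''a'')))))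
       (Assign ''m'' (Var ''q'') ;; Assign ''b'' (Var ''q'') ;; part_prog ;;
        Write ''s'' (Var ''m'') (Const 1) ;;
        Write ''L'' (Var ''k'') (Var ''a'') ;;
        Write ''M'' (Var ''k'') (Var ''m'') ;;
        Write ''R'' (Var ''k'') (Var ''b'') ;;
        IVar ''k'')
       Skip ;;
     Cond (Eq (Read ''s'' (Var ''q'')) (Const 0)) Skip (Assign ''a'' (Var ''q'')) ;;
     IVar ''q'')"

definition task_prog :: com where
  "task_prog = Assign ''y'' (Read ''L'' (Var ''t'')) ;;
    While (Less (Var ''y'') (Read ''R'' (Var ''t'')))
     (Cond (Less (Var ''y'') (Read ''M'' (Var ''t'')))
        (Assign ''a'' (Read ''M'' (Var ''t'')) ;; Assign ''h'' (Read ''R'' (Var ''t'')))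
        (Assign ''a'' (Read ''L'' (Var ''t'')) ;; Assign ''h'' (Read ''M'' (Var ''t''))) ;;
      Assign ''q'' (Plus (Var ''a'') (Const 1)) ;;
      scan_prog ;;
      IVar ''y'') ;;
    IVar ''t''"

text \<open>The tasks form a queue that is never shortened: \<open>t\<close> is the first open task
  and \<open>k\<close> the next free index, over all stages. The stage of \<open>c\<close> ends when
  the queue is exhausted.\<close>

definition stage_prog :: com where
  "stage_prog = Assign ''e'' (Plus (Var ''c'') (Const 1)) ;;
    While (Eq (Read ''s'' (Var ''e'')) (Const 0)) (IVar ''e'') ;;
    Write ''E'' (Var ''c'') (Var ''e'') ;;
    Cond (Less (Plus (Var ''c'') (Const 1)) (Var ''e''))
      (Write ''L'' (Var ''k'') (Var ''c'') ;;
       Write ''M'' (Var ''k'') (Plus (Var ''c'') (Const 1)) ;;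
       Write ''R'' (Var ''k'') (Var ''e'') ;;
       IVar ''k'' ;;
       Write ''s'' (Plus (Var ''c'') (Const 1)) (Const 1))
      Skip ;;
    While (Less (Var ''t'') (Var ''k'')) task_prog ;;
    IVar ''c''"

definition refine_prog :: com where
  "refine_prog = While (Less (Var ''c'') (Var ''n'')) (Write ''p'' (Var ''c'') (Var ''c'') ;; IVar ''c'') ;;
    Write ''s'' (Const 0) (Const 1) ;;
    Write ''s'' (Var ''n'') (Const 1) ;;
    Assign ''c'' (Const 0) ;;
    While (Less (Var ''c'') (Var ''n'')) stage_prog"

section \<open>Frames and word sizes\<close>

definition frame :: "string set \<Rightarrow> string set \<Rightarrow> store \<Rightarrow> store \<Rightarrow> bool" where
  "frame V W s s' \<longleftrightarrow> (\<forall>v. v \<notin> V \<longrightarrow> fst s' v = fst s v) \<and> (\<forall>w. w \<notin> W \<longrightarrow> snd s' w = snd s w)"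

lemma frame_refl: "frame V W s s" by (simp add: frame_def)

lemma frame_trans: "frame V W s s' \<Longrightarrow> frame V' W' s' s'' \<Longrightarrow> V \<subseteq> V'' \<Longrightarrow> V' \<subseteq> V'' \<Longrightarrow> W \<subseteq> W'' \<Longrightarrow> W' \<subseteq> W'' \<Longrightarrow> frame V'' W'' s s''"
  unfolding frame_def by (metis subsetD)

lemma frameD: "frame V W s s' \<Longrightarrow> v \<notin> V \<Longrightarrow> fst s' v = fst s v" "frame V W s s' \<Longrightarrow> w \<notin> W \<Longrightarrow> snd s' w = snd s w"
  by (auto simp: frame_def)

text \<open>The quadratic bound covers the indices into the two matrices, the input \<open>A\<close>
  and the level rows \<open>W\<close>; all other values stay linear in \<open>n\<close>.\<close>

locale word_bound =
  fixes n B :: nat and A :: "nat \<Rightarrow> nat"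
  assumes n_pos: "0 < n" and B_ge: "16 * (n + 1) ^ 2 \<le> B" and A_le: "A i \<le> n"
begin

lemma small_fits: "x \<le> 8 * (n + 1) \<Longrightarrow> x < B"
proof -
  assume "x \<le> 8 * (n + 1)"
  also have "\<dots> < 16 * (n + 1) ^ 2" by (simp add: power2_eq_square)
  finally show ?thesis using B_ge by linarith
qed

lemma index_fits:
  assumes "x \<le> n + 4" "y \<le> 4 * (n + 1)"
  shows "x * n < B" "x * n + y < B"
proof -
  have "x * n \<le> (n + 4) * n" using assms by (intro mult_right_mono) auto
  then have "x * n + y \<le> (n + 4) * n + 4 * (n + 1)" using assms by linarith
  also have "\<dots> < 16 * (n + 1) ^ 2" by (simp add: power2_eq_square algebra_simps)
  finally show "x * n + y < B" using B_ge by linarith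
  then show "x * n < B" by linarith
qed

lemma A_fits: "A i < B" using A_le[of i] by (intro small_fits) simp

lemma fit_simps:
  "n < B" "Suc n < B" "0 < B" "Suc 0 < B" "A i < B" "i < n \<Longrightarrow> i < B" "i < n \<Longrightarrow> Suc i < B"
  "i < n \<Longrightarrow> j < n \<Longrightarrow> i * n < B" "i < n \<Longrightarrow> j < n \<Longrightarrow> i * n + j < B"
  using A_fits index_fits[of i j] by (auto intro!: small_fits)

definition mt :: "nat \<Rightarrow> nat \<Rightarrow> nat" where "mt i j = A (i * n + j)"

end

section \<open>Running time of the refinement\<close>

lemma frame_upd [simp]:
  "v \<in> V \<Longrightarrow> frame V W s (f(v := x), h) \<longleftrightarrow> frame V W s (f, h)"
  "w \<in> W \<Longrightarrow> frame V W s (f, h(w := y)) \<longleftrightarrow> frame V W s (f, h)"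
  by (auto simp: frame_def)

locale matrix_program = word_bound n B A for n B A +
  assumes good_mt: "good {..<n} (row_rel mt)"
begin

sublocale refinement n mt
  by unfold_locales (use good_mt in auto)

definition base :: "store \<Rightarrow> bool" where
  "base s \<longleftrightarrow> fst s ''n'' = n \<and> snd s ''A'' = A"

text \<open>\<open>\<tau>\<close> accumulates the swaps. At each moment it moves only positions from
  \<open>q\<close> up to the scan position, so the pivot \<open>y\<close>, the reference
  \<open>a\<close> and the entries still to be read keep their places.\<close>

lemma part_wp:
  fixes s :: store and P st :: "nat \<Rightarrow> nat"
  assumes base: "base s" and P: "snd s ''p'' = P" "\<And>i. i < n \<Longrightarrow> P i < n"
    and st: "snd s ''s'' = st" "\<And>i. st i \<le> 1" "st e \<noteq> 0" "\<And>i. q \<le> i \<Longrightarrow> i < e \<Longrightarrow> st i = 0"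
    and vars: "fst s ''y'' = y" "fst s ''a'' = a" "fst s ''b'' = q" "fst s ''m'' = q"
    and le: "y < n" "y < q \<or> e \<le> y" "a < q" "q < e" "e \<le> n"
    and gas: "100 * int (n + 1) \<le> g"
    and Q: "\<And>g' s' \<tau> m. g - 100 * int (n + 1) \<le> g' \<Longrightarrow> frame {''b'', ''m'', ''x''} {''p''} s s' \<Longrightarrow>
      \<tau> permutes {q..<e} \<Longrightarrow> snd s' ''p'' = P \<circ> \<tau> \<Longrightarrow> fst s' ''m'' = m \<Longrightarrow> fst s' ''b'' = e \<Longrightarrow>
      q \<le> m \<Longrightarrow> m \<le> e \<Longrightarrow> (\<And>i. q \<le> i \<Longrightarrow> i < m \<Longrightarrow> mt (P y) ((P \<circ> \<tau>) i) = mt (P y) (P a)) \<Longrightarrow>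
      (\<And>i. m \<le> i \<Longrightarrow> i < e \<Longrightarrow> mt (P y) ((P \<circ> \<tau>) i) \<noteq> mt (P y) (P a)) \<Longrightarrow> Q g' s'"
  shows "wp B part_prog Q g s"
proof -
  define ok where "ok \<tau> m b g' s' \<longleftrightarrow> frame {''b'', ''m'', ''x''} {''p''} s s' \<and> \<tau> permutes {q..<b} \<and>
    snd s' ''p'' = P \<circ> \<tau> \<and> fst s' ''m'' = m \<and> fst s' ''b'' = b \<and> q \<le> m \<and> m \<le> b \<and> b \<le> e \<and>
    (\<forall>i. q \<le> i \<longrightarrow> i < m \<longrightarrow> mt (P y) ((P \<circ> \<tau>) i) = mt (P y) (P a)) \<and>
    (\<forall>i. m \<le> i \<longrightarrow> i < b \<longrightarrow> mt (P y) ((P \<circ> \<tau>) i) \<noteq> mt (P y) (P a)) \<and>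
    g - 100 * int (n + 1) + 90 * int (e - b) + 50 \<le> g'" for \<tau> m b g' and s' :: store
  define I where "I g' s' \<longleftrightarrow> (\<exists>\<tau> m b. ok \<tau> m b g' s')" for g' s'
  have facts: "fst s' ''n'' = n \<and> snd s' ''A'' = A \<and> snd s' ''s'' = st \<and> fst s' ''y'' = y \<and> fst s' ''a'' = a \<and>
      (P \<circ> \<tau>) y = P y \<and> (P \<circ> \<tau>) a = P a \<and> (b < e \<longrightarrow> (P \<circ> \<tau>) b = P b \<and> \<tau> b = b) \<and> (\<forall>i<n. (P \<circ> \<tau>) i < n) \<and>
      snd s' ''p'' = P \<circ> \<tau> \<and> fst s' ''m'' = m \<and> fst s' ''b'' = b \<and> q \<le> m \<and> m \<le> b \<and> b \<le> e"
    if o: "ok \<tau> m b g' s'" for \<tau> m b g' s'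
  proof -
    have fr: "frame {''b'', ''m'', ''x''} {''p''} s s'" and \<tau>: "\<tau> permutes {q..<b}" and be: "b \<le> e"
      using o by (simp_all add: ok_def)
    have out: "\<tau> i = i" if "i < q \<or> b \<le> i" for i
      using that \<tau> by (auto simp: permutes_def)
    have "\<tau> i < n" if "i < n" for i
      using permutes_in_image[OF \<tau>, of i] out[of i] be le(5) that by (cases "i < q \<or> b \<le> i") auto
    then show ?thesis
      using o base out[of y] out[of a] out[of b] le be P(2) frameD[OF fr] st(1) vars
      by (auto simp: ok_def base_def)
  qed
  show ?thesis
    unfolding part_prog_def
  proof (rule wp_While[where I = I])
    have "ok id q q g s"
      using gas le vars P by (auto simp: ok_def frame_refl permutes_id)
    then show "I g s" by (auto simp: I_def)
  next
    fix g' s' assume "I g' s'"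
    then obtain \<tau> m b where o: "ok \<tau> m b g' s'" by (auto simp: I_def)
    note f = facts[OF o]
    have "0 \<le> g'" using o gas by (auto simp: ok_def)
    moreover have "b < B" "st b < B"
      using f le st(2)[of b] by (simp_all add: small_fits)
    moreover have "0 < B" by (rule small_fits) simp
    ultimately show "0 \<le> g' \<and> bfits B (Eq (Read ''s'' (Var ''b'')) (Const 0)) s'" using f by simp
  next
    fix g' s' assume "I g' s'" and bv: "bval (Eq (Read ''s'' (Var ''b'')) (Const 0)) s'"
    then obtain \<tau> m b where o: "ok \<tau> m b g' s'" by (auto simp: I_def)
    note f = facts[OF o]
    have st0: "st b = 0" using bv f by simp
    then have be: "b < e" using f st(3) by (metis le_neq_implies_less)
    then have bn: "b < n" "P y < n" "P b < n" "P a < n" "(P \<circ> \<tau>) m < n" "m < n" "a < n" "\<tau> b = b" "P (\<tau> m) < n"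
      "P (\<tau> y) = P y" "P (\<tau> a) = P a"
      using le f P(2) by auto
    have ok_I: "I g'' s''" if "ok \<tau> m b g1 s''" "g1 \<le> g''" for \<tau> m b g1 g'' s''
      using that unfolding I_def ok_def by (meson order_trans)
    have upd: "\<tau> permutes {q..<Suc b}" using o by (auto simp: ok_def intro: permutes_subset)
    have g_upd: "g - 100 * int (n + 1) + 90 * int (e - Suc b) + 50 \<le> g' - 90"
      using o be by (simp add: ok_def of_nat_diff algebra_simps)
    show "wp B (Cond (Eq (Entry (Var ''y'') (Var ''b'')) (Entry (Var ''y'') (Var ''a'')))
       (Assign ''x'' (Read ''p'' (Var ''b'')) ;; Write ''p'' (Var ''b'') (Read ''p'' (Var ''m'')) ;;
        Write ''p'' (Var ''m'') (Var ''x'') ;; IVar ''m'') Skip ;; IVar ''b'') I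
       (g' - 1 - int (bcost (Eq (Read ''s'' (Var ''b'')) (Const 0)))) s'"
    proof (cases "mt (P y) (P b) = mt (P y) (P a)")
      case eq: True
      let ?\<tau> = "\<tau> \<circ> transpose b m"
      have "ok ?\<tau> (Suc m) (Suc b) (g' - 90) ((fst s')(''x'' := P b, ''m'' := Suc m, ''b'' := Suc b),
        (snd s')(''p'' := P \<circ> ?\<tau>))"
        unfolding ok_def
      proof (intro conjI allI impI)
        show "frame {''b'', ''m'', ''x''} {''p''} s ((fst s')(''x'' := P b, ''m'' := Suc m, ''b'' := Suc b),
          (snd s')(''p'' := P \<circ> ?\<tau>))" using o by (simp add: ok_def)
        have "transpose b m permutes {q..<Suc b}" using f by (intro permutes_swap_id) auto
        then show "?\<tau> permutes {q..<Suc b}" using upd by (intro permutes_compose)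
        fix i assume i: "q \<le> i" "i < Suc m"
        show "mt (P y) ((P \<circ> ?\<tau>) i) = mt (P y) (P a)"
        proof (cases "i = m")
          case True
          then show ?thesis using eq bn by simp
        next
          case False
          then have "transpose b m i = i" using i f by (auto simp: transpose_def)
          then show ?thesis using o i False by (simp add: ok_def)
        qed
      next
        fix i assume i: "Suc m \<le> i" "i < Suc b"
        show "mt (P y) ((P \<circ> ?\<tau>) i) \<noteq> mt (P y) (P a)"
        proof (cases "i = b")
          case True
          then show ?thesis using o i by (auto simp: ok_def)
        next
          case False
          then have "transpose b m i = i" using i f by (auto simp: transpose_def)
          then show ?thesis using o i False by (simp add: ok_def)
        qed
      qed (use f be g_upd in auto)
      moreover have "(P \<circ> \<tau>)(b := P (\<tau> m), m := P b) = P \<circ> ?\<tau>"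
        using bn by (auto simp: transpose_def fun_eq_iff)
      ultimately have "\<And>x. g' - 90 \<le> x \<Longrightarrow> I x ((fst s')(''x'' := P b, ''m'' := Suc m, ''b'' := Suc b),
        (snd s')(''p'' := (P \<circ> \<tau>)(b := P (\<tau> m), m := P b)))" using ok_I by metis
      then show ?thesis
        using f bn eq be le(1) by (simp add: wp_simps fit_simps mt_def)
    next
      case neq: False
      have "ok \<tau> m (Suc b) (g' - 90) ((fst s')(''b'' := Suc b), snd s')"
        using o be g_upd upd neq bn by (auto simp: ok_def less_Suc_eq)
      then have "\<And>x. g' - 90 \<le> x \<Longrightarrow> I x ((fst s')(''b'' := Suc b), snd s')" using ok_I by metis
      then show ?thesis
        using f bn neq be le(1) by (simp add: wp_simps fit_simps mt_def)
    qed
  next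
    fix g' s' assume "I g' s'" and bv: "\<not> bval (Eq (Read ''s'' (Var ''b'')) (Const 0)) s'"
    then obtain \<tau> m b where o: "ok \<tau> m b g' s'" by (auto simp: I_def)
    note f = facts[OF o]
    have "b = e" using bv f st(4)[of b] by (auto simp: le_less)
    show "Q (g' - 1 - int (bcost (Eq (Read ''s'' (Var ''b'')) (Const 0)))) s'"
      by (rule Q[of _ s' \<tau> m]) (use o \<open>b = e\<close> in \<open>auto simp: ok_def\<close>)
  qed
qed

section \<open>Amortised cost of scans, tasks and stages\<close>

text \<open>Every later split and every later comparison is paid for in advance: \<open>potential\<close> bounds the time that
  refining the current partition can still take.\<close>

definition potential :: "(nat \<Rightarrow> nat) \<Rightarrow> (nat \<Rightarrow> nat) \<Rightarrow> (nat \<Rightarrow> nat) \<Rightarrow> (nat \<Rightarrow> nat) \<Rightarrow> nat \<Rightarrow> nat \<Rightarrow> int" where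
  "potential st L M R ns t = 3000 * int n * int (unsplit n st) + 1000 * int n * int (ns - t) +
     1000 * int (linked_pairs n st + (\<Sum>k\<in>{t..<ns}. (M k - L k) * (R k - M k)))"

lemma potential_nonneg: "0 \<le> potential st L M R ns t"
  unfolding potential_def by (intro add_nonneg_nonneg mult_nonneg_nonneg of_nat_0_le_iff) simp_all

lemma potential_step:
  "t < ns \<Longrightarrow> potential st L M R ns t = potential st L M R ns (Suc t) + 1000 * int n + 1000 * int ((M t - L t) * (R t - M t))"
  by (simp add: potential_def sum.atLeast_Suc_lessThan Suc_diff_Suc[symmetric] algebra_simps)

text \<open>The vanishing unsplit position releases \<open>3000 * n\<close>. Of this,
  \<open>1000 * n\<close> goes to the new task and \<open>2000 * n\<close> is left to pay for
  partitioning. The separated pairs merely move from \<open>linked_pairs\<close> into the sum over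
  the tasks.\<close>

lemma potential_split:
  assumes "a < m" "m < e" "e \<le> n" "\<And>i. a < i \<Longrightarrow> i < e \<Longrightarrow> st i = 0" "t \<le> ns"
  shows "potential (st(m := Suc 0)) (L(ns := a)) (M(ns := m)) (R(ns := e)) (Suc ns) t + 2000 * int n \<le> potential st L M R ns t"
proof -
  have m: "0 < m" "m < n" "st m = 0" using assms by auto
  have "(\<Sum>k\<in>{t..<Suc ns}. ((M(ns := m)) k - (L(ns := a)) k) * ((R(ns := e)) k - (M(ns := m)) k)) =
    (\<Sum>k\<in>{t..<ns}. (M k - L k) * (R k - M k)) + (m - a) * (e - m)"
    using assms(5) by (simp add: sum.atLeastLessThan_Suc)
  moreover have "linked_pairs n (st(m := Suc 0)) + (m - a) * (e - m) \<le> linked_pairs n st"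
    by (rule linked_pairs_upd) (use assms in auto)
  moreover have "Suc ns - t = Suc (ns - t)" using assms(5) by simp
  moreover have "unsplit n st = Suc (unsplit n (st(m := Suc 0)))"
    using unsplit_upd[of m n st] m by blast
  ultimately have lin: "linked_pairs n (st(m := Suc 0)) + (\<Sum>k\<in>{t..<Suc ns}. ((M(ns := m)) k - (L(ns := a)) k) * ((R(ns := e)) k - (M(ns := m)) k))
      \<le> linked_pairs n st + (\<Sum>k\<in>{t..<ns}. (M k - L k) * (R k - M k))"
    and u: "int (unsplit n st) = int (unsplit n (st(m := Suc 0))) + 1" "int (Suc ns - t) = int (ns - t) + 1"
    by linarith+
  have "3000 * int n * (x + 1) + 1000 * int n * y + 1000 * int v' \<ge> 3000 * int n * x + 1000 * int n * (y + 1) + 1000 * int v + 2000 * int n"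
    if "v \<le> v'" for x y :: int and v v' :: nat
    using that by (simp add: algebra_simps)
  from this[OF lin] show ?thesis unfolding potential_def u by simp
qed

definition in_range :: "store \<Rightarrow> bool" where
  "in_range s \<longleftrightarrow> base s \<and> (\<forall>i<n. snd s ''p'' i < n) \<and> (\<forall>i. snd s ''s'' i \<le> 1)"

abbreviation task_state where
  "task_state d s t y q \<equiv> state_ok d (snd s ''p'') (snd s ''s'') (snd s ''L'') (snd s ''M'') (snd s ''R'') (fst s ''k'') (snd s ''E'')
    (pend (snd s ''L'') (snd s ''M'') (snd s ''R'') (fst s ''k'') t y q)"

abbreviation store_scan where
  "store_scan s t y a q h \<equiv> scan_ok (snd s ''p'') (snd s ''s'') (snd s ''L'') (snd s ''M'') (snd s ''R'') t y a q h"

abbreviation store_potential where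
  "store_potential s t \<equiv> potential (snd s ''s'') (snd s ''L'') (snd s ''M'') (snd s ''R'') (fst s ''k'') t"

text \<open>Every task uses up one unsplit position, so there are never more than \<open>n\<close>
  tasks and their indices are words.\<close>

lemma unsplit_tasks: "unsplit n st + ns \<le> n \<Longrightarrow> 0 < m \<Longrightarrow> m < n \<Longrightarrow> st m = 0 \<Longrightarrow> unsplit n (st(m := Suc 0)) + Suc ns \<le> n"
  using unsplit_upd[of m n st] by simp

lemma next_boundary:
  fixes st :: "nat \<Rightarrow> nat"
  assumes "q < n" "st n \<noteq> 0"
  obtains e where "q \<le> e" "e \<le> n" "st e \<noteq> 0" "\<And>i. q \<le> i \<Longrightarrow> i < e \<Longrightarrow> st i = 0"
proof -
  let ?e = "LEAST e. q \<le> e \<and> st e \<noteq> 0"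
  have "q \<le> ?e \<and> st ?e \<noteq> 0" by (rule LeastI[of _ n]) (use assms in simp)
  moreover have "?e \<le> n" by (rule Least_le) (use assms in simp)
  moreover have "st i = 0" if "q \<le> i" "i < ?e" for i using not_less_Least[OF that(2)] that(1) by blast
  ultimately show ?thesis using that by blast
qed

abbreviation "scan_vars \<equiv> {''q'', ''a'', ''m'', ''b'', ''x'', ''k''}"
abbreviation "scan_arrays \<equiv> {''p'', ''s'', ''L'', ''M'', ''R''}"

lemma in_range_vars: "in_range (f, h) \<Longrightarrow> f' ''n'' = f ''n'' \<Longrightarrow> in_range (f', h)"
  by (simp add: in_range_def base_def)

text \<open>Splits are paid from the potential, plain steps from the term
  \<open>200 * int (h - q)\<close>. \<open>G\<close> is the budget of the surrounding code, which
  passes through untouched; this form makes the cost lemmas composable.\<close>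

lemma scan_wp:
  fixes s :: store
  assumes rng: "in_range s" and ok: "task_state d s t y (fst s ''q'')"
    and sc: "store_scan s t y (fst s ''a'') (fst s ''q'') h"
    and vars: "fst s ''y'' = y" "fst s ''h'' = h" and t: "t < fst s ''k''"
    and cnt: "unsplit n (snd s ''s'') + fst s ''k'' \<le> n"
    and gas: "store_potential s (Suc t) + 200 * int (h - fst s ''q'') + 50 + G \<le> g" "0 \<le> G"
    and Q: "\<And>g' s'. frame scan_vars scan_arrays s s' \<Longrightarrow> in_range s' \<Longrightarrow> task_state d s' t y h \<Longrightarrow>
      fst s ''k'' \<le> fst s' ''k'' \<Longrightarrow> snd s' ''L'' t = snd s ''L'' t \<Longrightarrow> snd s' ''M'' t = snd s ''M'' t \<Longrightarrow>
      snd s' ''R'' t = snd s ''R'' t \<Longrightarrow> unsplit n (snd s' ''s'') + fst s' ''k'' \<le> n \<Longrightarrow>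
      store_potential s' (Suc t) + G \<le> g' \<Longrightarrow> Q g' s'"
  shows "wp B scan_prog Q g s"
proof -
  define I where "I g' s' \<longleftrightarrow> frame scan_vars scan_arrays s s' \<and> in_range s' \<and> task_state d s' t y (fst s' ''q'') \<and>
      store_scan s' t y (fst s' ''a'') (fst s' ''q'') h \<and> fst s ''k'' \<le> fst s' ''k'' \<and>
      snd s' ''L'' t = snd s ''L'' t \<and> snd s' ''M'' t = snd s ''M'' t \<and> snd s' ''R'' t = snd s ''R'' t \<and>
      unsplit n (snd s' ''s'') + fst s' ''k'' \<le> n \<and>
      store_potential s' (Suc t) + 200 * int (h - fst s' ''q'') + 50 + G \<le> g'" for g' s'
  have hn: "h \<le> n"
  proof -
    have "tasks_wf n (snd s ''s'') (snd s ''L'') (snd s ''M'') (snd s ''R'') (fst s ''k'')"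
      using ok by (simp add: state_ok_def)
    then have "snd s ''M'' t < snd s ''R'' t \<and> snd s ''R'' t \<le> n" using t unfolding tasks_wf_def by blast
    moreover have "h = (if y < snd s ''M'' t then snd s ''R'' t else snd s ''M'' t)" using sc unfolding scan_ok_def by blast
    ultimately show ?thesis by simp
  qed
  have yn: "y < n"
  proof -
    have "y < snd s ''R'' t" using sc unfolding scan_ok_def by blast
    moreover have "snd s ''R'' t \<le> n" using ok t unfolding state_ok_def tasks_wf_def by blast
    ultimately show ?thesis by linarith
  qed
  have fr: "fst s' ''y'' = y" "fst s' ''h'' = h" if "I g' s'" for g' s'
  proof -
    have "frame scan_vars scan_arrays s s'" using that by (simp add: I_def)
    from frameD(1)[OF this, of "''y''"] frameD(1)[OF this, of "''h''"] show "fst s' ''y'' = y" "fst s' ''h'' = h"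
      using vars by simp_all
  qed
  have qa: "fst s' ''q'' \<le> n" "fst s' ''a'' < fst s' ''q''" "fst s' ''q'' \<le> h" if "I g' s'" for g' s'
  proof -
    have "fst s' ''a'' < fst s' ''q'' \<and> fst s' ''q'' \<le> h" using that unfolding I_def scan_ok_def by blast
    then show "fst s' ''q'' \<le> n" "fst s' ''a'' < fst s' ''q''" "fst s' ''q'' \<le> h" using hn by linarith+
  qed
  define tail where "tail = (Cond (Eq (Read ''s'' (Var ''q'')) (Const 0)) Skip (Assign ''a'' (Var ''q'')) ;; IVar ''q'')"
  have tail: "wp B tail I g2 s2"
    if H: "frame scan_vars scan_arrays s s2" "in_range s2" "task_state d s2 t y p0"
        "store_scan s2 t y a0 p0 h" "fst s2 ''q'' = p0" "fst s2 ''a'' = a0" "fst s ''k'' \<le> fst s2 ''k''"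
        "snd s2 ''L'' t = snd s ''L'' t" "snd s2 ''M'' t = snd s ''M'' t" "snd s2 ''R'' t = snd s ''R'' t"
        "unsplit n (snd s2 ''s'') + fst s2 ''k'' \<le> n"
        "snd s2 ''s'' p0 = 0 \<Longrightarrow> mt (snd s2 ''p'' y) (snd s2 ''p'' p0) = mt (snd s2 ''p'' y) (snd s2 ''p'' a0)"
        "store_potential s2 (Suc t) + 200 * int (h - Suc p0) + 80 + G \<le> g2" and qh: "p0 < h"
      for s2 g2 p0 a0
  proof -
    note step = scan_step[OF H(3) H(4) qh H(12)]
    have qn: "p0 < n" using qh hn by simp
    have stq: "snd s2 ''s'' p0 < B" using H(2) by (intro small_fits) (auto simp: in_range_def intro: order_trans)
    have rg: "in_range (f, snd s2)" if "f ''n'' = fst s2 ''n''" for f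
      by (rule in_range_vars[of "fst s2"]) (use H(2) that in simp_all)
    show ?thesis
    proof (cases "snd s2 ''s'' p0 = 0")
      case True
      have sc': "store_scan s2 t y a0 (Suc p0) h" using step(2) unfolding if_P[OF True] .
      have "I x ((fst s2)(''q'' := Suc p0), snd s2)" if "g2 - 30 \<le> x" for x
        unfolding I_def using H(1,6-11,13) step(1) sc' rg that by simp
      then show ?thesis unfolding tail_def using True H(5) qn stq by (simp add: wp_simps fit_simps)
    next
      case False
      have sc': "store_scan s2 t y p0 (Suc p0) h" using step(2) unfolding if_not_P[OF False] .
      have "I x ((fst s2)(''a'' := p0, ''q'' := Suc p0), snd s2)" if "g2 - 30 \<le> x" for x
        unfolding I_def using H(1,6-11,13) step(1) sc' rg that by simp
      then show ?thesis unfolding tail_def using False H(5) qn stq by (simp add: wp_simps fit_simps)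
    qed
  qed
  show ?thesis
    unfolding scan_prog_def tail_def[symmetric]
  proof (rule wp_While[where I = I])
    show "I g s" unfolding I_def by (intro conjI frame_refl rng ok sc order_refl refl cnt gas(1))
  next
    fix g' s' assume i: "I g' s'"
    have "0 \<le> g'"
      using i gas(2) potential_nonneg[of "snd s' ''s''" "snd s' ''L''" "snd s' ''M''" "snd s' ''R''" "fst s' ''k''" "Suc t"]
      unfolding I_def by linarith
    then show "0 \<le> g' \<and> bfits B (Less (Var ''q'') (Var ''h'')) s'"
      using fr[OF i] qa[OF i] hn by (simp add: small_fits)
  next
    fix g' s' assume i: "I g' s'" and "\<not> bval (Less (Var ''q'') (Var ''h'')) s'"
    then have "fst s' ''q'' = h" using fr[OF i] qa(3)[OF i] by simp
    then show "Q (g' - 1 - int (bcost (Less (Var ''q'') (Var ''h'')))) s'"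
      using i unfolding I_def by (intro Q) (simp_all only:, simp)
  next
    fix g' s' assume i: "I g' s'" and "bval (Less (Var ''q'') (Var ''h'')) s'"
    then have qh: "fst s' ''q'' < h" using fr[OF i] by simp
    define q where "q = fst s' ''q''"
    define a where "a = fst s' ''a''"
    define k where "k = fst s' ''k''"
    define P where "P = snd s' ''p''"
    define st where "st = snd s' ''s''"
    define L where "L = snd s' ''L''"
    define M where "M = snd s' ''M''"
    define R where "R = snd s' ''R''"
    note abbr = q_def[symmetric] a_def[symmetric] k_def[symmetric] P_def[symmetric] st_def[symmetric]
      L_def[symmetric] M_def[symmetric] R_def[symmetric]
    have ii: "frame scan_vars scan_arrays s s'" "in_range s'" "state_ok d P st L M R k (snd s' ''E'') (pend L M R k t y q)"
      "scan_ok P st L M R t y a q h" "fst s ''k'' \<le> k" "L t = snd s ''L'' t" "M t = snd s ''M'' t" "R t = snd s ''R'' t"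
      "unsplit n st + k \<le> n" "potential st L M R k (Suc t) + 200 * int (h - q) + 50 + G \<le> g'"
      using i unfolding I_def abbr by blast+
    have rg: "fst s' ''n'' = n" "snd s' ''A'' = A" "\<And>i. i < n \<Longrightarrow> P i < n" "\<And>i. st i \<le> 1"
      using ii(2) unfolding in_range_def base_def abbr by blast+
    have yh: "fst s' ''y'' = y" "fst s' ''h'' = h" using fr[OF i] .
    have bnds: "q < n" "a < n" "a < q" "q < h" "P y < n" "P q < n" "P a < n" "t < k"
      using qh qa[OF i] hn rg(3) yn t ii(5) unfolding abbr by auto
    have kn: "k \<le> n" using ii(9) by simp
    have stq: "st q < B" using rg(4)[of q] by (intro small_fits) simp
    have qh': "int (h - q) = int (h - Suc q) + 1" using bnds(4) by simp
    show "wp B (Cond (Conj (Eq (Read ''s'' (Var ''q'')) (Const 0))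
        (Neg (Eq (Entry (Var ''y'') (Var ''q'')) (Entry (Var ''y'') (Var ''a'')))))
       (Assign ''m'' (Var ''q'') ;; Assign ''b'' (Var ''q'') ;; part_prog ;;
        Write ''s'' (Var ''m'') (Const 1) ;; Write ''L'' (Var ''k'') (Var ''a'') ;;
        Write ''M'' (Var ''k'') (Var ''m'') ;; Write ''R'' (Var ''k'') (Var ''b'') ;; IVar ''k'')
       Skip ;; tail) I (g' - 1 - int (bcost (Less (Var ''q'') (Var ''h'')))) s'"
    proof (cases "st q = 0 \<and> mt (P y) (P q) \<noteq> mt (P y) (P a)")
      case False
      have "wp B tail I x s'" if "g' - 60 \<le> x" for x
      proof (rule tail[of _ q a])
        show "snd s' ''s'' q = 0 \<Longrightarrow> mt (snd s' ''p'' y) (snd s' ''p'' q) = mt (snd s' ''p'' y) (snd s' ''p'' a)"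
          using False unfolding abbr by blast
        show "store_potential s' (Suc t) + 200 * int (h - Suc q) + 80 + G \<le> x"
          using ii(10) qh' that unfolding abbr by linarith
      qed (use ii bnds in \<open>unfold abbr, (assumption | simp)+\<close>)
      then show ?thesis
        using False yh rg(1,2) bnds yn stq unfolding mt_def
        by (auto simp: wp_simps fit_simps abbr)
    next
      case True
      have stn: "st n \<noteq> 0" using ii(3) by (simp add: state_ok_def)
      obtain e where e: "q \<le> e" "e \<le> n" "st e \<noteq> 0" "\<And>i. q \<le> i \<Longrightarrow> i < e \<Longrightarrow> st i = 0"
        using next_boundary[of q st] bnds(1) stn by blast
      have qe: "q < e" using e True by (metis le_neq_implies_less)
      have a0: "st i = 0" if "a < i" "i < e" for i
        using ii(4) e(4) that unfolding scan_ok_def by (meson not_le)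
      \<comment> \<open>The boundary \<open>M t\<close> separates the pivot from the class that is
        being scanned, so the pivot cannot be moved by the partitioning.\<close>
      have yout: "y < q \<or> e \<le> y"
      proof (rule ccontr)
        assume "\<not> ?thesis"
        then have ay: "a < y" "y < e" using bnds by auto
        have "st (M t) \<noteq> 0" "st (R t) \<noteq> 0" "L t < M t" "M t < R t"
          using ii(3) bnds(8) unfolding state_ok_def tasks_wf_def by blast+
        moreover have "if y < M t then M t \<le> a else y \<ge> M t \<and> h = M t"
          using ii(4) unfolding scan_ok_def by (auto split: if_splits)
        ultimately show False using ay a0[of "M t"] bnds \<open>\<not> (y < q \<or> e \<le> y)\<close> by (auto split: if_splits)
      qed
      define s1 where "s1 = ((fst s')(''m'' := q, ''b'' := q), snd s')"
      have "wp B part_prog (wp B (Write ''s'' (Var ''m'') (Const 1) ;; Write ''L'' (Var ''k'') (Var ''a'') ;;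
        Write ''M'' (Var ''k'') (Var ''m'') ;; Write ''R'' (Var ''k'') (Var ''b'') ;; IVar ''k'') (wp B tail I)) x s1"
        if x: "g' - 60 \<le> x" for x
      proof (rule part_wp[where P = P and st = st and e = e and q = q and y = y and a = a])
        show "base s1" using ii(2) by (simp add: in_range_def base_def s1_def)
        have pot: "potential st L M R k (Suc t) \<ge> 2000 * int n"
          using potential_split[of a q e st "Suc t" k L M R] bnds(3,8) qe e(2) a0 potential_nonneg[of "st(q := Suc 0)" "L(k := a)" "M(k := q)" "R(k := e)" "Suc k" "Suc t"]
          by simp
        then show "100 * int (n + 1) \<le> x" using ii(10) x gas(2) n_pos by simp
      next
        fix g3 s3 \<tau> m
        assume g3: "x - 100 * int (n + 1) \<le> g3" and f3: "frame {''b'', ''m'', ''x''} {''p''} s1 s3"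
          and \<tau>: "\<tau> permutes {q..<e}" "snd s3 ''p'' = P \<circ> \<tau>" and m: "fst s3 ''m'' = m" "fst s3 ''b'' = e" "q \<le> m" "m \<le> e"
          and eqs: "\<And>i. q \<le> i \<Longrightarrow> i < m \<Longrightarrow> mt (P y) ((P \<circ> \<tau>) i) = mt (P y) (P a)"
          and neqs: "\<And>i. m \<le> i \<Longrightarrow> i < e \<Longrightarrow> mt (P y) ((P \<circ> \<tau>) i) \<noteq> mt (P y) (P a)"
        have out: "\<tau> i = i" if "i < q \<or> e \<le> i" for i using that \<tau>(1) by (auto simp: permutes_def)
        have Py: "(P \<circ> \<tau>) y = P y" "(P \<circ> \<tau>) a = P a" using out yout bnds(3) by auto
        \<comment> \<open>The entry found at \<open>q\<close> disagrees with the reference and must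
          have ended up at \<open>m\<close> or later, so the second part is not empty.\<close>
        have me: "m < e"
        proof (rule ccontr)
          assume "\<not> m < e"
          obtain i where i: "\<tau> i = q" using permutes_surj[OF \<tau>(1)] by (metis surjD)
          then have "q \<le> i" "i < e" using permutes_in_image[OF \<tau>(1), of i] qe by auto
          then show False using eqs[of i] True i \<open>\<not> m < e\<close> m(4) by auto
        qed
        have eqs': "\<And>i. q \<le> i \<Longrightarrow> i < m \<Longrightarrow> mt ((P \<circ> \<tau>) y) ((P \<circ> \<tau>) i) = mt ((P \<circ> \<tau>) y) ((P \<circ> \<tau>) a)"
          unfolding Py by (fact eqs)
        have neqs': "\<And>i. m \<le> i \<Longrightarrow> i < e \<Longrightarrow> mt ((P \<circ> \<tau>) y) ((P \<circ> \<tau>) i) \<noteq> mt ((P \<circ> \<tau>) y) ((P \<circ> \<tau>) a)"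
          unfolding Py by (fact neqs)
        note sp = split_step[OF ii(3) bnds(8) ii(4) bnds(4) m(3) me e(2,3) _ \<tau>(1) refl]
        have v3: "fst s3 ''k'' = k" "fst s3 ''a'' = a" "fst s3 ''q'' = q" "fst s3 ''n'' = n"
          "snd s3 ''s'' = st" "snd s3 ''L'' = L" "snd s3 ''M'' = M" "snd s3 ''R'' = R" "snd s3 ''A'' = A" "snd s3 ''E'' = snd s' ''E''"
          using frameD[OF f3] rg(1,2) by (simp_all add: s1_def abbr)
        define s4 where "s4 = ((fst s3)(''k'' := Suc k), (snd s3)(''s'' := st(m := Suc 0), ''L'' := L(k := a), ''M'' := M(k := m), ''R'' := R(k := e)))"
        have s4: "fst s4 ''q'' = q" "fst s4 ''a'' = a" "fst s4 ''k'' = Suc k" "fst s4 ''n'' = n" "snd s4 ''A'' = A"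
          "snd s4 ''p'' = P \<circ> \<tau>" "snd s4 ''s'' = st(m := Suc 0)" "snd s4 ''L'' = L(k := a)" "snd s4 ''M'' = M(k := m)"
          "snd s4 ''R'' = R(k := e)" "snd s4 ''E'' = snd s' ''E''"
          by (simp_all add: s4_def v3 \<tau>(2))
        have "wp B tail I x4 s4" if x4: "g3 - 60 \<le> x4" for x4
        proof (rule tail[of _ q a])
          have "frame scan_vars scan_arrays s s1" using ii(1) by (simp add: s1_def)
          then have "frame scan_vars scan_arrays s s3" by (rule frame_trans[OF _ f3]) auto
          then show "frame scan_vars scan_arrays s s4" by (simp add: s4_def)
          have "\<tau> i < n" if "i < n" for i
            using permutes_in_image[OF \<tau>(1), of i] out[of i] e(2) that by (cases "i < q \<or> e \<le> i") auto
          then show "in_range s4" using rg(3,4) by (simp add: in_range_def base_def s4)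
          show "task_state d s4 t y q" unfolding s4 by (rule sp(1); fact)
          show "store_scan s4 t y a q h" unfolding s4 by (rule sp(2); fact)
          show "mt (snd s4 ''p'' y) (snd s4 ''p'' q) = mt (snd s4 ''p'' y) (snd s4 ''p'' a)" if "snd s4 ''s'' q = 0"
          proof -
            have "q \<noteq> m" using that by (auto simp: s4)
            then show ?thesis using eqs'[of q] m(3) by (simp add: s4)
          qed
          have m': "0 < m" "m < n" "st m = 0" using bnds m(3) me e by auto
          show "unsplit n (snd s4 ''s'') + fst s4 ''k'' \<le> n" unfolding s4 using unsplit_tasks[OF ii(9) m'] .
          have am: "a < m" using bnds(3) m(3) by simp
          have "potential (st(m := Suc 0)) (L(k := a)) (M(k := m)) (R(k := e)) (Suc k) (Suc t) + 2000 * int n \<le> potential st L M R k (Suc t)"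
            by (rule potential_split) (use am me e(2) a0 bnds(8) in auto)
          then show "store_potential s4 (Suc t) + 200 * int (h - Suc q) + 80 + G \<le> x4"
            unfolding s4 using ii(10) qh' x g3 x4 n_pos by simp
        qed (use ii bnds in \<open>simp_all add: s4\<close>)
        then show "wp B (Write ''s'' (Var ''m'') (Const 1) ;; Write ''L'' (Var ''k'') (Var ''a'') ;;
          Write ''M'' (Var ''k'') (Var ''m'') ;; Write ''R'' (Var ''k'') (Var ''b'') ;; IVar ''k'') (wp B tail I) g3 s3"
          using m me e(2) bnds kn by (simp add: wp_simps fit_simps small_fits v3 s4_def)
      qed (use yh bnds rg e qe yn yout in \<open>simp_all add: s1_def abbr\<close>)
      then show ?thesis
        using True yh rg(1,2) bnds yn stq unfolding mt_def s1_def
        by (simp add: wp_simps fit_simps abbr)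
    qed
  qed
qed

abbreviation "task_vars \<equiv> {''y'', ''h'', ''t''} \<union> scan_vars"

lemma task_wp:
  fixes s :: store
  assumes rng: "in_range s" and ok: "task_state d s t 0 0" and tv: "fst s ''t'' = t" "t < fst s ''k''"
    and cnt: "unsplit n (snd s ''s'') + fst s ''k'' \<le> n"
    and gas: "store_potential s t + G \<le> g" "0 \<le> G"
    and Q: "\<And>g' s'. frame task_vars scan_arrays s s' \<Longrightarrow> in_range s' \<Longrightarrow> task_state d s' (Suc t) 0 0 \<Longrightarrow>
      fst s' ''t'' = Suc t \<Longrightarrow> Suc t \<le> fst s' ''k'' \<Longrightarrow> unsplit n (snd s' ''s'') + fst s' ''k'' \<le> n \<Longrightarrow>
      store_potential s' (Suc t) + G + 20 \<le> g' \<Longrightarrow> Q g' s'"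
  shows "wp B task_prog Q g s"
proof -
  define k L M R where "k = fst s ''k''" and "L = snd s ''L'' t" and "M = snd s ''M'' t" and "R = snd s ''R'' t"
  have LMR: "L < M" "M < R" "R \<le> n"
    using ok tv(2) unfolding state_ok_def tasks_wf_def L_def M_def R_def by blast+
  define side where "side y = (if y < M then R - M else M - L)" for y
  \<comment> \<open>\<open>rest y\<close> counts the comparisons of the pivots from \<open>y\<close>
    on. \<open>rest L\<close> is twice the product reserved in \<open>potential\<close>, since each
    pair is examined from both sides.\<close>
  define rest where "rest y = (if y < M then (M - y) * (R - M) + (R - M) * (M - L) else (R - y) * (M - L))" for y
  have rest_step: "int (rest y) = int (side y) + int (rest (Suc y))" if y: "y < R" for y
  proof -
    consider "Suc y < M" | "Suc y = M" | "M \<le> y" by linarith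
    then show ?thesis
    proof cases
      case 1
      then have "M - y = Suc (M - Suc y)" by simp
      then show ?thesis using 1 by (simp add: rest_def side_def)
    next
      case 2
      then have "M - y = 1" "y < M" by auto
      then show ?thesis using 2 by (auto simp: rest_def side_def)
    next
      case 3
      then have "R - y = Suc (R - Suc y)" using y by simp
      then show ?thesis using 3 by (simp add: rest_def side_def)
    qed
  qed
  define I where "I g' s' \<longleftrightarrow> frame task_vars scan_arrays s s' \<and> in_range s' \<and> task_state d s' t (fst s' ''y'') 0 \<and>
      fst s' ''t'' = t \<and> L \<le> fst s' ''y'' \<and> fst s' ''y'' \<le> R \<and> k \<le> fst s' ''k'' \<and>
      snd s' ''L'' t = L \<and> snd s' ''M'' t = M \<and> snd s' ''R'' t = R \<and>
      unsplit n (snd s' ''s'') + fst s' ''k'' \<le> n \<and>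
      store_potential s' (Suc t) + 200 * int (rest (fst s' ''y'')) + 300 * int (R - fst s' ''y'') + 100 + G \<le> g'" for g' s'
  have rg: "fst s ''n'' = n" "snd s ''A'' = A" using rng by (simp_all add: in_range_def base_def)
  have init: "I x ((fst s)(''y'' := L), snd s)" if x: "g - 20 \<le> x" for x
  proof -
    have pot: "store_potential s t = store_potential s (Suc t) + 1000 * int n + 1000 * int ((M - L) * (R - M))"
      unfolding L_def M_def R_def by (rule potential_step) (use tv in simp)
    have "rest L = 2 * ((M - L) * (R - M))" using LMR by (simp add: rest_def algebra_simps)
    moreover have "0 < (M - L) * (R - M)" using LMR by (intro mult_pos_pos) simp_all
    moreover have "R - L \<le> n" using LMR by simp
    ultimately have "200 * int (rest L) + 300 * int (R - L) + 200 \<le> 1000 * int n + 1000 * int ((M - L) * (R - M))"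
      using n_pos by linarith
    then have gas': "store_potential s (Suc t) + 200 * int (rest L) + 300 * int (R - L) + 100 + G \<le> x"
      using pot gas(1) x by linarith
    have "task_state d s t L 0" using task_begin[OF ok] by (simp add: L_def)
    then show ?thesis
      unfolding I_def using gas' rng cnt tv LMR
      by (simp add: frame_refl in_range_def base_def k_def[symmetric] L_def[symmetric] M_def[symmetric] R_def[symmetric])
  qed
  have facts: "fst s' ''n'' = n" "snd s' ''A'' = A" "t < fst s' ''k''" "t < n" "fst s' ''k'' \<le> n" if "I g' s'" for g' s'
    using that tv unfolding I_def in_range_def base_def k_def by (blast, blast, linarith, linarith, linarith)
  define body where "body = (Cond (Less (Var ''y'') (Read ''M'' (Var ''t'')))
        (Assign ''a'' (Read ''M'' (Var ''t'')) ;; Assign ''h'' (Read ''R'' (Var ''t'')))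
        (Assign ''a'' (Read ''L'' (Var ''t'')) ;; Assign ''h'' (Read ''M'' (Var ''t''))) ;;
      Assign ''q'' (Plus (Var ''a'') (Const 1)) ;; scan_prog ;; IVar ''y'')"
  have loop: "wp B (While (Less (Var ''y'') (Read ''R'' (Var ''t''))) body) (wp B (IVar ''t'') Q) x ((fst s)(''y'' := L), snd s)"
    if x: "g - 20 \<le> x" for x
  proof (rule wp_While[where I = I])
    show "I x ((fst s)(''y'' := L), snd s)" by (rule init[OF x])
  next
    fix g' s' assume i: "I g' s'"
    have "0 \<le> g'"
      using i gas(2) potential_nonneg[of "snd s' ''s''" "snd s' ''L''" "snd s' ''M''" "snd s' ''R''" "fst s' ''k''" "Suc t"]
      unfolding I_def by linarith
    moreover have "fst s' ''y'' \<le> n" "fst s' ''t'' = t" "snd s' ''R'' t \<le> n" using i LMR unfolding I_def by linarith+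
    ultimately show "0 \<le> g' \<and> bfits B (Less (Var ''y'') (Read ''R'' (Var ''t''))) s'"
      using facts[OF i] by (simp add: small_fits)
  next
    fix g' s' assume i: "I g' s'" and b: "\<not> bval (Less (Var ''y'') (Read ''R'' (Var ''t''))) s'"
    have ii: "frame task_vars scan_arrays s s'" "in_range s'" "task_state d s' t (fst s' ''y'') 0"
      "fst s' ''t'' = t" "fst s' ''y'' \<le> R" "snd s' ''R'' t = R" "unsplit n (snd s' ''s'') + fst s' ''k'' \<le> n"
      "store_potential s' (Suc t) + 200 * int (rest (fst s' ''y'')) + 300 * int (R - fst s' ''y'') + 100 + G \<le> g'"
      using i unfolding I_def by blast+
    have "snd s' ''R'' t \<le> fst s' ''y''" using b ii(4) by simp
    from task_end[OF ii(3) this] have "task_state d s' (Suc t) 0 0" .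
    then have "Q y ((fst s')(''t'' := Suc t), snd s')" if "g' - 50 \<le> y" for y
      by (intro Q) (use ii facts[OF i] that in \<open>simp_all add: in_range_def base_def\<close>)
    then show "wp B (IVar ''t'') Q (g' - 1 - int (bcost (Less (Var ''y'') (Read ''R'' (Var ''t''))))) s'"
      using facts[OF i] ii(4) by (simp add: wp_simps fit_simps)
  next
    fix g' s' assume i: "I g' s'" and b: "bval (Less (Var ''y'') (Read ''R'' (Var ''t''))) s'"
    define y where "y = fst s' ''y''"
    have ii: "frame task_vars scan_arrays s s'" "in_range s'" "task_state d s' t y 0"
      "fst s' ''t'' = t" "L \<le> y" "y \<le> R" "k \<le> fst s' ''k''" "snd s' ''L'' t = L" "snd s' ''M'' t = M" "snd s' ''R'' t = R"
      "unsplit n (snd s' ''s'') + fst s' ''k'' \<le> n"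
      "store_potential s' (Suc t) + 200 * int (rest y) + 300 * int (R - y) + 100 + G \<le> g'"
      using i unfolding I_def y_def by blast+
    have yR: "y < R" using b ii(4,10) by (simp add: y_def)
    define a h where "a = (if y < M then M else L)" and "h = (if y < M then R else M)"
    have side: "h - a = side y" "a < h" "a \<le> n" "h \<le> n" "a < n" using LMR by (auto simp: a_def h_def side_def)
    have piv: "task_state d s' t y (Suc a)"
      by (rule pivot_begin[OF ii(3)]) (use ii yR in \<open>simp_all add: a_def\<close>)
    define s1 where "s1 = ((fst s')(''a'' := a, ''h'' := h, ''q'' := Suc a), snd s')"
    have "wp B scan_prog (wp B (IVar ''y'') I) x s1" if x: "g' - 80 \<le> x" for x
    proof (rule scan_wp[where t = t and y = y and h = h and d = d and G = "200 * int (rest (Suc y)) + 300 * int (R - Suc y) + 150 + G"])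
      show "in_range s1" using ii(2) by (simp add: in_range_def base_def s1_def)
      show "task_state d s1 t y (fst s1 ''q'')" using piv by (simp add: s1_def)
      have sta: "snd s' ''s'' a \<noteq> 0"
        using ii(3,8,9) facts(3)[OF i] unfolding state_ok_def tasks_wf_def a_def by (auto split: if_splits)
      have s1v: "fst s1 ''a'' = a" "fst s1 ''q'' = Suc a" "snd s1 = snd s'" by (simp_all add: s1_def)
      have one: "j = a" if "a \<le> j" "j < Suc a" for j using that by simp
      have "\<forall>j. a < j \<longrightarrow> j < Suc a \<longrightarrow> snd s' ''s'' j = 0" by simp
      moreover have "\<forall>j. a \<le> j \<longrightarrow> j < Suc a \<longrightarrow> mt (snd s' ''p'' y) (snd s' ''p'' j) = mt (snd s' ''p'' y) (snd s' ''p'' a)"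
        using one by blast
      moreover have "(if y < M then M else L) \<le> a" "h = (if y < M then R else M)" "L \<le> y" "y < R" "a < Suc a" "Suc a \<le> h"
        using ii(5) yR side by (simp_all add: a_def h_def)
      ultimately show "store_scan s1 t y (fst s1 ''a'') (fst s1 ''q'') h"
        using sta unfolding scan_ok_def s1v ii(8-10) by blast
      show "store_potential s1 (Suc t) + 200 * int (h - fst s1 ''q'') + 50 + (200 * int (rest (Suc y)) + 300 * int (R - Suc y) + 150 + G) \<le> x"
      proof -
        have "int (R - y) = int (R - Suc y) + 1" "int (h - Suc a) + 1 = int (side y)" using yR side by linarith+
        then have "store_potential s' (Suc t) + 200 * int (h - Suc a) + 50 + (200 * int (rest (Suc y)) + 300 * int (R - Suc y) + 150 + G) \<le> x"
          using ii(12) x rest_step[OF yR] by linarith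
        then show ?thesis by (simp add: s1_def)
      qed
      show "fst s1 ''y'' = y" by (simp add: s1_def y_def)
      show "fst s1 ''h'' = h" by (simp add: s1_def)
      show "t < fst s1 ''k''" using facts(3)[OF i] by (simp add: s1_def)
      show "unsplit n (snd s1 ''s'') + fst s1 ''k'' \<le> n" using ii(11) by (simp add: s1_def)
      show "0 \<le> 200 * int (rest (Suc y)) + 300 * int (R - Suc y) + 150 + G" using gas(2) by simp
    next
      fix g2 s2 assume f2: "frame scan_vars scan_arrays s1 s2" and r2: "in_range s2" and t2: "task_state d s2 t y h"
        and k2: "fst s1 ''k'' \<le> fst s2 ''k''" and L2: "snd s2 ''L'' t = snd s1 ''L'' t" "snd s2 ''M'' t = snd s1 ''M'' t" "snd s2 ''R'' t = snd s1 ''R'' t"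
        and c2: "unsplit n (snd s2 ''s'') + fst s2 ''k'' \<le> n"
        and g2: "store_potential s2 (Suc t) + (200 * int (rest (Suc y)) + 300 * int (R - Suc y) + 150 + G) \<le> g2"
      have L2': "snd s2 ''L'' t = L" "snd s2 ''M'' t = M" "snd s2 ''R'' t = R" using L2 ii by (simp_all add: s1_def)
      have v2: "fst s2 ''y'' = y" "fst s2 ''t'' = t" using frameD(1)[OF f2] ii(4) by (simp_all add: s1_def y_def)
      have kk: "k \<le> fst s2 ''k''" using k2 ii(7) by (simp add: s1_def)
      have "task_state d s2 t (Suc y) 0"
        by (rule pivot_end[OF t2]) (use kk tv L2' in \<open>simp_all add: k_def h_def\<close>)
      moreover have "frame task_vars scan_arrays s s1" using ii(1) by (simp add: s1_def)
      then have "frame task_vars scan_arrays s s2" by (rule frame_trans[OF _ f2]) auto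
      moreover have "in_range ((fst s2)(''y'' := Suc y), snd s2)" using r2 by (simp add: in_range_def base_def)
      ultimately have "I x ((fst s2)(''y'' := Suc y), snd s2)" if "g2 - 20 \<le> x" for x
        unfolding I_def using v2 L2' kk c2 g2 that yR ii(5) by simp
      then show "wp B (IVar ''y'') I g2 s2"
        using v2 yR LMR by (simp add: wp_simps fit_simps small_fits)
    qed
    then have S: "wp B scan_prog (wp B (IVar ''y'') I) x ((fst s')(''a'' := a, ''h'' := h, ''q'' := Suc a), snd s')" if "g' - 80 \<le> x" for x
      using that by (simp add: s1_def)
    show "wp B body I (g' - 1 - int (bcost (Less (Var ''y'') (Read ''R'' (Var ''t''))))) s'"
    proof (cases "y < M")
      case True
      then show ?thesis
        using S ii(4,8-10) LMR facts[OF i] unfolding body_def a_def h_def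
        by (simp add: wp_simps fit_simps small_fits y_def[symmetric])
    next
      case False
      then show ?thesis
        using S ii(4,8-10) LMR facts[OF i] yR unfolding body_def a_def h_def
        by (simp add: wp_simps fit_simps small_fits y_def[symmetric])
    qed
  qed
  have "L < B" "t < B" using LMR tv cnt by (auto intro!: small_fits)
  then show ?thesis
    unfolding task_prog_def body_def[symmetric] using loop tv(1) by (simp add: wp_simps L_def[symmetric])
qed

abbreviation "stage_vars \<equiv> {''e'', ''c''} \<union> task_vars"
abbreviation "stage_arrays \<equiv> {''E''} \<union> scan_arrays"

abbreviation stage_state where
  "stage_state c s \<equiv> state_ok c (snd s ''p'') (snd s ''s'') (snd s ''L'') (snd s ''M'') (snd s ''R'') (fst s ''k'') (snd s ''E'')
    (\<lambda>_ _ _. False)"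

lemma stage_wp:
  fixes s :: store
  assumes rng: "in_range s" and ok: "stage_state c s" and v: "fst s ''c'' = c" "fst s ''t'' = fst s ''k''" and c: "c < n"
    and cnt: "unsplit n (snd s ''s'') + fst s ''k'' \<le> n"
    and gas: "store_potential s (fst s ''k'') + 500 * int (n + 1) + G \<le> g" "0 \<le> G"
    and Q: "\<And>g' s'. frame stage_vars stage_arrays s s' \<Longrightarrow> in_range s' \<Longrightarrow> stage_state (Suc c) s' \<Longrightarrow>
      fst s' ''c'' = Suc c \<Longrightarrow> fst s' ''t'' = fst s' ''k'' \<Longrightarrow> unsplit n (snd s' ''s'') + fst s' ''k'' \<le> n \<Longrightarrow>
      store_potential s' (fst s' ''k'') + G \<le> g' \<Longrightarrow> Q g' s'"
  shows "wp B stage_prog Q g s"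
proof -
  define k st where "k = fst s ''k''" and "st = snd s ''s''"
  have rg: "fst s ''n'' = n" "snd s ''A'' = A" "\<And>i. st i \<le> 1" using rng by (simp_all add: in_range_def base_def st_def)
  have kn: "k \<le> n" using cnt by (simp add: k_def)
  have stn: "st n \<noteq> 0" "st c \<noteq> 0" using ok by (simp_all add: state_ok_def st_def)
  \<comment> \<open>The mark at \<open>n\<close> guarantees that the search for the end of the class
    of \<open>c\<close> stops.\<close>
  obtain e where e: "Suc c \<le> e" "e \<le> n" "st e \<noteq> 0" "\<And>i. Suc c \<le> i \<Longrightarrow> i < e \<Longrightarrow> st i = 0"
  proof (cases "Suc c < n")
    case True
    then show ?thesis using next_boundary[of "Suc c" st] stn(1) that by blast
  next
    case False
    then have "Suc c = n" using c by simp
    then show ?thesis using stn that[of n] by simp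
  qed
  define loopT where "loopT = While (Less (Var ''t'') (Var ''k'')) task_prog"
  have tasks: "wp B loopT (wp B (IVar ''c'') Q) x s2"
    if H: "frame stage_vars stage_arrays s s2" "in_range s2" "task_state (Suc c) s2 k 0 0" "fst s2 ''c'' = c" "fst s2 ''t'' = k" "k \<le> fst s2 ''k''"
      "unsplit n (snd s2 ''s'') + fst s2 ''k'' \<le> n" "store_potential s2 k + 100 + G \<le> x" for x s2
    unfolding loopT_def
  proof (rule wp_While[where I = "\<lambda>g' s'. frame stage_vars stage_arrays s s' \<and> in_range s' \<and> task_state (Suc c) s' (fst s' ''t'') 0 0 \<and>
      fst s' ''c'' = c \<and> fst s' ''t'' \<le> fst s' ''k'' \<and> unsplit n (snd s' ''s'') + fst s' ''k'' \<le> n \<and>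
      store_potential s' (fst s' ''t'') + 100 + G \<le> g'"], goal_cases)
    case 1
    then show ?case using H by simp
  next
    case (2 g' s')
    then have "0 \<le> g'"
      using gas(2) potential_nonneg[of "snd s' ''s''" "snd s' ''L''" "snd s' ''M''" "snd s' ''R''" "fst s' ''k''" "fst s' ''t''"]
      by linarith
    moreover have "fst s' ''t'' \<le> n" "fst s' ''k'' \<le> n" using 2 by linarith+
    ultimately show ?case by (simp add: small_fits)
  next
    case (3 g' s')
    then have i: "frame stage_vars stage_arrays s s'" "in_range s'" "task_state (Suc c) s' (fst s' ''t'') 0 0" "fst s' ''c'' = c"
      "fst s' ''t'' < fst s' ''k''" "unsplit n (snd s' ''s'') + fst s' ''k'' \<le> n"
      "store_potential s' (fst s' ''t'') + 100 + G \<le> g'" by auto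
    show ?case
    proof (rule task_wp[OF i(2,3) refl i(5,6), where G = "90 + G"], goal_cases)
      case (3 g2 s2)
      have "fst s2 ''c'' = c" using frameD(1)[OF 3(1), of "''c''"] i(4) by simp
      moreover have "frame stage_vars stage_arrays s s2" by (rule frame_trans[OF i(1) 3(1)]) auto
      ultimately show ?case using 3 by simp
    qed (use i(7) gas(2) in simp_all)
  next
    case (4 g' s')
    then have i: "frame stage_vars stage_arrays s s'" "in_range s'" "task_state (Suc c) s' (fst s' ''k'') 0 0" "fst s' ''c'' = c"
      "fst s' ''t'' = fst s' ''k''" "unsplit n (snd s' ''s'') + fst s' ''k'' \<le> n"
      "store_potential s' (fst s' ''k'') + 100 + G \<le> g'" by auto
    have st': "stage_state (Suc c) s'" by (rule no_pending[OF i(3)])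
    have "Q x ((fst s')(''c'' := Suc c), snd s')" if "g' - 50 \<le> x" for x
      by (rule Q) (use i st' that in \<open>simp_all add: in_range_def base_def\<close>)
    then show ?case using i(4) c by (simp add: wp_simps fit_simps)
  qed
  define post where "post = (Write ''E'' (Var ''c'') (Var ''e'') ;;
    Cond (Less (Plus (Var ''c'') (Const 1)) (Var ''e''))
      (Write ''L'' (Var ''k'') (Var ''c'') ;; Write ''M'' (Var ''k'') (Plus (Var ''c'') (Const 1)) ;;
       Write ''R'' (Var ''k'') (Var ''e'') ;; IVar ''k'' ;; Write ''s'' (Plus (Var ''c'') (Const 1)) (Const 1))
      Skip ;; loopT ;; IVar ''c'')"
  have E: "c < e" "\<And>i. c < i \<Longrightarrow> i < e \<Longrightarrow> st i = 0" using e by auto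
  have sb: "e = Suc c \<Longrightarrow> state_ok (Suc c) (snd s ''p'') st (snd s ''L'') (snd s ''M'') (snd s ''R'') k ((snd s ''E'')(c := e)) (\<lambda>_ _ _. False)"
    "Suc c < e \<Longrightarrow> state_ok (Suc c) (snd s ''p'') (st(Suc c := Suc 0)) ((snd s ''L'')(k := c)) ((snd s ''M'')(k := Suc c)) ((snd s ''R'')(k := e))
      (Suc k) ((snd s ''E'')(c := e)) (pend ((snd s ''L'')(k := c)) ((snd s ''M'')(k := Suc c)) ((snd s ''R'')(k := e)) (Suc k) k 0 0)"
    using stage_begin[of c "snd s ''p''" st "snd s ''L''" "snd s ''M''" "snd s ''R''" k "snd s ''E''" e] ok c E e(2,3)
    unfolding k_def st_def by blast+
  have find: "wp B (While (Eq (Read ''s'' (Var ''e'')) (Const 0)) (IVar ''e'')) (wp B post Q) x ((fst s)(''e'' := Suc c), snd s)"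
    if x: "g - 20 \<le> x" for x
  proof (rule wp_While[where I = "\<lambda>g' s'. \<exists>j. s' = ((fst s)(''e'' := j), snd s) \<and> Suc c \<le> j \<and> j \<le> e \<and>
      store_potential s k + 400 * int (n + 1) + 50 * int (e - j) + G \<le> g'"], goal_cases)
    case 1
    have "int (e - Suc c) \<le> int n" using e by simp
    then have "store_potential s k + 400 * int (n + 1) + 50 * int (e - Suc c) + G \<le> x"
      using gas(1) x n_pos by (simp add: k_def)
    then show ?case using e by auto
  next
    case (2 g' s')
    then obtain j where j: "s' = ((fst s)(''e'' := j), snd s)" "j \<le> e" "store_potential s k + 400 * int (n + 1) + 50 * int (e - j) + G \<le> g'" by blast
    then have "0 \<le> g'" using gas(2) potential_nonneg[of "snd s ''s''" "snd s ''L''" "snd s ''M''" "snd s ''R''" "fst s ''k''" k] by linarith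
    moreover have "j < B" "st j < B" using j e rg(3)[of j] by (auto intro!: small_fits)
    ultimately show ?case using j(1) by (simp add: fit_simps st_def)
  next
    case (3 g' s')
    then obtain j where j: "s' = ((fst s)(''e'' := j), snd s)" "Suc c \<le> j" "j \<le> e" "store_potential s k + 400 * int (n + 1) + 50 * int (e - j) + G \<le> g'" by blast
    then have "st j = 0" using 3(2) by (simp add: st_def)
    then have "j < e" using j e(3) by (metis le_neq_implies_less)
    then have "int (e - j) = int (e - Suc j) + 1" "j < n" using e by auto
    then show ?case using j \<open>j < e\<close> by (auto simp: wp_simps fit_simps)
  next
    case (4 g' s')
    then obtain j where j: "s' = ((fst s)(''e'' := j), snd s)" "Suc c \<le> j" "j \<le> e" "store_potential s k + 400 * int (n + 1) + 50 * int (e - j) + G \<le> g'" by blast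
    then have "j = e" using 4(2) e(4)[of j] by (auto simp: st_def le_less)
    have g': "store_potential s k + 800 + G \<le> g'" using j(4) \<open>j = e\<close> n_pos by simp
    have en: "e < B" "c < B" "Suc c < B" using e c by (auto intro!: small_fits)
    show ?case
    proof (cases "e = Suc c")
      case True
      let ?s2 = "((fst s)(''e'' := e), (snd s)(''E'' := (snd s ''E'')(c := e)))"
      have ok2: "task_state (Suc c) ?s2 k 0 0"
        by (simp add: k_def[symmetric] st_def[symmetric]) (rule state_ok_mono[OF sb(1)[OF True]], simp)
      have "wp B loopT (wp B (IVar ''c'') Q) y ?s2" if "g' - 100 \<le> y" for y
        by (rule tasks) (use rng ok2 v cnt g' that in \<open>simp_all add: frame_refl in_range_def base_def k_def\<close>)
      then show ?thesis
        using True v(1) en unfolding j(1) \<open>j = e\<close> post_def by (simp add: wp_simps fit_simps)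
    next
      case False
      then have ce: "Suc c < e" using e(1) by simp
      let ?s2 = "((fst s)(''e'' := e, ''k'' := Suc k), (snd s)(''E'' := (snd s ''E'')(c := e), ''L'' := (snd s ''L'')(k := c),
        ''M'' := (snd s ''M'')(k := Suc c), ''R'' := (snd s ''R'')(k := e), ''s'' := st(Suc c := Suc 0)))"
      have z: "st (Suc c) = 0" using e(4)[of "Suc c"] ce by simp
      have ok2: "task_state (Suc c) ?s2 k 0 0"
        using sb(2)[OF ce] by (simp add: k_def[symmetric] st_def[symmetric])
      have pot: "potential (st(Suc c := Suc 0)) ((snd s ''L'')(k := c)) ((snd s ''M'')(k := Suc c)) ((snd s ''R'')(k := e)) (Suc k) k
          + 2000 * int n \<le> potential st (snd s ''L'') (snd s ''M'') (snd s ''R'') k k"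
        by (rule potential_split) (use ce e E in auto)
      have cnt2: "unsplit n (st(Suc c := Suc 0)) + Suc k \<le> n"
        using unsplit_tasks[of st k "Suc c"] cnt z ce e(2) by (simp add: k_def st_def)
      have rng2: "in_range ?s2" using rng rg(3) by (simp add: in_range_def base_def st_def)
      have "wp B loopT (wp B (IVar ''c'') Q) y ?s2" if "g' - 300 \<le> y" for y
      proof (rule tasks)
        show "task_state (Suc c) ?s2 k 0 0" by (rule ok2)
        show "in_range ?s2" by (rule rng2)
        show "unsplit n (snd ?s2 ''s'') + fst ?s2 ''k'' \<le> n" using cnt2 by simp
        show "store_potential ?s2 k + 100 + G \<le> y"
          using pot g' that n_pos by (simp add: k_def[symmetric] st_def[symmetric])
      qed (use v in \<open>simp_all add: frame_refl k_def\<close>)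
      then show ?thesis
        using ce v(1) en kn unfolding j(1) \<open>j = e\<close> post_def
        by (simp add: wp_simps fit_simps small_fits k_def[symmetric] st_def[symmetric])
    qed
  qed
  show ?thesis
    unfolding stage_prog_def loopT_def[symmetric] post_def[symmetric]
    using find v(1) c by (simp add: wp_simps fit_simps)
qed

end

section \<open>Laminar blocks, live positions and kids\<close>

section \<open>Blocks and forcing\<close>

text \<open>The result of the first phase after renaming elements by their positions:
  \<open>en c\<close> is the end of the block of \<open>c\<close>.\<close>

locale hierarchy = good_matrix "{..<n}" a for n :: nat and a :: "nat \<Rightarrow> nat \<Rightarrow> nat" +
  fixes en :: "nat \<Rightarrow> nat"
  assumes en_bounds: "c < n \<Longrightarrow> c < en c" "c < n \<Longrightarrow> en c \<le> n"
    and block_md: "c < n \<Longrightarrow> md {c..<en c}"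
    and md_in_block: "md S \<Longrightarrow> c \<in> S \<Longrightarrow> S \<subseteq> {c..} \<Longrightarrow> S \<subseteq> {c..<en c}"
begin

abbreviation "block b \<equiv> {b..<en b}"

lemma block_self: "c < n \<Longrightarrow> c \<in> block c"
  using en_bounds by simp

text \<open>A block starting inside the block of \<open>c\<close> unites with it to a module that
  starts at \<open>c\<close>, and the block of \<open>c\<close> is the largest of these.\<close>

lemma laminar:
  assumes "c \<le> b" "b < en c" "c < n"
  shows "en b \<le> en c" "b < n"
proof -
  show b: "b < n" using assms en_bounds(2)[OF assms(3)] by simp
  have "block c \<inter> block b \<noteq> {}" using assms block_self[OF b] by auto
  then have "md (block c \<union> block b)" using md_Un block_md assms b by blast
  then have "block c \<union> block b \<subseteq> block c"
    by (rule md_in_block) (use assms block_self in auto)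
  moreover have "en b - 1 \<in> block b" using en_bounds(1)[OF b] by auto
  ultimately have "en b - 1 < en c" by auto
  then show "en b \<le> en c" by simp
qed

text \<open>The starts of the maximal blocks among all blocks starting at \<open>c\<close> or later.
  They are the roots of the forest that exists when the construction has come down to
  \<open>c\<close>.\<close>

definition live :: "nat \<Rightarrow> nat set" where
  "live c = {z. c \<le> z \<and> z < n \<and> (\<forall>i. c \<le> i \<longrightarrow> i < z \<longrightarrow> en i \<le> z)}"

definition kids :: "nat \<Rightarrow> nat set" where
  "kids c = {b \<in> live (Suc c). b < en c}"

lemma finite_live: "finite (live c)"
  by (rule finite_subset[of _ "{..<n}"]) (auto simp: live_def)

lemma finite_kids: "finite (kids c)"
  unfolding kids_def using finite_live by simp

lemma live_0: assumes "0 < n" shows "live 0 = {0}" "en 0 = n"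
proof -
  have "{..<n} \<subseteq> block 0" by (rule md_in_block[OF md_N]) (use assms in auto)
  moreover have "n - 1 \<in> {..<n}" using assms by simp
  ultimately have "n - 1 < en 0" by (meson atLeastLessThan_iff subsetD)
  then show e: "en 0 = n" using en_bounds(2)[OF assms] by simp
  show "live 0 = {0}" using assms e by (auto simp: live_def)
qed

lemma live_n: "live n = {}"
  by (auto simp: live_def)

text \<open>Coming down to \<open>c\<close>, the kids of \<open>c\<close> give way to
  \<open>c\<close> itself and never return. Each position is therefore a kid at most once, which
  bounds the total number of search events linearly.\<close>

lemma live_step:
  assumes "c < n"
  shows "live c = insert c (live (Suc c) - kids c)"
proof (intro equalityI subsetI)
  fix z assume "z \<in> live c"
  then show "z \<in> insert c (live (Suc c) - kids c)"
    using assms by (cases "z = c") (auto simp: live_def kids_def)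
next
  fix z assume "z \<in> insert c (live (Suc c) - kids c)"
  then show "z \<in> live c"
    using assms by (auto simp: live_def kids_def not_less) (metis Suc_leI le_neq_implies_less)
qed

lemma kidsD:
  assumes "b \<in> kids c"
  shows "c < b" "b < en c" "b < n" "i \<in> {c<..<b} \<Longrightarrow> en i \<le> b"
  using assms by (auto simp: kids_def live_def Suc_le_eq)

lemma first_kid: "c < n \<Longrightarrow> Suc c < en c \<Longrightarrow> Suc c \<in> kids c"
  using en_bounds(2)[of c] by (auto simp: kids_def live_def)

text \<open>Kids tile the block without \<open>c\<close>: the end of one is the start of the next.
  The program enumerates them by jumping along \<open>en\<close>.\<close>

lemma next_kid:
  assumes c: "c < n" and b: "b \<in> kids c"
  shows "en b \<le> en c" "en b < en c \<Longrightarrow> en b \<in> kids c" "i \<in> kids c \<Longrightarrow> b < i \<Longrightarrow> en b \<le> i"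
proof -
  note k = kidsD[OF b]
  show le: "en b \<le> en c" using laminar(1)[of c b] k c by simp
  show "en b \<le> i" if "i \<in> kids c" "b < i"
    using kidsD(4)[OF that(1), of b] k that(2) by simp
  show "en b \<in> kids c" if lt: "en b < en c"
  proof -
    have "en i \<le> en b" if i: "Suc c \<le> i" "i < en b" for i
    proof (cases "i < b")
      case True
      then show ?thesis using k(4)[of i] i en_bounds(1)[OF k(3)] by simp
    next
      case False
      then show ?thesis using laminar(1)[of b i] i k(3) by simp
    qed
    moreover have "b < en b" using en_bounds(1)[OF k(3)] .
    ultimately show ?thesis using lt k(1) en_bounds(2)[OF c] by (auto simp: kids_def live_def)
  qed
qed

lemma kid_blocks:
  assumes c: "c < n"
  shows "{c<..<en c} = \<Union>(block ` kids c)" "b \<in> kids c \<Longrightarrow> b' \<in> kids c \<Longrightarrow> b \<noteq> b' \<Longrightarrow> block b \<inter> block b' = {}"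
proof -
  have ex: "\<exists>b\<in>kids c. z \<in> block b" if z: "c < z" "z < en c" for z
  proof -
    let ?S = "{b \<in> kids c. b \<le> z}"
    have fin: "finite ?S" using finite_kids by simp
    have "Suc c \<in> ?S" using first_kid[OF c] z by auto
    then have ne: "?S \<noteq> {}" by blast
    have m: "Max ?S \<in> kids c" "Max ?S \<le> z" using Max_in[OF fin ne] by auto
    have "z < en (Max ?S)"
    proof (rule ccontr)
      assume "\<not> z < en (Max ?S)"
      then have "en (Max ?S) \<in> ?S" using next_kid(2)[OF c m(1)] z by auto
      then have "en (Max ?S) \<le> Max ?S" using fin by simp
      then show False using en_bounds(1)[OF kidsD(3)[OF m(1)]] by simp
    qed
    then show ?thesis using m by auto
  qed
  show "{c<..<en c} = \<Union>(block ` kids c)"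
  proof (intro equalityI subsetI)
    fix z assume "z \<in> \<Union>(block ` kids c)"
    then obtain b where "b \<in> kids c" "z \<in> block b" by blast
    then show "z \<in> {c<..<en c}" using kidsD(1)[of b c] next_kid(1)[OF c, of b] by auto
  qed (use ex in auto)
  show "block b \<inter> block b' = {}" if "b \<in> kids c" "b' \<in> kids c" "b \<noteq> b'" for b b'
    using next_kid(3)[OF c that(1), of b'] next_kid(3)[OF c that(2), of b] that by (cases b b' rule: linorder_cases) auto
qed

text \<open>The module lies in the block of its least position, which by laminarity lies in the
  block of the kid around that position.\<close>

lemma maximal_kid:
  assumes c: "c < n" and S: "md S" "S \<noteq> {}" "S \<subseteq> {c<..<en c}"
  shows "\<exists>b\<in>kids c. S \<subseteq> block b"
proof -
  have fin: "finite S" using S(3) finite_subset by blast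
  define m where "m = Min S"
  have m: "m \<in> S" "S \<subseteq> {m..}" using fin S(2) by (auto simp: m_def)
  then have Sm: "S \<subseteq> block m" using md_in_block S(1) by blast
  obtain b where b: "b \<in> kids c" "m \<in> block b" using m(1) S(3) kid_blocks(1)[OF c] by blast
  have "en m \<le> en b" using laminar(1)[of b m] b kidsD(3)[OF b(1)] by simp
  then have "S \<subseteq> block b" using Sm b(2) by auto
  then show ?thesis using b(1) by blast
qed

section \<open>Forcing between kids and its sink components\<close>

definition forces :: "nat \<Rightarrow> nat \<Rightarrow> nat \<Rightarrow> bool" where
  "forces c x y \<longleftrightarrow> a y c \<noteq> a y x"

definition closed_in :: "nat \<Rightarrow> nat set \<Rightarrow> bool" where
  "closed_in c Z \<longleftrightarrow> Z \<subseteq> kids c \<and> (\<forall>x\<in>Z. \<forall>y\<in>kids c - Z. \<not> forces c x y)"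

definition core :: "nat \<Rightarrow> nat set \<Rightarrow> nat set" where
  "core c Z = insert c (\<Union>(block ` Z))"

lemma core_mem:
  assumes c: "c < n" and Z: "Z \<subseteq> kids c" and y: "y \<in> kids c"
  shows "y \<in> core c Z \<longleftrightarrow> y \<in> Z"
proof
  assume "y \<in> core c Z"
  then obtain z where z: "z \<in> Z" "y \<in> block z" using kidsD(1)[OF y] by (auto simp: core_def)
  have "y \<in> block y" using block_self kidsD(3)[OF y] by blast
  then have "z = y" using kid_blocks(2)[OF c _ y, of z] z Z by blast
  then show "y \<in> Z" using z by simp
next
  assume "y \<in> Z"
  then show "y \<in> core c Z" using block_self[OF kidsD(3)[OF y]] by (auto simp: core_def)
qed

text \<open>Closedness consults only the first position of each kid. Goodness of the block of
  \<open>b\<close> extends the comparison of \<open>c\<close> with \<open>x\<close> from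
  \<open>b\<close> to all pivots of that block, and the block of \<open>x\<close>, being a module,
  extends it from \<open>x\<close> to all of its elements.\<close>

lemma closed_iff_md:
  assumes c: "c < n" and Z: "Z \<subseteq> kids c"
  shows "md (core c Z) \<longleftrightarrow> closed_in c Z"
proof
  assume m: "md (core c Z)"
  have "\<not> forces c x y" if "x \<in> Z" "y \<in> kids c - Z" for x y
  proof -
    have "y \<notin> core c Z" "x \<in> core c Z" "c \<in> core c Z" "y < n"
      using core_mem[OF c Z] that Z kidsD(3) by (auto simp: core_def)
    then show ?thesis using mdD[OF m, of y c x] by (simp add: forces_def)
  qed
  then show "closed_in c Z" using Z by (auto simp: closed_in_def)
next
  assume cl: "closed_in c Z"
  have "\<Union>(block ` Z) \<subseteq> {c<..<en c}" unfolding kid_blocks(1)[OF c] using Z by blast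
  then have sub: "core c Z \<subseteq> block c" using block_self[OF c] unfolding core_def by auto
  show "md (core c Z)"
    unfolding md_iff
  proof (intro conjI ballI)
    show "core c Z \<subseteq> {..<n}" using sub en_bounds(2)[OF c] by auto
  next
    fix y m m' assume y: "y \<in> {..<n} - core c Z" and m: "m \<in> core c Z" "m' \<in> core c Z"
    have "a y c = a y m" if m: "m \<in> core c Z" for m
    proof (cases "y \<in> block c")
      case False
      then show ?thesis using mdD[OF block_md[OF c], of y c m] y m sub block_self[OF c] by blast
    next
      case True
      then have "y \<in> {c<..<en c}" using y by (auto simp: core_def le_less)
      then obtain b where b: "b \<in> kids c" "y \<in> block b" using kid_blocks(1)[OF c] by blast
      have bZ: "b \<notin> Z" using b y by (auto simp: core_def)
      show ?thesis
      proof (cases "m = c")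
        case False
        then obtain x where x: "x \<in> Z" "m \<in> block x" using m by (auto simp: core_def)
        have xk: "x \<in> kids c" "x \<noteq> b" using x Z bZ by auto
        have dis: "block x \<inter> block b = {}" using kid_blocks(2)[OF c xk(1) b(1) xk(2)] .
        have bn: "b < n" "x < n" using kidsD(3) b xk by auto
        have "a b c = a b x" using cl x(1) b(1) bZ by (auto simp: closed_in_def forces_def)
        moreover have "c \<in> {..<n} - block b" "x \<in> {..<n} - block b"
          using c kidsD(1)[OF b(1)] bn block_self[OF bn(2)] dis by auto
        ultimately have "a y c = a y x" using goodD[OF block_md[OF bn(1)] block_self[OF bn(1)] b(2)] by blast
        moreover have "a y x = a y m"
          using mdD[OF block_md[OF bn(2)], of y x m] y b(2) dis x(2) block_self[OF bn(2)] by blast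
        ultimately show ?thesis by simp
      qed simp
    qed
    then show "a y m = a y m'" using m by metis
  qed
qed

lemma core_Un: "core c (Z \<union> K) = core c Z \<union> \<Union>(block ` K)"
  by (auto simp: core_def)

lemma core_kids: "c < n \<Longrightarrow> core c (kids c) = block c"
  unfolding core_def kid_blocks(1)[symmetric] using en_bounds(1)[of c] by auto

lemma core_empty: "core c {} = {c}"
  by (simp add: core_def)

text \<open>A strongly connected component \<open>K\<close> that is a sink among the remaining children.\<close>

definition sink_component :: "nat \<Rightarrow> nat set \<Rightarrow> nat set \<Rightarrow> bool" where
  "sink_component c D K \<longleftrightarrow> closed_in c D \<and> closed_in c (D \<union> K) \<and> K \<noteq> {} \<and> D \<inter> K = {} \<and>
     (\<forall>Z. closed_in c Z \<longrightarrow> Z \<inter> K \<noteq> {} \<longrightarrow> K \<subseteq> Z)"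

lemma sink_componentD:
  assumes c: "c < n" and S: "sink_component c D K"
  shows "D \<subseteq> kids c" "K \<subseteq> kids c" "md (core c D)" "md (core c (D \<union> K))" "b \<in> K \<Longrightarrow> block b \<inter> core c D = {}"
proof -
  show D: "D \<subseteq> kids c" and K: "K \<subseteq> kids c" using S by (auto simp: sink_component_def closed_in_def)
  show "md (core c D)" "md (core c (D \<union> K))"
    using S D K closed_iff_md[OF c, of D] closed_iff_md[OF c, of "D \<union> K"] by (auto simp: sink_component_def)
  show "block b \<inter> core c D = {}" if b: "b \<in> K" for b
  proof -
    have "block b \<inter> block z = {}" if "z \<in> D" for z
      using kid_blocks(2)[OF c, of b z] b K D S that by (auto simp: sink_component_def)
    moreover have "c \<notin> block b" using kidsD(1)[of b c] b K by auto
    ultimately show ?thesis unfolding core_def by blast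
  qed
qed

text \<open>A union with \<open>core c D\<close> inside corresponds to a closed set; if it meets
  \<open>K\<close>, it contains \<open>K\<close>. A union without it is a module inside the block of
  \<open>c\<close> avoiding \<open>c\<close>, so it fits into one kid. Hence only trivial unions are
  modules and \<open>decomp_prime\<close> applies.\<close>

lemma component_prime:
  assumes c: "c < n" and S: "sink_component c D (set bs)" and bs: "distinct bs" "2 \<le> length bs"
  shows "decomp (core c (D \<union> set bs)) Prime (core c D # map block bs)"
proof -
  define K where "K = set bs"
  have S': "sink_component c D K" using S by (simp add: K_def)
  note sc = sink_componentD[OF c S']
  have bn: "b < n" if "b \<in> K" for b using kidsD(3) sc(2) that by blast
  have inj: "inj_on block K"
  proof (rule inj_onI)
    fix x y assume x: "x \<in> K" and y: "y \<in> K" and eq: "block x = block y"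
    have "x \<in> block y" using block_self[OF bn[OF x]] unfolding eq .
    moreover have "y \<in> block x" unfolding eq using block_self[OF bn[OF y]] .
    ultimately show "x = y" by simp
  qed
  have V: "set (core c D # map block bs) = insert (core c D) (block ` K)" by (simp add: K_def)
  have coreD: "core c D \<notin> block ` K"
  proof
    assume "core c D \<in> block ` K"
    then obtain b where "b \<in> K" "block b = core c D" by blast
    then show False using sc(5)[of b] by (auto simp: core_def)
  qed
  have disj: "disjoint (insert (core c D) (block ` K))"
  proof (rule disjointI)
    fix X Y assume "X \<in> insert (core c D) (block ` K)" "Y \<in> insert (core c D) (block ` K)" "X \<noteq> Y"
    then consider (1) x y where "X = block x" "Y = block y" "x \<in> K" "y \<in> K" "x \<noteq> y"
      | (2) x where "X = block x" "Y = core c D" "x \<in> K" | (3) x where "Y = block x" "X = core c D" "x \<in> K" by blast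
    then show "X \<inter> Y = {}"
    proof cases
      case 1
      then show ?thesis using kid_blocks(2)[OF c, of x y] sc(2) by blast
    next
      case 2
      then show ?thesis using sc(5) by blast
    next
      case 3
      then show ?thesis using sc(5) by blast
    qed
  qed
  show ?thesis
  proof (rule decomp_prime)
    show "md (core c (D \<union> set bs))" using sc(4) by (simp add: K_def)
    show "\<Union>(set (core c D # map block bs)) = core c (D \<union> set bs)" by (simp add: core_Un K_def)
    show "3 \<le> length (core c D # map block bs)" using bs by simp
    show "distinct (core c D # map block bs)"
      using bs(1) inj coreD by (simp add: distinct_map K_def)
    have "c \<in> core c D" by (simp add: core_def)
    then show "{} \<notin> set (core c D # map block bs)" using block_self[OF bn] V by auto
    show "disjoint (set (core c D # map block bs))" unfolding V by (rule disj)
    show "md C" if "C \<in> set (core c D # map block bs)" for C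
      using that sc(3) block_md[OF bn] unfolding V by auto
  next
    fix T assume T: "T \<subseteq> set (core c D # map block bs)" "md (\<Union>T)"
    have ub: "block b \<subseteq> {c<..<en c}" if "b \<in> K" for b using kid_blocks(1)[OF c] that sc(2) by blast
    show "T = {} \<or> card T = 1 \<or> T = set (core c D # map block bs)"
    proof (cases "core c D \<in> T")
      case False
      then have Tb: "T \<subseteq> block ` K" using T(1) unfolding V by (simp add: subset_insert)
      show ?thesis
      proof (cases "T = {}")
        case False
        then obtain b where b: "b \<in> K" "block b \<in> T" using Tb by blast
        have "\<Union>T \<noteq> {}" using b block_self[OF bn[OF b(1)]] by blast
        moreover have "\<Union>T \<subseteq> {c<..<en c}" using Tb ub by blast
        ultimately obtain b' where b': "b' \<in> kids c" "\<Union>T \<subseteq> block b'" using maximal_kid[OF c T(2)] by blast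
        have "x = b'" if "x \<in> K" "block x \<in> T" for x
        proof (rule ccontr)
          assume "x \<noteq> b'"
          then have "block x \<inter> block b' = {}" using kid_blocks(2)[OF c _ b'(1), of x] that sc(2) by blast
          moreover have "x \<in> block x" using block_self bn that by blast
          ultimately show False using that b'(2) by blast
        qed
        then have "T = {block b'}" using Tb b by blast
        then show ?thesis by simp
      qed simp
    next
      case True
      define K' where "K' = {b \<in> K. block b \<in> T}"
      have T_eq: "T = insert (core c D) (block ` K')" using True T(1) V by (auto simp: K'_def)
      then have "\<Union>T = core c (D \<union> K')" by (simp add: core_Un)
      moreover have DK: "D \<union> K' \<subseteq> kids c" using sc(1,2) by (auto simp: K'_def)
      ultimately have cl: "closed_in c (D \<union> K')" using T(2) closed_iff_md[OF c DK] by simp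
      show ?thesis
      proof (cases "K' = {}")
        case True
        then show ?thesis using T_eq by simp
      next
        case False
        then have "(D \<union> K') \<inter> K \<noteq> {}" by (auto simp: K'_def)
        then have "K \<subseteq> D \<union> K'" using S' cl unfolding sink_component_def by blast
        then have "K' = K" using S' by (auto simp: sink_component_def K'_def)
        then show ?thesis using T_eq V by simp
      qed
    qed
  qed
qed

section \<open>The path-based search\<close>

text \<open>
  The path-based search for strongly connected components. Level 0 holds the finished children (and
  all positions that are not children), level 1 the unvisited ones, and the levels from 3 on the
  sets of the current path; level 2 is the empty path.
\<close>

definition path_ok :: "nat \<Rightarrow> (nat \<Rightarrow> nat) \<Rightarrow> nat \<Rightarrow> bool" where
  "path_ok c V r \<longleftrightarrow> 2 \<le> r \<and> (\<forall>z. V z \<noteq> 0 \<longrightarrow> z \<in> kids c \<and> V z \<le> r \<and> V z \<noteq> 2) \<and> (\<forall>j. 3 \<le> j \<longrightarrow> j \<le> r \<longrightarrow> (\<exists>z. V z = j)) \<and>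
     closed_in c {z \<in> kids c. V z = 0} \<and>
     (\<forall>Z. closed_in c Z \<longrightarrow> (\<forall>x\<in>Z. 3 \<le> V x \<longrightarrow> (\<forall>y\<in>kids c. V x \<le> V y \<longrightarrow> y \<in> Z)))"

definition finished :: "nat \<Rightarrow> (nat \<Rightarrow> nat) \<Rightarrow> nat set" where
  "finished c V = {z \<in> kids c. V z = 0}"

lemma path_init:
  assumes "c < n" "\<And>z. V z = (if z \<in> kids c then 1 else 0)"
  shows "path_ok c V 2"
  using assms by (auto simp: path_ok_def closed_in_def)

text \<open>The new top level is forced from the old one, so a closed set that contains some path
  element still contains everything above it.\<close>

lemma path_push:
  assumes ok: "path_ok c V r" and y: "V y = 1" and f: "3 \<le> r \<Longrightarrow> \<exists>x. V x = r \<and> forces c x y"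
  shows "path_ok c (V(y := Suc r)) (Suc r)"
proof -
  have r: "2 \<le> r" and V: "\<And>z. V z \<noteq> 0 \<Longrightarrow> z \<in> kids c \<and> V z \<le> r \<and> V z \<noteq> 2"
    and ne: "\<And>j. 3 \<le> j \<Longrightarrow> j \<le> r \<Longrightarrow> \<exists>z. V z = j" and cl: "closed_in c {z \<in> kids c. V z = 0}"
    and con: "\<And>Z x y. closed_in c Z \<Longrightarrow> x \<in> Z \<Longrightarrow> 3 \<le> V x \<Longrightarrow> y \<in> kids c \<Longrightarrow> V x \<le> V y \<Longrightarrow> y \<in> Z"
    using ok unfolding path_ok_def by blast+
  have yk: "y \<in> kids c" using V[of y] y by simp
  show ?thesis
    unfolding path_ok_def
  proof (intro conjI allI impI ballI)
    show "2 \<le> Suc r" using r by simp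
    show "z \<in> kids c" "(V(y := Suc r)) z \<le> Suc r" "(V(y := Suc r)) z \<noteq> 2" if "(V(y := Suc r)) z \<noteq> 0" for z
      using that V[of z] yk r by (auto split: if_splits)
    show "\<exists>z. (V(y := Suc r)) z = j" if jr: "3 \<le> j" "j \<le> Suc r" for j
    proof (cases "j = Suc r")
      case False
      then have "\<exists>z. V z = j" using ne[of j] jr by simp
      then obtain z where "V z = j" by blast
      then show ?thesis using y jr by (intro exI[of _ z]) auto
    qed (auto intro: exI[of _ y])
    have "{z \<in> kids c. (V(y := Suc r)) z = 0} = {z \<in> kids c. V z = 0}" using y by auto
    then show "closed_in c {z \<in> kids c. (V(y := Suc r)) z = 0}" using cl by simp
  next
    fix Z x w assume Z: "closed_in c Z" "x \<in> Z" "3 \<le> (V(y := Suc r)) x" and w: "w \<in> kids c" "(V(y := Suc r)) x \<le> (V(y := Suc r)) w"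
    show "w \<in> Z"
    proof (cases "x = y")
      case True
      then have "w = y" using w V[of w] by (auto split: if_splits)
      then show ?thesis using True Z by simp
    next
      case False
      then have x3: "3 \<le> V x" using Z by simp
      then have "V x \<le> r" using V[of x] by auto
      then have r3: "3 \<le> r" using x3 by simp
      show ?thesis
      proof (cases "w = y")
        case False
        then show ?thesis using con[OF Z(1,2) x3 w(1)] w(2) \<open>x \<noteq> y\<close> by simp
      next
        case True
        obtain u where u: "V u = r" "forces c u y" using f[OF r3] by blast
        have "u \<in> Z" using con[OF Z(1,2) x3, of u] V[of u] u(1) r3 \<open>V x \<le> r\<close> by auto
        then show ?thesis using Z(1) u(2) yk True unfolding closed_in_def by blast
      qed
    qed
  qed
qed

text \<open>The top forces an element \<open>y\<close> of a lower level, so a closed set reached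
  from either of the two topmost levels contains both. Only these two are merged; if
  \<open>y\<close> lies deeper, the same edge triggers further merges.\<close>

lemma path_merge:
  assumes ok: "path_ok c V r" and y: "V y \<noteq> 0" "V y \<noteq> 1" "V y \<noteq> r" and f: "\<exists>x. V x = r \<and> forces c x y"
  shows "path_ok c (\<lambda>z. if V z = r then r - 1 else V z) (r - 1)" "4 \<le> r"
proof -
  have V: "\<And>z. V z \<noteq> 0 \<Longrightarrow> z \<in> kids c \<and> V z \<le> r \<and> V z \<noteq> 2"
    and ne: "\<And>j. 3 \<le> j \<Longrightarrow> j \<le> r \<Longrightarrow> \<exists>z. V z = j" and cl: "closed_in c {z \<in> kids c. V z = 0}"
    and con: "\<And>Z x y. closed_in c Z \<Longrightarrow> x \<in> Z \<Longrightarrow> 3 \<le> V x \<Longrightarrow> y \<in> kids c \<Longrightarrow> V x \<le> V y \<Longrightarrow> y \<in> Z"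
    using ok unfolding path_ok_def by blast+
  have yk: "y \<in> kids c" "3 \<le> V y" "V y < r" using V[of y] y by auto
  then show r: "4 \<le> r" by simp
  obtain u where u: "V u = r" "forces c u y" using f by blast
  have u': "u \<in> kids c" using V[of u] u(1) r by simp
  let ?V = "\<lambda>z. if V z = r then r - 1 else V z"
  show "path_ok c ?V (r - 1)"
    unfolding path_ok_def
  proof (intro conjI allI impI ballI)
    show "2 \<le> r - 1" using r by simp
    show "z \<in> kids c" "?V z \<le> r - 1" "?V z \<noteq> 2" if "?V z \<noteq> 0" for z
      using that V[of z] r by (auto split: if_splits)
    show "\<exists>z. ?V z = j" if jr: "3 \<le> j" "j \<le> r - 1" for j
    proof -
      have "\<exists>z. V z = j" using ne[of j] jr by simp
      then obtain z where "V z = j" by blast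
      then show ?thesis using jr r by (intro exI[of _ z]) auto
    qed
    have "{z \<in> kids c. ?V z = 0} = {z \<in> kids c. V z = 0}" using r by auto
    then show "closed_in c {z \<in> kids c. ?V z = 0}" using cl by simp
  next
    fix Z x w assume Z: "closed_in c Z" "x \<in> Z" "3 \<le> ?V x" and w: "w \<in> kids c" "?V x \<le> ?V w"
    have x3: "3 \<le> V x" using Z(3) r by (auto split: if_splits)
    show "w \<in> Z"
    proof (cases "V x = r")
      case False
      have "V x \<le> V w" using w(2) False by (auto split: if_splits)
      then show ?thesis using con[OF Z(1,2) x3 w(1)] by simp
    next
      case True
      have "u \<in> Z" using con[OF Z(1,2) x3 u'] u(1) True by simp
      then have yZ: "y \<in> Z" using Z(1) u(2) yk(1) unfolding closed_in_def by blast
      have "V y \<le> V w" using w(2) True yk(3) by (auto split: if_splits)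
      then show ?thesis using con[OF Z(1) yZ yk(2) w(1)] by simp
    qed
  qed
qed

text \<open>Since the top level forces only finished kids, it is closed together with them; and
  \<open>path_ok\<close> makes every closed set that meets the level contain it. These are the two
  properties of a sink component.\<close>

lemma path_output:
  assumes ok: "path_ok c V r" and r: "3 \<le> r"
    and no: "\<And>x y. V x = r \<Longrightarrow> V y \<noteq> 0 \<Longrightarrow> V y \<noteq> r \<Longrightarrow> \<not> forces c x y"
  shows "sink_component c (finished c V) {z. V z = r}"
    "path_ok c (\<lambda>z. if V z = r then 0 else V z) (r - 1)"
    "finished c (\<lambda>z. if V z = r then 0 else V z) = finished c V \<union> {z. V z = r}"
proof -
  have V: "\<And>z. V z \<noteq> 0 \<Longrightarrow> z \<in> kids c \<and> V z \<le> r \<and> V z \<noteq> 2"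
    and ne: "\<And>j. 3 \<le> j \<Longrightarrow> j \<le> r \<Longrightarrow> \<exists>z. V z = j" and cl: "closed_in c {z \<in> kids c. V z = 0}"
    and con: "\<And>Z x y. closed_in c Z \<Longrightarrow> x \<in> Z \<Longrightarrow> 3 \<le> V x \<Longrightarrow> y \<in> kids c \<Longrightarrow> V x \<le> V y \<Longrightarrow> y \<in> Z"
    using ok unfolding path_ok_def by blast+
  have rk: "z \<in> kids c" if "V z = r" for z using V[of z] that r by simp
  let ?V = "\<lambda>z. if V z = r then 0 else V z"
  show fin: "finished c ?V = finished c V \<union> {z. V z = r}" using rk by (auto simp: finished_def)
  have cl': "closed_in c (finished c V \<union> {z. V z = r})"
    using cl no rk by (auto simp: closed_in_def finished_def)
  show "sink_component c (finished c V) {z. V z = r}"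
    unfolding sink_component_def
  proof (intro conjI allI impI)
    show "closed_in c (finished c V)" using cl by (simp add: finished_def)
    show "closed_in c (finished c V \<union> {z. V z = r})" by (rule cl')
    show "{z. V z = r} \<noteq> {}" using ne[of r] r by auto
    show "finished c V \<inter> {z. V z = r} = {}" using r by (auto simp: finished_def)
    fix Z assume Z: "closed_in c Z" "Z \<inter> {z. V z = r} \<noteq> {}"
    then obtain x where x: "x \<in> Z" "V x = r" by blast
    show "{z. V z = r} \<subseteq> Z"
    proof
      fix w assume "w \<in> {z. V z = r}"
      then show "w \<in> Z" using con[OF Z(1) x(1), of w] x(2) r rk[of w] by simp
    qed
  qed
  show "path_ok c ?V (r - 1)"
    unfolding path_ok_def
  proof (intro conjI allI impI ballI)
    show "2 \<le> r - 1" using r by simp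
    show "z \<in> kids c" "?V z \<le> r - 1" "?V z \<noteq> 2" if "?V z \<noteq> 0" for z
      using that V[of z] r by (auto split: if_splits)
    show "\<exists>z. ?V z = j" if jr: "3 \<le> j" "j \<le> r - 1" for j
    proof -
      have "\<exists>z. V z = j" using ne[of j] jr by simp
      then obtain z where "V z = j" by blast
      then show ?thesis using jr r by (intro exI[of _ z]) auto
    qed
    show "closed_in c {z \<in> kids c. ?V z = 0}" using cl' fin by (simp add: finished_def)
  next
    fix Z x w assume "closed_in c Z" "x \<in> Z" "3 \<le> ?V x" "w \<in> kids c" "?V x \<le> ?V w"
    then show "w \<in> Z" using con[of Z x w] by (auto split: if_splits)
  qed
qed

end

section \<open>Trees in memory\<close>

text \<open>Trees annotated with the addresses of their records.\<close>

datatype atree = ALeaf nat nat | ANode nat node_type "atree list"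

fun rid :: "atree \<Rightarrow> nat" where
  "rid (ALeaf g i) = g" | "rid (ANode g ty ts) = g"

fun strip :: "atree \<Rightarrow> nat mdtree" where
  "strip (ALeaf g i) = Leaf i" | "strip (ANode g ty ts) = Node ty (map strip ts)"

fun ids :: "atree \<Rightarrow> nat list" where
  "ids (ALeaf g i) = [g]" | "ids (ANode g ty ts) = g # concat (map ids ts)"

lemma rid_in_ids: "rid t \<in> set (ids t)"
  by (cases t) auto

lemma distinct_concat_rev: "distinct (concat (rev xs)) \<longleftrightarrow> distinct (concat xs)"
  by (induction xs) auto

lemma distinct_concat_rid: "distinct (concat (map ids ts)) \<Longrightarrow> distinct (map rid ts)"
proof (induction ts)
  case (Cons t ts)
  have "rid t \<noteq> rid u" if "u \<in> set ts" for u
  proof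
    assume "rid t = rid u"
    then have "rid t \<in> set (concat (map ids ts))" using that rid_in_ids[of u] by auto
    then show False using Cons.prems rid_in_ids[of t] by auto
  qed
  then show ?case using Cons by auto
qed simp

lemma distinct_concat_rid_notin:
  assumes "distinct (concat (map ids ts))" "u \<in> set ts" "x \<in> set (ids u) - {rid u}"
  shows "x \<notin> set (map rid ts)"
proof
  assume "x \<in> set (map rid ts)"
  then obtain t where t: "t \<in> set ts" "x = rid t" by auto
  have "t \<noteq> u" using t assms(3) by auto
  obtain xs ys where ts: "ts = xs @ u # ys" using assms(2) by (meson split_list)
  then have "t \<in> set xs \<union> set ys" using t(1) \<open>t \<noteq> u\<close> by auto
  then have "x \<in> set (concat (map ids xs)) \<union> set (concat (map ids ys))" using t(2) rid_in_ids[of t] by auto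
  then show False using assms(1,3) unfolding ts by auto
qed

type_synonym memory = "string \<Rightarrow> nat \<Rightarrow> nat"

fun linked :: "(nat \<Rightarrow> nat) \<Rightarrow> nat \<Rightarrow> nat list \<Rightarrow> bool" where
  "linked nx p [] \<longleftrightarrow> p = 0"
| "linked nx p (g # gs) \<longleftrightarrow> p = g \<and> g \<noteq> 0 \<and> linked nx (nx g) gs"

text \<open>\<open>N\<close> holds the index of some leaf below the node and \<open>Z\<close> points
  to its last child, so representatives of both outer children are reached in constant time. The
  field \<open>next\<close> of the root is left open, as it belongs to the list in which the tree
  hangs.\<close>

fun hok :: "memory \<Rightarrow> (nat \<Rightarrow> nat) \<Rightarrow> atree \<Rightarrow> bool" where
  "hok m P (ALeaf g i) \<longleftrightarrow> g \<noteq> 0 \<and> m ''kind'' g = 0 \<and> m ''label'' g = P i \<and> m ''N'' g = P i"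
| "hok m P (ANode g ty ts) \<longleftrightarrow> g \<noteq> 0 \<and> m ''kind'' g = type_code ty \<and> ts \<noteq> [] \<and>
     linked (m ''next'') (m ''child'' g) (map rid ts) \<and> m ''Z'' g = rid (last ts) \<and>
     (\<exists>i\<in>set_mdtree (Node ty (map strip ts)). m ''N'' g = P i) \<and> (\<forall>t\<in>set ts. hok m P t)"

lemma hok_label: "hok m P t \<Longrightarrow> \<exists>i\<in>set_mdtree (strip t). m ''N'' (rid t) = P i"
  by (cases t) auto

lemma stored_forest_linked:
  "linked (m ''next'') p (map rid ts) \<Longrightarrow> (\<And>t. t \<in> set ts \<Longrightarrow> stored_tree m (rid t) (map_mdtree P (strip t))) \<Longrightarrow>
   stored_forest m p (map (\<lambda>t. map_mdtree P (strip t)) ts)"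
  by (induction ts arbitrary: p) auto

lemma stored_tree_hok: "hok m P t \<Longrightarrow> stored_tree m (rid t) (map_mdtree P (strip t))"
proof (induction t)
  case (ANode g ty ts)
  then show ?case
    using stored_forest_linked[of m "m ''child'' g" ts P] by (auto simp: comp_def)
qed auto

lemma linked_cong: "linked nx p gs \<Longrightarrow> (\<And>g. g \<in> set gs \<Longrightarrow> nx' g = nx g) \<Longrightarrow> linked nx' p gs"
  by (induction gs arbitrary: p) auto

text \<open>The field \<open>next\<close> of the root is exempt for the same reason: linking a
  finished tree into a list of siblings must not count as a change of the tree.\<close>

definition agree :: "memory \<Rightarrow> memory \<Rightarrow> atree \<Rightarrow> bool" where
  "agree m m' t \<longleftrightarrow> (\<forall>g\<in>set (ids t). \<forall>w\<in>{''kind'', ''label'', ''child'', ''Z'', ''N''}. m' w g = m w g) \<and>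
     (\<forall>g\<in>set (ids t) - {rid t}. m' ''next'' g = m ''next'' g)"

lemma hok_agree: "hok m P t \<Longrightarrow> distinct (ids t) \<Longrightarrow> agree m m' t \<Longrightarrow> hok m' P t"
proof (induction t)
  case (ANode g ty ts)
  have ag: "agree m m' t" if "t \<in> set ts" for t
  proof -
    have "set (ids t) \<subseteq> set (ids (ANode g ty ts))" "g \<notin> set (ids t)" using that ANode.prems(2) by auto
    then show ?thesis using ANode.prems(3) unfolding agree_def by auto
  qed
  have "hok m' P t" if "t \<in> set ts" for t
    using ANode.IH[OF that] ANode.prems(1,2) ag[OF that] that by (auto simp: distinct_concat_iff)
  moreover have "linked (m' ''next'') (m' ''child'' g) (map rid ts)"
  proof -
    have "m' ''next'' h = m ''next'' h" if "h \<in> set (map rid ts)" for h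
      using that ANode.prems(2,3) rid_in_ids unfolding agree_def by fastforce
    then have "linked (m' ''next'') (m ''child'' g) (map rid ts)"
      using ANode.prems(1) linked_cong[of "m ''next''" "m ''child'' g" "map rid ts" "m' ''next''"] by simp
    then show ?thesis using ANode.prems(3) by (simp add: agree_def)
  qed
  ultimately show ?case using ANode.prems by (simp add: agree_def)
qed (auto simp: agree_def)

lemma (in good_matrix) set_mdtree_local_tree: "local_tree M t \<Longrightarrow> set_mdtree t = M"
proof (induction M t rule: local_tree.induct)
  case (Node M ty Cs ts)
  have "\<Union>(set_mdtree ` set ts) = \<Union>(set Cs)"
    using Node(2) by (induction rule: list_all2_induct) auto
  then show ?case using decompD(6)[OF Node(1)] by simp
qed simp

lemma linked_iff:
  "gs \<noteq> [] \<Longrightarrow> linked nx p gs \<longleftrightarrow> p = hd gs \<and> 0 \<notin> set gs \<and> successively (\<lambda>x y. nx x = y) gs \<and> nx (last gs) = 0"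
proof (induction gs arbitrary: p rule: induct_list012)
  case (3 x y zs)
  then show ?case by auto
qed auto

lemma linked_append: "linked nx p (xs @ ys) \<longleftrightarrow> (xs = [] \<and> linked nx p ys) \<or>
   (xs \<noteq> [] \<and> p = hd xs \<and> 0 \<notin> set xs \<and> successively (\<lambda>x y. nx x = y) xs \<and> linked nx (nx (last xs)) ys)"
proof (induction xs arbitrary: p rule: induct_list012)
  case (3 x y zs)
  then show ?case by auto
qed auto

section \<open>Reversing and orienting a list of siblings\<close>

definition reverse_prog :: com where
  "reverse_prog = Assign ''v'' (Const 0) ;;
    While (Neg (Eq (Var ''h'') (Const 0)))
     (Assign ''w'' (Read ''next'' (Var ''h'')) ;;
      Write ''next'' (Var ''h'') (Var ''v'') ;;
      Assign ''v'' (Var ''h'') ;;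
      Assign ''h'' (Var ''w'')) ;;
    Assign ''h'' (Var ''v'')"

text \<open>\<open>b\<close> and \<open>m\<close> hold the outcomes of the two outer tests. Their
  sum tells kept, linear or complete, and comparing \<open>b\<close> with \<open>d\<close> decides
  about reversal. The kinds 1 and 2 are the types that may dissolve; \<open>a\<close> is raised to
  the code of a linear node if one side demands it.\<close>

definition orient_prog :: com where
  "orient_prog = Assign ''h'' (Var ''u'') ;; Assign ''t'' (Var ''u'') ;;
    Cond (Conj (Less (Const 0) (Read ''kind'' (Var ''u''))) (Less (Read ''kind'' (Var ''u'')) (Const 3)))
     (Assign ''x'' (Read ''N'' (Read ''child'' (Var ''u''))) ;;
      Assign ''e'' (Read ''N'' (Read ''Z'' (Var ''u''))) ;;
      Assign ''b'' (Const 0) ;; Assign ''m'' (Const 0) ;;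
      Cond (Eq (Read ''A'' (Plus (Times (Var ''x'') (Var ''n'')) (Var ''e''))) (Read ''A'' (Plus (Times (Var ''x'') (Var ''n'')) (Var ''f''))))
        (Assign ''b'' (Const 1)) Skip ;;
      Cond (Eq (Read ''A'' (Plus (Times (Var ''e'') (Var ''n'')) (Var ''x''))) (Read ''A'' (Plus (Times (Var ''e'') (Var ''n'')) (Var ''f''))))
        (Assign ''m'' (Const 1)) Skip ;;
      Cond (Less (Const 0) (Plus (Var ''b'') (Var ''m'')))
       (Assign ''h'' (Read ''child'' (Var ''u'')) ;; Assign ''t'' (Read ''Z'' (Var ''u'')) ;;
        Cond (Eq (Plus (Var ''b'') (Var ''m'')) (Const 1))
          (Assign ''a'' (Const 2) ;;
           Cond (Eq (Var ''b'') (Var ''d'')) Skip (Assign ''t'' (Var ''h'') ;; reverse_prog))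
          Skip)
       Skip)
     Skip"

locale build = word_bound n B A + hierarchy n a en for n B A a en +
  fixes P :: "nat \<Rightarrow> nat"
  assumes P_less: "i < n \<Longrightarrow> P i < n" and a_eq: "i < n \<Longrightarrow> j < n \<Longrightarrow> a i j = mt (P i) (P j)"
begin

lemma reverse_wp:
  fixes s :: store
  assumes l: "linked (snd s ''next'') (fst s ''h'') gs" "distinct gs" "\<And>g. g \<in> set gs \<Longrightarrow> g \<le> 3 * n" "gs \<noteq> []"
    and gas: "50 * int (length gs) + 50 + G \<le> g" "0 \<le> G"
    and Q: "\<And>g' s'. frame {''v'', ''w'', ''h''} {''next''} s s' \<Longrightarrow> fst s' ''h'' = last gs \<Longrightarrow>
      linked (snd s' ''next'') (last gs) (rev gs) \<Longrightarrow> (\<And>x. x \<notin> set gs \<Longrightarrow> snd s' ''next'' x = snd s ''next'' x) \<Longrightarrow> G \<le> g' \<Longrightarrow> Q g' s'"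
  shows "wp B reverse_prog Q g s"
proof -
  define ok where "ok xs ys g' s' \<longleftrightarrow> frame {''v'', ''w'', ''h''} {''next''} s s' \<and> gs = xs @ ys \<and>
    linked (snd s' ''next'') (fst s' ''h'') ys \<and> linked (snd s' ''next'') (fst s' ''v'') (rev xs) \<and>
    (\<forall>x. x \<notin> set gs \<longrightarrow> snd s' ''next'' x = snd s ''next'' x) \<and> 50 * int (length ys) + 20 + G \<le> g'" for xs ys g' and s' :: store
  define I where "I g' s' \<longleftrightarrow> (\<exists>xs ys. ok xs ys g' s')" for g' s'
  have ok_mono: "ok xs ys g1 s' \<Longrightarrow> g1 \<le> g2 \<Longrightarrow> ok xs ys g2 s'" for xs ys g1 g2 s' by (simp add: ok_def)
  have small: "x \<le> 3 * n \<Longrightarrow> x < B" for x by (intro small_fits) simp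
  have b: "fst s' ''h'' \<le> 3 * n" "fst s' ''v'' \<le> 3 * n" if o: "ok xs ys g' s'" for xs ys g' s'
  proof -
    have "fst s' ''h'' = 0 \<or> fst s' ''h'' \<in> set gs" using o by (cases ys) (auto simp: ok_def)
    then show "fst s' ''h'' \<le> 3 * n" using l(3) by auto
    have "fst s' ''v'' = 0 \<or> fst s' ''v'' \<in> set gs" using o by (cases xs rule: rev_cases) (auto simp: ok_def)
    then show "fst s' ''v'' \<le> 3 * n" using l(3) by auto
  qed
  have loop: "wp B (While (Neg (Eq (Var ''h'') (Const 0)))
     (Assign ''w'' (Read ''next'' (Var ''h'')) ;; Write ''next'' (Var ''h'') (Var ''v'') ;;
      Assign ''v'' (Var ''h'') ;; Assign ''h'' (Var ''w''))) (wp B (Assign ''h'' (Var ''v'')) Q) x ((fst s)(''v'' := 0), snd s)"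
    if x: "g - 10 \<le> x" for x
  proof (rule wp_While[where I = I], goal_cases)
    case 1
    have "ok [] gs x ((fst s)(''v'' := 0), snd s)" using l gas x by (simp add: ok_def frame_refl)
    then show ?case by (auto simp: I_def)
  next
    case (2 g' s')
    then obtain xs ys where o: "ok xs ys g' s'" by (auto simp: I_def)
    have "0 \<le> g'" using o gas(2) by (simp add: ok_def)
    then show ?case using b[OF o] by (simp add: small fit_simps)
  next
    case (3 g' s')
    then obtain xs ys where o: "ok xs ys g' s'" by (auto simp: I_def)
    then obtain y zs where ys: "ys = y # zs" using 3(2) by (cases ys) (auto simp: ok_def)
    have h: "fst s' ''h'' = y" "y \<noteq> 0" "linked (snd s' ''next'') (snd s' ''next'' y) zs" using o ys by (auto simp: ok_def)
    have d: "y \<notin> set zs" "y \<notin> set xs" using l(2) o ys by (auto simp: ok_def)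
    have nb: "snd s' ''next'' y \<le> 3 * n"
    proof -
      have "snd s' ''next'' y = 0 \<or> snd s' ''next'' y \<in> set gs" using h(3) o ys by (cases zs) (auto simp: ok_def)
      then show ?thesis using l(3) by auto
    qed
    let ?nx = "(snd s' ''next'')(y := fst s' ''v'')"
    have okn: "ok (xs @ [y]) zs (g' - 30) ((fst s')(''w'' := snd s' ''next'' y, ''v'' := y, ''h'' := snd s' ''next'' y), (snd s')(''next'' := ?nx))"
    proof -
      have "linked ?nx (snd s' ''next'' y) zs" using h(3) by (rule linked_cong) (use d in auto)
      moreover have "linked (snd s' ''next'') (fst s' ''v'') (rev xs)" using o unfolding ok_def by blast
      then have "linked ?nx (fst s' ''v'') (rev xs)" by (rule linked_cong) (use d in auto)
      moreover have "y \<in> set gs" using o ys by (auto simp: ok_def)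
      ultimately show ?thesis using o ys h by (auto simp: ok_def)
    qed
    have "I x ((fst s')(''w'' := snd s' ''next'' y, ''v'' := y, ''h'' := snd s' ''next'' y), (snd s')(''next'' := ?nx))" if "g' - 30 \<le> x" for x
      unfolding I_def by (rule exI[of _ "xs @ [y]"], rule exI[of _ zs], rule ok_mono[OF okn that])
    then show ?case using h b[OF o] nb by (simp add: wp_simps small)
  next
    case (4 g' s')
    then obtain xs ys where o: "ok xs ys g' s'" by (auto simp: I_def)
    then have "ys = []" using 4(2) by (cases ys) (auto simp: ok_def)
    then have e: "gs = xs" using o by (simp add: ok_def)
    then have v: "fst s' ''v'' = last gs" using o l(4) by (cases xs rule: rev_cases) (auto simp: ok_def)
    have "Q x ((fst s')(''h'' := last gs), snd s')" if "g' - 10 \<le> x" for x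
      by (rule Q) (use o e v that \<open>ys = []\<close> in \<open>auto simp: ok_def\<close>)
    then show ?case using b[OF o] v by (simp add: wp_simps small)
  qed
  then show ?thesis unfolding reverse_prog_def by (simp add: wp_simps fit_simps)
qed

text \<open>The memory side of \<open>oriented\<close>. Either \<open>tr\<close> is kept and its
  \<open>next\<close> field with it, or its children form a list that ends in the null pointer; no
  record outside \<open>tr\<close> is relinked.\<close>

definition oriented_list :: "memory \<Rightarrow> atree \<Rightarrow> nat set \<Rightarrow> nat \<Rightarrow> bool \<Rightarrow> memory \<Rightarrow> atree list \<Rightarrow> nat set list \<Rightarrow> bool \<Rightarrow> bool" where
  "oriented_list m tr F f d m' Ds Bs lin \<longleftrightarrow> Ds \<noteq> [] \<and> list_all2 local_tree Bs (map strip Ds) \<and> oriented F f d Bs lin \<and>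
     (\<forall>t\<in>set Ds. hok m' P t) \<and> distinct (concat (map ids Ds)) \<and> set (concat (map ids Ds)) \<subseteq> set (ids tr) \<and>
     successively (\<lambda>x y. m' ''next'' x = y) (map rid Ds) \<and>
     m' ''next'' (rid (last Ds)) = (if Ds = [tr] then m ''next'' (rid tr) else 0) \<and>
     (\<forall>x. x \<notin> set (ids tr) - {rid tr} \<longrightarrow> m' ''next'' x = m ''next'' x)"

abbreviation "orient_vars \<equiv> {''h'', ''t'', ''x'', ''e'', ''b'', ''m'', ''a'', ''v'', ''w''}"

lemma orient_wp:
  fixes s :: store
  assumes tr: "hok (snd s) P tr" "distinct (ids tr)" "\<And>g. g \<in> set (ids tr) \<Longrightarrow> g \<le> 3 * n" "length (ids tr) \<le> 3 * n"
      "local_tree F (strip tr)" "F \<subseteq> {..<n}"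
    and v: "fst s ''u'' = rid tr" "fst s ''f'' = P f" "f < n" "f \<notin> F" "fst s ''d'' = (if d then 1 else 0)" "fst s ''n'' = n" "snd s ''A'' = A"
    and gas: "150 * int n + 400 + G \<le> g" "0 \<le> G"
    and Q: "\<And>g' s' Ds Bs lin. frame orient_vars {''next''} s s' \<Longrightarrow> oriented_list (snd s) tr F f d (snd s') Ds Bs lin \<Longrightarrow>
      fst s' ''h'' = rid (hd Ds) \<Longrightarrow> fst s' ''t'' = rid (last Ds) \<Longrightarrow> fst s' ''a'' = (if lin then 2 else fst s ''a'') \<Longrightarrow> G \<le> g' \<Longrightarrow> Q g' s'"
  shows "wp B orient_prog Q g s"
proof -
  have small: "x \<le> 3 * n \<Longrightarrow> x < B" for x by (intro small_fits) simp
  have num: "2 < B" "3 < B" "Suc (Suc 0) < B" using n_pos by (auto intro!: small_fits)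
  have rb: "rid tr \<le> 3 * n" using tr(3) rid_in_ids by blast
  define k where "k = snd s ''kind'' (rid tr)"
  have kept: "oriented F f d [F] False \<Longrightarrow> oriented_list (snd s) tr F f d (snd s) [tr] [F] False"
    using tr by (simp add: oriented_list_def)
  show ?thesis
  proof (cases "0 < k \<and> k < 3")
    case False
    have "oriented F f d [F] False"
    proof (cases tr)
      case (ALeaf g i)
      then have "local_tree F (Leaf i)" using tr(5) by simp
      then have "F = {i}" "i \<in> {..<n}" by (auto elim: local_tree.cases)
      then show ?thesis by (auto intro: oriented.Singleton)
    next
      case (ANode g ty ts)
      then have "ty = Prime" using tr(1) False by (cases ty) (auto simp: k_def)
      have "local_tree F (Node ty (map strip ts))" using tr(5) ANode by simp
      then obtain Cs where D: "decomp F ty Cs" by (auto elim: local_tree.cases)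
      note dd = decompD[OF D]
      obtain x y where "x \<in> hd Cs" "y \<in> last Cs" using dd(4,11,12) by (metis ex_in_conv)
      then show ?thesis using D \<open>ty = Prime\<close> by (intro oriented.Kept) (auto simp: merges_def)
    qed
    then have "Q x ((fst s)(''h'' := rid tr, ''t'' := rid tr), snd s)" if "G \<le> x" for x
      by (intro Q[of _ "[tr]" "[F]" False]) (use kept that in \<open>simp_all add: frame_refl\<close>)
    moreover have "k \<le> 3"
    proof (cases tr)
      case (ANode q ty ts)
      then show ?thesis using tr(1) by (cases ty) (auto simp: k_def)
    qed (use tr(1) in \<open>auto simp: k_def\<close>)
    then have "k < B" using n_pos by (intro small) simp
    moreover have "k = 0 \<or> (0 < k \<and> \<not> k < 3)" using False by auto
    ultimately show ?thesis
      using v(1) rb gas unfolding orient_prog_def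
      by (elim disjE) (simp_all add: wp_simps small num fit_simps k_def[symmetric])
  next
    case True
    then obtain q ty ts where t: "tr = ANode q ty ts" using tr(1) by (cases tr) (auto simp: k_def)
    have ty: "ty \<noteq> Prime" using True tr(1) t by (auto simp: k_def)
    have hk: "linked (snd s ''next'') (snd s ''child'' q) (map rid ts)" "ts \<noteq> []" "snd s ''Z'' q = rid (last ts)"
      "\<And>t. t \<in> set ts \<Longrightarrow> hok (snd s) P t"
      using tr(1) t by auto
    have "local_tree F (Node ty (map strip ts))" using tr(5) t by simp
    then obtain Cs where D: "decomp F ty Cs" and Cs: "list_all2 local_tree Cs (map strip ts)" by (auto elim: local_tree.cases)
    note dd = decompD[OF D]
    have len: "length Cs = length ts" using Cs by (auto dest: list_all2_lengthD)
    have lt: "local_tree (hd Cs) (strip (hd ts))" "local_tree (last Cs) (strip (last ts))"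
    proof -
      have "local_tree (Cs ! i) (strip (ts ! i))" if "i < length ts" for i
        using list_all2_nthD[OF Cs, of i] that len by simp
      from this[of 0] this[of "length ts - 1"] show "local_tree (hd Cs) (strip (hd ts))" "local_tree (last Cs) (strip (last ts))"
        using hk(2) dd(10) len by (simp_all add: hd_conv_nth last_conv_nth)
    qed
    obtain x where x: "x \<in> hd Cs" "snd s ''N'' (rid (hd ts)) = P x"
      using hok_label[OF hk(4)[of "hd ts"]] hk(2) set_mdtree_local_tree[OF lt(1)] by auto
    obtain y where y: "y \<in> last Cs" "snd s ''N'' (rid (last ts)) = P y"
      using hok_label[OF hk(4)[of "last ts"]] hk(2) set_mdtree_local_tree[OF lt(2)] by auto
    have xy: "x < n" "y < n" "x \<in> F" "y \<in> F" using x y dd(6,11,12) tr(6) by blast+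
    have Pn: "P x < n" "P y < n" "P f < n" using P_less xy v(3) by auto
    have ch: "snd s ''child'' q = rid (hd ts)" using hk(1,2) by (cases ts) auto
    define c1 where "c1 \<longleftrightarrow> a x y = a x f"
    define c2 where "c2 \<longleftrightarrow> a y x = a y f"
    have cA: "c1 \<longleftrightarrow> A (P x * n + P y) = A (P x * n + P f)" "c2 \<longleftrightarrow> A (P y * n + P x) = A (P y * n + P f)"
      using a_eq xy v(3) by (simp_all add: c1_def c2_def mt_def)
    have rts: "rid t \<in> set (ids tr)" if "t \<in> set ts" for t using that t rid_in_ids[of t] by auto
    have rbs: "rid (hd ts) \<le> 3 * n" "rid (last ts) \<le> 3 * n" using rts hk(2) tr(3) by auto
    have kq: "snd s ''kind'' q = k" using t by (simp add: k_def)
    have g: "rid tr = q" "q \<notin> set (concat (map ids ts))" "distinct (concat (map ids ts))" using t tr(2) by auto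
    have kB: "k < B" using True num by simp
    have base_ol: "oriented_list (snd s) tr F f d (snd s) ts Bs lin"
      if "oriented F f d Bs lin" "list_all2 local_tree Bs (map strip ts)" for Bs lin
    proof -
      have "ts \<noteq> [tr]" using g(1,2) rid_in_ids[of tr] by auto
      then show ?thesis
        using that hk g t linked_iff[of "map rid ts" "snd s ''next''" "snd s ''child'' q"]
        by (auto simp: oriented_list_def last_map)
    qed
    \<comment> \<open>No test succeeds, both do, or exactly one does; in the last case agreement of
      the first test with \<open>d\<close> means that the stored order already is the wanted
      one.\<close>
    consider (no) "\<not> c1" "\<not> c2" | (both) "c1" "c2" | (keep) "c1 \<noteq> c2" "c1 = d" | (flip) "c1 \<noteq> c2" "c1 \<noteq> d" by blast
    then show ?thesis
    proof cases
      case no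
      then have "oriented F f d [F] False" using ty
        by (intro oriented.Kept[OF D x(1) y(1)]) (auto simp: merges_def c1_def c2_def)
      then have "Q z ((fst s)(''h'' := q, ''t'' := q, ''x'' := P x, ''e'' := P y, ''b'' := 0, ''m'' := 0), snd s)" if "G \<le> z" for z
        by (intro Q[of _ "[tr]" "[F]" False]) (use kept that g in \<open>simp_all add: frame_refl\<close>)
      then show ?thesis
        using True v rb gas no cA Pn rbs ch hk(3) x(2) y(2) kB unfolding orient_prog_def
        by (simp add: wp_simps small num fit_simps kq g(1))
    next
      case both
      then have "oriented F f d Cs False" using ty
        by (intro oriented.Merged[OF D x(1) y(1)]) (simp_all add: merges_def c1_def c2_def)
      then have "Q z ((fst s)(''x'' := P x, ''e'' := P y, ''b'' := Suc 0, ''m'' := Suc 0, ''h'' := rid (hd ts), ''t'' := rid (last ts)), snd s)" if "G \<le> z" for z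
        by (intro Q[of _ ts Cs False]) (use base_ol[OF _ Cs] that in \<open>simp_all add: frame_refl\<close>)
      then show ?thesis
        using True v rb gas both cA Pn rbs ch hk(3) x(2) y(2) kB unfolding orient_prog_def
        by (simp add: wp_simps small num fit_simps kq g(1) fun_upd_twist numeral_2_eq_2)
    next
      case keep
      then have or: "oriented F f d Cs True" using ty
        by (intro oriented.Merged[OF D x(1) y(1)]) (auto simp: merges_def c1_def c2_def)
      have "Q z (s1, snd s)" if "G \<le> z" "s1 ''h'' = rid (hd ts)" "s1 ''t'' = rid (last ts)" "s1 ''a'' = 2" "frame orient_vars {''next''} s (s1, snd s)" for z s1
        by (rule Q[of _ ts Cs True]) (use base_ol[OF or Cs] that in simp_all)
      then show ?thesis
        using True v rb gas keep cA Pn rbs ch hk(3) x(2) y(2) kB unfolding orient_prog_def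
        by (auto simp: wp_simps small num fit_simps kq g(1) frame_refl)
    next
      case flip
      then have or: "oriented F f d (rev Cs) True" using ty
        by (intro oriented.Merged[OF D x(1) y(1)]) (auto simp: merges_def c1_def c2_def)
      have lenb: "length ts \<le> 3 * n"
      proof -
        have "card (set (map rid ts)) \<le> card (set (ids tr))" by (rule card_mono) (use rts in auto)
        moreover have "distinct (map rid ts)"
          using g(3) by (rule distinct_concat_rid)
        ultimately show ?thesis using tr(2,4) distinct_card[of "map rid ts"] distinct_card[of "ids tr"] by simp
      qed
      have dist: "distinct (map rid ts)" using g(3) by (rule distinct_concat_rid)
      have rev: "wp B reverse_prog Q z (s1, snd s)"
        if z: "G + 150 * int n + 100 \<le> z" and s1: "s1 ''h'' = rid (hd ts)" "s1 ''t'' = rid (hd ts)" "s1 ''a'' = 2" "frame orient_vars {''next''} s (s1, snd s)" for z s1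
      proof (rule reverse_wp[where gs = "map rid ts" and G = G])
        show "linked (snd (s1, snd s) ''next'') (fst (s1, snd s) ''h'') (map rid ts)" using hk(1) ch s1(1) by simp
        show "distinct (map rid ts)" by (rule dist)
        show "q' \<le> 3 * n" if "q' \<in> set (map rid ts)" for q' using that rts tr(3) by auto
        show "map rid ts \<noteq> []" using hk(2) by simp
        show "50 * int (length (map rid ts)) + 50 + G \<le> z" using z lenb by simp
        show "0 \<le> G" by (rule gas(2))
      next
        fix g' s' assume f': "frame {''v'', ''w'', ''h''} {''next''} (s1, snd s) s'" and h': "fst s' ''h'' = last (map rid ts)"
          and l': "linked (snd s' ''next'') (last (map rid ts)) (rev (map rid ts))"
          and o': "\<And>x. x \<notin> set (map rid ts) \<Longrightarrow> snd s' ''next'' x = snd (s1, snd s) ''next'' x" and G': "G \<le> g'"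
        have fr: "frame orient_vars {''next''} s s'" by (rule frame_trans[OF s1(4) f']) auto
        have hok': "hok (snd s') P u" if u: "u \<in> set ts" for u
        proof (rule hok_agree[OF hk(4)[OF u]])
          show "distinct (ids u)" using g(3) u by (auto simp: distinct_concat_iff)
          have "x \<notin> set (map rid ts)" if x: "x \<in> set (ids u) - {rid u}" for x
            using distinct_concat_rid_notin[OF g(3) u] x by blast
          then show "agree (snd s) (snd s') u" using frameD(2)[OF fr] o' by (simp add: agree_def)
        qed
        have lk: "successively (\<lambda>x y. snd s' ''next'' x = y) (map rid (rev ts)) \<and> snd s' ''next'' (rid (last (rev ts))) = 0"
          using l' linked_iff[of "rev (map rid ts)" "snd s' ''next''" "last (map rid ts)"] hk(2)
          by (simp add: rev_map[symmetric] last_rev hd_map hd_rev last_map)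
        have "rev ts \<noteq> [tr]"
        proof
          assume "rev ts = [tr]"
          then have "tr \<in> set ts" by (metis in_set_conv_decomp list.set_intros(1) set_rev)
          then show False using g(1,2) rid_in_ids[of tr] by auto
        qed
        moreover have "list_all2 local_tree (rev Cs) (map strip (rev ts))" using Cs by (simp add: rev_map[symmetric])
        moreover have "distinct (concat (map ids (rev ts)))" "set (concat (map ids (rev ts))) \<subseteq> set (ids tr)"
          using g(3) t distinct_concat_rev[of "map ids ts"] by (auto simp: rev_map[symmetric])
        moreover have "snd s' ''next'' x = snd s ''next'' x" if "x \<notin> set (ids tr) - {rid tr}" for x
          using o'[of x] that rts g(1,2) rid_in_ids by fastforce
        ultimately have "oriented_list (snd s) tr F f d (snd s') (rev ts) (rev Cs) True"
          using or lk hok' hk(2) unfolding oriented_list_def by simp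
        then show "Q g' s'"
          by (rule Q[OF fr]) (use h' hk(2) frameD(1)[OF f'] s1 G' in \<open>simp_all add: hd_rev last_rev last_map\<close>)
      qed
      then show ?thesis
        using True v rb gas flip cA Pn rbs ch hk(3) x(2) y(2) kB unfolding orient_prog_def
        by (auto simp: wp_simps small num fit_simps kq g(1) frame_refl)
    qed
  qed
qed

end

section \<open>Total cost of the refinement\<close>

context matrix_program
begin


lemma refine_wp:
  fixes s :: store
  assumes s: "fst s ''n'' = n" "snd s ''A'' = A" "\<And>v. v \<noteq> ''n'' \<Longrightarrow> fst s v = 0" "\<And>w i. w \<noteq> ''A'' \<Longrightarrow> snd s w i = 0"
    and gas: "10000 * int n * int n + G \<le> g" "0 \<le> G"
    and Q: "\<And>g' s'. frame stage_vars stage_arrays s s' \<Longrightarrow> bij_betw (snd s' ''p'') {..<n} {..<n} \<Longrightarrow>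
      stages_done n (snd s' ''p'') (snd s' ''E'') \<Longrightarrow> fst s' ''c'' = n \<Longrightarrow> G \<le> g' \<Longrightarrow> Q g' s'"
  shows "wp B refine_prog Q g s"
proof -
  define main where "main = While (Less (Var ''c'') (Var ''n'')) stage_prog"
  have main: "wp B main Q x s1"
    if H: "frame stage_vars stage_arrays s s1" "in_range s1" "stage_state 0 s1" "fst s1 ''c'' = 0" "fst s1 ''t'' = 0" "fst s1 ''k'' = 0"
      "5000 * int n * int n + 500 * int n * int (n + 1) + 100 * int n + 200 + G \<le> x" for x s1
    unfolding main_def
  proof (rule wp_While[where I = "\<lambda>g' s'. frame stage_vars stage_arrays s s' \<and> in_range s' \<and> stage_state (fst s' ''c'') s' \<and>
      fst s' ''t'' = fst s' ''k'' \<and> fst s' ''c'' \<le> n \<and> unsplit n (snd s' ''s'') + fst s' ''k'' \<le> n \<and>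
      store_potential s' (fst s' ''k'') + (500 * int (n + 1) + 100) * int (n - fst s' ''c'') + 100 + G \<le> g'"], goal_cases)
    case 1
    have "int (unsplit n (snd s1 ''s'')) \<le> int n" "int (linked_pairs n (snd s1 ''s'')) \<le> int (n * n)"
      using unsplit_le[of n "snd s1 ''s''"] linked_pairs_le[of n "snd s1 ''s''"] by linarith+
    then have "3000 * int n * int (unsplit n (snd s1 ''s'')) \<le> 3000 * int n * int n"
      by (intro mult_left_mono) auto
    \<comment> \<open>At the start there are no tasks, at most \<open>n\<close> unsplit positions
      and at most \<open>n * n\<close> linked pairs: 3000 and 1000 times
      \<open>n * n\<close>.\<close>
    then have "store_potential s1 0 \<le> 4000 * int n * int n"
      using \<open>int (linked_pairs n (snd s1 ''s'')) \<le> int (n * n)\<close> H(6) by (simp add: potential_def)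
    moreover have "(500 * int (n + 1) + 100) * int (n - 0) = 500 * int n * int (n + 1) + 100 * int n" by (simp add: algebra_simps)
    ultimately have "store_potential s1 0 + (500 * int (n + 1) + 100) * int (n - 0) + 100 + G \<le> x"
      using H(7) zero_le_mult_iff[of "int n" "int n"] by linarith
    then show ?case using H unsplit_le[of n "snd s1 ''s''"] by simp
  next
    case (2 g' s')
    have "0 \<le> (500 * int (n + 1) + 100) * int (n - fst s' ''c'')" by simp
    then have "0 \<le> g'"
      using 2 gas(2) potential_nonneg[of "snd s' ''s''" "snd s' ''L''" "snd s' ''M''" "snd s' ''R''" "fst s' ''k''" "fst s' ''k''"] by linarith
    then show ?case using 2 by (simp add: small_fits in_range_def base_def)
  next
    case (3 g' s')
    then have i: "frame stage_vars stage_arrays s s'" "in_range s'" "stage_state (fst s' ''c'') s'" "fst s' ''t'' = fst s' ''k''"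
      "fst s' ''c'' < n" "unsplit n (snd s' ''s'') + fst s' ''k'' \<le> n"
      "store_potential s' (fst s' ''k'') + (500 * int (n + 1) + 100) * int (n - fst s' ''c'') + 100 + G \<le> g'"
      by (auto simp: in_range_def base_def)
    have "int (n - fst s' ''c'') = int (n - Suc (fst s' ''c'')) + 1" using i(5) by simp
    then have st: "(500 * int (n + 1) + 100) * int (n - fst s' ''c'') =
      (500 * int (n + 1) + 100) * int (n - Suc (fst s' ''c'')) + 500 * int (n + 1) + 100" by (simp only: distrib_left mult_1_right add.assoc)
    show ?case
    proof (rule stage_wp[OF i(2,3) refl i(4,5,6), where G = "(500 * int (n + 1) + 100) * int (n - Suc (fst s' ''c'')) + 100 + G"], goal_cases)
      case 1
      have "int (bcost (Less (Var ''c'') (Var ''n''))) = 3" by simp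
      then show ?case using i(7) unfolding st by linarith
    next
      case 2
      have "0 \<le> (500 * int (n + 1) + 100) * int (n - Suc (fst s' ''c''))" by simp
      then show ?case using gas(2) by linarith
    next
      case (3 g2 s2)
      have "frame stage_vars stage_arrays s s2" by (rule frame_trans[OF i(1) 3(1)]) auto
      then show ?case using 3 i(5) by (simp add: add.assoc)
    qed
  next
    case (4 g' s')
    then have c: "fst s' ''c'' = n" by (simp add: in_range_def base_def)
    have "bij_betw (snd s' ''p'') {..<n} {..<n}" "stages_done n (snd s' ''p'') (snd s' ''E'')"
      using 4 state_ok_final unfolding c by blast+
    moreover have "0 \<le> store_potential s' (fst s' ''k'')" by (rule potential_nonneg)
    ultimately show ?case
      using 4 c by (intro Q) (simp_all only:, simp)
  qed
  define rest where "rest = (Write ''s'' (Const 0) (Const 1) ;; Write ''s'' (Var ''n'') (Const 1) ;; Assign ''c'' (Const 0) ;; main)"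
  define I where "I g' s' \<longleftrightarrow> (\<exists>j P. s' = ((fst s)(''c'' := j), (snd s)(''p'' := P)) \<and> j \<le> n \<and> (\<forall>i<j. P i = i) \<and>
      5000 * int n * int n + 500 * int n * int (n + 1) + 100 * int n + 300 + 50 * int (n - j) + G \<le> g')" for g' and s' :: store
  have "wp B (While (Less (Var ''c'') (Var ''n'')) (Write ''p'' (Var ''c'') (Var ''c'') ;; IVar ''c'')) (wp B rest Q) x s"
    if x: "g - 10 \<le> x" for x
  proof (rule wp_While[where I = I], goal_cases)
    case 1
    have "1 \<le> int n * int n" "int n \<le> int n * int n" using n_pos by (simp_all flip: of_nat_mult)
    then have "5000 * int n * int n + 500 * int n * int (n + 1) + 100 * int n + 300 + 50 * int (n - 0) + G \<le> x"
      using gas(1) x by (simp add: algebra_simps)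
    then show ?case using s(3)[of "''c''"]
      unfolding I_def by (intro exI[of _ 0] exI[of _ "snd s ''p''"]) (simp add: fun_upd_idem)
  next
    case (2 g' s')
    then obtain j P where j: "s' = ((fst s)(''c'' := j), (snd s)(''p'' := P))" "j \<le> n"
      "5000 * int n * int n + 500 * int n * int (n + 1) + 100 * int n + 300 + 50 * int (n - j) + G \<le> g'" unfolding I_def by blast
    have "0 \<le> 5000 * int n * int n" "0 \<le> 500 * int n * int (n + 1)" by simp_all
    then have "0 \<le> g'" using j(3) gas(2) by linarith
    then show ?case using j(1,2) s(1) by (simp add: small_fits)
  next
    case (3 g' s')
    then obtain j P where j: "s' = ((fst s)(''c'' := j), (snd s)(''p'' := P))" "j \<le> n" "\<forall>i<j. P i = i"
      "5000 * int n * int n + 500 * int n * int (n + 1) + 100 * int n + 300 + 50 * int (n - j) + G \<le> g'" unfolding I_def by blast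
    then have jn: "j < n" using 3(2) s(1) by simp
    then have "int (n - j) = int (n - Suc j) + 1" by simp
    then have g': "5000 * int n * int n + 500 * int n * int (n + 1) + 100 * int n + 300 + 50 * int (n - Suc j) + G \<le> g' - 50"
      using j(4) by linarith
    have "I y ((fst s)(''c'' := Suc j), (snd s)(''p'' := P(j := j)))" if "g' - 50 \<le> y" for y
      unfolding I_def by (rule exI[of _ "Suc j"], rule exI[of _ "P(j := j)"]) (use jn j(3) g' that in auto)
    then show ?case using jn by (simp add: j(1) wp_simps fit_simps)
  next
    case (4 g' s')
    then obtain j P where j: "s' = ((fst s)(''c'' := j), (snd s)(''p'' := P))" "j \<le> n" "\<forall>i<j. P i = i"
      "5000 * int n * int n + 500 * int n * int (n + 1) + 100 * int n + 300 + 50 * int (n - j) + G \<le> g'" unfolding I_def by blast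
    then have jn: "j = n" using 4(2) s(1) by simp
    have z: "snd s ''s'' = (\<lambda>i. 0)" using s(4) by auto
    define s1 where "s1 = ((fst s)(''c'' := 0), (snd s)(''p'' := P, ''s'' := (\<lambda>i. 0)(0 := Suc 0, n := Suc 0)))"
    have "wp B main Q y s1" if "g' - 50 \<le> y" for y
    proof (rule main)
      show "frame stage_vars stage_arrays s s1" by (simp add: s1_def frame_refl)
      show "in_range s1" using s j(3) jn by (simp add: in_range_def base_def s1_def)
      have "state_ok 0 P ((\<lambda>i. 0)(0 := Suc 0, n := Suc 0)) (snd s ''L'') (snd s ''M'') (snd s ''R'') 0 (snd s ''E'') (\<lambda>_ _ _. False)"
        by (rule state_ok_init) (use j(3) jn in auto)
      then show "stage_state 0 s1" using s(3)[of "''k''"] by (simp add: s1_def)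
      show "5000 * int n * int n + 500 * int n * int (n + 1) + 100 * int n + 200 + G \<le> y" using j(4) jn that by simp
    qed (use s(3) in \<open>simp_all add: s1_def\<close>)
    then show ?case
      using jn s(1) unfolding rest_def by (simp add: j(1) wp_simps fit_simps z s1_def)
  qed
  then show ?thesis
    unfolding refine_prog_def main_def[symmetric] rest_def[symmetric] by (simp add: wp_simps)
qed

end

section \<open>Construction of the tree\<close>

text \<open>The summand \<open>3 - r\<close> is 1 on the empty path, where \<open>r = 2\<close>, and
  0 from \<open>r = 3\<close> on by truncated subtraction. So every unvisited kid qualifies as the
  start of a path, while otherwise row \<open>r\<close> of \<open>W\<close> has to admit the
  target.\<close>

definition search_prog :: com where
  "search_prog = Assign ''y'' (Plus (Var ''c'') (Const 1)) ;;
    While (Conj (Less (Var ''y'') (Read ''E'' (Var ''c'')))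
        (Neg (Conj (Conj (Less (Const 0) (Read ''V'' (Var ''y''))) (Neg (Eq (Read ''V'' (Var ''y'')) (Var ''r''))))
          (Less (Const 0) (Plus (Read ''W'' (Plus (Times (Var ''r'') (Var ''n'')) (Var ''y''))) (Minus (Const 3) (Var ''r'')))))))
      (IVar ''y'')"

text \<open>Row \<open>r\<close> of \<open>W\<close> marks what some member of level
  \<open>r\<close> forces. Looking for an edge out of the top level thus scans one row, and merging
  levels is a disjunction of two rows.\<close>

definition push_prog :: com where
  "push_prog = IVar ''r'' ;; Write ''V'' (Var ''y'') (Var ''r'') ;;
    Assign ''z'' (Plus (Var ''c'') (Const 1)) ;;
    While (Less (Var ''z'') (Read ''E'' (Var ''c'')))
     (Cond (Eq (Entry (Var ''z'') (Var ''c'')) (Entry (Var ''z'') (Var ''y'')))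
        (Write ''W'' (Plus (Times (Var ''r'') (Var ''n'')) (Var ''z'')) (Const 0))
        (Write ''W'' (Plus (Times (Var ''r'') (Var ''n'')) (Var ''z'')) (Const 1)) ;;
      IVar ''z'')"

definition merge_prog :: com where
  "merge_prog = Assign ''z'' (Plus (Var ''c'') (Const 1)) ;;
    While (Less (Var ''z'') (Read ''E'' (Var ''c'')))
     (Cond (Eq (Read ''V'' (Var ''z'')) (Var ''r'')) (Write ''V'' (Var ''z'') (Minus (Var ''r'') (Const 1))) Skip ;;
      Cond (Less (Const 0) (Read ''W'' (Plus (Times (Var ''r'') (Var ''n'')) (Var ''z''))))
        (Write ''W'' (Plus (Times (Minus (Var ''r'') (Const 1)) (Var ''n'')) (Var ''z'')) (Const 1)) Skip ;;
      IVar ''z'') ;;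
    Assign ''r'' (Minus (Var ''r'') (Const 1))"

definition link_prog :: com where
  "link_prog = Assign ''j'' (Var ''i'') ;; Assign ''k'' (Const 0) ;; Assign ''z'' (Plus (Var ''c'') (Const 1)) ;;
    While (Less (Var ''z'') (Read ''E'' (Var ''c'')))
     (Cond (Eq (Read ''V'' (Var ''z'')) (Var ''r''))
       (Write ''V'' (Var ''z'') (Const 0) ;; Write ''next'' (Var ''j'') (Read ''T'' (Var ''z'')) ;;
        Assign ''j'' (Read ''T'' (Var ''z'')) ;; IVar ''k'')
       Skip ;;
      IVar ''z'')"

definition join_tail_prog :: com where
  "join_tail_prog = Write ''next'' (Var ''q'') (Var ''h'') ;; Write ''child'' (Var ''g'') (Var ''l'') ;; Write ''Z'' (Var ''g'') (Var ''t'') ;;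
    Write ''kind'' (Var ''g'') (Var ''a'')"

definition join_second_prog :: com where
  "join_second_prog = Assign ''l'' (Var ''h'') ;; Assign ''q'' (Var ''t'') ;;
    Assign ''u'' (Var ''j'') ;; Assign ''f'' (Read ''N'' (Var ''i'')) ;; Assign ''d'' (Const 0) ;; orient_prog ;; join_tail_prog"

definition join_prog :: com where
  "join_prog = Assign ''a'' (Const 1) ;;
    Assign ''u'' (Var ''i'') ;; Assign ''f'' (Read ''N'' (Var ''j'')) ;; Assign ''d'' (Const 1) ;; orient_prog ;; join_second_prog"

definition output_prog :: com where
  "output_prog = link_prog ;; Assign ''r'' (Minus (Var ''r'') (Const 1)) ;; IVar ''g'' ;;
    Cond (Eq (Var ''k'') (Const 1)) join_prog
      (Write ''child'' (Var ''g'') (Var ''i'') ;; Write ''Z'' (Var ''g'') (Var ''j'') ;; Write ''kind'' (Var ''g'') (Const 3)) ;;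
    Write ''N'' (Var ''g'') (Read ''p'' (Var ''c'')) ;; Assign ''i'' (Var ''g'')"

definition event_prog :: com where
  "event_prog = search_prog ;;
    Cond (Less (Var ''y'') (Read ''E'' (Var ''c'')))
      (Cond (Eq (Read ''V'' (Var ''y'')) (Const 1)) push_prog merge_prog)
      (Cond (Eq (Var ''r'') (Const 2)) (Assign ''o'' (Const 0)) output_prog)"

text \<open>The leaf of position \<open>c\<close> has the address \<open>c + 1\<close>; inner nodes
  use the addresses above \<open>n\<close>, with \<open>g\<close> the last one taken.
  \<open>i\<close> points to the tree of the growing core of \<open>c\<close>.\<close>

definition node_prog :: com where
  "node_prog = Assign ''c'' (Minus (Var ''c'') (Const 1)) ;; Assign ''i'' (Plus (Var ''c'') (Const 1)) ;;
    Write ''label'' (Var ''i'') (Read ''p'' (Var ''c'')) ;; Write ''N'' (Var ''i'') (Read ''p'' (Var ''c'')) ;;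
    Assign ''z'' (Plus (Var ''c'') (Const 1)) ;;
    While (Less (Var ''z'') (Read ''E'' (Var ''c''))) (Write ''V'' (Var ''z'') (Const 1) ;; Assign ''z'' (Read ''E'' (Var ''z''))) ;;
    Assign ''r'' (Const 2) ;; Assign ''o'' (Const 1) ;;
    While (Eq (Var ''o'') (Const 1)) event_prog ;;
    Write ''T'' (Var ''c'') (Var ''i'')"

definition build_prog :: com where
  "build_prog = Assign ''g'' (Var ''n'') ;; While (Less (Const 0) (Var ''c'')) node_prog ;; Assign ''root'' (Var ''i'')"

lemma row_index_eq:
  assumes "j * n + z = j' * n + z'" "z < n" "z' < (n::nat)"
  shows "j = j' \<and> z = z'"
proof -
  have "j = (j * n + z) div n" using assms(2) by simp
  also have "\<dots> = (j' * n + z') div n" by (simp only: assms(1))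
  also have "\<dots> = j'" using assms(3) by simp
  finally have "j = j'" .
  then show ?thesis using assms(1) by simp
qed

section \<open>Search, push and merge on the level rows\<close>

context build
begin

text \<open>Levels of the path are numbered from 3 and there are at most \<open>n\<close> of them,
  whence the bound \<open>n + 2\<close>.\<close>

definition env :: "nat \<Rightarrow> store \<Rightarrow> bool" where
  "env c s \<longleftrightarrow> fst s ''n'' = n \<and> snd s ''A'' = A \<and> fst s ''c'' = c \<and> c < n \<and> (\<forall>i<n. snd s ''p'' i = P i) \<and> (\<forall>i<n. snd s ''E'' i = en i) \<and>
     (\<forall>i. snd s ''W'' i \<le> 1) \<and> (\<forall>i. snd s ''V'' i \<le> n + 2) \<and> (\<forall>z. snd s ''V'' z \<noteq> 0 \<longrightarrow> c < z \<and> z < en c) \<and> 2 \<le> fst s ''r'' \<and> fst s ''r'' \<le> n + 2"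

lemma envD:
  assumes "env c s"
  shows "fst s ''n'' = n" "snd s ''A'' = A" "fst s ''c'' = c" "c < n" "i < n \<Longrightarrow> snd s ''p'' i = P i" "i < n \<Longrightarrow> snd s ''E'' i = en i"
    "snd s ''W'' i \<le> 1" "snd s ''V'' i \<le> n + 2" "snd s ''V'' i \<noteq> 0 \<Longrightarrow> c < i \<and> i < en c" "2 \<le> fst s ''r''" "fst s ''r'' \<le> n + 2" "en c \<le> n" "snd s ''E'' c = en c"
    "c < en c"
  using assms en_bounds unfolding env_def by blast+

lemma env_frame:
  assumes "env c s" "frame X Y s s'" "X \<inter> {''n'', ''c'', ''r''} = {}" "Y \<inter> {''A'', ''p'', ''E'', ''V'', ''W''} = {}"
  shows "env c s'"
proof -
  have "fst s' v = fst s v" if "v \<in> {''n'', ''c'', ''r''}" for v using assms(2,3) that unfolding frame_def by blast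
  moreover have "snd s' w = snd s w" if "w \<in> {''A'', ''p'', ''E'', ''V'', ''W''}" for w using assms(2,4) that unfolding frame_def by blast
  ultimately show ?thesis using assms(1) unfolding env_def by simp
qed

lemma small: "x \<le> 4 * (n + 1) \<Longrightarrow> x < B"
  by (rule small_fits) simp

definition target :: "store \<Rightarrow> nat \<Rightarrow> bool" where
  "target s z \<longleftrightarrow> 0 < snd s ''V'' z \<and> snd s ''V'' z \<noteq> fst s ''r'' \<and> 0 < snd s ''W'' (fst s ''r'' * n + z) + (3 - fst s ''r'')"

lemma search_wp:
  fixes s :: store
  assumes e: "env c s" and gas: "100 * int (n + 1) + G \<le> g" "0 \<le> G"
    and Q: "\<And>g' s' y. frame {''y''} {} s s' \<Longrightarrow> fst s' ''y'' = y \<Longrightarrow> c < y \<Longrightarrow> y \<le> en c \<Longrightarrow>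
      (\<And>z. c < z \<Longrightarrow> z < y \<Longrightarrow> \<not> target s z) \<Longrightarrow> (y < en c \<Longrightarrow> target s y) \<Longrightarrow> G \<le> g' \<Longrightarrow> Q g' s'"
  shows "wp B search_prog Q g s"
proof -
  note ev = envD[OF e]
  define I where "I g' s' \<longleftrightarrow> (\<exists>y. s' = ((fst s)(''y'' := y), snd s) \<and> c < y \<and> y \<le> en c \<and> (\<forall>z. c < z \<longrightarrow> z < y \<longrightarrow> \<not> target s z) \<and>
    60 * int (en c - y) + 50 + G \<le> g')" for g' and s' :: store
  have b: "fst s ''r'' * n < B" "fst s ''r'' * n + y < B" "snd s ''V'' y < B" "snd s ''W'' i < B" "3 < B" "fst s ''r'' < B" "y < B"
      "snd s ''W'' i + (3 - fst s ''r'') < B" "c < B" "en c < B" if "y \<le> n" for y i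
    using index_fits[of "fst s ''r''" y] that ev(4,11,12) ev(8)[of y] ev(7)[of i] n_pos by (auto intro!: small)
  have loop: "wp B (While (Conj (Less (Var ''y'') (Read ''E'' (Var ''c'')))
        (Neg (Conj (Conj (Less (Const 0) (Read ''V'' (Var ''y''))) (Neg (Eq (Read ''V'' (Var ''y'')) (Var ''r''))))
          (Less (Const 0) (Plus (Read ''W'' (Plus (Times (Var ''r'') (Var ''n'')) (Var ''y''))) (Minus (Const 3) (Var ''r'')))))))
      (IVar ''y'')) Q x ((fst s)(''y'' := Suc c), snd s)" if x: "g - 20 \<le> x" for x
  proof (rule wp_While[where I = I], goal_cases)
    case 1
    then show ?case using gas x ev(12,14) unfolding I_def by (intro exI[of _ "Suc c"]) auto
  next
    case (2 g' s')
    then obtain y where y: "s' = ((fst s)(''y'' := y), snd s)" "y \<le> en c" "60 * int (en c - y) + 50 + G \<le> g'" by (auto simp: I_def)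
    have "y \<le> n" using y(2) ev(12) by simp
    then show ?case using y gas(2) ev b[of y] by (simp add: fit_simps)
  next
    case (3 g' s')
    then obtain y where y: "s' = ((fst s)(''y'' := y), snd s)" "c < y" "y \<le> en c" "\<forall>z. c < z \<longrightarrow> z < y \<longrightarrow> \<not> target s z"
      "60 * int (en c - y) + 50 + G \<le> g'" by (auto simp: I_def)
    have bv: "y < en c" "\<not> target s y" using 3(2) y ev by (simp_all add: target_def)
    have "I x ((fst s)(''y'' := Suc y), snd s)" if "g' - 50 \<le> x" for x
      unfolding I_def using y bv that by (intro exI[of _ "Suc y"]) (auto simp: less_Suc_eq)
    then show ?case using y(1) bv(1) ev(12) by (simp add: wp_simps fit_simps)
  next
    case (4 g' s')
    then obtain y where y: "s' = ((fst s)(''y'' := y), snd s)" "c < y" "y \<le> en c" "\<forall>z. c < z \<longrightarrow> z < y \<longrightarrow> \<not> target s z"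
      "60 * int (en c - y) + 50 + G \<le> g'" by (auto simp: I_def)
    have t: "y < en c \<Longrightarrow> target s y" using 4(2) y(1) ev by (simp add: target_def)
    show ?case
      by (rule Q[of s' y]) (use y t in \<open>auto simp: frame_refl\<close>)
  qed
  then show ?thesis unfolding search_prog_def using ev(3,4) by (simp add: wp_simps fit_simps)
qed

lemma push_wp:
  fixes s :: store
  assumes e: "env c s" and y: "fst s ''y'' = y" "c < y" "y < en c" and r: "fst s ''r'' = r" "r \<le> n + 1"
    and gas: "200 * int (n + 1) + G \<le> g" "0 \<le> G"
    and Q: "\<And>g' s'. frame {''r'', ''z''} {''V'', ''W''} s s' \<Longrightarrow> env c s' \<Longrightarrow> fst s' ''r'' = Suc r \<Longrightarrow> snd s' ''V'' = (snd s ''V'')(y := Suc r) \<Longrightarrow>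
      (\<And>z. c < z \<Longrightarrow> z < en c \<Longrightarrow> 0 < snd s' ''W'' (Suc r * n + z) \<longleftrightarrow> forces c y z) \<Longrightarrow>
      (\<And>j z. j \<le> r \<Longrightarrow> z < n \<Longrightarrow> snd s' ''W'' (j * n + z) = snd s ''W'' (j * n + z)) \<Longrightarrow> G \<le> g' \<Longrightarrow> Q g' s'"
  shows "wp B push_prog Q g s"
proof -
  note ev = envD[OF e]
  have yn: "y < n" using y(3) ev(12) by simp
  define s0 where "s0 = ((fst s)(''r'' := Suc r, ''z'' := Suc c), (snd s)(''V'' := (snd s ''V'')(y := Suc r)))"
  define I where "I g' s' \<longleftrightarrow> (\<exists>z W. s' = ((fst s)(''r'' := Suc r, ''z'' := z), (snd s)(''V'' := (snd s ''V'')(y := Suc r), ''W'' := W)) \<and>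
    c < z \<and> z \<le> en c \<and> (\<forall>x. c < x \<longrightarrow> x < z \<longrightarrow> (0 < W (Suc r * n + x) \<longleftrightarrow> forces c y x)) \<and>
    (\<forall>j x. j \<le> r \<longrightarrow> x < n \<longrightarrow> W (j * n + x) = snd s ''W'' (j * n + x)) \<and> (\<forall>i. W i \<le> 1) \<and>
    100 * int (en c - z) + 50 + G \<le> g')" for g' and s' :: store
  have b: "Suc r < B" "en c < B" "c < B" "y < B" using r ev yn by (auto intro!: small)
  have ix: "Suc r * n < B" "Suc r * n + z < B" if "z < n" for z
    using index_fits[of "Suc r" z] that r(2) by simp_all
  have loop: "wp B (While (Less (Var ''z'') (Read ''E'' (Var ''c'')))
     (Cond (Eq (Entry (Var ''z'') (Var ''c'')) (Entry (Var ''z'') (Var ''y'')))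
        (Write ''W'' (Plus (Times (Var ''r'') (Var ''n'')) (Var ''z'')) (Const 0))
        (Write ''W'' (Plus (Times (Var ''r'') (Var ''n'')) (Var ''z'')) (Const 1)) ;; IVar ''z'')) Q x s0" if x: "g - 40 \<le> x" for x
  proof (rule wp_While[where I = I], goal_cases)
    case 1
    have "s0 = ((fst s)(''r'' := Suc r, ''z'' := Suc c), (snd s)(''V'' := (snd s ''V'')(y := Suc r), ''W'' := snd s ''W''))"
      by (simp add: s0_def fun_upd_idem)
    then show ?case using gas x ev(7,12,14) unfolding I_def by (intro exI[of _ "Suc c"] exI[of _ "snd s ''W''"]) auto
  next
    case (2 g' s')
    then obtain z W where z: "s' = ((fst s)(''r'' := Suc r, ''z'' := z), (snd s)(''V'' := (snd s ''V'')(y := Suc r), ''W'' := W))" "z \<le> en c"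
      "100 * int (en c - z) + 50 + G \<le> g'" unfolding I_def by blast
    have "z < B" using z(2) ev(12) by (intro small) simp
    then show ?case using z gas(2) ev b by simp
  next
    case (3 g' s')
    then obtain z W where z: "s' = ((fst s)(''r'' := Suc r, ''z'' := z), (snd s)(''V'' := (snd s ''V'')(y := Suc r), ''W'' := W))" "c < z" "z \<le> en c"
      "\<And>x. c < x \<Longrightarrow> x < z \<Longrightarrow> 0 < W (Suc r * n + x) \<longleftrightarrow> forces c y x"
      "\<And>j x. j \<le> r \<Longrightarrow> x < n \<Longrightarrow> W (j * n + x) = snd s ''W'' (j * n + x)" "\<And>i. W i \<le> 1"
      "100 * int (en c - z) + 50 + G \<le> g'" unfolding I_def by blast
    have zn: "z < en c" "z < n" using 3(2) z(1,3) ev by simp_all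
    have Pz: "P z < n" "P c < n" "P y < n" using P_less zn ev(4) yn by auto
    have fz: "forces c y z \<longleftrightarrow> A (P z * n + P c) \<noteq> A (P z * n + P y)"
      using a_eq zn(2) ev(4) yn by (simp add: forces_def mt_def)
    define w where "w = (if forces c y z then Suc 0 else 0)"
    have Iw: "I x ((fst s)(''r'' := Suc r, ''z'' := Suc z), (snd s)(''V'' := (snd s ''V'')(y := Suc r), ''W'' := W(Suc r * n + z := w)))" if "g' - 90 \<le> x" for x
      unfolding I_def
    proof (intro exI[of _ "Suc z"] exI[of _ "W(Suc r * n + z := w)"] conjI allI impI refl)
      fix x assume x: "c < x" "x < Suc z"
      show "0 < (W(Suc r * n + z := w)) (Suc r * n + x) \<longleftrightarrow> forces c y x"
        using z(4)[of x] x by (cases "x = z") (auto simp: w_def)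
    next
      fix j x assume "j \<le> r" "x < n"
      then show "(W(Suc r * n + z := w)) (j * n + x) = snd s ''W'' (j * n + x)"
        using z(5)[of j x] row_index_eq[of j n x "Suc r" z] zn(2) by (auto simp del: mult_Suc)
    next
      fix i show "(W(Suc r * n + z := w)) i \<le> 1" using z(6)[of i] by (simp add: w_def)
    qed (use z zn that in auto)
    have "wp B (Cond (Eq (Entry (Var ''z'') (Var ''c'')) (Entry (Var ''z'') (Var ''y'')))
        (Write ''W'' (Plus (Times (Var ''r'') (Var ''n'')) (Var ''z'')) (Const 0))
        (Write ''W'' (Plus (Times (Var ''r'') (Var ''n'')) (Var ''z'')) (Const 1)) ;; IVar ''z'') I x s'" if x: "g' - 10 \<le> x" for x
    proof (cases "forces c y z")
      case True
      then show ?thesis using Iw[unfolded w_def] x fz Pz zn ev yn y b ix[OF zn(2)]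
        unfolding z(1) by (simp add: wp_simps fit_simps del: mult_Suc)
    next
      case False
      then show ?thesis using Iw[unfolded w_def] x fz Pz zn ev yn y b ix[OF zn(2)]
        unfolding z(1) by (simp add: wp_simps fit_simps del: mult_Suc)
    qed
    then show ?case by simp
  next
    case (4 g' s')
    then obtain z W where z: "s' = ((fst s)(''r'' := Suc r, ''z'' := z), (snd s)(''V'' := (snd s ''V'')(y := Suc r), ''W'' := W))" "c < z" "z \<le> en c"
      "\<And>x. c < x \<Longrightarrow> x < z \<Longrightarrow> 0 < W (Suc r * n + x) \<longleftrightarrow> forces c y x"
      "\<And>j x. j \<le> r \<Longrightarrow> x < n \<Longrightarrow> W (j * n + x) = snd s ''W'' (j * n + x)" "\<And>i. W i \<le> 1"
      "100 * int (en c - z) + 50 + G \<le> g'" unfolding I_def by blast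
    have ze: "z = en c" using 4(2) z(1,3) ev by simp
    have "env c s'"
      using e y r z(6) unfolding z(1) env_def by (auto simp del: mult_Suc)
    then show ?case
      by (intro Q) (use z ze in \<open>simp_all add: frame_refl del: mult_Suc\<close>)
  qed
  have "fst s ''r'' < B" using ev(11) by (intro small) simp
  then show ?thesis unfolding push_prog_def using loop ev y r b unfolding s0_def
    by (simp add: wp_simps fit_simps)
qed

lemma merge_wp:
  fixes s :: store
  assumes e: "env c s" and r: "fst s ''r'' = Suc r" "3 \<le> r"
    and gas: "300 * int (n + 1) + G \<le> g" "0 \<le> G"
    and Q: "\<And>g' s'. frame {''r'', ''z''} {''V'', ''W''} s s' \<Longrightarrow> env c s' \<Longrightarrow> fst s' ''r'' = r \<Longrightarrow>
      snd s' ''V'' = (\<lambda>z. if snd s ''V'' z = Suc r then r else snd s ''V'' z) \<Longrightarrow>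
      (\<And>z. c < z \<Longrightarrow> z < en c \<Longrightarrow> 0 < snd s' ''W'' (r * n + z) \<longleftrightarrow> 0 < snd s ''W'' (r * n + z) \<or> 0 < snd s ''W'' (Suc r * n + z)) \<Longrightarrow>
      (\<And>j z. j < r \<Longrightarrow> z < n \<Longrightarrow> snd s' ''W'' (j * n + z) = snd s ''W'' (j * n + z)) \<Longrightarrow> G \<le> g' \<Longrightarrow> Q g' s'"
  shows "wp B merge_prog Q g s"
proof -
  note ev = envD[OF e]
  define V where "V = snd s ''V''"
  \<comment> \<open>The level array once the positions below \<open>z\<close> have been treated.
    Levels occur only inside the block of \<open>c\<close>, so it starts as \<open>V\<close> and
    ends as the complete replacement.\<close>
  define Vm where "Vm z = (\<lambda>x. if V x = Suc r \<and> x < z then r else V x)" for z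
  define I where "I g' s' \<longleftrightarrow> (\<exists>z W. s' = ((fst s)(''z'' := z), (snd s)(''V'' := Vm z, ''W'' := W)) \<and>
    c < z \<and> z \<le> en c \<and> (\<forall>x. c < x \<longrightarrow> x < en c \<longrightarrow> (0 < W (r * n + x) \<longleftrightarrow> 0 < snd s ''W'' (r * n + x) \<or> x < z \<and> 0 < snd s ''W'' (Suc r * n + x))) \<and>
    (\<forall>j x. j \<noteq> r \<longrightarrow> x < n \<longrightarrow> W (j * n + x) = snd s ''W'' (j * n + x)) \<and> (\<forall>i. W i \<le> 1) \<and>
    150 * int (en c - z) + 50 + G \<le> g')" for g' and s' :: store
  have rb: "Suc r \<le> n + 2" using ev(11) r by simp
  have b: "Suc r < B" "r < B" "en c < B" "c < B" using rb ev by (auto intro!: small)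
  have ix: "Suc r * n < B" "Suc r * n + z < B" "r * n < B" "r * n + z < B" if "z < n" for z
    using index_fits[of "Suc r" z] index_fits[of r z] that rb by simp_all
  have Vsuc: "Vm (Suc z) = (Vm z)(z := (if V z = Suc r then r else V z))" for z by (auto simp: Vm_def fun_eq_iff less_Suc_eq)
  have Vpos: "c < x \<and> x < en c" if "V x = Suc r" for x using ev(9)[of x] that by (simp add: V_def)
  have V0: "Vm (Suc c) = V" using Vpos unfolding Vm_def by (fastforce simp: fun_eq_iff)
  have Vend: "Vm (en c) = (\<lambda>z. if V z = Suc r then r else V z)"
    using ev(9) unfolding Vm_def V_def by (force simp: fun_eq_iff)
  have Vb: "Vm z x \<le> n + 2" for z x using ev(8)[of x] rb by (simp add: Vm_def V_def)
  have loop: "wp B (While (Less (Var ''z'') (Read ''E'' (Var ''c'')))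
     (Cond (Eq (Read ''V'' (Var ''z'')) (Var ''r'')) (Write ''V'' (Var ''z'') (Minus (Var ''r'') (Const 1))) Skip ;;
      Cond (Less (Const 0) (Read ''W'' (Plus (Times (Var ''r'') (Var ''n'')) (Var ''z''))))
        (Write ''W'' (Plus (Times (Minus (Var ''r'') (Const 1)) (Var ''n'')) (Var ''z'')) (Const 1)) Skip ;;
      IVar ''z'')) (wp B (Assign ''r'' (Minus (Var ''r'') (Const 1))) Q) x ((fst s)(''z'' := Suc c), snd s)" if x: "g - 40 \<le> x" for x
  proof (rule wp_While[where I = I], goal_cases)
    case 1
    have "((fst s)(''z'' := Suc c), snd s) = ((fst s)(''z'' := Suc c), (snd s)(''V'' := Vm (Suc c), ''W'' := snd s ''W''))"
      by (simp add: V0 V_def fun_upd_idem)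
    then show ?case using gas x ev(7,12,14) unfolding I_def by (intro exI[of _ "Suc c"] exI[of _ "snd s ''W''"]) auto
  next
    case (2 g' s')
    then obtain z W where z: "s' = ((fst s)(''z'' := z), (snd s)(''V'' := Vm z, ''W'' := W))" "z \<le> en c"
      "150 * int (en c - z) + 50 + G \<le> g'" unfolding I_def by blast
    have "z < B" using z(2) ev(12) by (intro small) simp
    then show ?case using z gas(2) ev b by simp
  next
    case (3 g' s')
    then obtain z W where z: "s' = ((fst s)(''z'' := z), (snd s)(''V'' := Vm z, ''W'' := W))" "c < z" "z \<le> en c"
      "\<And>x. c < x \<Longrightarrow> x < en c \<Longrightarrow> 0 < W (r * n + x) \<longleftrightarrow> 0 < snd s ''W'' (r * n + x) \<or> x < z \<and> 0 < snd s ''W'' (Suc r * n + x)"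
      "\<And>j x. j \<noteq> r \<Longrightarrow> x < n \<Longrightarrow> W (j * n + x) = snd s ''W'' (j * n + x)" "\<And>i. W i \<le> 1"
      "150 * int (en c - z) + 50 + G \<le> g'" unfolding I_def by blast
    have zn: "z < en c" "z < n" using 3(2) z(1,3) ev by simp_all
    have Wz: "W (Suc r * n + z) = snd s ''W'' (Suc r * n + z)" using z(5)[of "Suc r" z] zn by simp
    define W' where "W' = (if 0 < W (Suc r * n + z) then W(r * n + z := Suc 0) else W)"
    have Iw: "I x ((fst s)(''z'' := Suc z), (snd s)(''V'' := Vm (Suc z), ''W'' := W'))" if "g' - 140 \<le> x" for x
      unfolding I_def
    proof (intro exI[of _ "Suc z"] exI[of _ W'] conjI allI impI refl)
      fix x assume x: "c < x" "x < en c"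
      then have "r * n + x = r * n + z \<longleftrightarrow> x = z" by simp
      then show "0 < W' (r * n + x) \<longleftrightarrow> 0 < snd s ''W'' (r * n + x) \<or> x < Suc z \<and> 0 < snd s ''W'' (Suc r * n + x)"
        using z(4)[OF x] Wz by (cases "x = z") (auto simp: W'_def less_Suc_eq simp del: mult_Suc)
    next
      fix j x assume "j \<noteq> r" "x < n"
      then show "W' (j * n + x) = snd s ''W'' (j * n + x)"
        using z(5)[of j x] row_index_eq[of j n x r z] zn(2) by (auto simp: W'_def simp del: mult_Suc)
    next
      fix i show "W' i \<le> 1" using z(6)[of i] by (simp add: W'_def)
    qed (use z zn that in auto)
    have vz: "Vm z z = V z" by (simp add: Vm_def)
    have WB: "W i < B" for i using z(6)[of i] by (intro small) simp
    have vB: "V z < B" "z < B" using Vb[of z z] zn by (auto simp: vz intro!: small)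
    have nochange: "(snd s)(''V'' := Vm z, ''W'' := W) = (snd s)(''V'' := (Vm z)(z := V z), ''W'' := W)" using vz by (simp add: fun_upd_idem)
    show ?case
    proof (cases "V z = Suc r")
      case True
      then show ?thesis using Iw[unfolded Vsuc W'_def] zn ev b ix[OF zn(2)] r WB vz vB
        unfolding z(1) by (cases "0 < W (Suc r * n + z)") (simp_all add: wp_simps fit_simps fun_upd_twist[of "''W''" "''V''"] del: mult_Suc)
    next
      case False
      have idem: "(Vm z)(z := V z) = Vm z" using vz by (simp add: fun_upd_idem)
      show ?thesis using Iw[unfolded Vsuc W'_def] False idem zn ev b ix[OF zn(2)] r WB vz vB
        unfolding z(1) by (cases "0 < W (Suc r * n + z)") (simp_all add: wp_simps fit_simps del: mult_Suc)
    qed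
  next
    case (4 g' s')
    then obtain z W where z: "s' = ((fst s)(''z'' := z), (snd s)(''V'' := Vm z, ''W'' := W))" "c < z" "z \<le> en c"
      "\<And>x. c < x \<Longrightarrow> x < en c \<Longrightarrow> 0 < W (r * n + x) \<longleftrightarrow> 0 < snd s ''W'' (r * n + x) \<or> x < z \<and> 0 < snd s ''W'' (Suc r * n + x)"
      "\<And>j x. j \<noteq> r \<Longrightarrow> x < n \<Longrightarrow> W (j * n + x) = snd s ''W'' (j * n + x)" "\<And>i. W i \<le> 1"
      "150 * int (en c - z) + 50 + G \<le> g'" unfolding I_def by blast
    have ze: "z = en c" using 4(2) z(1,3) ev by simp
    define s2 where "s2 = ((fst s)(''z'' := z, ''r'' := r), (snd s)(''V'' := Vm z, ''W'' := W))"
    have v9: "c < x \<and> x < en c" if "Vm (en c) x \<noteq> 0" for x using ev(9)[of x] that r(2) by (auto simp: Vm_def V_def split: if_splits)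
    have "env c s2"
      using e r rb Vb z(6) v9 ze unfolding s2_def env_def by (auto simp del: mult_Suc)
    then have "Q x s2" if "g' - 40 \<le> x" for x
      by (intro Q) (use z ze that Vend[unfolded V_def] in \<open>simp_all add: frame_refl s2_def V_def del: mult_Suc\<close>)
    then show ?case using r b unfolding z(1) s2_def by (simp add: wp_simps fit_simps)
  qed
  then show ?thesis unfolding merge_prog_def using ev b by (simp add: wp_simps fit_simps)
qed

end

text \<open>The link of the last element joins no two members of the list, so it may be redirected
  to append something.\<close>

lemma successively_upd_last:
  "successively (\<lambda>x y. nx x = y) xs \<Longrightarrow> distinct xs \<Longrightarrow> successively (\<lambda>x y. (nx(last xs := t)) x = y) xs"
proof (induction xs rule: induct_list012)
  case (3 x y zs)
  then have "x \<noteq> last (y # zs)" using last_in_set[of "y # zs"] by auto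
  then show ?case using 3 by simp
qed auto

lemma successively_link_cong:
  "successively (\<lambda>x y. nx x = y) xs \<Longrightarrow> (\<And>x. x \<in> set xs \<Longrightarrow> nx' x = nx x) \<Longrightarrow> successively (\<lambda>x y. nx' x = y) xs"
  by (induction xs rule: induct_list012) auto

lemma distinct_ids: "distinct (concat (map ids ts)) \<Longrightarrow> u \<in> set ts \<Longrightarrow> distinct (ids u)"
  by (induction ts) auto

section \<open>Joining two trees\<close>

abbreviation "heap_arrays \<equiv> {''kind'', ''label'', ''child'', ''Z'', ''N'', ''next''}"

context build
begin

text \<open>What a new node record \<open>p\<close> over the addresses \<open>U\<close> must
  satisfy, be it prime or binary. The field \<open>N\<close> of \<open>p\<close> is left to the code
  that follows both cases.\<close>

definition built :: "memory \<Rightarrow> memory \<Rightarrow> nat \<Rightarrow> nat set \<Rightarrow> nat set \<Rightarrow> node_type \<Rightarrow> atree list \<Rightarrow> bool" where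
  "built m m' p U F ty ts \<longleftrightarrow> ts \<noteq> [] \<and> local_tree F (Node ty (map strip ts)) \<and>
     linked (m' ''next'') (m' ''child'' p) (map rid ts) \<and> m' ''Z'' p = rid (last ts) \<and> m' ''kind'' p = type_code ty \<and>
     (\<forall>t\<in>set ts. hok m' P t) \<and> distinct (concat (map ids ts)) \<and> set (concat (map ids ts)) \<subseteq> U \<and>
     (\<forall>x. x \<notin> insert p U \<longrightarrow> (\<forall>w\<in>heap_arrays. m' w x = m w x)) \<and> m' ''next'' p = m ''next'' p"

text \<open>Each side is oriented with the representative of the other and with opposite flags. The
  address sets are disjoint, so the second run leaves the list of the first side as it is.\<close>

lemma join_wp:
  fixes s :: store
  assumes t1: "hok (snd s) P t1" "local_tree F1 (strip t1)" and t2: "hok (snd s) P t2" "local_tree F2 (strip t2)"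
    and ids: "distinct (ids t1 @ ids t2)" "set (ids t1 @ ids t2) \<subseteq> {1..2 * n}"
    and F: "F1 \<subseteq> {..<n}" "F2 \<subseteq> {..<n}" "md F1" "md F2" "F1 \<inter> F2 = {}" "md (F1 \<union> F2)"
    and v: "fst s ''i'' = rid t1" "fst s ''j'' = rid t2" "fst s ''g'' = p" "fst s ''n'' = n" "snd s ''A'' = A"
    and nx: "snd s ''next'' (rid t2) = 0"
    and p: "p \<notin> set (ids t1 @ ids t2)" "p \<le> 3 * n"
    and gas: "300 * int n + 1200 + G \<le> g" "0 \<le> G"
    and Q: "\<And>g' s' ty ts. frame (orient_vars \<union> {''u'', ''f'', ''d'', ''l'', ''q''}) {''next'', ''child'', ''Z'', ''kind''} s s' \<Longrightarrow>
      built (snd s) (snd s') p (set (ids t1 @ ids t2)) (F1 \<union> F2) ty ts \<Longrightarrow> G \<le> g' \<Longrightarrow> Q g' s'"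
  shows "wp B join_prog Q g s"
proof -
  have small3: "x \<le> 3 * n \<Longrightarrow> x < B" for x by (intro small_fits) simp
  have dj: "set (ids t1) \<inter> set (ids t2) = {}" "distinct (ids t1)" "distinct (ids t2)" using ids(1) by auto
  have idb: "x \<le> 3 * n" if "x \<in> set (ids t1) \<union> set (ids t2)" for x
  proof -
    have "x \<in> {1..2 * n}" using ids(2) that by auto
    then show ?thesis by simp
  qed
  have len: "length (ids t) \<le> 3 * n" if "distinct (ids t)" "set (ids t) \<subseteq> set (ids t1 @ ids t2)" for t
  proof -
    have "card (set (ids t)) \<le> card {1..2 * n}" using that(2) ids(2) by (intro card_mono) auto
    then show ?thesis using distinct_card[OF that(1)] by simp
  qed
  obtain f1 where f1: "f1 \<in> F1" "snd s ''N'' (rid t1) = P f1"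
    using hok_label[OF t1(1)] set_mdtree_local_tree[OF t1(2)] by auto
  obtain f2 where f2: "f2 \<in> F2" "snd s ''N'' (rid t2) = P f2"
    using hok_label[OF t2(1)] set_mdtree_local_tree[OF t2(2)] by auto
  have fn: "f1 < n" "f2 < n" "f1 \<notin> F2" "f2 \<notin> F1" using f1 f2 F by auto
  have Pf: "P f1 < B" "P f2 < B" using P_less[OF fn(1)] P_less[OF fn(2)] by (auto intro!: small3)
  have rb: "rid t1 < B" "rid t2 < B" "p < B" using idb rid_in_ids p by (auto intro!: small3)
  define s1 where "s1 = ((fst s)(''a'' := Suc 0, ''u'' := rid t1, ''f'' := P f2, ''d'' := Suc 0), snd s)"
  have main: "wp B orient_prog (wp B join_second_prog Q) x s1" if x: "g - 20 \<le> x" for x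
  proof (rule orient_wp[where tr = t1 and F = F1 and f = f2 and d = True and G = "150 * int n + 700 + G"])
    show "hok (snd s1) P t1" "fst s1 ''u'' = rid t1" "fst s1 ''f'' = P f2" "fst s1 ''d'' = (if True then 1 else 0)" "fst s1 ''n'' = n" "snd s1 ''A'' = A"
      using t1 v by (simp_all add: s1_def)
    show "y \<le> 3 * n" if "y \<in> set (ids t1)" for y using idb that by blast
    show "length (ids t1) \<le> 3 * n" using len dj by auto
    show "150 * int n + 400 + (150 * int n + 700 + G) \<le> x" using gas x by simp
  next
    fix g2 s2 Ds1 Bs1 lin1
    assume fr2: "frame orient_vars {''next''} s1 s2" and O1: "oriented_list (snd s1) t1 F1 f2 True (snd s2) Ds1 Bs1 lin1"
      and h2: "fst s2 ''h'' = rid (hd Ds1)" "fst s2 ''t'' = rid (last Ds1)" "fst s2 ''a'' = (if lin1 then 2 else fst s1 ''a'')"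
      and g2: "150 * int n + 700 + G \<le> g2"
    note o1 = O1[unfolded oriented_list_def, THEN conjunct1] and o1s = O1[unfolded oriented_list_def]
    have D1: "list_all2 local_tree Bs1 (map strip Ds1)" "oriented F1 f2 True Bs1 lin1" "\<And>t. t \<in> set Ds1 \<Longrightarrow> hok (snd s2) P t"
      "distinct (concat (map ids Ds1))" "set (concat (map ids Ds1)) \<subseteq> set (ids t1)" "successively (\<lambda>x y. snd s2 ''next'' x = y) (map rid Ds1)"
      "\<And>x. x \<notin> set (ids t1) - {rid t1} \<Longrightarrow> snd s2 ''next'' x = snd s ''next'' x"
      using o1s unfolding s1_def by auto
    have m2: "snd s2 w = snd s w" if "w \<noteq> ''next''" for w using frameD(2)[OF fr2, of w] that by (simp add: s1_def)
    have v2: "fst s2 ''i'' = rid t1" "fst s2 ''j'' = rid t2" "fst s2 ''g'' = p" "fst s2 ''n'' = n"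
      using frameD(1)[OF fr2, of "''i''"] frameD(1)[OF fr2, of "''j''"] frameD(1)[OF fr2, of "''g''"] frameD(1)[OF fr2, of "''n''"] v by (simp_all add: s1_def)
    have rD1: "rid t \<in> set (ids t1)" if "t \<in> set Ds1" for t using D1(5) rid_in_ids[of t] that by auto
    have hb1: "rid (hd Ds1) < B" "rid (last Ds1) < B" using rD1 o1 idb by (auto intro!: small3)
    define s3 where "s3 = ((fst s2)(''l'' := rid (hd Ds1), ''q'' := rid (last Ds1), ''u'' := rid t2, ''f'' := P f1, ''d'' := 0), snd s2)"
    have second: "wp B orient_prog (wp B join_tail_prog Q) x s3" if x: "g2 - 20 \<le> x" for x
    proof (rule orient_wp[where tr = t2 and F = F2 and f = f1 and d = False and G = "100 + G"])
      show "hok (snd s3) P t2"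
      proof (rule hok_agree[OF t2(1) dj(3)])
        show "agree (snd s) (snd s3) t2" using m2 D1(7) dj(1) by (auto simp: agree_def s3_def)
      qed
      show "fst s3 ''u'' = rid t2" "fst s3 ''f'' = P f1" "fst s3 ''d'' = (if False then 1 else 0)" "fst s3 ''n'' = n" "snd s3 ''A'' = A"
        using v2 m2[of "''A''"] v by (simp_all add: s3_def)
      show "y \<le> 3 * n" if "y \<in> set (ids t2)" for y using idb that by blast
      show "length (ids t2) \<le> 3 * n" using len dj by auto
      show "150 * int n + 400 + (100 + G) \<le> x" using g2 x by simp
      show "0 \<le> 100 + G" using gas by simp
    next
      fix g4 s4 Ds2 Bs2 lin2
      assume fr4: "frame orient_vars {''next''} s3 s4" and O2: "oriented_list (snd s3) t2 F2 f1 False (snd s4) Ds2 Bs2 lin2"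
        and h4: "fst s4 ''h'' = rid (hd Ds2)" "fst s4 ''t'' = rid (last Ds2)" "fst s4 ''a'' = (if lin2 then 2 else fst s3 ''a'')"
        and g4: "100 + G \<le> g4"
      note o2s = O2[unfolded oriented_list_def]
      have s3s: "snd s3 = snd s2" by (simp add: s3_def)
      have D2: "Ds2 \<noteq> []" "list_all2 local_tree Bs2 (map strip Ds2)" "oriented F2 f1 False Bs2 lin2" "\<And>t. t \<in> set Ds2 \<Longrightarrow> hok (snd s4) P t"
        "distinct (concat (map ids Ds2))" "set (concat (map ids Ds2)) \<subseteq> set (ids t2)" "successively (\<lambda>x y. snd s4 ''next'' x = y) (map rid Ds2)"
        "\<And>x. x \<notin> set (ids t2) - {rid t2} \<Longrightarrow> snd s4 ''next'' x = snd s2 ''next'' x"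
        using o2s unfolding s3s by auto
      \<comment> \<open>If the second tree is kept whole, its own \<open>next\<close> field ends the
        joint list, hence it has to be null already.\<close>
      have "snd s2 ''next'' (rid t2) = 0" using D1(7)[of "rid t2"] dj(1) rid_in_ids[of t2] nx by auto
      then have D2l: "snd s4 ''next'' (rid (last Ds2)) = 0" using o2s unfolding s3s by presburger
      have m4: "snd s4 w = snd s w" if "w \<noteq> ''next''" for w using frameD(2)[OF fr4, of w] m2[OF that] that by (simp add: s3_def)
      have v4: "fst s4 ''q'' = rid (last Ds1)" "fst s4 ''l'' = rid (hd Ds1)" "fst s4 ''g'' = p" "fst s3 ''a'' = (if lin1 then 2 else 1)"
        using frameD(1)[OF fr4, of "''q''"] frameD(1)[OF fr4, of "''l''"] frameD(1)[OF fr4, of "''g''"] v2 h2(3) by (simp_all add: s3_def s1_def)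
      have rD2: "rid t \<in> set (ids t2)" if "t \<in> set Ds2" for t using D2(6) rid_in_ids[of t] that by auto
      have hb2: "rid (hd Ds2) < B" "rid (last Ds2) < B" using rD2 D2(1) idb by (auto intro!: small3)
      define lin where "lin \<longleftrightarrow> lin1 \<or> lin2"
      have a4: "fst s4 ''a'' = type_code (if lin then Linear else Complete)" using h4(3) v4(4) by (simp add: lin_def)
      have ab: "fst s4 ''a'' < B" unfolding a4 using n_pos by (auto intro!: small_fits)
      define q where "q = rid (last Ds1)"
      define s5 where "s5 = (fst s4, (snd s4)(''next'' := (snd s4 ''next'')(q := rid (hd Ds2)),
          ''child'' := (snd s ''child'')(p := rid (hd Ds1)), ''Z'' := (snd s ''Z'')(p := rid (last Ds2)),
          ''kind'' := (snd s ''kind'')(p := type_code (if lin then Linear else Complete))))"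
      have q1: "q \<in> set (ids t1)" using rD1 o1 by (simp add: q_def)
      have nx5: "snd s5 ''next'' = (snd s4 ''next'')(q := rid (hd Ds2))" by (simp add: s5_def)
      have pq: "p \<noteq> q" using p q1 by auto
      have frame5: "frame (orient_vars \<union> {''u'', ''f'', ''d'', ''l'', ''q''}) {''next'', ''child'', ''Z'', ''kind''} s s5"
      proof -
        have "frame (orient_vars \<union> {''u'', ''f'', ''d'', ''l'', ''q''}) {''next''} s s1" by (simp add: s1_def frame_refl)
        then have "frame (orient_vars \<union> {''u'', ''f'', ''d'', ''l'', ''q''}) {''next''} s s2" by (rule frame_trans[OF _ fr2]) auto
        then have "frame (orient_vars \<union> {''u'', ''f'', ''d'', ''l'', ''q''}) {''next''} s s3" by (simp add: s3_def)
        then have "frame (orient_vars \<union> {''u'', ''f'', ''d'', ''l'', ''q''}) {''next'', ''child'', ''Z'', ''kind''} s s4" by (rule frame_trans[OF _ fr4]) auto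
        then show ?thesis by (simp add: s5_def)
      qed
      have mem5: "snd s5 w x = snd s w x" if "w \<noteq> ''next''" "x \<noteq> p" for w x using that m4[of w] by (auto simp: s5_def)
      have built: "built (snd s) (snd s5) p (set (ids t1 @ ids t2)) (F1 \<union> F2) (if lin then Linear else Complete) (Ds1 @ Ds2)"
        unfolding built_def
      proof (intro conjI ballI allI impI)
        show "Ds1 @ Ds2 \<noteq> []" using o1 by simp
        have "decomp (F1 \<union> F2) (if lin then Linear else Complete) (Bs1 @ Bs2)"
          unfolding lin_def by (rule decomp_binary[OF D1(2) D2(3) F(3,4,5,6) f1(1) f2(1)])
        then show "local_tree (F1 \<union> F2) (Node (if lin then Linear else Complete) (map strip (Ds1 @ Ds2)))"
          by (rule local_tree.Node) (use D1(1) D2(2) in \<open>simp add: list_all2_appendI\<close>)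
        show "distinct (concat (map ids (Ds1 @ Ds2)))" using D1(4,5) D2(5,6) dj(1) by (auto simp del: set_concat)
        show "set (concat (map ids (Ds1 @ Ds2))) \<subseteq> set (ids t1 @ ids t2)" using D1(5) D2(6) by auto
        show "snd s5 ''Z'' p = rid (last (Ds1 @ Ds2))" using D2(1) by (simp add: s5_def)
        show "snd s5 ''kind'' p = type_code (if lin then Linear else Complete)" by (simp add: s5_def)
        show "snd s5 ''next'' p = snd s ''next'' p"
          using pq p(1) D2(8)[of p] D1(7)[of p] unfolding nx5 by simp
        have d1: "distinct (map rid Ds1)" by (rule distinct_concat_rid[OF D1(4)])
        have "successively (\<lambda>x y. snd s4 ''next'' x = y) (map rid Ds1)"
          by (rule successively_link_cong[OF D1(6)]) (use rD1 dj(1) D2(8) in auto)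
        from successively_upd_last[OF this d1, of "rid (hd Ds2)"]
        have su: "successively (\<lambda>x y. snd s5 ''next'' x = y) (map rid Ds1)" using o1 by (simp add: nx5 q_def last_map)
        have "q \<notin> set (map rid Ds2)" using q1 rD2 dj(1) by auto
        then have "successively (\<lambda>x y. snd s5 ''next'' x = y) (map rid Ds2)"
          by (intro successively_link_cong[OF D2(7)]) (auto simp: nx5)
        moreover have "rid (last Ds2) \<noteq> q" using q1 rD2[of "last Ds2"] D2(1) dj(1) by auto
        moreover have "0 \<notin> set (map rid Ds2)" using rD2 ids(2) by fastforce
        ultimately have "linked (snd s5 ''next'') (rid (hd Ds2)) (map rid Ds2)"
          using D2(1) D2l linked_iff[of "map rid Ds2"] by (auto simp: hd_map last_map nx5)
        moreover have "0 \<notin> set (map rid Ds1)" using rD1 ids(2) by fastforce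
        moreover have "snd s5 ''next'' (last (map rid Ds1)) = rid (hd Ds2)" using o1 by (simp add: nx5 q_def last_map)
        moreover have "snd s5 ''child'' p = rid (hd Ds1)" by (simp add: s5_def)
        ultimately show "linked (snd s5 ''next'') (snd s5 ''child'' p) (map rid (Ds1 @ Ds2))"
          using o1 su unfolding map_append linked_append by (simp add: hd_map)
        fix x w assume x: "x \<notin> insert p (set (ids t1 @ ids t2))" and w: "w \<in> heap_arrays"
        show "snd s5 w x = snd s w x"
        proof (cases "w = ''next''")
          case True
          then show ?thesis using x q1 D2(8)[of x] D1(7)[of x] by (auto simp: nx5)
        qed (use mem5[of w x] x in auto)
      next
        fix u assume "u \<in> set (Ds1 @ Ds2)"
        then consider "u \<in> set Ds1" | "u \<in> set Ds2" by auto
        then show "hok (snd s5) P u"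
        proof cases
          \<comment> \<open>The link from \<open>q\<close> into the second list changes only the
            \<open>next\<close> field of a root, which \<open>agree\<close> exempts.\<close>
          case 1
          have sub: "set (ids u) \<subseteq> set (ids t1)" using D1(5) 1 by auto
          have "x \<noteq> q" if "x \<in> set (ids u) - {rid u}" for x
            using distinct_concat_rid_notin[OF D1(4) 1 that] o1 unfolding q_def by auto
          moreover have "snd s4 ''next'' x = snd s2 ''next'' x" if "x \<in> set (ids u)" for x using D2(8)[of x] sub dj(1) that by blast
          moreover have "x \<noteq> p" if "x \<in> set (ids u)" for x using sub p(1) that by auto
          ultimately have "agree (snd s2) (snd s5) u" using mem5 m2 by (auto simp: agree_def nx5)
          then show ?thesis by (rule hok_agree[OF D1(3)[OF 1] distinct_ids[OF D1(4) 1]])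
        next
          case 2
          have sub: "set (ids u) \<subseteq> set (ids t2)" using D2(6) 2 by auto
          then have "x \<noteq> q" "x \<noteq> p" if "x \<in> set (ids u)" for x using q1 dj(1) p(1) that by auto
          then have "agree (snd s4) (snd s5) u" using mem5 m4 by (auto simp: agree_def nx5)
          then show ?thesis by (rule hok_agree[OF D2(4)[OF 2] distinct_ids[OF D2(5) 2]])
        qed
      qed
      have "Q x s5" if "g4 - 50 \<le> x" for x by (rule Q[OF frame5 built]) (use that g4 in simp)
      then show "wp B join_tail_prog Q g4 s4"
        using h4(1,2) v4(1,2,3) a4 ab hb1 hb2 rb m4[of "''child''"] m4[of "''Z''"] m4[of "''kind''"]
        unfolding join_tail_prog_def s5_def q_def by (simp add: wp_simps)
    qed (use F fn t2 dj in auto)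
    show "wp B join_second_prog Q g2 s2"
      using second[unfolded s3_def] h2(1,2) v2 hb1 rb Pf f1(2) m2[of "''N''"] unfolding join_second_prog_def by (simp add: wp_simps fit_simps)
  qed (use F fn t1 dj gas in auto)
  then show ?thesis unfolding join_prog_def s1_def using v rb f2(2) Pf by (simp add: wp_simps fit_simps)
qed


section \<open>Linking the trees of a component\<close>

lemma link_wp:
  fixes s :: store
  assumes e: "env c s" and r: "fst s ''r'' = r" "0 < r" and i: "fst s ''i'' \<le> 3 * n"
    and T: "\<And>z. snd s ''V'' z = r \<Longrightarrow> snd s ''T'' z \<le> 3 * n \<and> snd s ''T'' z \<noteq> fst s ''i''" "inj_on (snd s ''T'') {z. snd s ''V'' z = r}"
    and gas: "100 * int (n + 1) + G \<le> g" "0 \<le> G"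
    and bs: "bs = filter (\<lambda>z. snd s ''V'' z = r) [Suc c..<en c]" and ch: "ch = fst s ''i'' # map (snd s ''T'') bs"
    and Q: "\<And>g' s'. frame {''j'', ''k'', ''z''} {''V'', ''next''} s s' \<Longrightarrow> snd s' ''V'' = (\<lambda>z. if snd s ''V'' z = r then 0 else snd s ''V'' z) \<Longrightarrow>
      fst s' ''j'' = last ch \<Longrightarrow> fst s' ''k'' = length bs \<Longrightarrow> successively (\<lambda>x y. snd s' ''next'' x = y) ch \<Longrightarrow>
      (\<And>x. x \<notin> set (butlast ch) \<Longrightarrow> snd s' ''next'' x = snd s ''next'' x) \<Longrightarrow> G \<le> g' \<Longrightarrow> Q g' s'"
  shows "wp B link_prog Q g s"
proof -
  note ev = envD[OF e]
  define V where "V = snd s ''V''"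
  define T where "T = snd s ''T''"
  define i where "i = fst s ''i''"
  define Vm where "Vm z = (\<lambda>x. if V x = r \<and> x < z then 0 else V x)" for z
  define bz where "bz z = filter (\<lambda>z. V z = r) [Suc c..<z]" for z
  define cz where "cz z = i # map T (bz z)" for z
  have Tb: "T z \<le> 3 * n" "T z \<noteq> i" if "V z = r" for z using assms(5) that by (auto simp: T_def V_def i_def)
  have Ti: "inj_on T {z. V z = r}" using assms(6) by (simp add: T_def V_def)
  have dist: "distinct (cz z)" for z
    using Tb(2) inj_on_subset[OF Ti, of "set (bz z)"] by (fastforce simp: cz_def bz_def distinct_map)
  have czb: "x \<le> 3 * n" if "x \<in> set (cz z)" for x z using that Tb(1) assms(4) by (auto simp: cz_def bz_def i_def)
  have bz_Suc: "bz (Suc z) = bz z @ (if V z = r then [z] else [])" if "c < z" for z using that by (simp add: bz_def)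
  have lenb: "length (bz z) \<le> z" for z
  proof -
    have "length (bz z) \<le> length [Suc c..<z]" unfolding bz_def by (rule length_filter_le)
    then show ?thesis by simp
  qed
  have Vsuc: "Vm (Suc z) = (Vm z)(z := (if V z = r then 0 else V z))" for z by (auto simp: Vm_def fun_eq_iff less_Suc_eq)
  have Vpos: "c < x \<and> x < en c" if "V x = r" for x using ev(9)[of x] that r(2) by (simp add: V_def)
  have V0: "Vm (Suc c) = V" using Vpos unfolding Vm_def by (fastforce simp: fun_eq_iff)
  have Vend: "Vm (en c) = (\<lambda>z. if V z = r then 0 else V z)" using Vpos unfolding Vm_def by (fastforce simp: fun_eq_iff)
  have small3: "x \<le> 3 * n \<Longrightarrow> x < B" for x by (intro small_fits) simp
  have rB: "r < B" "c < B" "en c < B" using r ev(4,11,12) by (auto intro!: small)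
  define st where "st z nx = ((fst s)(''j'' := last (cz z), ''k'' := length (bz z), ''z'' := z), (snd s)(''V'' := Vm z, ''next'' := nx))" for z nx
  define ok where "ok z nx g' \<longleftrightarrow> c < z \<and> z \<le> en c \<and> successively (\<lambda>x y. nx x = y) (cz z) \<and>
      (\<forall>x. x \<notin> set (butlast (cz z)) \<longrightarrow> nx x = snd s ''next'' x) \<and> 80 * int (en c - z) + 30 + G \<le> g'" for z nx g'
  define I where "I g' s' \<longleftrightarrow> (\<exists>z nx. s' = st z nx \<and> ok z nx g')" for g' and s' :: store
  have loop: "wp B (While (Less (Var ''z'') (Read ''E'' (Var ''c'')))
     (Cond (Eq (Read ''V'' (Var ''z'')) (Var ''r''))
       (Write ''V'' (Var ''z'') (Const 0) ;; Write ''next'' (Var ''j'') (Read ''T'' (Var ''z'')) ;;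
        Assign ''j'' (Read ''T'' (Var ''z'')) ;; IVar ''k'')
       Skip ;;
      IVar ''z'')) Q x ((fst s)(''j'' := i, ''k'' := 0, ''z'' := Suc c), snd s)" if x: "g - 20 \<le> x" for x
  proof (rule wp_While[where I = I], goal_cases)
    case 1
    have "((fst s)(''j'' := i, ''k'' := 0, ''z'' := Suc c), snd s) = st (Suc c) (snd s ''next'')"
      by (simp add: st_def cz_def bz_def V0 V_def fun_upd_idem)
    moreover have "ok (Suc c) (snd s ''next'') x" using gas x ev(12,14) by (simp add: ok_def cz_def bz_def)
    ultimately show ?case unfolding I_def by blast
  next
    case (2 g' s')
    then obtain z nx where z: "s' = st z nx" "ok z nx g'" by (auto simp: I_def)
    have "z < B" using z(2) ev(12) by (intro small) (simp add: ok_def)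
    then show ?case using z gas(2) ev rB by (simp add: ok_def st_def)
  next
    case (3 g' s')
    then obtain z nx where z: "s' = st z nx" "ok z nx g'" by (auto simp: I_def)
    have zn: "z < en c" "z < n" "c < z" using 3(2) z ev by (simp_all add: ok_def st_def)
    have vz: "Vm z z = V z" by (simp add: Vm_def)
    have lc: "last (cz z) < B" by (rule small3[OF czb[OF last_in_set[of "cz z"]]]) (simp add: cz_def)
    have zB: "z < B" "Suc z < B" "length (bz z) < B" "Suc (length (bz z)) < B" using zn lenb[of z] by (auto intro!: small_fits)
    have VB: "V z < B" using ev(8)[of z] by (intro small) (simp add: V_def)
    show ?case
    proof (cases "V z = r")
      case True
      have cs: "cz (Suc z) = cz z @ [T z]" using bz_Suc[OF zn(3)] True by (simp add: cz_def)
      have ne: "cz z \<noteq> []" by (simp add: cz_def)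
      have "ok (Suc z) (nx(last (cz z) := T z)) x" if "g' - 60 \<le> x" for x
      proof -
        have "successively (\<lambda>x y. (nx(last (cz z) := T z)) x = y) (cz z @ [T z])"
          using successively_upd_last[of nx "cz z" "T z"] z(2) dist[of z] ne by (simp add: successively_append_iff ok_def)
        moreover have "set (cz z) = insert (last (cz z)) (set (butlast (cz z)))"
          using ne by (metis append_butlast_last_id list.simps(15) rotate1.simps(2) set_rotate1)
        ultimately show ?thesis using z(2) zn that unfolding ok_def cs by auto
      qed
      then have Ix: "I x (st (Suc z) (nx(last (cz z) := T z)))" if "g' - 60 \<le> x" for x using that unfolding I_def by blast
      have "st (Suc z) (nx(last (cz z) := T z)) = ((fst s)(''j'' := T z, ''k'' := Suc (length (bz z)), ''z'' := Suc z),
          (snd s)(''V'' := (Vm z)(z := 0), ''next'' := nx(last (cz z) := T z)))"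
        using True bz_Suc[OF zn(3)] by (simp add: st_def cs Vsuc)
      with Ix show ?thesis using z(1) True vz VB rB zB lc r small3[OF Tb(1)[OF True]]
        by (simp add: wp_simps fit_simps st_def V_def T_def fun_upd_twist)
    next
      case False
      have "bz (Suc z) = bz z" using bz_Suc[OF zn(3)] False by simp
      then have cs: "bz (Suc z) = bz z" "cz (Suc z) = cz z" by (simp_all add: cz_def)
      have "Vm (Suc z) = Vm z" using False vz by (simp add: Vsuc fun_upd_idem)
      then have "st (Suc z) nx = ((fst s)(''j'' := last (cz z), ''k'' := length (bz z), ''z'' := Suc z), (snd s)(''V'' := Vm z, ''next'' := nx))"
        by (simp add: st_def cs)
      moreover have "ok (Suc z) nx x" if "g' - 60 \<le> x" for x using z(2) zn that by (auto simp: ok_def cs)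
      then have "I x (st (Suc z) nx)" if "g' - 60 \<le> x" for x using that unfolding I_def by blast
      ultimately show ?thesis using z(1) False vz VB rB zB r by (simp add: wp_simps fit_simps st_def V_def)
    qed
  next
    case (4 g' s')
    then obtain z nx where z: "s' = st z nx" "ok z nx g'" by (auto simp: I_def)
    have ze: "z = en c" using 4(2) z ev by (simp add: ok_def st_def)
    have c': "cz (en c) = ch" "bz (en c) = bs" by (simp_all add: ch bs cz_def bz_def V_def T_def i_def)
    show ?case
      by (rule Q) (use z Vend[unfolded V_def] in \<open>simp_all add: st_def ok_def ze c' frame_refl\<close>)
  qed
  have iB: "fst s ''i'' < B" using small3[OF assms(4)] .
  show ?thesis unfolding link_prog_def using loop[unfolded i_def] iB ev(3) rB fit_simps(7)[OF ev(4)] n_pos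
    by (simp add: wp_simps fit_simps)
qed

text \<open>Disjoint trees in memory, indexed by \<open>J\<close>, with leaf sets \<open>S\<close>
  and addresses \<open>R\<close>. Beyond the range from \<open>lo\<close> to \<open>g\<close> the
  fields \<open>next\<close> and \<open>kind\<close> are zero, so a fresh record is a leaf without
  sibling from the start.\<close>

definition forest :: "nat set \<Rightarrow> (nat \<Rightarrow> nat set) \<Rightarrow> (nat \<Rightarrow> nat) \<Rightarrow> (nat \<Rightarrow> atree) \<Rightarrow> nat \<Rightarrow> nat \<Rightarrow> memory \<Rightarrow> bool" where
  "forest J S R tr lo g m \<longleftrightarrow> finite J \<and>
     (\<forall>z\<in>J. hok m P (tr z) \<and> distinct (ids (tr z)) \<and> set (ids (tr z)) \<subseteq> {lo..g} \<and> local_tree (S z) (strip (tr z)) \<and>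
       m ''next'' (rid (tr z)) = 0 \<and> rid (tr z) = R z) \<and>
     (\<forall>x\<in>J. \<forall>y\<in>J. x \<noteq> y \<longrightarrow> set (ids (tr x)) \<inter> set (ids (tr y)) = {}) \<and>
     (\<forall>x. x < lo \<or> g < x \<longrightarrow> m ''next'' x = 0 \<and> m ''kind'' x = 0)"

lemma forestD:
  assumes "forest J S R tr lo g m"
  shows "finite J" "z \<in> J \<Longrightarrow> hok m P (tr z)" "z \<in> J \<Longrightarrow> distinct (ids (tr z))" "z \<in> J \<Longrightarrow> set (ids (tr z)) \<subseteq> {lo..g}"
    "z \<in> J \<Longrightarrow> local_tree (S z) (strip (tr z))" "z \<in> J \<Longrightarrow> m ''next'' (rid (tr z)) = 0" "z \<in> J \<Longrightarrow> rid (tr z) = R z"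
    "x \<in> J \<Longrightarrow> y \<in> J \<Longrightarrow> x \<noteq> y \<Longrightarrow> set (ids (tr x)) \<inter> set (ids (tr y)) = {}" "x < lo \<Longrightarrow> m ''next'' x = 0" "x < lo \<Longrightarrow> m ''kind'' x = 0"
    "g < x \<Longrightarrow> m ''next'' x = 0" "g < x \<Longrightarrow> m ''kind'' x = 0"
  using assms unfolding forest_def by blast+

lemma hok_same: "hok m P t \<Longrightarrow> distinct (ids t) \<Longrightarrow> (\<And>x w. x \<in> set (ids t) \<Longrightarrow> w \<in> heap_arrays \<Longrightarrow> m' w x = m w x) \<Longrightarrow> hok m' P t"
  by (rule hok_agree) (auto simp: agree_def)

text \<open>Serves both ways in which the forest changes: a new leaf, with \<open>K\<close> empty
  and \<open>p\<close> just below the range, and a new inner node that replaces the trees of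
  \<open>K\<close>, with \<open>p\<close> just above it.\<close>

lemma forest_insert:
  assumes F: "forest J S R tr lo g m" and K: "K \<subseteq> J" and U: "U = (\<Union>z\<in>K. set (ids (tr z)))"
    and lo: "lo' \<le> lo" "g \<le> g'" "p \<in> {lo'..g'}" "p \<notin> {lo..g}" "\<And>x. x \<in> {lo'..g'} \<Longrightarrow> x \<noteq> p \<Longrightarrow> x \<in> {lo..g}" and c: "c \<notin> J - K"
    and same: "\<And>x w. x \<notin> insert p U \<Longrightarrow> w \<in> heap_arrays \<Longrightarrow> m' w x = m w x"
    and t: "hok m' P t" "distinct (ids t)" "set (ids t) \<subseteq> insert p U" "local_tree S' (strip t)" "m' ''next'' (rid t) = 0"
  shows "forest (insert c (J - K)) (S(c := S')) (R(c := rid t)) (tr(c := t)) lo' g' m'"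
proof -
  have dj: "set (ids (tr z)) \<inter> insert p U = {}" if "z \<in> J - K" for z
    using forestD(4)[OF F, of z] forestD(8)[OF F, of z] that K lo(4) unfolding U by blast
  have Ul: "insert p U \<subseteq> {lo'..g'}"
    using forestD(4)[OF F] K lo(1,2,3) unfolding U by fastforce
  have s: "m' w x = m w x" if "z \<in> J - K" "x \<in> set (ids (tr z))" "w \<in> heap_arrays" for z x w
    using same[of x w] dj[OF that(1)] that by blast
  show ?thesis
    unfolding forest_def
  proof (intro conjI ballI allI impI)
    show "finite (insert c (J - K))" using forestD(1)[OF F] by simp
  next
    fix z assume z: "z \<in> insert c (J - K)"
    have old: "z \<in> J" "z \<noteq> c" if "z \<in> J - K" using that c by auto
    show "hok m' P ((tr(c := t)) z)"
      using z t(1) hok_same[OF forestD(2)[OF F] forestD(3)[OF F], of z m'] s[of z] old by (cases "z = c") auto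
    show "distinct (ids ((tr(c := t)) z))" "local_tree ((S(c := S')) z) (strip ((tr(c := t)) z))" "rid ((tr(c := t)) z) = (R(c := rid t)) z"
      using z t(2,4) forestD(3,5,7)[OF F, of z] by auto
    show "set (ids ((tr(c := t)) z)) \<subseteq> {lo'..g'}"
      using z t(3) Ul forestD(4)[OF F, of z] lo(1,2) by (cases "z = c") (auto; fastforce)+
    show "m' ''next'' (rid ((tr(c := t)) z)) = 0"
      using z t(5) forestD(6)[OF F, of z] s[of z "rid (tr z)" "''next''"] rid_in_ids[of "tr z"] by (cases "z = c") auto
  next
    fix x y assume x: "x \<in> insert c (J - K)" and y: "y \<in> insert c (J - K)" and ne: "x \<noteq> y"
    show "set (ids ((tr(c := t)) x)) \<inter> set (ids ((tr(c := t)) y)) = {}"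
      using x y ne dj[of x] dj[of y] t(3) forestD(8)[OF F, of x y] by (cases "x = c"; cases "y = c") auto
  next
    fix x assume x: "x < lo' \<or> g' < x"
    then have "x \<notin> insert p U" using Ul by fastforce
    moreover have "x < lo \<or> g < x" using x lo by auto
    ultimately show "m' ''next'' x = 0" "m' ''kind'' x = 0"
      using same[of x "''next''"] same[of x "''kind''"] forestD(9-12)[OF F, of x] by auto
  qed
qed

text \<open>The trees of finished kids have been absorbed by the tree at \<open>c\<close>.\<close>

definition trees_left :: "nat \<Rightarrow> (nat \<Rightarrow> nat) \<Rightarrow> nat set" where
  "trees_left c V = insert c (live (Suc c) - finished c V)"

text \<open>A new inner node takes one address and removes at least one tree, and a new leaf adds
  one tree while \<open>c\<close> drops by one. So the sum compared with \<open>2 * n\<close> never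
  grows, and addresses stay within words.\<close>

definition forest_state :: "nat \<Rightarrow> (nat \<Rightarrow> atree) \<Rightarrow> store \<Rightarrow> bool" where
  "forest_state c tr s \<longleftrightarrow> forest (trees_left c (snd s ''V'')) (\<lambda>z. if z = c then core c (finished c (snd s ''V'')) else block z)
     (\<lambda>z. if z = c then fst s ''i'' else snd s ''T'' z) tr (Suc c) (fst s ''g'') (snd s) \<and> fst s ''g'' + card (trees_left c (snd s ''V'')) + c \<le> 2 * n"

abbreviation "output_vars \<equiv> orient_vars \<union> {''u'', ''f'', ''d'', ''l'', ''q'', ''j'', ''k'', ''z'', ''r'', ''g'', ''i''}"

lemma output_wp:
  fixes s :: store
  assumes e: "env c s" and r: "fst s ''r'' = r" "3 \<le> r" and ok: "path_ok c (snd s ''V'') r"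
    and no: "\<And>x y. snd s ''V'' x = r \<Longrightarrow> snd s ''V'' y \<noteq> 0 \<Longrightarrow> snd s ''V'' y \<noteq> r \<Longrightarrow> \<not> forces c x y"
    and F: "forest_state c tr s"
    and gas: "1000 * int (n + 1) + 1000 + G \<le> g" "0 \<le> G"
    and Q: "\<And>g' s' tr'. frame output_vars {''V'', ''next'', ''child'', ''Z'', ''kind'', ''N''} s s' \<Longrightarrow> env c s' \<Longrightarrow> fst s' ''r'' = r - 1 \<Longrightarrow>
      snd s' ''V'' = (\<lambda>z. if snd s ''V'' z = r then 0 else snd s ''V'' z) \<Longrightarrow> forest_state c tr' s' \<Longrightarrow> G \<le> g' \<Longrightarrow> Q g' s'"
  shows "wp B output_prog Q g s"
proof -
  note ev = envD[OF e]
  define V where "V = snd s ''V''"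
  define T where "T = snd s ''T''"
  define D where "D = finished c V"
  define K where "K = {z. V z = r}"
  define J where "J = trees_left c V"
  define S where "S = (\<lambda>z. if z = c then core c D else block z)"
  define R where "R = (\<lambda>z. if z = c then fst s ''i'' else T z)"
  define g0 where "g0 = fst s ''g''"
  define p where "p = Suc g0"
  define bs where "bs = filter (\<lambda>z. V z = r) [Suc c..<en c]"
  define V' where "V' = (\<lambda>z. if V z = r then 0 else V z)"
  have fo: "forest J S R tr (Suc c) g0 (snd s)" and cnt: "g0 + card J + c \<le> 2 * n"
    using F unfolding forest_state_def J_def S_def R_def g0_def T_def V_def D_def by blast+
  note f = forestD[OF fo]
  have po: "sink_component c D K" "finished c V' = D \<union> K"
    unfolding D_def K_def V'_def V_def using path_output(1,3)[OF ok r(2) no] by simp_all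
  note sc = sink_componentD[OF ev(4) po(1)]
  have Vpos: "c < z \<and> z < en c" if "V z = r" for z using ev(9)[of z] that r(2) by (simp add: V_def)
  have setbs: "set bs = K" unfolding bs_def K_def using Vpos by (auto simp: Suc_le_eq)
  have dbs: "distinct bs" by (simp add: bs_def)
  have KJ: "K \<subseteq> J" "c \<notin> K" "c \<in> J"
  proof -
    show "c \<in> J" by (simp add: J_def trees_left_def)
    show "c \<notin> K" using sc(2) kidsD(1)[of c c] by auto
    have "z \<in> J" if z: "z \<in> K" for z
    proof -
      have "z \<in> live (Suc c)" using sc(2) z by (auto simp: kids_def)
      moreover have "V z \<noteq> 0" using z r(2) by (simp add: K_def)
      ultimately show ?thesis by (simp add: J_def trees_left_def finished_def)
    qed
    then show "K \<subseteq> J" by blast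
  qed
  have Kne: "K \<noteq> {}" using po(1) by (simp add: sink_component_def)
  have Rz: "rid (tr c) = fst s ''i''" "\<And>z. z \<in> K \<Longrightarrow> rid (tr z) = T z" using f(7) KJ by (auto simp: R_def)
  obtain b0 where b0: "b0 \<in> K" using Kne by blast
  \<comment> \<open>The core and a member of \<open>K\<close> are two different trees, so
    \<open>card J\<close> is at least two and the next address is still in range.\<close>
  have gb: "g0 + 2 \<le> 2 * n"
  proof -
    have "card {c, b0} \<le> card J" by (rule card_mono) (use f(1) KJ b0 in auto)
    then show ?thesis using cnt KJ b0 by (cases "c = b0") auto
  qed
  have idb: "x \<in> {1..2 * n}" "x \<noteq> p" if "x \<in> set (ids (tr z))" "z \<in> J" for x z
    using f(4)[OF that(2)] that(1) gb by (auto simp: p_def)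
  have djK: "set (ids (tr x)) \<inter> set (ids (tr y)) = {}" if "x \<in> insert c K" "y \<in> insert c K" "x \<noteq> y" for x y
    using f(8)[of x y] that KJ by blast
  define ch where "ch = fst s ''i'' # map T bs"
  have ch_rid: "ch = map rid (tr c # map tr bs)" using Rz setbs by (simp add: ch_def)
  have dist: "distinct (concat (map ids (tr c # map tr bs)))"
  proof -
    have "distinct (concat (map (ids \<circ> tr) zs))" if "distinct zs" "set zs \<subseteq> insert c K" for zs
      using that
    proof (induction zs)
      case (Cons z zs)
      have "set (ids (tr z)) \<inter> set (ids (tr y)) = {}" if "y \<in> set zs" for y using djK[of z y] Cons.prems that by auto
      then show ?case using Cons f(3)[of z] KJ by auto
    qed simp
    from this[of "c # bs"] show ?thesis using dbs setbs KJ(2) by (simp add: comp_def)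
  qed
  define U where "U = (\<Union>z\<in>insert c K. set (ids (tr z)))"
  have Uc: "U = set (concat (map ids (tr c # map tr bs)))" using setbs by (auto simp: U_def)
  have pU: "p \<notin> U" using idb(2) KJ by (auto simp: U_def)
  have small3: "x \<le> 3 * n \<Longrightarrow> x < B" for x by (intro small_fits) simp
  have rin: "rid (tr z) \<in> U" if "z \<in> insert c K" for z using that rid_in_ids[of "tr z"] by (auto simp: U_def)
  have Ub: "x \<le> 2 * n" "0 < x" if "x \<in> U" for x using that idb(1) KJ unfolding U_def by fastforce+
  have chU: "set ch \<subseteq> U" using rin setbs by (auto simp: ch_rid)
  have dch: "distinct ch" unfolding ch_rid by (rule distinct_concat_rid[OF dist])
  define tail where "tail = (Write ''N'' (Var ''g'') (Read ''p'' (Var ''c'')) ;; Assign ''i'' (Var ''g''))"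
  define branch where "branch = Cond (Eq (Var ''k'') (Const 1)) join_prog
      (Write ''child'' (Var ''g'') (Var ''i'') ;; Write ''Z'' (Var ''g'') (Var ''j'') ;; Write ''kind'' (Var ''g'') (Const 3))"
  define rest where "rest = (Assign ''r'' (Minus (Var ''r'') (Const 1)) ;; IVar ''g'' ;; branch ;; tail)"
  \<comment> \<open>Prime and binary nodes end alike: once the record satisfies
    \<open>built\<close>, setting \<open>N\<close> and \<open>i\<close> yields the next forest
    state.\<close>
  have fin: "wp B tail Q x s2"
    if fr: "frame (output_vars - {''i''}) {''V'', ''next'', ''child'', ''Z'', ''kind''} s s2" and v2: "fst s2 ''g'' = p" "fst s2 ''r'' = r - 1" "snd s2 ''V'' = V'"
      and m1: "\<And>w y. w \<in> heap_arrays \<Longrightarrow> y \<notin> U \<Longrightarrow> m1 w y = snd s w y" and bt: "built m1 (snd s2) p U (core c (D \<union> K)) ty ts"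
      and x: "100 + G \<le> x" for x s2 m1 ty ts
  proof -
    define s3 where "s3 = ((fst s2)(''i'' := p), (snd s2)(''N'' := (snd s2 ''N'')(p := P c)))"
    define t where "t = ANode p ty ts"
    note b = bt[unfolded built_def]
    have idu: "set (ids u) \<subseteq> U" "distinct (ids u)" if "u \<in> set ts" for u
      using b that distinct_ids[of ts u] by auto
    have m3: "snd s3 w y = snd s2 w y" if "w \<noteq> ''N'' \<or> y \<noteq> p" for w y using that by (auto simp: s3_def)
    have sub: "hok (snd s3) P u" if u: "u \<in> set ts" for u
    proof (rule hok_same[OF _ idu(2)[OF u]])
      show "hok (snd s2) P u" using b u by blast
      show "snd s3 w y = snd s2 w y" if "y \<in> set (ids u)" for y w using m3[of w y] idu(1)[OF u] pU that by blast
    qed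
    have "set_mdtree (Node ty (map strip ts)) = core c (D \<union> K)" using b set_mdtree_local_tree by blast
    moreover have "c \<in> core c (D \<union> K)" by (simp add: core_def)
    moreover have "snd s3 ''N'' p = P c" by (simp add: s3_def)
    ultimately have "\<exists>i\<in>set_mdtree (Node ty (map strip ts)). snd s3 ''N'' p = P i" by blast
    moreover have "snd s3 w = snd s2 w" if "w \<noteq> ''N''" for w using that by (simp add: s3_def)
    moreover have "p \<noteq> 0" by (simp add: p_def)
    ultimately have hok: "hok (snd s3) P t" using b sub unfolding t_def hok.simps by simp
    have "forest (insert c (J - insert c K)) (S(c := core c (D \<union> K))) (R(c := rid t)) (tr(c := t)) (Suc c) p (snd s3)"
    proof (rule forest_insert[OF fo, where K = "insert c K" and U = U and p = p])
      show "insert c K \<subseteq> J" using KJ by simp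
      show "U = (\<Union>z\<in>insert c K. set (ids (tr z)))" by (rule U_def)
      have "c \<le> g0" using f(4)[OF KJ(3)] rid_in_ids[of "tr c"] by auto
      then show "p \<in> {Suc c..p}" by (simp add: p_def)
      show "snd s3 w y = snd s w y" if "y \<notin> insert p U" "w \<in> heap_arrays" for y w using b m1[of w y] m3[of w y] that by auto
      show "distinct (ids t)" "set (ids t) \<subseteq> insert p U" using b pU by (auto simp: t_def simp del: set_concat)
      show "local_tree (core c (D \<union> K)) (strip t)" using b by (simp add: t_def)
      have "snd s2 ''next'' p = m1 ''next'' p" using b by blast
      then show "snd s3 ''next'' (rid t) = 0" using m1[of "''next''" p] pU f(11)[of p] by (simp add: t_def s3_def p_def)
    qed (use hok in \<open>auto simp: p_def\<close>)
    moreover have JK: "insert c (J - insert c K) = trees_left c V'" "J - K = trees_left c V'"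
      using KJ(2) po(2) sc(2) by (auto simp: J_def trees_left_def D_def)
    moreover have T3: "snd s3 ''T'' = T" "snd s3 ''V'' = V'" using frameD(2)[OF fr, of "''T''"] v2 by (simp_all add: s3_def T_def)
    moreover have "S(c := core c (D \<union> K)) = (\<lambda>z. if z = c then core c (finished c V') else block z)" unfolding S_def po(2) by (rule ext) simp
    moreover have "R(c := rid t) = (\<lambda>z. if z = c then p else T z)" unfolding R_def t_def by (rule ext) simp
    moreover have "fst s3 ''g'' = p" "fst s3 ''i'' = p" using v2 by (simp_all add: s3_def)
    moreover have "p + card (trees_left c V') + c \<le> 2 * n"
    proof -
      have "card (J - K) < card J" by (rule psubset_card_mono[OF f(1)]) (use KJ(1) Kne in auto)
      then show ?thesis using cnt JK by (simp add: p_def)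
    qed
    ultimately have fs: "forest_state c (tr(c := t)) s3" by (simp add: forest_state_def cong: if_cong)
    have fr3: "frame output_vars {''V'', ''next'', ''child'', ''Z'', ''kind'', ''N''} s s3"
    proof -
      have "frame output_vars {''V'', ''next'', ''child'', ''Z'', ''kind'', ''N''} s s2" by (rule frame_trans[OF fr frame_refl[of "{}" "{}"]]) auto
      then show ?thesis by (simp add: s3_def)
    qed
    have r3: "fst s3 ''r'' = r - 1" using v2 by (simp add: s3_def)
    have e3: "env c s3"
    proof -
      have "fst s3 v = fst s v" if "v \<in> {''n'', ''c''}" for v using frameD(1)[OF fr3, of v] that by blast
      moreover have "snd s3 w = snd s w" if "w \<in> {''A'', ''p'', ''E'', ''W''}" for w using frameD(2)[OF fr3, of w] that by blast
      moreover have "V' z \<le> n + 2" "V' z \<noteq> 0 \<Longrightarrow> c < z \<and> z < en c" for z using ev(8,9)[of z] by (auto simp: V'_def V_def split: if_splits)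
      moreover have "2 \<le> r - 1" "r - 1 \<le> n + 2" using r ev(11) by auto
      ultimately show ?thesis using e r3 T3(2) unfolding env_def by simp
    qed
    have "Q y s3" if "x - 20 \<le> y" for y
      by (rule Q[OF fr3 e3 r3 _ fs]) (use T3(2)[unfolded V'_def V_def] x that in simp_all)
    moreover have "fst s2 ''c'' = c" "snd s2 ''p'' c = P c" using frameD(1)[OF fr, of "''c''"] frameD(2)[OF fr, of "''p''"] ev(3,4,5) by simp_all
    moreover have "p < B" "P c < B" using gb P_less[OF ev(4)] by (auto simp: p_def intro!: small3)
    ultimately show ?thesis unfolding tail_def using v2(1) ev(4) by (simp add: wp_simps fit_simps s3_def)
  qed
  have "wp B link_prog (wp B rest Q) x s" if x: "g - 10 \<le> x" for x
  proof (rule link_wp[OF e r(1), where G = "500 * int (n + 1) + 1000 + G" and bs = bs and ch = ch])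
    show "fst s ''i'' \<le> 3 * n" using Ub(1)[OF rin[of c]] Rz(1) by simp
    show "snd s ''T'' z \<le> 3 * n \<and> snd s ''T'' z \<noteq> fst s ''i''" if "snd s ''V'' z = r" for z
    proof -
      have z: "z \<in> K" using that by (simp add: K_def V_def)
      then have "T z \<in> set (map T bs)" using setbs by simp
      then have "T z \<noteq> fst s ''i''" using dch by (auto simp: ch_def)
      moreover have "T z \<le> 2 * n" using Ub(1)[OF rin[of z]] Rz(2)[OF z] z by simp
      ultimately show ?thesis by (simp add: T_def)
    qed
    show "inj_on (snd s ''T'') {z. snd s ''V'' z = r}" using dch setbs by (simp add: ch_def distinct_map T_def K_def V_def)
    show "bs = filter (\<lambda>z. snd s ''V'' z = r) [Suc c..<en c]" by (simp add: bs_def V_def)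
    show "ch = fst s ''i'' # map (snd s ''T'') bs" by (simp add: ch_def T_def)
    show "100 * int (n + 1) + (500 * int (n + 1) + 1000 + G) \<le> x" using gas x by simp
    show "0 \<le> 500 * int (n + 1) + 1000 + G" using gas by simp
  next
    fix g1 s1
    assume fr1: "frame {''j'', ''k'', ''z''} {''V'', ''next''} s s1" and V1: "snd s1 ''V'' = (\<lambda>z. if snd s ''V'' z = r then 0 else snd s ''V'' z)"
      and j1: "fst s1 ''j'' = last ch" and k1: "fst s1 ''k'' = length bs" and su: "successively (\<lambda>x y. snd s1 ''next'' x = y) ch"
      and nx1: "\<And>x. x \<notin> set (butlast ch) \<Longrightarrow> snd s1 ''next'' x = snd s ''next'' x" and g1: "500 * int (n + 1) + 1000 + G \<le> g1"
    have V1': "snd s1 ''V'' = V'" unfolding V1 V'_def V_def ..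
    have m1: "snd s1 w = snd s w" if "w \<noteq> ''V''" "w \<noteq> ''next''" for w using frameD(2)[OF fr1, of w] that by simp
    have v1: "fst s1 v = fst s v" if "v \<notin> {''j'', ''k'', ''z''}" for v using frameD(1)[OF fr1, of v] that by blast
    have out1: "snd s1 w y = snd s w y" if "w \<in> heap_arrays" "y \<notin> U" for w y
      using m1[of w] nx1[of y] chU in_set_butlastD[of y ch] that by (cases "w = ''next''") auto
    define s1' where "s1' = ((fst s1)(''r'' := r - 1, ''g'' := p), snd s1)"
    have fr1': "frame (output_vars - {''i''}) {''V'', ''next'', ''child'', ''Z'', ''kind''} s s1'"
    proof -
      have "frame (output_vars - {''i''}) {''V'', ''next'', ''child'', ''Z'', ''kind''} s s1" by (rule frame_trans[OF fr1 frame_refl[of "{}" "{}"]]) auto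
      then show ?thesis by (simp add: s1'_def)
    qed
    have hok1: "hok (snd s1) P (tr z)" if z: "z \<in> insert c K" for z
    proof (rule hok_agree[OF f(2) f(3)])
      show "z \<in> J" "z \<in> J" using z KJ by auto
      have "x \<notin> set ch" if "x \<in> set (ids (tr z)) - {rid (tr z)}" for x
        unfolding ch_rid by (rule distinct_concat_rid_notin[OF dist _ that]) (use z setbs in auto)
      then show "agree (snd s) (snd s1) (tr z)" using m1 nx1 in_set_butlastD by (fastforce simp: agree_def)
    qed
    have lch: "last ch \<in> set ch" by (rule last_in_set) (simp add: ch_def)
    then have lc2: "last ch \<le> 2 * n" using Ub(1) chU by blast
    \<comment> \<open>Linking rewrites \<open>next\<close> only at the trees before the last one,
      whose own field was null.\<close>
    have last0: "snd s1 ''next'' (last ch) = 0"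
    proof -
      have "last ch \<notin> set (butlast ch)"
      proof -
        have "butlast ch @ [last ch] = ch" by (rule append_butlast_last_id) (simp add: ch_def)
        then have "distinct (butlast ch @ [last ch])" using dch by simp
        then show ?thesis by simp
      qed
      moreover note lch
      then obtain z where "z \<in> insert c K" "last ch = rid (tr z)" using setbs unfolding ch_rid by auto
      ultimately show ?thesis using nx1 f(6)[of z] KJ by auto
    qed
    have lb: "length bs = card K" using distinct_card[OF dbs] setbs by simp
    have "K \<subseteq> {..<n}" using sc(2) kidsD(3) by auto
    then have "card K \<le> n" using card_mono[of "{..<n}" K] by simp
    then have kB: "length bs < B" using lb by (intro small_fits) simp
    have pB: "p < B" "g0 < B" "r < B" "r - 1 < B" "rid (tr c) < B" "last ch < B"
      using gb r ev(11) Ub(1)[OF rin[of c]] lc2 by (auto simp: p_def intro!: small_fits)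
    have body: "wp B branch (wp B tail Q) x s1'"
      if x: "g1 - 20 \<le> x" for x
    proof (cases "length bs = 1")
      case True
      then obtain b where b: "bs = [b]" by (auto simp: length_Suc_conv)
      then have Kb: "K = {b}" using setbs by simp
      have bn: "b < n" using sc(2) Kb kidsD(3) by simp
      have cu: "core c D \<union> block b = core c (D \<union> K)" unfolding core_Un Kb by simp
      have Ui: "set (ids (tr c) @ ids (tr b)) = U" by (simp add: U_def Kb)
      have "wp B join_prog (wp B tail Q) y s1'" if y: "300 * int n + 1200 + (100 + G) \<le> y" for y
      proof (rule join_wp[where ?t1.0 = "tr c" and ?t2.0 = "tr b" and ?F1.0 = "core c D" and ?F2.0 = "block b" and p = p and G = "100 + G"])
        show "hok (snd s1') P (tr c)" "hok (snd s1') P (tr b)" using hok1 Kb by (simp_all add: s1'_def)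
        have "b \<noteq> c" "b \<in> J" using KJ Kb by auto
        then show "local_tree (core c D) (strip (tr c))" "local_tree (block b) (strip (tr b))" using f(5)[OF KJ(3)] f(5)[of b] by (simp_all add: S_def)
        show "distinct (ids (tr c) @ ids (tr b))" using dist b by simp
        show "set (ids (tr c) @ ids (tr b)) \<subseteq> {1..2 * n}" unfolding Ui using Ub by fastforce
        show "md (core c D)" "md (block b)" "md (core c D \<union> block b)" using sc(3,4) block_md[OF bn] cu by simp_all
        then show "core c D \<subseteq> {..<n}" "block b \<subseteq> {..<n}" by (auto simp: hom_module_def)
        show "core c D \<inter> block b = {}" using sc(5)[of b] Kb by auto
        show "fst s1' ''i'' = rid (tr c)" "fst s1' ''g'' = p" "fst s1' ''n'' = n" "snd s1' ''A'' = A"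
          using v1 Rz(1) m1 ev(1,2) by (simp_all add: s1'_def)
        show "fst s1' ''j'' = rid (tr b)" using j1 by (simp add: s1'_def ch_rid b)
        show "snd s1' ''next'' (rid (tr b)) = 0" using last0 by (simp add: s1'_def ch_rid b)
        show "p \<notin> set (ids (tr c) @ ids (tr b))" unfolding Ui by (rule pU)
        show "p \<le> 3 * n" using gb by (simp add: p_def)
        show "0 \<le> 100 + G" using gas by simp
        fix g2 s2 ty ts
        assume fr2: "frame (orient_vars \<union> {''u'', ''f'', ''d'', ''l'', ''q''}) {''next'', ''child'', ''Z'', ''kind''} s1' s2"
          and bt: "built (snd s1') (snd s2) p (set (ids (tr c) @ ids (tr b))) (core c D \<union> block b) ty ts" and g2: "100 + G \<le> g2"
        show "wp B tail Q g2 s2"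
        proof (rule fin[OF _ _ _ _ out1 bt[unfolded Ui cu s1'_def snd_conv] g2])
          show "frame (output_vars - {''i''}) {''V'', ''next'', ''child'', ''Z'', ''kind''} s s2" by (rule frame_trans[OF fr1' fr2]) auto
          show "fst s2 ''g'' = p" "fst s2 ''r'' = r - 1" using frameD(1)[OF fr2, of "''g''"] frameD(1)[OF fr2, of "''r''"] by (simp_all add: s1'_def)
          show "snd s2 ''V'' = V'" using frameD(2)[OF fr2, of "''V''"] V1' by (simp add: s1'_def)
        qed
      qed (rule y)
      then show ?thesis using True x g1 k1 kB by (simp add: wp_simps fit_simps s1'_def branch_def)
    next
      case False
      have l2: "2 \<le> length bs" using False lb Kne card_gt_0_iff[of K] finite_subset[OF \<open>K \<subseteq> {..<n}\<close>] by auto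
      define m2 where "m2 = (snd s1)(''child'' := (snd s ''child'')(p := rid (tr c)), ''Z'' := (snd s ''Z'')(p := last ch), ''kind'' := (snd s ''kind'')(p := 3))"
      define s2 where "s2 = (fst s1', m2)"
      have same2: "m2 w y = snd s1 w y" if "y \<noteq> p \<or> w \<notin> {''child'', ''Z'', ''kind''}" for w y using that m1 by (auto simp: m2_def)
      have bt: "built (snd s1) m2 p U (core c (D \<union> K)) Prime (tr c # map tr bs)"
        unfolding built_def
      proof (intro conjI ballI allI impI)
        show "tr c # map tr bs \<noteq> []" by simp
        have dec: "decomp (core c (D \<union> K)) Prime (core c D # map block bs)"
          unfolding setbs[symmetric] by (rule component_prime[OF ev(4) _ dbs l2]) (use po(1) setbs in simp)
        show "local_tree (core c (D \<union> K)) (Node Prime (map strip (tr c # map tr bs)))"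
        proof (rule local_tree.Node[OF dec])
          have "local_tree (block z) (strip (tr z))" if z: "z \<in> K" for z
          proof -
            have "z \<noteq> c" "z \<in> J" using KJ z by auto
            then show ?thesis using f(5)[of z] by (simp add: S_def)
          qed
          moreover have "local_tree (core c D) (strip (tr c))" using f(5)[OF KJ(3)] by (simp add: S_def)
          ultimately show "list_all2 local_tree (core c D # map block bs) (map strip (tr c # map tr bs))"
            using setbs by (auto simp: list_all2_map1 list_all2_map2 intro!: list.rel_refl_strong)
        qed
        have "0 \<notin> set ch" using chU Ub(2) by blast
        moreover have "ch \<noteq> []" by (simp add: ch_def)
        ultimately have "linked (snd s1 ''next'') (hd ch) ch" using su last0 linked_iff[of ch] by blast
        moreover have "hd ch = rid (tr c)" by (simp add: ch_rid)
        ultimately show "linked (m2 ''next'') (m2 ''child'' p) (map rid (tr c # map tr bs))" by (simp add: m2_def ch_rid)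
        show "m2 ''Z'' p = rid (last (tr c # map tr bs))"
          unfolding m2_def ch_rid by (simp add: last_map)
        show "m2 ''kind'' p = type_code Prime" by (simp add: m2_def)
        show "distinct (concat (map ids (tr c # map tr bs)))" by (rule dist)
        show "set (concat (map ids (tr c # map tr bs))) \<subseteq> U" unfolding Uc by simp
        show "m2 ''next'' p = snd s1 ''next'' p" by (simp add: m2_def)
        show "m2 w y = snd s1 w y" if "y \<notin> insert p U" for w y using same2 that by blast
        show "hok m2 P t" if t: "t \<in> set (tr c # map tr bs)" for t
        proof -
          obtain z where z: "z \<in> insert c K" "t = tr z" using t setbs by auto
          have "z \<in> J" using z KJ by auto
          moreover have "y \<noteq> p" if "y \<in> set (ids (tr z))" for y
          proof -
            have "y \<in> U" using z(1) that by (auto simp: U_def)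
            then show ?thesis using pU by auto
          qed
          ultimately show ?thesis
            unfolding z(2) by (intro hok_same[OF hok1[OF z(1)] f(3)] same2) auto
        qed
      qed
      have fr2: "frame (output_vars - {''i''}) {''V'', ''next'', ''child'', ''Z'', ''kind''} s s2"
        using fr1' by (simp add: s2_def m2_def s1'_def)
      have bt2: "built (snd s1) (snd s2) p U (core c (D \<union> K)) Prime (tr c # map tr bs)"
        using bt by (simp only: s2_def snd_conv)
      have "wp B tail Q y s2" if "100 + G \<le> y" for y
        by (rule fin[OF fr2 _ _ _ out1 bt2 that]) (use V1' in \<open>simp_all add: s2_def s1'_def m2_def\<close>)
      then show ?thesis using False x g1 k1 j1 kB pB Rz(1) v1[of "''i''"] m1 fit_simps(3,4) small_fits[of 3] n_pos
        unfolding s2_def m2_def by (simp add: wp_simps s1'_def branch_def)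
    qed
    show "wp B rest Q g1 s1"
      unfolding rest_def using body v1[of "''r''"] v1[of "''g''"] r pB
      by (simp add: wp_simps fit_simps s1'_def g0_def p_def)
  qed (use r in auto)
  then show ?thesis unfolding output_prog_def rest_def tail_def branch_def by (simp add: wp_simps)
qed


section \<open>One event of the search\<close>

lemma forest_cong:
  assumes F: "forest J S R tr lo g m" and same: "\<And>w. w \<in> heap_arrays \<Longrightarrow> m' w = m w"
  shows "forest J S R tr lo g m'"
proof -
  have "hok m' P (tr z)" if "z \<in> J" for z
    by (rule hok_same[OF forestD(2)[OF F that] forestD(3)[OF F that]]) (simp add: same)
  moreover have "m' ''next'' = m ''next''" "m' ''kind'' = m ''kind''" using same by simp_all
  ultimately show ?thesis using F unfolding forest_def by (simp only:) blast
qed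

lemma forest_state_cong:
  assumes F: "forest_state c tr s" and same: "\<And>w. w \<in> heap_arrays \<union> {''T''} \<Longrightarrow> snd s' w = snd s w"
    and v: "fst s' ''i'' = fst s ''i''" "fst s' ''g'' = fst s ''g''" and fin: "finished c (snd s' ''V'') = finished c (snd s ''V'')"
  shows "forest_state c tr s'"
proof -
  have "snd s' ''T'' = snd s ''T''" "\<And>w. w \<in> heap_arrays \<Longrightarrow> snd s' w = snd s w" using same by blast+
  then show ?thesis
    using F forest_cong[of _ _ _ tr "Suc c" "fst s ''g''" "snd s" "snd s'"] v fin
    unfolding forest_state_def trees_left_def by (simp cong: if_cong)
qed

definition rows_ok :: "nat \<Rightarrow> store \<Rightarrow> bool" where
  "rows_ok c s \<longleftrightarrow> (\<forall>j z. 3 \<le> j \<longrightarrow> j \<le> fst s ''r'' \<longrightarrow> c < z \<longrightarrow> z < en c \<longrightarrow>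
     (0 < snd s ''W'' (j * n + z) \<longleftrightarrow> (\<exists>x. snd s ''V'' x = j \<and> forces c x z)))"

definition unvisited :: "store \<Rightarrow> nat set" where
  "unvisited s = {z. snd s ''V'' z = 1}"

text \<open>A push turns one unvisited kid into one new level; a merge or an output removes a level.
  With weight two on unvisited kids each of them lowers the sum.\<close>

definition events :: "store \<Rightarrow> nat" where
  "events s = 2 * card (unvisited s) + (fst s ''r'' - 2)"

definition event_inv :: "nat \<Rightarrow> (nat \<Rightarrow> atree) \<Rightarrow> store \<Rightarrow> bool" where
  "event_inv c tr s \<longleftrightarrow> env c s \<and> path_ok c (snd s ''V'') (fst s ''r'') \<and> rows_ok c s \<and>
     fst s ''r'' + card (unvisited s) \<le> n + 2 \<and> forest_state c tr s"

lemma finite_unvisited: "env c s \<Longrightarrow> finite (unvisited s)"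
proof (rule finite_subset)
  assume "env c s"
  note ev = envD[OF this]
  show "unvisited s \<subseteq> {..<n}"
  proof
    fix z assume "z \<in> unvisited s"
    then show "z \<in> {..<n}" using ev(9)[of z] ev(12) by (simp add: unvisited_def)
  qed
qed simp

abbreviation "event_vars \<equiv> output_vars \<union> {''y'', ''o''}"
abbreviation "event_arrays \<equiv> {''V'', ''W'', ''next'', ''child'', ''Z'', ''kind'', ''N''}"

lemma event_wp:
  fixes s :: store
  assumes inv: "event_inv c tr s" and gas: "3000 * int (n + 1) + G \<le> g" "0 \<le> G"
    and Q: "\<And>g' s' tr'. frame event_vars event_arrays s s' \<Longrightarrow> event_inv c tr' s' \<Longrightarrow>
      (fst s' ''o'' = fst s ''o'' \<and> events s' < events s) \<or> (fst s' ''o'' = 0 \<and> (\<forall>z. snd s' ''V'' z = 0)) \<Longrightarrow> G \<le> g' \<Longrightarrow> Q g' s'"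
  shows "wp B event_prog Q g s"
proof -
  have e: "env c s" and po: "path_ok c (snd s ''V'') (fst s ''r'')" and ro: "rows_ok c s"
    and ct: "fst s ''r'' + card (unvisited s) \<le> n + 2" and fs: "forest_state c tr s"
    using inv by (auto simp: event_inv_def)
  note ev = envD[OF e]
  define V where "V = snd s ''V''"
  define r where "r = fst s ''r''"
  have poV: "z \<in> kids c" "V z \<le> r" "V z \<noteq> 2" if "V z \<noteq> 0" for z using po that by (auto simp: path_ok_def V_def r_def)
  define rest where "rest = (Cond (Less (Var ''y'') (Read ''E'' (Var ''c'')))
      (Cond (Eq (Read ''V'' (Var ''y'')) (Const 1)) push_prog merge_prog)
      (Cond (Eq (Var ''r'') (Const 2)) (Assign ''o'' (Const 0)) output_prog))"
  have "wp B search_prog (wp B rest Q) x s" if x: "g - 10 \<le> x" for x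
  proof (rule search_wp[OF e, where G = "2500 * int (n + 1) + G"])
    show "100 * int (n + 1) + (2500 * int (n + 1) + G) \<le> x" using gas x by simp
    show "0 \<le> 2500 * int (n + 1) + G" using gas by simp
    fix g1 s1 y
    assume fr1: "frame {''y''} {} s s1" and y: "fst s1 ''y'' = y" "c < y" "y \<le> en c" "\<And>z. c < z \<Longrightarrow> z < y \<Longrightarrow> \<not> target s z"
      and ty: "y < en c \<Longrightarrow> target s y" and g1: "2500 * int (n + 1) + G \<le> g1"
    have m1: "snd s1 = snd s" using frameD(2)[OF fr1] by (auto simp: fun_eq_iff)
    have v1: "fst s1 v = fst s v" if "v \<noteq> ''y''" for v using frameD(1)[OF fr1, of v] that by simp
    have e1: "env c s1" by (rule env_frame[OF e fr1]) auto
    have fr1': "frame event_vars event_arrays s s1" by (rule frame_trans[OF fr1 frame_refl[of "{}" "{}"]]) auto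
    have r1: "fst s1 ''r'' = r" using v1 by (simp add: r_def)
    have bnd: "y < B" "en c < B" "c < B" "V y < B" "r < B" "2 < B" "3 < B"
      by (rule small, use y(3) ev(4,11,12) ev(8)[of y] in \<open>simp add: V_def r_def\<close>)+
    have br: "wp B rest Q g1 s1 \<longleftrightarrow> (if y < en c
       then (if V y = 1 then wp B push_prog Q (g1 - 5 - 5) s1 else wp B merge_prog Q (g1 - 5 - 5) s1)
       else (if r = 2 then Q (g1 - 5 - 4 - 2) ((fst s1)(''o'' := 0), snd s1) else wp B output_prog Q (g1 - 5 - 4) s1))"
      unfolding rest_def using y(1) v1 m1 ev bnd r1 by (simp add: wp_simps fit_simps V_def)
    consider (push) "y < en c" "V y = 1" | (merge) "y < en c" "V y \<noteq> 1" | (stop) "\<not> y < en c" "r = 2" | (out) "\<not> y < en c" "r \<noteq> 2" by blast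
    then show "wp B rest Q g1 s1"
    proof cases
      case push
      have tg: "target s y" using ty push by blast
      have yk: "y \<in> kids c" "y < n" using poV(1)[of y] push kidsD(3) by auto
      have yu: "y \<in> unvisited s" using push by (simp add: unvisited_def V_def)
      have cu: "card (unvisited s) = Suc (card (unvisited s - {y}))"
        using finite_unvisited[OF e] yu by (metis card.remove)
      have "wp B push_prog Q (g1 - 5 - 5) s1"
      proof (rule push_wp[OF e1 y(1,2) push(1) r1, where G = G])
        show "r \<le> n + 1" using ct cu by (simp add: r_def)
        show "200 * int (n + 1) + G \<le> g1 - 5 - 5" using g1 by simp
        show "0 \<le> G" by (rule gas(2))
        fix g2 s2
        assume fr2: "frame {''r'', ''z''} {''V'', ''W''} s1 s2" and e2: "env c s2" and r2: "fst s2 ''r'' = Suc r"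
          and V2: "snd s2 ''V'' = (snd s1 ''V'')(y := Suc r)"
          and W2: "\<And>z. c < z \<Longrightarrow> z < en c \<Longrightarrow> 0 < snd s2 ''W'' (Suc r * n + z) \<longleftrightarrow> forces c y z"
          and W2': "\<And>j z. j \<le> r \<Longrightarrow> z < n \<Longrightarrow> snd s2 ''W'' (j * n + z) = snd s1 ''W'' (j * n + z)" and g2: "G \<le> g2"
        have V2': "snd s2 ''V'' = V(y := Suc r)" using V2 m1 by (simp add: V_def)
        have "\<exists>x. V x = r \<and> forces c x y" if "3 \<le> r"
        proof -
          have "0 < snd s ''W'' (r * n + y)" using tg that by (simp add: target_def r_def)
          then show ?thesis using ro that y push(1) unfolding rows_ok_def r_def V_def by blast
        qed
        then have p2: "path_ok c (V(y := Suc r)) (Suc r)"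
          using path_push[OF po[folded V_def r_def] push(2)] by blast
        have rows2: "rows_ok c s2"
          unfolding rows_ok_def
        proof (intro allI impI)
          fix j z assume j: "3 \<le> j" "j \<le> fst s2 ''r''" and z: "c < z" "z < en c"
          show "(0 < snd s2 ''W'' (j * n + z)) = (\<exists>x. snd s2 ''V'' x = j \<and> forces c x z)"
          proof (cases "j = Suc r")
            case True
            have "snd s2 ''V'' x = j \<longleftrightarrow> x = y" for x using poV(2)[of x] True by (auto simp: V2')
            then show ?thesis using W2[OF z] True by auto
          next
            case False
            then have jr: "j \<le> r" using j r2 by simp
            have "snd s2 ''V'' x = j \<longleftrightarrow> V x = j" for x using False push(2) j by (auto simp: V2')
            moreover have "z < n" using z ev(12) by simp
            ultimately show ?thesis using W2'[OF jr, of z] ro jr j z m1 unfolding rows_ok_def V_def r_def by auto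
          qed
        qed
        have un2: "unvisited s2 = unvisited s - {y}"
          using ev(10) by (auto simp: unvisited_def V2' V_def r_def)
        have same: "snd s2 w = snd s w" if "w \<in> heap_arrays \<union> {''T''}" for w using frameD(2)[OF fr2, of w] m1 that by auto
        have fs2: "forest_state c tr s2"
        proof (rule forest_state_cong[OF fs same])
          show "fst s2 ''i'' = fst s ''i''" "fst s2 ''g'' = fst s ''g''"
            using frameD(1)[OF fr2, of "''i''"] frameD(1)[OF fr2, of "''g''"] v1 by simp_all
          show "finished c (snd s2 ''V'') = finished c (snd s ''V'')" using push(2) by (auto simp: finished_def V2' V_def)
        qed
        have "event_inv c tr s2" unfolding event_inv_def using e2 p2 rows2 fs2 ct cu un2 r2 by (simp add: V2' r_def)
        moreover have "frame event_vars event_arrays s s2" by (rule frame_trans[OF fr1' fr2]) auto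
        moreover have "fst s2 ''o'' = fst s ''o''" using frameD(1)[OF fr2, of "''o''"] v1 by simp
        moreover have "events s2 < events s" using cu un2 r2 ev(10) by (simp add: events_def r_def)
        ultimately show "Q g2 s2" using g2 Q by blast
      qed
      then show ?thesis unfolding br using push by simp
    next
      case merge
      have tg: "target s y" using ty merge by blast
      have vy: "V y \<noteq> 0" "V y \<noteq> 1" "V y \<noteq> r" using tg merge by (auto simp: target_def V_def r_def)
      then have r3: "3 \<le> r" using poV(2,3)[of y] by linarith
      then have "0 < snd s ''W'' (r * n + y)" using tg by (simp add: target_def r_def)
      then have fy: "\<exists>x. V x = r \<and> forces c x y" using ro r3 y merge(1) unfolding rows_ok_def r_def V_def by blast
      note pm = path_merge[OF po[folded V_def r_def] vy fy]
      define q where "q = r - 1"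
      have q: "r = Suc q" "3 \<le> q" using pm(2) by (auto simp: q_def)
      have "wp B merge_prog Q (g1 - 5 - 5) s1"
      proof (rule merge_wp[OF e1, where r = q and G = G])
        show "fst s1 ''r'' = Suc q" using r1 q by simp
        show "3 \<le> q" by (rule q(2))
        show "300 * int (n + 1) + G \<le> g1 - 5 - 5" using g1 by simp
        show "0 \<le> G" by (rule gas(2))
        fix g2 s2
        assume fr2: "frame {''r'', ''z''} {''V'', ''W''} s1 s2" and e2: "env c s2" and r2: "fst s2 ''r'' = q"
          and V2: "snd s2 ''V'' = (\<lambda>z. if snd s1 ''V'' z = Suc q then q else snd s1 ''V'' z)"
          and W2: "\<And>z. c < z \<Longrightarrow> z < en c \<Longrightarrow> 0 < snd s2 ''W'' (q * n + z) \<longleftrightarrow> 0 < snd s1 ''W'' (q * n + z) \<or> 0 < snd s1 ''W'' (Suc q * n + z)"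
          and W2': "\<And>j z. j < q \<Longrightarrow> z < n \<Longrightarrow> snd s2 ''W'' (j * n + z) = snd s1 ''W'' (j * n + z)" and g2: "G \<le> g2"
        have V2': "snd s2 ''V'' = (\<lambda>z. if V z = r then r - 1 else V z)" unfolding V2 m1 V_def by (simp add: q cong: if_cong)
        have vq: "r - 1 = q" using q by simp
        have rows2: "rows_ok c s2"
          unfolding rows_ok_def
        proof (intro allI impI)
          fix j z assume j: "3 \<le> j" "j \<le> fst s2 ''r''" and z: "c < z" "z < en c"
          have row: "0 < snd s ''W'' (j' * n + z) \<longleftrightarrow> (\<exists>x. V x = j' \<and> forces c x z)" if "3 \<le> j'" "j' \<le> r" for j'
            using ro that z unfolding rows_ok_def V_def r_def by blast
          show "(0 < snd s2 ''W'' (j * n + z)) = (\<exists>x. snd s2 ''V'' x = j \<and> forces c x z)"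
          proof (cases "j = q")
            case True
            have "snd s2 ''V'' x = j \<longleftrightarrow> V x = q \<or> V x = r" for x using True q(1) by (simp add: V2')
            then have "(\<exists>x. snd s2 ''V'' x = j \<and> forces c x z) \<longleftrightarrow> 0 < snd s ''W'' (q * n + z) \<or> 0 < snd s ''W'' (r * n + z)"
              using row[of q] row[of r] q by auto
            then show ?thesis using W2[OF z] True m1 q(1) by simp
          next
            case False
            then have jr: "j < q" using j r2 by simp
            then have "snd s2 ''V'' x = j \<longleftrightarrow> V x = j" for x using q by (auto simp: V2')
            moreover have "z < n" using z ev(12) by simp
            ultimately show ?thesis using W2'[OF jr, of z] row[of j] jr j q m1 by simp
          qed
        qed
        have un2: "unvisited s2 = unvisited s" using q by (auto simp: unvisited_def V2' V_def[symmetric])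
        have same: "snd s2 w = snd s w" if "w \<in> heap_arrays \<union> {''T''}" for w using frameD(2)[OF fr2, of w] m1 that by auto
        have fs2: "forest_state c tr s2"
        proof (rule forest_state_cong[OF fs same])
          show "fst s2 ''i'' = fst s ''i''" "fst s2 ''g'' = fst s ''g''"
            using frameD(1)[OF fr2, of "''i''"] frameD(1)[OF fr2, of "''g''"] v1 by simp_all
          show "finished c (snd s2 ''V'') = finished c (snd s ''V'')" using q by (auto simp: finished_def V2' V_def[symmetric])
        qed
        have "event_inv c tr s2" unfolding event_inv_def V2' r2 using e2 pm(1) rows2 fs2 ct un2 q by (simp add: r_def)
        moreover have "frame event_vars event_arrays s s2" by (rule frame_trans[OF fr1' fr2]) auto
        moreover have "fst s2 ''o'' = fst s ''o''" using frameD(1)[OF fr2, of "''o''"] v1 by simp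
        moreover have "events s2 < events s" using un2 r2 q by (simp add: events_def r_def)
        ultimately show "Q g2 s2" using g2 Q by blast
      qed
      then show ?thesis unfolding br using merge by simp
    next
      case stop
      \<comment> \<open>On the empty path any unvisited kid would have been a target, so a failed
        search means that all kids are finished.\<close>
      have nou: "V z \<noteq> 1" for z
      proof
        assume z: "V z = 1"
        then have "c < z" "z < y" using ev(9)[of z] stop(1) y(3) by (auto simp: V_def)
        moreover have "target s z" using z stop(2) by (simp add: target_def V_def r_def)
        ultimately show False using y(4) by blast
      qed
      have V0: "V z = 0" for z
      proof (rule ccontr)
        assume "V z \<noteq> 0"
        then show False using poV(2,3)[of z] nou[of z] stop(2) by linarith
      qed
      define s2 where "s2 = ((fst s1)(''o'' := 0), snd s1)"
      have e2: "env c s2" by (rule env_frame[OF e1, of "{''o''}" "{}"]) (auto simp: s2_def frame_refl)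
      have "forest_state c tr s2" by (rule forest_state_cong[OF fs]) (use m1 v1 in \<open>auto simp: s2_def\<close>)
      then have ei: "event_inv c tr s2" using e2 po ro ct m1 v1 by (simp add: event_inv_def s2_def rows_ok_def unvisited_def)
      have fr2: "frame event_vars event_arrays s s2" using fr1' by (simp add: s2_def)
      have "Q (g1 - 5 - 4 - 2) s2"
        by (rule Q[OF fr2 ei]) (use V0 m1 g1 in \<open>auto simp: s2_def V_def\<close>)
      then show ?thesis unfolding br using stop by (simp add: s2_def)
    next
      case out
      then have r3: "3 \<le> r" using ev(10) by (simp add: r_def)
      have "wp B output_prog Q (g1 - 5 - 4) s1"
      proof (rule output_wp[OF e1 r1 r3, where tr = tr and G = G])
        show "path_ok c (snd s1 ''V'') r" using po m1 by (simp add: r_def)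
        show "\<not> forces c x z" if "snd s1 ''V'' x = r" "snd s1 ''V'' z \<noteq> 0" "snd s1 ''V'' z \<noteq> r" for x z
        proof -
          have z: "c < z" "z < en c" using ev(9)[of z] that m1 by auto
          then have "\<not> target s z" using y(4)[of z] out(1) y(3) by simp
          then have "\<not> 0 < snd s ''W'' (r * n + z)" using that m1 by (simp add: target_def r_def)
          then show ?thesis using ro r3 z that(1) m1 unfolding rows_ok_def r_def by auto
        qed
        show "forest_state c tr s1" by (rule forest_state_cong[OF fs]) (use m1 v1 in auto)
        show "1000 * int (n + 1) + 1000 + G \<le> g1 - 5 - 4" using g1 by simp
        show "0 \<le> G" by (rule gas(2))
        fix g2 s2 tr'
        assume fr2: "frame output_vars {''V'', ''next'', ''child'', ''Z'', ''kind'', ''N''} s1 s2" and e2: "env c s2" and r2: "fst s2 ''r'' = r - 1"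
          and V2: "snd s2 ''V'' = (\<lambda>z. if snd s1 ''V'' z = r then 0 else snd s1 ''V'' z)" and fs2: "forest_state c tr' s2" and g2: "G \<le> g2"
        have V2': "snd s2 ''V'' = (\<lambda>z. if V z = r then 0 else V z)" unfolding V2 m1 V_def ..
        have W2: "snd s2 ''W'' = snd s ''W''" using frameD(2)[OF fr2, of "''W''"] m1 by simp
        have p2: "path_ok c (snd s2 ''V'') (fst s2 ''r'')"
          unfolding V2' r2
        proof (rule path_output(2)[OF po[folded V_def r_def] r3])
          fix x z assume x: "V x = r" "V z \<noteq> 0" "V z \<noteq> r"
          have z: "c < z" "z < en c" using ev(9)[of z] x by (auto simp: V_def)
          then have "\<not> target s z" using y(4)[of z] out(1) y(3) by simp
          then have "\<not> 0 < snd s ''W'' (r * n + z)" using x by (simp add: target_def r_def V_def)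
          then show "\<not> forces c x z" using ro r3 z x(1) unfolding rows_ok_def r_def V_def by auto
        qed
        have rows2: "rows_ok c s2"
          unfolding rows_ok_def
        proof (intro allI impI)
          fix j z assume j: "3 \<le> j" "j \<le> fst s2 ''r''" and z: "c < z" "z < en c"
          then have "snd s2 ''V'' x = j \<longleftrightarrow> V x = j" for x using r2 r3 by (auto simp: V2')
          then show "(0 < snd s2 ''W'' (j * n + z)) = (\<exists>x. snd s2 ''V'' x = j \<and> forces c x z)"
            using ro j z W2 r2 unfolding rows_ok_def V_def r_def by simp
        qed
        have un2: "unvisited s2 = unvisited s" using r3 by (auto simp: unvisited_def V2' V_def[symmetric])
        have "event_inv c tr' s2" unfolding event_inv_def using e2 p2 rows2 fs2 ct un2 r2 r_def by simp
        moreover have "frame event_vars event_arrays s s2" by (rule frame_trans[OF fr1' fr2]) auto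
        moreover have "fst s2 ''o'' = fst s ''o''" using frameD(1)[OF fr2, of "''o''"] v1 by simp
        moreover have "events s2 < events s" using un2 r2 r3 by (simp add: events_def r_def)
        ultimately show "Q g2 s2" using g2 Q by blast
      qed
      then show ?thesis unfolding br using out by simp
    qed
  qed
  then show ?thesis unfolding event_prog_def rest_def by (simp add: wp_simps)
qed


section \<open>From one position to the whole tree\<close>

lemma kids_init_wp:
  fixes s :: store
  assumes s: "fst s ''c'' = c" "c < n" "\<And>i. i < n \<Longrightarrow> snd s ''E'' i = en i" "snd s ''V'' = (\<lambda>_. 0)" "fst s ''z'' = Suc c"
    and gas: "100 * int (n + 1) + G \<le> g" "0 \<le> G"
    and Q: "\<And>g' s'. frame {''z''} {''V''} s s' \<Longrightarrow> snd s' ''V'' = (\<lambda>x. if x \<in> kids c then 1 else 0) \<Longrightarrow> G \<le> g' \<Longrightarrow> Q g' s'"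
  shows "wp B (While (Less (Var ''z'') (Read ''E'' (Var ''c''))) (Write ''V'' (Var ''z'') (Const 1) ;; Assign ''z'' (Read ''E'' (Var ''z'')))) Q g s"
proof -
  define Vz where "Vz z = (\<lambda>x. if x \<in> kids c \<and> x < z then 1 else 0 :: nat)" for z
  define I where "I g' s' \<longleftrightarrow> (\<exists>z. s' = ((fst s)(''z'' := z), (snd s)(''V'' := Vz z)) \<and> c < z \<and> z \<le> en c \<and> (z < en c \<longrightarrow> z \<in> kids c) \<and>
    50 * int (en c - z) + 20 + G \<le> g')" for g' and s' :: store
  have en: "c < en c" "en c \<le> n" using en_bounds s(2) by auto
  have b: "x < B" if "x \<le> n" for x using that by (intro small) simp
  show ?thesis
  proof (rule wp_While[where I = I], goal_cases)
    case 1
    have "\<not> (x \<in> kids c \<and> x < Suc c)" for x using kidsD(1)[of x c] by auto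
    then have "Vz (Suc c) = (\<lambda>_. 0)" by (auto simp: Vz_def fun_eq_iff)
    then have "s = ((fst s)(''z'' := Suc c), (snd s)(''V'' := Vz (Suc c)))" using s(4,5) by (simp add: fun_upd_idem)
    moreover have "Suc c < en c \<longrightarrow> Suc c \<in> kids c" using first_kid[OF s(2)] by blast
    ultimately show ?case using gas en unfolding I_def by (intro exI[of _ "Suc c"]) auto
  next
    case (2 g' s')
    then obtain z where z: "s' = ((fst s)(''z'' := z), (snd s)(''V'' := Vz z))" "z \<le> en c" "50 * int (en c - z) + 20 + G \<le> g'"
      unfolding I_def by blast
    then show ?case using s gas(2) en b[of z] b[of "en c"] b[of c] by simp
  next
    case (3 g' s')
    then obtain z where z: "s' = ((fst s)(''z'' := z), (snd s)(''V'' := Vz z))" "c < z" "z \<le> en c" "z < en c \<longrightarrow> z \<in> kids c"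
      "50 * int (en c - z) + 20 + G \<le> g'" unfolding I_def by blast
    have zk: "z < en c" "z \<in> kids c" using 3(2) z s by auto
    have zn: "z < n" using zk(1) en by simp
    note nk = next_kid[OF s(2) zk(2)]
    have ez: "z < en z" "en z \<le> n" using en_bounds[OF zn] by auto
    have "x = z" if "x \<in> kids c" "x < en z" "\<not> x < z" for x
      using nk(3)[of x] that by (cases "x = z") auto
    then have V: "Vz (en z) = (Vz z)(z := 1)" using zk ez unfolding Vz_def by (auto simp: fun_eq_iff)
    have "I x ((fst s)(''z'' := en z), (snd s)(''V'' := Vz (en z)))" if "g' - 40 \<le> x" for x
      unfolding I_def using z zk ez nk(1,2) that by (intro exI[of _ "en z"]) auto
    then show ?case using z(1) s(1,2,3) zn ez b[of z] b[of "en z"] V fit_simps(4) by (simp add: wp_simps)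
  next
    case (4 g' s')
    then obtain z where z: "s' = ((fst s)(''z'' := z), (snd s)(''V'' := Vz z))" "c < z" "z \<le> en c" "50 * int (en c - z) + 20 + G \<le> g'"
      unfolding I_def by blast
    have "z = en c" using 4(2) z s by auto
    moreover have "x \<in> kids c \<and> x < en c \<longleftrightarrow> x \<in> kids c" for x using kidsD(2)[of x c] by auto
    then have "Vz (en c) = (\<lambda>x. if x \<in> kids c then 1 else 0)" by (simp add: Vz_def)
    ultimately show ?case by (intro Q) (use z in \<open>simp_all add: frame_refl\<close>)
  qed
qed

definition built_upto :: "nat \<Rightarrow> (nat \<Rightarrow> atree) \<Rightarrow> store \<Rightarrow> bool" where
  "built_upto c tr s \<longleftrightarrow> fst s ''n'' = n \<and> snd s ''A'' = A \<and> fst s ''c'' = c \<and> c \<le> n \<and> (\<forall>i<n. snd s ''p'' i = P i) \<and> (\<forall>i<n. snd s ''E'' i = en i) \<and>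
     (\<forall>i. snd s ''W'' i \<le> 1) \<and> snd s ''V'' = (\<lambda>_. 0) \<and> c \<le> fst s ''g'' \<and> fst s ''g'' + card (live c) + c \<le> 2 * n \<and>
     forest (live c) block (snd s ''T'') tr (Suc c) (fst s ''g'') (snd s) \<and> (c < n \<longrightarrow> fst s ''i'' = snd s ''T'' c)"

text \<open>At most \<open>2 * card (kids c)\<close> events precede the failed search that ends the
  loop, each of linear cost. The summand 2 in the budget covers this last search and the linear work
  around the loop.\<close>

lemma node_wp:
  fixes s :: store
  assumes inv: "built_upto (Suc c) tr s"
    and gas: "4000 * int (n + 1) * (2 * int (card (kids c)) + 2) + G \<le> g" "0 \<le> G"
    and Q: "\<And>g' s' tr'. built_upto c tr' s' \<Longrightarrow> G \<le> g' \<Longrightarrow> Q g' s'"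
  shows "wp B node_prog Q g s"
proof -
  have st: "fst s ''n'' = n" "snd s ''A'' = A" "fst s ''c'' = Suc c" "c < n" "\<And>i. i < n \<Longrightarrow> snd s ''p'' i = P i" "\<And>i. i < n \<Longrightarrow> snd s ''E'' i = en i"
    "\<And>i. snd s ''W'' i \<le> 1" "snd s ''V'' = (\<lambda>_. 0)" "Suc c \<le> fst s ''g''" "fst s ''g'' + card (live (Suc c)) + Suc c \<le> 2 * n"
    and fo: "forest (live (Suc c)) block (snd s ''T'') tr (Suc (Suc c)) (fst s ''g'') (snd s)"
    using inv by (auto simp: built_upto_def)
  define N1 where "N1 = int (n + 1)"
  define k where "k = int (card (kids c))"
  have k0: "0 \<le> k" "1 \<le> N1" by (simp_all add: k_def N1_def)
  define loop1 where "loop1 = While (Less (Var ''z'') (Read ''E'' (Var ''c''))) (Write ''V'' (Var ''z'') (Const 1) ;; Assign ''z'' (Read ''E'' (Var ''z'')))"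
  define loop2 where "loop2 = While (Eq (Var ''o'') (Const 1)) event_prog"
  define tail where "tail = Write ''T'' (Var ''c'') (Var ''i'')"
  define rest where "rest = Assign ''r'' (Const 2) ;; Assign ''o'' (Const 1) ;; loop2 ;; tail"
  have en: "c < en c" "en c \<le> n" using en_bounds st(4) by auto
  have ind: "(4000 * N1) * (2 * k + 2) = 8000 * (N1 * k) + 8000 * N1" by (simp add: algebra_simps)
  have N1k: "0 \<le> N1 * k" using k0 by simp
  define s1 where "s1 = ((fst s)(''c'' := c, ''i'' := Suc c, ''z'' := Suc c),
     (snd s)(''label'' := (snd s ''label'')(Suc c := P c), ''N'' := (snd s ''N'')(Suc c := P c)))"
  have cl: "c \<notin> live (Suc c)" by (auto simp: live_def)
  have final: "wp B tail Q x s3" if inv3: "event_inv c tr3 s3" and V3: "\<And>z. snd s3 ''V'' z = 0" and x: "50 + G \<le> x" for x s3 tr3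
  proof -
    have e: "env c s3" and fs: "forest_state c tr3 s3" using inv3 by (auto simp: event_inv_def)
    note ev = envD[OF e]
    have V0: "snd s3 ''V'' = (\<lambda>_. 0)" using V3 by (simp add: fun_eq_iff)
    have fin: "finished c (snd s3 ''V'') = kids c" by (simp add: finished_def V0)
    have tl: "trees_left c (snd s3 ''V'') = live c" using live_step[OF st(4)] fin by (simp add: trees_left_def)
    define T4 where "T4 = (snd s3 ''T'')(c := fst s3 ''i'')"
    define s4 where "s4 = (fst s3, (snd s3)(''T'' := T4))"
    \<comment> \<open>With all kids finished the core has grown to the whole block of
      \<open>c\<close>.\<close>
    have S: "(\<lambda>z. if z = c then core c (kids c) else block z) = block" by (rule ext) (use core_kids[OF st(4)] in simp)
    have R: "(\<lambda>z. if z = c then fst s3 ''i'' else snd s3 ''T'' z) = T4" by (auto simp: T4_def)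
    have f3: "forest (live c) block T4 tr3 (Suc c) (fst s3 ''g'') (snd s3)" and c3: "fst s3 ''g'' + card (live c) + c \<le> 2 * n"
      using fs unfolding forest_state_def tl fin S R by blast+
    have f4: "forest (live c) block T4 tr3 (Suc c) (fst s3 ''g'') (snd s4)" by (rule forest_cong[OF f3]) (auto simp: s4_def)
    have lc: "c \<in> live c" using live_step[OF st(4)] by simp
    have ri: "rid (tr3 c) = fst s3 ''i''" "rid (tr3 c) \<in> {Suc c..fst s3 ''g''}"
      using forestD(4,7)[OF f3 lc] rid_in_ids[of "tr3 c"] by (auto simp: T4_def)
    have "built_upto c tr3 s4"
      using e f4 c3 ri V0 unfolding built_upto_def env_def by (simp add: s4_def T4_def)
    then have "Q y s4" if "x - 10 \<le> y" for y using Q that x by auto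
    moreover have "fst s3 ''i'' < B" using ri c3 by (intro small_fits) simp
    ultimately show ?thesis unfolding tail_def using ev(3,4) by (simp add: wp_simps fit_simps s4_def T4_def)
  qed
  have loop2: "wp B loop2 (wp B tail Q) x s2"
    if i2: "event_inv c tr2 s2" "fst s2 ''o'' = 1" "events s2 = 2 * card (kids c)" and x: "8000 * (N1 * k) + 7000 * N1 + G \<le> x" for x s2 tr2
    unfolding loop2_def
  proof (rule wp_While[where I = "\<lambda>g' s'. (\<exists>tr'. event_inv c tr' s') \<and>
      (fst s' ''o'' = 1 \<and> 3500 * N1 * int (events s') + 3500 * N1 + G \<le> g' \<or> fst s' ''o'' = 0 \<and> (\<forall>z. snd s' ''V'' z = 0) \<and> 100 + G \<le> g')"], goal_cases)
    case 1
    have "3500 * N1 * int (events s2) = 7000 * (N1 * k)" by (simp add: i2(3) k_def)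
    then have "3500 * N1 * int (events s2) + 3500 * N1 + G \<le> x" using x N1k k0(2) by linarith
    then show ?case using i2(1,2) by auto
  next
    case (2 g' s')
    have "0 \<le> 3500 * N1 * int (events s')" using k0 by simp
    moreover have "0 \<le> g'" if "3500 * N1 * int (events s') + 3500 * N1 + G \<le> g'" using calculation that gas(2) k0 by linarith
    ultimately show ?case using 2 gas(2) fit_simps(3,4) by auto
  next
    case (3 g' s')
    then obtain tr' where t: "event_inv c tr' s'" and o: "fst s' ''o'' = 1" and g': "3500 * N1 * int (events s') + 3500 * N1 + G \<le> g'" by auto
    define e' where "e' = N1 * int (events s')"
    have e': "0 \<le> e'" using k0 by (simp add: e'_def)
    have g2: "3500 * e' + 3500 * N1 + G \<le> g'" using g' by (simp add: e'_def)
    show ?case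
    proof (rule event_wp[OF t, where G = "3500 * e' + 400 * N1 + G"])
      show "3000 * int (n + 1) + (3500 * e' + 400 * N1 + G) \<le> g' - 1 - int (bcost (Eq (Var ''o'') (Const 1)))"
        using g2 k0 by (simp add: N1_def)
      show "0 \<le> 3500 * e' + 400 * N1 + G" using e' k0 gas(2) by simp
      fix g3 s3 tr3
      assume i3: "event_inv c tr3 s3" and d: "fst s3 ''o'' = fst s' ''o'' \<and> events s3 < events s' \<or> fst s3 ''o'' = 0 \<and> (\<forall>z. snd s3 ''V'' z = 0)"
        and g3: "3500 * e' + 400 * N1 + G \<le> g3"
      have "3500 * N1 * int (events s3) + 3500 * N1 + G \<le> g3" if "events s3 < events s'"
      proof -
        have "N1 * (int (events s3) + 1) \<le> e'" unfolding e'_def using that k0 by (intro mult_left_mono) auto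
        then have "N1 * int (events s3) + N1 \<le> e'" by (simp add: algebra_simps)
        then show ?thesis using g3 k0 by simp
      qed
      moreover have "100 + G \<le> g3" using g3 e' k0 by simp
      ultimately show "(\<exists>tr'. event_inv c tr' s3) \<and>
        (fst s3 ''o'' = 1 \<and> 3500 * N1 * int (events s3) + 3500 * N1 + G \<le> g3 \<or> fst s3 ''o'' = 0 \<and> (\<forall>z. snd s3 ''V'' z = 0) \<and> 100 + G \<le> g3)"
        using i3 d o by auto
    qed
  next
    case (4 g' s')
    then obtain tr' where t: "event_inv c tr' s'" and o: "\<And>z. snd s' ''V'' z = 0" "100 + G \<le> g'" by auto
    show ?case by (rule final[OF t o(1)]) (use o(2) in simp)
  qed
  have "wp B loop1 (wp B rest Q) x s1" if x: "g - 50 \<le> x" for x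
    unfolding loop1_def
  proof (rule kids_init_wp[of s1 c, where G = "8000 * (N1 * k) + 7500 * N1 + G"])
    show "fst s1 ''c'' = c" "snd s1 ''V'' = (\<lambda>_. 0)" "fst s1 ''z'' = Suc c" "\<And>i. i < n \<Longrightarrow> snd s1 ''E'' i = en i" using st by (simp_all add: s1_def)
    show "100 * int (n + 1) + (8000 * (N1 * k) + 7500 * N1 + G) \<le> x"
      using gas(1) x ind k0 unfolding N1_def[symmetric] k_def[symmetric] by linarith
    show "0 \<le> 8000 * (N1 * k) + 7500 * N1 + G" using N1k k0 gas(2) by linarith
    fix g2 s2
    assume fr: "frame {''z''} {''V''} s1 s2" and V2: "snd s2 ''V'' = (\<lambda>x. if x \<in> kids c then 1 else 0)" and g2: "8000 * (N1 * k) + 7500 * N1 + G \<le> g2"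
    define s3 where "s3 = ((fst s2)(''r'' := 2, ''o'' := Suc 0), snd s2)"
    have m2: "snd s2 w = snd s1 w" if "w \<noteq> ''V''" for w using frameD(2)[OF fr, of w] that by simp
    have v2: "fst s2 v = fst s1 v" if "v \<noteq> ''z''" for v using frameD(1)[OF fr, of v] that by simp
    define t where "t = ALeaf (Suc c) c"
    have fin: "finished c (snd s3 ''V'') = {}" by (simp add: finished_def s3_def V2)
    have e3: "env c s3"
      using st v2 m2 V2 kidsD(1,2)[of _ c] n_pos unfolding env_def by (simp add: s3_def s1_def)
    have f3: "forest (insert c (live (Suc c) - {})) (block(c := {c})) ((snd s ''T'')(c := rid t)) (tr(c := t)) (Suc c) (fst s ''g'') (snd s3)"
    proof (rule forest_insert[OF fo, where K = "{}" and U = "{}" and p = "Suc c"])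
      show "snd s3 w y = snd s w y" if "y \<notin> insert (Suc c) {}" "w \<in> heap_arrays" for y w
        using that m2[of w] by (auto simp: s3_def s1_def)
      have "snd s ''next'' (Suc c) = 0" "snd s ''kind'' (Suc c) = 0" using forestD(9,10)[OF fo, of "Suc c"] by simp_all
      then show "hok (snd s3) P t" "snd s3 ''next'' (rid t) = 0" using m2 by (simp_all add: t_def s3_def s1_def)
      show "local_tree {c} (strip t)" using st(4) by (simp add: t_def local_tree.Leaf)
    qed (use st(9) cl in \<open>auto simp: t_def\<close>)
    have fs3: "forest_state c (tr(c := t)) s3"
    proof -
      have "trees_left c (snd s3 ''V'') = insert c (live (Suc c))" by (simp add: trees_left_def fin)
      moreover have "(\<lambda>z. if z = c then core c (finished c (snd s3 ''V'')) else block z) = block(c := {c})" unfolding fin core_empty by (rule ext) simp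
      moreover have "(\<lambda>z. if z = c then fst s3 ''i'' else snd s3 ''T'' z) = (snd s ''T'')(c := rid t)"
        using m2 v2 by (auto simp: s3_def s1_def t_def)
      moreover have "fst s3 ''g'' = fst s ''g''" using v2 by (simp add: s3_def s1_def)
      moreover have "card (insert c (live (Suc c))) = Suc (card (live (Suc c)))" using cl finite_live by simp
      ultimately show ?thesis using f3 st(10) unfolding forest_state_def by simp
    qed
    have un: "unvisited s3 = kids c" by (auto simp: unvisited_def s3_def V2)
    have "card (kids c) \<le> card {..<n}" by (rule card_mono) (use kidsD(3)[of _ c] in auto)
    then have "event_inv c (tr(c := t)) s3"
      unfolding event_inv_def using e3 fs3 path_init[OF st(4), of "snd s3 ''V''"] V2 un by (simp add: s3_def rows_ok_def)
    then have "wp B loop2 (wp B tail Q) x s3" if "g2 - 20 \<le> x" for x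
      by (rule loop2) (use un g2 k0 that in \<open>simp_all add: s3_def events_def\<close>)
    moreover have "2 < B" "Suc (Suc 0) < B" using n_pos by (auto intro!: small)
    ultimately show "wp B rest Q g2 s2" unfolding rest_def by (simp add: wp_simps fit_simps s3_def)
  qed (use st in simp_all)
  moreover have "fst s ''c'' < B" "2 < B" "c < B" "P c < B" "Suc c < B" "Suc (Suc 0) < B" using st(3,4) P_less[OF st(4)] by (auto intro!: small)
  ultimately show ?thesis
    unfolding node_prog_def loop1_def[symmetric] loop2_def[symmetric] tail_def[symmetric] rest_def[symmetric] using st(3,4,5)
    by (simp add: wp_simps fit_simps s1_def)
qed

lemma build_wp:
  fixes s :: store
  assumes s: "fst s ''n'' = n" "snd s ''A'' = A" "fst s ''c'' = n" "\<And>i. i < n \<Longrightarrow> snd s ''p'' i = P i" "\<And>i. i < n \<Longrightarrow> snd s ''E'' i = en i"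
      "\<And>w. w \<in> {''W'', ''V'', ''next'', ''kind''} \<Longrightarrow> snd s w = (\<lambda>_. 0)"
    and gas: "30000 * int (n + 1) * int n + 100 + G \<le> g" "0 \<le> G"
    and Q: "\<And>g' s' t. stored_tree (snd s') (fst s' ''root'') (map_mdtree P t) \<Longrightarrow> local_tree {..<n} t \<Longrightarrow> G \<le> g' \<Longrightarrow> Q g' s'"
  shows "wp B build_prog Q g s"
proof -
  define N1 where "N1 = int (n + 1)"
  have N1: "1 \<le> N1" by (simp add: N1_def)
  \<comment> \<open>Coming down by one position with \<open>k\<close> kids, \<open>live\<close>
    loses \<open>k - 1\<close> elements and \<open>c\<close> drops by one. The potential falls by
    \<open>2 * k + 2\<close>, the factor in the budget of \<open>node_wp\<close>.\<close>
  define pot where "pot c = 2 * int (card (live c)) + 4 * int c" for c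
  have pot: "0 \<le> pot c" for c by (simp add: pot_def)
  define s0 where "s0 = ((fst s)(''g'' := n), snd s)"
  have "wp B (While (Less (Const 0) (Var ''c'')) node_prog) (wp B (Assign ''root'' (Var ''i'')) Q) x s0" if x: "g - 10 \<le> x" for x
  proof (rule wp_While[where I = "\<lambda>g' s'. (\<exists>c tr. built_upto c tr s' \<and> 5000 * N1 * pot c + 50 + G \<le> g')"], goal_cases)
    case 1
    have "forest {} block (snd s ''T'') undefined (Suc n) n (snd s)" using s(6) by (simp add: forest_def)
    \<comment> \<open>No tree exists yet, so any assignment of trees describes the empty
      forest.\<close>
    then have "built_upto n undefined s0" using s by (simp add: built_upto_def s0_def live_n)
    moreover have "5000 * N1 * pot n = 20000 * (N1 * int n)" by (simp add: pot_def live_n)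
    moreover have "30000 * (N1 * int n) + 100 + G \<le> g" using gas(1) unfolding N1_def by (simp only: mult.assoc)
    moreover have "0 \<le> N1 * int n" using N1 by simp
    ultimately show ?case using x by (intro exI[of _ n] exI[of _ undefined] conjI) linarith+
  next
    case (2 g' s')
    then obtain c tr where c: "built_upto c tr s'" "5000 * N1 * pot c + 50 + G \<le> g'" by blast
    moreover have "0 \<le> N1 * pot c" using N1 pot by simp
    moreover have "fst s' ''c'' < B" using c(1) by (intro small) (simp add: built_upto_def)
    ultimately show ?case using gas(2) fit_simps(3) by simp
  next
    case (3 g' s')
    then obtain c tr where c: "built_upto c tr s'" "5000 * N1 * pot c + 50 + G \<le> g'" by blast
    then obtain d where d: "c = Suc d" using 3(2) by (cases c) (auto simp: built_upto_def)
    have dn: "d < n" using c(1) by (simp add: built_upto_def d)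
    define k where "k = int (card (kids d))"
    have sub: "kids d \<subseteq> live (Suc d)" by (auto simp: kids_def)
    have "d \<notin> live (Suc d)" by (auto simp: live_def)
    then have "card (live d) = Suc (card (live (Suc d)) - card (kids d))"
      unfolding live_step[OF dn] using finite_live card_Diff_subset[OF finite_kids sub] by simp
    moreover have "card (kids d) \<le> card (live (Suc d))" by (rule card_mono[OF finite_live sub])
    ultimately have pk: "pot c = pot d + 2 * k + 2" by (simp add: pot_def d k_def)
    have eq: "5000 * N1 * pot c = 5000 * N1 * pot d + 5000 * N1 * (2 * k + 2)" unfolding pk by (simp add: algebra_simps)
    have le: "4000 * N1 * (2 * k + 2) + 1000 \<le> 5000 * N1 * (2 * k + 2)"
    proof -
      have "1 * 1 \<le> N1 * (2 * k + 2)" by (rule mult_mono) (use N1 in \<open>simp_all add: k_def\<close>)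
      then show ?thesis by (simp add: algebra_simps)
    qed
    show ?case
    proof (rule node_wp[where c = d and tr = tr and G = "5000 * N1 * pot d + 50 + G"])
      show "built_upto (Suc d) tr s'" using c(1) by (simp add: d)
      show "4000 * int (n + 1) * (2 * int (card (kids d)) + 2) + (5000 * N1 * pot d + 50 + G) \<le> g' - 1 - int (bcost (Less (Const 0) (Var ''c'')))"
        using c(2) eq le unfolding N1_def[symmetric] k_def[symmetric] by simp
      show "0 \<le> 5000 * N1 * pot d + 50 + G" using N1 pot gas(2) by simp
    qed blast
  next
    case (4 g' s')
    then obtain c tr where c: "built_upto c tr s'" "5000 * N1 * pot c + 50 + G \<le> g'" by blast
    then have c0: "c = 0" using 4(2) by (simp add: built_upto_def)
    have p0: "0 \<le> N1 * pot c" using N1 pot by simp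
    have f: "forest {0} block (snd s' ''T'') tr (Suc 0) (fst s' ''g'') (snd s')" "fst s' ''i'' = snd s' ''T'' 0" "fst s' ''g'' \<le> 2 * n"
      using c(1) n_pos live_0(1) by (auto simp: built_upto_def c0)
    define s2 where "s2 = ((fst s')(''root'' := fst s' ''i''), snd s')"
    have "stored_tree (snd s2) (fst s2 ''root'') (map_mdtree P (strip (tr 0)))"
      using stored_tree_hok[OF forestD(2)[OF f(1), of 0]] forestD(7)[OF f(1), of 0] f(2) by (simp add: s2_def)
    moreover have "{..<n} = block 0" using live_0(2) n_pos by auto
    then have "local_tree {..<n} (strip (tr 0))" using forestD(5)[OF f(1), of 0] by simp
    ultimately have "Q y s2" if "G \<le> y" for y using Q that by blast
    moreover have "fst s' ''i'' \<in> {Suc 0..fst s' ''g''}" using forestD(4,7)[OF f(1), of 0] f(2) rid_in_ids[of "tr 0"] by auto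
    then have "fst s' ''i'' < B" using f(3) by (intro small_fits) simp
    ultimately show ?case using c(2) p0 by (simp add: wp_simps s2_def)
  qed
  then show ?thesis unfolding build_prog_def using s(1) by (simp add: wp_simps fit_simps s0_def)
qed

end

section \<open>Isomorphic relations\<close>

text \<open>Transport along a bijection, used between positions, matrix indices and elements of
  \<open>X\<close>. Agreement is required on diverse triples only, because \<open>row_rel\<close>
  compares diagonal entries on the others.\<close>

locale hom_iso =
  fixes f :: "'a \<Rightarrow> 'b" and N X H' H
  assumes bij: "bij_betw f N X"
    and rel: "i \<in> N \<Longrightarrow> j \<in> N \<Longrightarrow> k \<in> N \<Longrightarrow> j \<noteq> i \<Longrightarrow> k \<noteq> i \<Longrightarrow> H' i j k \<longleftrightarrow> H (f i) (f j) (f k)"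
begin

lemma inj: "inj_on f N" and img: "f ` N = X"
  using bij by (auto simp: bij_betw_def)

lemma inj_image: "inj_on ((`) f) (Pow N)"
  by (rule inj_on_image_Pow[OF inj])

lemma image_eq: "A \<subseteq> N \<Longrightarrow> B \<subseteq> N \<Longrightarrow> f ` A = f ` B \<longleftrightarrow> A = B"
  using inj_image by (auto dest: inj_onD)

lemma image_subset: "A \<subseteq> N \<Longrightarrow> B \<subseteq> N \<Longrightarrow> f ` A \<subseteq> f ` B \<longleftrightarrow> A \<subseteq> B"
  using inj by (auto simp: inj_on_def) blast

lemma image_psubset: "A \<subseteq> N \<Longrightarrow> B \<subseteq> N \<Longrightarrow> f ` A \<subset> f ` B \<longleftrightarrow> A \<subset> B"
  by (simp add: psubset_eq image_subset image_eq)

lemma image_Diff: "S \<subseteq> N \<Longrightarrow> X - f ` S = f ` (N - S)"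
  using inj_on_image_set_diff[OF inj, of N S] img by auto

lemma module_image:
  assumes "S \<subseteq> N"
  shows "hom_module X H (f ` S) \<longleftrightarrow> hom_module N H' S"
proof -
  have "H (f i) (f j) (f k) \<longleftrightarrow> H' i j k" if "i \<in> N - S" "j \<in> S" "k \<in> S" for i j k
    using rel[of i j k] that assms by blast
  then show ?thesis using assms img unfolding hom_module_def image_Diff[OF assms] by (auto simp: image_subset_iff)
qed

lemma module_preimage:
  assumes "hom_module X H M"
  obtains S where "S \<subseteq> N" "M = f ` S" "hom_module N H' S"
proof -
  have "M \<subseteq> f ` N" using assms img by (simp add: hom_module_def)
  then obtain S where "S \<subseteq> N" "M = f ` S" by (meson subset_imageE)
  then show ?thesis using that assms module_image by blast
qed

lemma good_iso: "good X H \<Longrightarrow> good N H'"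
  unfolding good_def
proof (intro allI impI ballI)
  fix M x y s t
  assume g: "\<forall>M. hom_module X H M \<longrightarrow> (\<forall>x\<in>M. \<forall>y\<in>M. \<forall>s\<in>X - M. \<forall>t\<in>X - M. H x s t = H y s t)"
    and M: "hom_module N H' M" and x: "x \<in> M" "y \<in> M" "s \<in> N - M" "t \<in> N - M"
  have MN: "M \<subseteq> N" using M by (simp add: hom_module_def)
  then have "hom_module X H (f ` M)" using module_image M by blast
  moreover have "f s \<in> X - f ` M" "f t \<in> X - f ` M" unfolding image_Diff[OF MN] using x by auto
  ultimately have "H (f x) (f s) (f t) \<longleftrightarrow> H (f y) (f s) (f t)" using g x by blast
  moreover have "H' z s t \<longleftrightarrow> H (f z) (f s) (f t)" if "z \<in> M" for z by (rule rel) (use x MN that in auto)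
  ultimately show "H' x s t = H' y s t" using x by blast
qed

lemma overlap_image:
  assumes "A \<subseteq> N" "B \<subseteq> N"
  shows "overlap (f ` A) (f ` B) \<longleftrightarrow> overlap A B"
proof -
  have "f ` S - f ` T = f ` (S - T)" if "S \<subseteq> N" "T \<subseteq> N" for S T
    using inj_on_image_set_diff[OF inj, of S T] that by blast
  moreover have "f ` A \<inter> f ` B = f ` (A \<inter> B)" using inj_on_image_Int[OF inj] assms by blast
  ultimately show ?thesis using assms by (simp add: overlap_def)
qed

lemma strong_image:
  assumes "S \<subseteq> N"
  shows "strong_module X H (f ` S) \<longleftrightarrow> strong_module N H' S"
proof -
  have "(\<forall>M'. hom_module X H M' \<longrightarrow> \<not> overlap (f ` S) M') \<longleftrightarrow> (\<forall>M'. hom_module N H' M' \<longrightarrow> \<not> overlap S M')" (is "?L \<longleftrightarrow> ?R")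
  proof
    show ?R if ?L
    proof (intro allI impI)
      fix M' assume M': "hom_module N H' M'"
      then have "M' \<subseteq> N" by (simp add: hom_module_def)
      then show "\<not> overlap S M'" using that M' module_image overlap_image[OF assms] by blast
    qed
    show ?L if ?R
    proof (intro allI impI)
      fix M' assume "hom_module X H M'"
      then obtain T where "T \<subseteq> N" "M' = f ` T" "hom_module N H' T" by (rule module_preimage)
      then show "\<not> overlap (f ` S) M'" using that overlap_image[OF assms] by blast
    qed
  qed
  then show ?thesis using module_image[OF assms] by (simp add: strong_module_def)
qed

lemma strong_subset: "strong_module N H' S \<Longrightarrow> S \<subseteq> N"
  by (simp add: strong_module_def hom_module_def)

lemma strong_preimage:
  assumes "strong_module X H C"
  obtains S where "S \<subseteq> N" "C = f ` S" "strong_module N H' S"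
proof -
  have "hom_module X H C" using assms by (simp add: strong_module_def)
  then obtain S where "S \<subseteq> N" "C = f ` S" by (rule module_preimage)
  then show ?thesis using that assms strong_image by blast
qed

lemma child_modules_image:
  assumes M: "M \<subseteq> N"
  shows "child_modules X H (f ` M) = (`) f ` child_modules N H' M"
proof (intro equalityI subsetI)
  fix C assume C: "C \<in> child_modules X H (f ` M)"
  then obtain S where S: "S \<subseteq> N" "C = f ` S" "strong_module N H' S" using strong_preimage by (auto simp: child_modules_def)
  have "\<not> (strong_module N H' D \<and> S \<subset> D \<and> D \<subset> M)" for D
  proof
    assume D: "strong_module N H' D \<and> S \<subset> D \<and> D \<subset> M"
    then have "D \<subseteq> N" using M by blast
    then have "strong_module X H (f ` D)" "f ` S \<subset> f ` D" "f ` D \<subset> f ` M" 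
      using D strong_image[OF \<open>D \<subseteq> N\<close>] image_psubset[OF S(1) \<open>D \<subseteq> N\<close>] image_psubset[OF \<open>D \<subseteq> N\<close> M] by simp_all
    then show False using C S(2) by (auto simp: child_modules_def)
  qed
  moreover have "S \<subset> M" using C S image_psubset[OF S(1) M] by (simp add: child_modules_def)
  ultimately show "C \<in> (`) f ` child_modules N H' M" using S by (auto simp: child_modules_def)
next
  fix C assume "C \<in> (`) f ` child_modules N H' M"
  then obtain S where S: "C = f ` S" "S \<in> child_modules N H' M" by blast
  then have s: "strong_module N H' S" "S \<subset> M" "S \<subseteq> N" using strong_subset by (auto simp: child_modules_def)
  have "\<not> (strong_module X H D \<and> f ` S \<subset> D \<and> D \<subset> f ` M)" for D
  proof
    assume D: "strong_module X H D \<and> f ` S \<subset> D \<and> D \<subset> f ` M"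
    then obtain E where E: "E \<subseteq> N" "D = f ` E" "strong_module N H' E" using strong_preimage by blast
    then have "S \<subset> E" "E \<subset> M" using D image_psubset[OF s(3) E(1)] image_psubset[OF E(1) M] by simp_all
    then show False using S(2) E(3) by (auto simp: child_modules_def)
  qed
  moreover have "strong_module X H (f ` S)" "f ` S \<subset> f ` M"
    using strong_image[OF s(3)] s(1,2) image_psubset[OF s(3) M] by simp_all
  ultimately show "C \<in> child_modules X H (f ` M)" unfolding S(1) child_modules_def mem_Collect_eq by (intro conjI) simp_all
qed

text \<open>A union of images is the image of a union, and taking images is injective on subsets of
  \<open>N\<close>; so every condition on a set of children of the image is pulled back to the
  original list in the same order.\<close>

lemma node_typed_image:
  assumes ty: "node_typed N H' ty Cs" and Cs: "set Cs \<subseteq> Pow N"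
  shows "node_typed X H ty (map ((`) f) Cs)"
proof -
  have pre: "\<exists>S'\<subseteq>set Cs. S = (`) f ` S' \<and> (hom_module X H (\<Union>S) \<longleftrightarrow> hom_module N H' (\<Union>S'))" if S: "S \<subseteq> set (map ((`) f) Cs)" for S
  proof -
    have "S \<subseteq> (`) f ` set Cs" using S by simp
    then obtain S' where S': "S' \<subseteq> set Cs" "S = (`) f ` S'" by (meson subset_imageE)
    have "\<Union>S = f ` \<Union>S'" unfolding S'(2) by blast
    moreover have "\<Union>S' \<subseteq> N" using S'(1) Cs by blast
    ultimately show ?thesis using S' module_image by metis
  qed
  have eq: "(`) f ` S = (`) f ` S' \<longleftrightarrow> S = S'" if "S \<subseteq> set Cs" "S' \<subseteq> set Cs" for S S'
    by (rule inj_on_image_eq_iff[OF inj_image]) (use that Cs in auto)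
  have sub: "set (take k (drop i Cs)) \<subseteq> set Cs" for i k
    using set_take_subset set_drop_subset by (metis subset_trans)
  have crd: "card ((`) f ` S) = card S" if "S \<subseteq> set Cs" for S
    by (rule card_image[OF inj_on_subset[OF inj_image]]) (use that Cs in blast)
  show ?thesis
  proof (cases ty)
    case Complete
    then show ?thesis using ty pre by (simp, metis)
  next
    case Linear
    have "hom_module X H (\<Union>S) \<longleftrightarrow> (\<exists>i k. S = set (take k (drop i (map ((`) f) Cs))))" if S: "S \<subseteq> set (map ((`) f) Cs)" for S
    proof -
      obtain S' where S': "S' \<subseteq> set Cs" "S = (`) f ` S'" "hom_module X H (\<Union>S) \<longleftrightarrow> hom_module N H' (\<Union>S')" using pre[OF S] by blast
      have "hom_module N H' (\<Union>S') \<longleftrightarrow> (\<exists>i k. S' = set (take k (drop i Cs)))" using ty S'(1) Linear by simp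
      also have "\<dots> \<longleftrightarrow> (\<exists>i k. (`) f ` S' = (`) f ` set (take k (drop i Cs)))" using eq[OF S'(1) sub] by simp
      finally show ?thesis using S'(2,3) by (simp add: take_map drop_map)
    qed
    then show ?thesis using ty Linear by simp
  next
    case Prime
    have "hom_module X H (\<Union>S) \<longleftrightarrow> S = {} \<or> card S = 1 \<or> S = set (map ((`) f) Cs)" if S: "S \<subseteq> set (map ((`) f) Cs)" for S
    proof -
      obtain S' where S': "S' \<subseteq> set Cs" "S = (`) f ` S'" "hom_module X H (\<Union>S) \<longleftrightarrow> hom_module N H' (\<Union>S')" using pre[OF S] by blast
      have "hom_module N H' (\<Union>S') \<longleftrightarrow> S' = {} \<or> card S' = 1 \<or> S' = set Cs" using ty S'(1) Prime by simp
      also have "\<dots> \<longleftrightarrow> S = {} \<or> card S = 1 \<or> S = set (map ((`) f) Cs)"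
        using S'(2) crd[OF S'(1)] eq[OF S'(1) order_refl] by simp
      finally show ?thesis using S'(3) by simp
    qed
    then show ?thesis using ty Prime by simp
  qed
qed

lemma md_tree_at_image: "md_tree_at N H' M t \<Longrightarrow> md_tree_at X H (f ` M) (map_mdtree f t)"
proof (induction M t rule: md_tree_at.induct)
  case (Leaf x)
  then show ?case using img by (auto intro: md_tree_at.Leaf)
next
  case (Node M Cs ty ts)
  have M: "M \<subseteq> N" using Node(1) by (rule strong_subset)
  have sub: "set Cs \<subseteq> Pow N" using Node(4) strong_subset by (auto simp: child_modules_def)
  show ?case
    unfolding mdtree.map
  proof (rule md_tree_at.Node)
    show "strong_module X H (f ` M)" using strong_image[OF M] Node(1) by simp
    show "\<not> is_singleton (f ` M)"
      using Node(2) inj_on_subset[OF inj M] by (simp add: is_singleton_altdef card_image)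
    show "distinct (map ((`) f) Cs)" using Node(3) inj_on_subset[OF inj_image sub] by (simp add: distinct_map)
    show "set (map ((`) f) Cs) = child_modules X H (f ` M)" using child_modules_image[OF M] Node(4) by simp
    show "node_typed X H ty (map ((`) f) Cs)" by (rule node_typed_image[OF Node(5) sub])
    show "list_all2 (md_tree_at X H) (map ((`) f) Cs) (map (map_mdtree f) ts)"
      using Node(6) unfolding list_all2_map1 list_all2_map2 by (rule list_all2_mono) simp
  qed
qed

end

section \<open>Assembly of the two phases\<close>

context matrix_program
begin

text \<open>Renaming by positions turns the permuted matrix into one in which every block is an
  interval. Modules correspond under \<open>P\<close>, so what \<open>stages_done\<close> says about
  indices becomes the assumptions on \<open>en\<close>.\<close>

lemma build_positions:
  assumes P: "bij_betw P {..<n} {..<n}" and en: "stages_done n P en"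
  shows "build n B A (\<lambda>i j. mt (P i) (P j)) en P"
proof -
  let ?a = "\<lambda>i j. mt (P i) (P j)"
  interpret iso: hom_iso P "{..<n}" "{..<n}" "row_rel ?a" "row_rel mt"
    by unfold_locales (use P in \<open>simp_all add: row_rel_def\<close>)
  have Pn: "P i < n" if "i < n" for i using iso.img that by auto
  have e: "c < en c" "en c \<le> n" "md (P ` {c..<en c})"
    "md S \<Longrightarrow> P c \<in> S \<Longrightarrow> (\<And>i. i < n \<Longrightarrow> P i \<in> S \<Longrightarrow> c \<le> i) \<Longrightarrow> i < n \<Longrightarrow> P i \<in> S \<Longrightarrow> i < en c"
    if "c < n" for c S i
    using en that unfolding stages_done_def stage_done_def by blast+
  have g: "good {..<n} (row_rel ?a)" by (rule iso.good_iso[OF good_mt])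
  show ?thesis
  proof unfold_locales
    show "finite {..<n}" by simp
    show "good {..<n} (row_rel ?a)" by (rule g)
    show "c < en c" "en c \<le> n" if "c < n" for c using e(1,2)[OF that] by simp_all
    show "hom_module {..<n} (row_rel ?a) {c..<en c}" if "c < n" for c
    proof -
      have "{c..<en c} \<subseteq> {..<n}" using e(2)[OF that] by auto
      then show ?thesis using iso.module_image e(3)[OF that] by simp
    qed
    show "S \<subseteq> {c..<en c}" if S: "hom_module {..<n} (row_rel ?a) S" "c \<in> S" "S \<subseteq> {c..}" for S c
    proof
      fix i assume i: "i \<in> S"
      have SN: "S \<subseteq> {..<n}" using S(1) by (simp add: hom_module_def)
      have m: "md (P ` S)" using iso.module_image[OF SN] S(1) by simp
      have mem: "j \<in> S" if j: "j < n" "P j \<in> P ` S" for j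
      proof -
        obtain k where k: "k \<in> S" "P j = P k" using j(2) by blast
        then have "j = k" using inj_onD[OF iso.inj k(2)] j(1) SN by blast
        then show ?thesis using k(1) by simp
      qed
      have "c < n" "i < n" using SN S(2) i by auto
      then have "i < en c" using e(4)[of c "P ` S" i] m S(2,3) i mem by blast
      then show "i \<in> {c..<en c}" using S(3) i by auto
    qed
  qed (use Pn in auto)
qed

lemma program_wp:
  fixes s :: store
  assumes s: "fst s ''n'' = n" "snd s ''A'' = A" "\<And>v. v \<noteq> ''n'' \<Longrightarrow> fst s v = 0" "\<And>w i. w \<noteq> ''A'' \<Longrightarrow> snd s w i = 0"
    and gas: "80000 * int n * int n \<le> g"
    and Q: "\<And>g' s' P t. stored_tree (snd s') (fst s' ''root'') (map_mdtree P t) \<Longrightarrow> bij_betw P {..<n} {..<n} \<Longrightarrow> set_mdtree t = {..<n} \<Longrightarrow>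
      md_tree_at {..<n} (row_rel (\<lambda>i j. mt (P i) (P j))) {..<n} t \<Longrightarrow> 0 \<le> g' \<Longrightarrow> Q g' s'"
  shows "wp B (refine_prog ;; build_prog) Q g s"
proof -
  have nn: "1 \<le> int n * int n" "int n \<le> int n * int n" using n_pos by (simp_all flip: of_nat_mult)
  have "wp B refine_prog (wp B build_prog Q) (g - 1) s"
  proof (rule refine_wp[OF s, where G = "30000 * int (n + 1) * int n + 100 + 0"])
    show "10000 * int n * int n + (30000 * int (n + 1) * int n + 100 + 0) \<le> g - 1"
      using gas nn by (simp add: algebra_simps)
    show "0 \<le> 30000 * int (n + 1) * int n + 100 + 0" by simp
    fix g1 s1
    assume fr: "frame stage_vars stage_arrays s s1" and P: "bij_betw (snd s1 ''p'') {..<n} {..<n}"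
      and en: "stages_done n (snd s1 ''p'') (snd s1 ''E'')" and c: "fst s1 ''c'' = n" and g1: "30000 * int (n + 1) * int n + 100 + 0 \<le> g1"
    interpret bp: build n B A "\<lambda>i j. mt (snd s1 ''p'' i) (snd s1 ''p'' j)" "snd s1 ''E''" "snd s1 ''p''"
      by (rule build_positions[OF P en])
    show "wp B build_prog Q g1 s1"
    proof (rule bp.build_wp[OF _ _ c refl refl _ g1])
      show "fst s1 ''n'' = n" "snd s1 ''A'' = A" using frameD(1)[OF fr, of "''n''"] frameD(2)[OF fr, of "''A''"] s by simp_all
      show "snd s1 w = (\<lambda>_. 0)" if "w \<in> {''W'', ''V'', ''next'', ''kind''}" for w
      proof -
        have "snd s1 w = snd s w" by (rule frameD(2)[OF fr]) (use that in auto)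
        moreover have "w \<noteq> ''A''" using that by auto
        ultimately show ?thesis using s(4)[of w] by (simp add: fun_eq_iff)
      qed
      fix g' :: int and s' :: store and t
      assume "stored_tree (snd s') (fst s' ''root'') (map_mdtree (snd s1 ''p'') t)" and lt: "bp.local_tree {..<n} t" and "0 \<le> g'"
      then show "Q g' s'" using Q P bp.set_mdtree_local_tree[OF lt] bp.md_tree_at_if_local_tree[OF lt] by blast
    qed simp
  qed
  then show ?thesis by (simp add: wp_simps)
qed

end

text \<open>The numbering is injective on the classes of one row, so equal entries mean equal
  classes; the row of \<open>x i\<close> thus carries exactly the relation at
  \<open>x i\<close>.\<close>

lemma matrix_representation_rel:
  assumes H: "homogeneous_relation X H" and m: "matrix_representation X H x A"
    and i: "i < card X" "j < card X" "k < card X" "j \<noteq> i" "k \<noteq> i"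
  shows "A i j = A i k \<longleftrightarrow> H (x i) (x j) (x k)"
proof -
  obtain num :: "nat \<Rightarrow> 'a set \<Rightarrow> nat" where bij: "bij_betw x {..<card X} X"
    and num: "inj_on (num i) ((X - {x i}) // hom_rel_at X H (x i))"
      "\<And>j. j < card X \<Longrightarrow> j \<noteq> i \<Longrightarrow> A i j = num i (hom_rel_at X H (x i) `` {x j})"
    using m i(1) unfolding matrix_representation_def by blast
  have X: "x l \<in> X - {x i}" if "l < card X" "l \<noteq> i" for l
    using bij i(1) that by (auto simp: bij_betw_def inj_on_def)
  have "x i \<in> X" using bij i(1) by (auto simp: bij_betw_def)
  then have eq: "equiv (X - {x i}) (hom_rel_at X H (x i))" using H by (simp add: homogeneous_relation_def)
  have "A i j = A i k \<longleftrightarrow> hom_rel_at X H (x i) `` {x j} = hom_rel_at X H (x i) `` {x k}"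
    unfolding num(2)[OF i(2,4)] num(2)[OF i(3,5)] using num(1) X i by (auto simp: quotientI dest: inj_onD)
  also have "\<dots> \<longleftrightarrow> (x j, x k) \<in> hom_rel_at X H (x i)" by (rule eq_equiv_class_iff[OF eq X[OF i(2,4)] X[OF i(3,5)]])
  also have "\<dots> \<longleftrightarrow> H (x i) (x j) (x k)" using X i by (simp add: hom_rel_at_def)
  finally show ?thesis .
qed

theorem theorem11:
  shows "\<exists>P d T. (\<lambda>n. real (T n)) \<in> O(\<lambda>n. real n ^ 2) \<and>
    (\<forall>(X :: 'a set) H x A.
      finite X \<longrightarrow> X \<noteq> {} \<longrightarrow> homogeneous_relation X H \<longrightarrow> good X H \<longrightarrow>
      matrix_representation X H x A \<longrightarrow>
      (\<exists>k s. exec ((card X + 1) ^ d) P (input_store (card X) A) k s \<and> k \<le> T (card X) \<and>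
             outputs_md_tree X H x s))"
proof (rule exI[of _ "refine_prog ;; build_prog"], rule exI[of _ 6], rule exI[of _ "\<lambda>n. 80000 * n * n"], intro conjI allI impI)
  show "(\<lambda>n. real (80000 * n * n)) \<in> O(\<lambda>n. real n ^ 2)"
    by (simp add: power2_eq_square mult.assoc)
  fix X :: "'a set" and H x A
  assume fin: "finite X" "X \<noteq> {}" and H: "homogeneous_relation X H" and good: "good X H" and m: "matrix_representation X H x A"
  define n where "n = card X"
  define F where "F p = (if p < n * n then A (p div n) (p mod n) else 0)" for p
  have n: "0 < n" using fin by (simp add: n_def card_gt_0_iff)
  have F_eq: "F (i * n + j) = A i j" if "i < n" "j < n" for i j
  proof -
    have "i * n + j < Suc i * n" using that by simp
    also have "\<dots> \<le> n * n" by (rule mult_right_mono) (use that in auto)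
    finally show ?thesis using that by (simp add: F_def)
  qed
  have A_le: "A i j \<le> n" if "i < n" "j < n" for i j using m that by (simp add: matrix_representation_def n_def)
  \<comment> \<open>The exponent 6 lets \<open>(n + 1) ^ 4\<close> absorb the factor 16 already at
    \<open>n = 1\<close>.\<close>
  have B: "16 * (n + 1) ^ 2 \<le> (n + 1) ^ 6"
  proof -
    have "2 ^ 4 \<le> (n + 1) ^ 4" by (rule power_mono) (use n in auto)
    then have "2 ^ 4 * (n + 1) ^ 2 \<le> (n + 1) ^ 4 * (n + 1) ^ 2" by (rule mult_right_mono) simp
    then show ?thesis by (simp flip: power_add)
  qed
  interpret wb: word_bound n "(n + 1) ^ 6" F
  proof
    show "F p \<le> n" for p
    proof (cases "p < n * n")
      case True
      then have "p div n < n" "p mod n < n" using n by (simp_all add: less_mult_imp_div_less)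
      then show ?thesis using A_le by (simp add: F_def)
    qed (auto simp: F_def)
  qed (use n B in auto)
  have mt: "wb.mt i j = A i j" if "i < n" "j < n" for i j using F_eq that by (simp add: wb.mt_def)
  have rel: "wb.mt i j = wb.mt i k \<longleftrightarrow> H (x i) (x j) (x k)" if "i < n" "j < n" "k < n" "j \<noteq> i" "k \<noteq> i" for i j k
    using matrix_representation_rel[OF H m, of i j k] that mt by (simp add: n_def)
  have bx: "bij_betw x {..<n} X" using m by (simp add: matrix_representation_def n_def)
  interpret ix: hom_iso x "{..<n}" X "row_rel wb.mt" H
    by unfold_locales (use bx rel in \<open>simp_all add: row_rel_def\<close>)
  interpret mp: matrix_program n "(n + 1) ^ 6" F
    by unfold_locales (rule ix.good_iso[OF good])
  have "wp ((n + 1) ^ 6) (refine_prog ;; build_prog) (\<lambda>g s. 0 \<le> g \<and> outputs_md_tree X H x s) (int (80000 * n * n)) (input_store n A)"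
  proof (rule mp.program_wp)
    show "snd (input_store n A) ''A'' = F" by (auto simp: input_store_def F_def)
    fix g' :: int and s' :: store and P t
    assume st: "stored_tree (snd s') (fst s' ''root'') (map_mdtree P t)" and P: "bij_betw P {..<n} {..<n}" and t: "set_mdtree t = {..<n}"
      and md: "md_tree_at {..<n} (row_rel (\<lambda>i j. wb.mt (P i) (P j))) {..<n} t" and g': "0 \<le> g'"
    \<comment> \<open>The tree is built over positions and stored with labels \<open>P i\<close>;
      translating the labels by \<open>x\<close> amounts to transport along the composition.\<close>
    have bP: "bij_betw (x \<circ> P) {..<n} X" by (rule bij_betw_trans[OF P bx])
    have "P i < n" if "i < n" for i using P that by (auto simp: bij_betw_def)
    moreover have "P i \<noteq> P j" if "i < n" "j < n" "i \<noteq> j" for i j using P that by (auto simp: bij_betw_def inj_on_def)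
    ultimately interpret ip: hom_iso "x \<circ> P" "{..<n}" X "row_rel (\<lambda>i j. wb.mt (P i) (P j))" H
      by unfold_locales (use bP rel in \<open>simp_all add: row_rel_def\<close>)
    have "md_tree_at X H X (map_mdtree x (map_mdtree P t))"
      using ip.md_tree_at_image[OF md] ip.img by (simp add: mdtree.map_comp)
    moreover have "set_mdtree (map_mdtree P t) \<subseteq> {..<card X}" using P t by (simp add: mdtree.set_map bij_betw_def n_def)
    ultimately show "0 \<le> g' \<and> outputs_md_tree X H x s'"
      using st g' unfolding outputs_md_tree_def modular_decomposition_tree_def by blast
  qed (simp_all add: input_store_def)
  then obtain k s where "exec ((n + 1) ^ 6) (refine_prog ;; build_prog) (input_store n A) k s" "0 \<le> int (80000 * n * n) - int k" "outputs_md_tree X H x s"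
    unfolding wp_def by blast
  then show "\<exists>k s. exec ((card X + 1) ^ 6) (refine_prog ;; build_prog) (input_store (card X) A) k s \<and> k \<le> 80000 * card X * card X \<and> outputs_md_tree X H x s"
    unfolding n_def by (metis diff_ge_0_iff_ge of_nat_le_iff)
qed

end
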